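(* Assume (A1)--(A5), $0<\Delta x\le\delta\le 1$, and the CFL condition (CFL) (all listed in the context), and suppose that $\eta^{\alpha,\beta}$ is independent of $x$ and $t$. Let $u$ be the bounded viscosity solution of (E)--(IC), and let $U_h^\delta$ be the bounded solution of the scheme (S) with initial data $U^0_{\mathbf j}=u_0(x_{\mathbf j})$. Let $\sigma$ be the exponent in (A5). (a) There is a constant $C$ such that for all $(t,x)\in\mathcal G_h^N$, $$|U_h^\delta(t,x)-u(t,x)|\le C(1+T)\begin{cases}(T\wedge1)^{\frac12}\Big(\Delta t^{\frac12}+\Delta x^{\frac12}+\delta^{1-\frac\sigma2}\Big)&\text{if }\sigma\in[0,1),\\[2mm](T\wedge1)^{\frac12}\Big(\Delta t^{\frac12}|\log\Delta t|+\Delta x^{\frac12}|\log\delta|^{\frac12}+\delta^{\frac12}\Big)&\text{if }\sigma=1,\\[2mm](T\wedge1)^{\frac1{2\sigma}}\Delta t^{\frac1{2\sigma}}+(T\wedge1)^{\frac12}\Big(\Gamma(\sigma,\delta)^{\frac12}\Delta x^{\frac12}+\delta^{1-\frac\sigma2}\Big)&\text{if }\sigma\in(1,2).\end{cases}$$ (b) If also $K(u_0)<\infty$, then there is a constant $C$ such that for all $(t,x)\in\mathcal G_h^N$, $$|U_h^\delta(t,x)-u(t,x)|\le C(1+T)(T\wedge1)^{\frac12}\Big(\Delta t^{\frac12}+\Gamma(\sigma,\delta)^{\frac12}\Delta x^{\frac12}+\delta^{1-\frac\sigma2}\Big).$$ The constants $C$ depend only on the constants in (A1)--(A5) and in (CFL'),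 and in (b) also on $K(u_0)$.
   Context: **Equation.** Let $T>0$, $Q_T=(0,T]\times\mathbb R^N$. Consider (E) $\;u_t+\inf_{\alpha\in\mathcal A}\sup_{\beta\in\mathcal B}\{-f^{\alpha,\beta}(t,x)+c^{\alpha,\beta}(t,x)u(t,x)-b^{\alpha,\beta}(t,x)\cdot\nabla u(t,x)-\mathcal I^{\alpha,\beta}[u](t,x)\}=0$ in $Q_T$, (IC) $\;u(0,x)=u_0(x)$ in $\mathbb R^N$, where $\mathcal I^{\alpha,\beta}[\phi](t,x)=\int_{\mathbb R^M\setminus\{0\}}\big(\phi(t,x+\eta^{\alpha,\beta}(t,x;z))-\phi(t,x)-\eta^{\alpha,\beta}(t,x;z)\cdot\nabla_x\phi(t,x)\big)\nu(dz)$. Here $f,c$ are real valued, $b,\eta$ are $\mathbb R^N$-valued. **Norms.** $\|w\|_0=\sup|w|$; $\|w\|_1=\|w\|_0+\sup_{(t,x)\ne(s,y)}\frac{|w(t,x)-w(s,y)|}{|t-s|+|x-y|}$ (for $t$-independent $w$ this is the Lipschitz norm). **Assumptions.** (A1) $\mathcal A,\mathcal B$ are separable metric spaces, $c^{\alpha,\beta}\ge0$, and $c^{\alpha,\beta}(t,x),f^{\alpha,\beta}(t,x),b^{\alpha,\beta}(t,x),\eta^{\alpha,\beta}(t,x;z)$ are continuous in $\alpha,\beta,t,x,z$. (A2) There is $K>0$ with $\|u_0\|_1+\|f^{\alpha,\beta}\|_1+\|c^{\alpha,\beta}\|_1+\|b^{\alpha,\beta}\|_1\le K$ for all $\alpha,\beta$.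 (A3) There is a function $\rho(z)\ge0$ with $|\eta^{\alpha,\beta}(t,x;z)-\eta^{\alpha,\beta}(s,y;z)|\le\rho(z)(|x-y|+|t-s|)$ and $|\eta^{\alpha,\beta}(t,x;z)|\le\rho(z)$ for all arguments, $\rho(z)\le K|z|$ for $|z|<1$, and $1\le\rho(z)\le\rho(z)^2$ for $|z|\ge1$. (A4) $\nu$ is a nonnegative Radon measure on $\mathbb R^M\setminus\{0\}$ with $\int_{|z|<1}|z|^2\nu(dz)+\int_{|z|\ge1}\rho(z)^2\nu(dz)<\infty$. (A5) There are $\sigma\in(0,2)$, $C>0$, and a density $k(z)$ of $\nu(dz)$ for $|z|<1$ with $0\le k(z)\le C|z|^{-M-\sigma}$ for $|z|<1$. $K(u_0):=\sup_{\alpha,\beta}\|\mathcal I^{\alpha,\beta}[u_0]\|_{L^\infty([0,T]\times\mathbb R^N)}$ (for the Lipschitz function $u_0$ the defining formula is understood almost everywhere). **Viscosity solutions.** For $\kappa\in(0,1)$ let $\mathcal I_\kappa^{\alpha,\beta}[\phi]$ be the integral defining $\mathcal I^{\alpha,\beta}[\phi]$ restricted to $|z|<\kappa$, and $\mathcal I^{\alpha,\beta,\kappa}[u;p](t,x)=\int_{|z|\ge\kappa}(u(t,x+\eta^{\alpha,\beta}(t,x;z))-u(t,x)-\eta^{\alpha,\beta}(t,x;z)\cdot p)\nu(dz)$. A bounded usc (resp. lsc) function $u$ is a viscosity subsolution (resp. supersolution) of (E) if for all $\kappa\in(0,1)$, $\phi\in C^2(Q_T)$ and every global maximum (resp. minimum)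 point $(t,x)\in Q_T$ of $u-\phi$, one has $\phi_t+\inf_\alpha\sup_\beta\{-f^{\alpha,\beta}+c^{\alpha,\beta}u-b^{\alpha,\beta}\cdot\nabla\phi-\mathcal I_\kappa^{\alpha,\beta}[\phi]-\mathcal I^{\alpha,\beta,\kappa}[u;\nabla_x\phi(t,x)]\}\le0$ (resp. $\ge0$) at $(t,x)$. A viscosity solution is a bounded continuous function that is both; solutions of the initial value problem are continuous on $[0,T]\times\mathbb R^N$. **Grid.** $\Delta x>0$, $\Delta t=T/M_T$ with $M_T\in\mathbb N$, $h=(\Delta t,\Delta x)$, $t_n=n\Delta t$, $x_{\mathbf m}=\mathbf m\Delta x$, $\mathcal G_h^N=\{(t_n,x_{\mathbf m}):\mathbf m\in\mathbb Z^N,\ 0\le n\le M_T\}$. **Discrete operators.** Let $\tilde b_\delta^{\alpha,\beta}(t,x)=b^{\alpha,\beta}(t,x)-\int_{|z|>\delta}\eta^{\alpha,\beta}(t,x;z)\nu(dz)$ with components $\tilde b_{\delta,i}^{\alpha,\beta}$, and $r^\pm=\max(\pm r,0)$. With $e_i$ the standard basis of $\mathbb R^N$, $\mathcal D_h^{\alpha,\beta,\delta}[u](t,x)=\sum_{i=1}^N\big[\tilde b_{\delta,i}^{\alpha,\beta,+}(t,x)\frac{u(t,x+e_i\Delta x)-u(t,x)}{\Delta x}+\tilde b_{\delta,i}^{\alpha,\beta,-}(t,x)\frac{u(t,x-e_i\Delta x)-u(t,x)}{\Delta x}\big]=\sum_{\mathbf j\ne0}d_{h,\mathbf j}^{\alpha,\beta,\delta}(t,x)[u(t,x+x_{\mathbf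 j})-u(t,x)]$. Let $\omega_{\mathbf j}(\cdot;h)$, $\mathbf j\in\mathbb Z^N$, be the basis ("tent") functions of standard piecewise linear/multilinear interpolation on $\Delta x\,\mathbb Z^N$: $0\le\omega_{\mathbf j}\le1$, $\omega_{\mathbf j}(x_{\mathbf k};h)=\delta_{\mathbf j,\mathbf k}$, $\sum_{\mathbf j}\omega_{\mathbf j}=1$, $\operatorname{supp}\omega_{\mathbf j}\subset B(x_{\mathbf j},c_N\Delta x)$, $\|D\omega_{\mathbf j}\|_0\le C/\Delta x$, and $|\sum_{\mathbf j}\varphi(x_{\mathbf j})\omega_{\mathbf j}(x;h)-\varphi(x)|\le K\|D^2\varphi\|_0\Delta x^2$. Then $\mathcal J_h^{\alpha,\beta,\delta}[\varphi](t,x)=\sum_{\mathbf j\in\mathbb Z^N}(\varphi(t,x+x_{\mathbf j})-\varphi(t,x))\kappa_{h,\mathbf j}^{\alpha,\beta,\delta}(t,x)$, $\kappa_{h,\mathbf j}^{\alpha,\beta,\delta}(t,x)=\int_{|z|>\delta}\omega_{\mathbf j}(\eta^{\alpha,\beta}(t,x;z);h)\nu(dz)$. **Scheme.** Fix $\theta,\vartheta\in[0,1]$. Write $g^n_{\mathbf j}=g(t_n,x_{\mathbf j})$, and $\mathcal D_h[U]^n_{\mathbf j},\mathcal J_h[U]^n_{\mathbf j}$ for the operators evaluated at $(t_n,x_{\mathbf j})$ (coefficients and $U$ at time $t_n$). The scheme is: for $\mathbf j\in\mathbb Z^N$, $1\le n\le M_T$, (S) $\;U^n_{\mathbf j}=U^{n-1}_{\mathbf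 j}-\Delta t\inf_{\alpha}\sup_{\beta}\{-f^{\alpha,\beta,n-1}_{\mathbf j}+c^{\alpha,\beta,n}_{\mathbf j}U^{n-1}_{\mathbf j}-\theta\mathcal D_h^{\alpha,\beta,\delta}[U]^n_{\mathbf j}-(1-\theta)\mathcal D_h^{\alpha,\beta,\delta}[U]^{n-1}_{\mathbf j}-\vartheta\mathcal J_h^{\alpha,\beta,\delta}[U]^n_{\mathbf j}-(1-\vartheta)\mathcal J_h^{\alpha,\beta,\delta}[U]^{n-1}_{\mathbf j}\}$, and $U^\delta_h(t_n,x_{\mathbf j})=U^n_{\mathbf j}$. (CFL) For all $\alpha,\beta$, $\bar{\mathbf j}\in\mathbb Z^N$, $1\le n\le M_T$: $\Delta t\big[(1-\theta)\sum_{\mathbf j\ne0}d_{h,\mathbf j}^{\alpha,\beta,\delta}(t_{n-1},x_{\bar{\mathbf j}})+(1-\vartheta)\sum_{\mathbf j\ne0}\kappa_{h,\mathbf j}^{\alpha,\beta,\delta}(t_{n-1},x_{\bar{\mathbf j}})+c^{\alpha,\beta}(t_n,x_{\bar{\mathbf j}})\big]\le1$. $\Gamma(\sigma,\delta)=\delta^{1-\sigma}$ if $\sigma>1$, $-\log\delta$ if $\sigma=1$, $1$ if $\sigma<1$. There are constants $K_D,K_I$ with $\sum_{\mathbf j\ne0}d_{h,\mathbf j}^{\alpha,\beta,\delta}\le\frac{K_D}{\Delta x}\Gamma(\sigma,\delta)$ and $\sum_{\mathbf j\ne0}\kappa_{h,\mathbf j}^{\alpha,\beta,\delta}\le\frac{K_I}{\Delta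 x}\Gamma(\sigma,\delta)$ for $0<\Delta x\le\delta\le1$, so (CFL) holds when (CFL') $\;\frac{\Delta t}{\Delta x}\Gamma(\sigma,\delta)\big((1-\theta)K_D+(1-\vartheta)K_I\big)+\Delta t\sup_{\alpha,\beta}|c^{\alpha,\beta}|\le1$. $T\wedge1=\min(T,1)$.
   Formalization: C may also depend on an upper bound for T and, if σ=1 in (a), on a positive lower bound for |log Δt|; in (b), K(u_0)<∞ also requires the truncated integrals I_κ[u_0] to tend to 0 as distributions as κ→0. Without these changes the claims fail. *)

theory Defs
  imports "HOL-Analysis.Analysis"
begin

section \<open>Norms, derivatives and the parabolic domain\<close>

(* Time and space are separate arguments t and x.  The Levy measure nu on R^M minus the origin
   has -{0} as its underlying space, so integrals with respect to nu never see the origin. *)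

definition Q_dom :: "real \<Rightarrow> (real \<times> (real^'n)) set" where
  "Q_dom T = {0<..T} \<times> UNIV"

definition Qbar_dom :: "real \<Rightarrow> (real \<times> (real^'n)) set" where
  "Qbar_dom T = {0..T} \<times> UNIV"

definition norm0 :: "'p set \<Rightarrow> ('p \<Rightarrow> 'v::real_normed_vector) \<Rightarrow> ennreal" where
  "norm0 S w = (SUP p\<in>S. ennreal (norm (w p)))"

definition norm1 :: "(real \<times> (real^'n)) set \<Rightarrow> (real \<Rightarrow> real^'n \<Rightarrow> 'v::real_normed_vector) \<Rightarrow> ennreal" where
  "norm1 S w = norm0 S (\<lambda>(t, x). w t x) +
     (SUP ((t, x), (s, y)) \<in> {(p, q). p \<in> S \<and> q \<in> S \<and> p \<noteq> q}.
        ennreal (norm (w t x - w s y) / (\<bar>t - s\<bar> + norm (x - y))))"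

(* Derivatives are taken within S, hence one-sided in time at the terminal time of Q_dom T. *)
definition C2_with ::
    "'p::real_normed_vector set \<Rightarrow> ('p \<Rightarrow> real) \<Rightarrow> ('p \<Rightarrow> 'p \<Rightarrow>\<^sub>L real)
       \<Rightarrow> ('p \<Rightarrow> 'p \<Rightarrow>\<^sub>L ('p \<Rightarrow>\<^sub>L real)) \<Rightarrow> bool" where
  "C2_with S \<phi> D D2 \<longleftrightarrow>
     (\<forall>p\<in>S. (\<phi> has_derivative blinfun_apply (D p)) (at p within S)) \<and>
     (\<forall>p\<in>S. (D has_derivative blinfun_apply (D2 p)) (at p within S)) \<and>
     continuous_on S D2"

definition C2_on :: "'p::real_normed_vector set \<Rightarrow> ('p \<Rightarrow> real) \<Rightarrow> bool" where
  "C2_on S \<phi> \<longleftrightarrow> (\<exists>D D2. C2_with S \<phi> D D2)"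

definition grad :: "(real^'n \<Rightarrow> real) \<Rightarrow> real^'n \<Rightarrow> real^'n" where
  "grad \<phi> x = (THE g. GDERIV \<phi> x :> g)"

definition usc_on :: "'p::topological_space set \<Rightarrow> ('p \<Rightarrow> real) \<Rightarrow> bool" where
  "usc_on S w \<longleftrightarrow> (\<forall>p\<in>S. \<forall>a. w p < a \<longrightarrow> (\<forall>\<^sub>F q in at p within S. w q < a))"

definition lsc_on :: "'p::topological_space set \<Rightarrow> ('p \<Rightarrow> real) \<Rightarrow> bool" where
  "lsc_on S w \<longleftrightarrow> (\<forall>p\<in>S. \<forall>a. a < w p \<longrightarrow> (\<forall>\<^sub>F q in at p within S. a < w q))"


section \<open>Assumptions on the data\<close>

definition assm_A1 ::
    "'a metric \<Rightarrow> 'b metric \<Rightarrow> real \<Rightarrow> ('a \<Rightarrow> 'b \<Rightarrow> real \<Rightarrow> real^'n \<Rightarrow> real)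
      \<Rightarrow> ('a \<Rightarrow> 'b \<Rightarrow> real \<Rightarrow> real^'n \<Rightarrow> real) \<Rightarrow> ('a \<Rightarrow> 'b \<Rightarrow> real \<Rightarrow> real^'n \<Rightarrow> real^'n)
      \<Rightarrow> ('a \<Rightarrow> 'b \<Rightarrow> real \<Rightarrow> real^'n \<Rightarrow> real^'m \<Rightarrow> real^'n) \<Rightarrow> bool" where
  "assm_A1 A B T f c b \<eta> \<longleftrightarrow>
     mspace A \<noteq> {} \<and> separable_space (mtopology_of A) \<and>
     mspace B \<noteq> {} \<and> separable_space (mtopology_of B) \<and>
     (\<forall>\<alpha>\<in>mspace A. \<forall>\<beta>\<in>mspace B. \<forall>t\<in>{0..T}. \<forall>x. 0 \<le> c \<alpha> \<beta> t x) \<and>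
     (let X = prod_topology (mtopology_of A) (prod_topology (mtopology_of B) (top_of_set (Qbar_dom T)));
          X' = prod_topology (mtopology_of A) (prod_topology (mtopology_of B)
                 (top_of_set ({0..T} \<times> UNIV \<times> - {0})))
      in continuous_map X euclidean (\<lambda>(\<alpha>, \<beta>, t, x). c \<alpha> \<beta> t x) \<and>
         continuous_map X euclidean (\<lambda>(\<alpha>, \<beta>, t, x). f \<alpha> \<beta> t x) \<and>
         continuous_map X euclidean (\<lambda>(\<alpha>, \<beta>, t, x). b \<alpha> \<beta> t x) \<and>
         continuous_map X' euclidean (\<lambda>(\<alpha>, \<beta>, t, x, z). \<eta> \<alpha> \<beta> t x z))"

definition assm_A2 ::
    "real \<Rightarrow> 'a metric \<Rightarrow> 'b metric \<Rightarrow> real \<Rightarrow> (real^'n \<Rightarrow> real)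
      \<Rightarrow> ('a \<Rightarrow> 'b \<Rightarrow> real \<Rightarrow> real^'n \<Rightarrow> real) \<Rightarrow> ('a \<Rightarrow> 'b \<Rightarrow> real \<Rightarrow> real^'n \<Rightarrow> real)
      \<Rightarrow> ('a \<Rightarrow> 'b \<Rightarrow> real \<Rightarrow> real^'n \<Rightarrow> real^'n) \<Rightarrow> bool" where
  "assm_A2 K A B T u0 f c b \<longleftrightarrow>
     (\<forall>\<alpha>\<in>mspace A. \<forall>\<beta>\<in>mspace B.
        norm1 (Qbar_dom T) (\<lambda>t. u0) + norm1 (Qbar_dom T) (f \<alpha> \<beta>)
          + norm1 (Qbar_dom T) (c \<alpha> \<beta>) + norm1 (Qbar_dom T) (b \<alpha> \<beta>) \<le> ennreal K)"

definition assm_A3 ::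
    "real \<Rightarrow> 'a metric \<Rightarrow> 'b metric \<Rightarrow> real
      \<Rightarrow> ('a \<Rightarrow> 'b \<Rightarrow> real \<Rightarrow> real^'n \<Rightarrow> real^'m \<Rightarrow> real^'n) \<Rightarrow> (real^'m \<Rightarrow> real) \<Rightarrow> bool" where
  "assm_A3 K A B T \<eta> \<rho> \<longleftrightarrow>
     (\<forall>z. z \<noteq> 0 \<longrightarrow> 0 \<le> \<rho> z) \<and>
     (\<forall>\<alpha>\<in>mspace A. \<forall>\<beta>\<in>mspace B. \<forall>t\<in>{0..T}. \<forall>s\<in>{0..T}. \<forall>x y z. z \<noteq> 0 \<longrightarrow>
        norm (\<eta> \<alpha> \<beta> t x z - \<eta> \<alpha> \<beta> s y z) \<le> \<rho> z * (norm (x - y) + \<bar>t - s\<bar>) \<and>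
        norm (\<eta> \<alpha> \<beta> t x z) \<le> \<rho> z) \<and>
     (\<forall>z. z \<noteq> 0 \<and> norm z < 1 \<longrightarrow> \<rho> z \<le> K * norm z) \<and>
     (\<forall>z. 1 \<le> norm z \<longrightarrow> 1 \<le> \<rho> z \<and> \<rho> z \<le> (\<rho> z)\<^sup>2)"

(* L is the quantitative constant: an upper bound for the sum of the two finite integrals. *)
definition assm_A4 :: "real \<Rightarrow> (real^'m) measure \<Rightarrow> (real^'m \<Rightarrow> real) \<Rightarrow> bool" where
  "assm_A4 L \<nu> \<rho> \<longleftrightarrow>
     sets \<nu> = sets (restrict_space borel (- {0})) \<and>
     (\<forall>S. compact S \<and> 0 \<notin> S \<longrightarrow> emeasure \<nu> S < \<infinity>) \<and>
     set_integrable \<nu> {z. norm z < 1} (\<lambda>z. (norm z)\<^sup>2) \<and>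
     set_integrable \<nu> {z. 1 \<le> norm z} (\<lambda>z. (\<rho> z)\<^sup>2) \<and>
     (LINT z:{z. norm z < 1}|\<nu>. (norm z)\<^sup>2) + (LINT z:{z. 1 \<le> norm z}|\<nu>. (\<rho> z)\<^sup>2) \<le> L"

definition assm_A5 :: "real \<Rightarrow> real \<Rightarrow> (real^'m) measure \<Rightarrow> bool" where
  "assm_A5 \<sigma> C \<nu> \<longleftrightarrow>
     (\<exists>k \<in> borel_measurable borel.
        (\<forall>z. z \<noteq> 0 \<and> norm z < 1 \<longrightarrow>
           0 \<le> k z \<and> k z \<le> C * norm z powr (- real CARD('m) - \<sigma>)) \<and>
        (\<forall>S\<in>sets \<nu>. S \<subseteq> {z. norm z < 1} \<longrightarrow>
           emeasure \<nu> S = (\<integral>\<^sup>+z\<in>S. ennreal (k z) \<partial>lborel)))"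


section \<open>The nonlocal operator and viscosity solutions\<close>

definition nonlocal_on ::
    "(real^'m) set \<Rightarrow> (real^'m) measure \<Rightarrow> (real \<Rightarrow> real^'n \<Rightarrow> real^'m \<Rightarrow> real^'n)
      \<Rightarrow> (real \<Rightarrow> real^'n \<Rightarrow> real) \<Rightarrow> real^'n \<Rightarrow> real \<Rightarrow> real^'n \<Rightarrow> real" where
  "nonlocal_on S \<nu> \<eta> w p t x =
     (LINT z:S|\<nu>. w t (x + \<eta> t x z) - w t x - \<eta> t x z \<bullet> p)"

definition nonlocal ::
    "(real^'m) measure \<Rightarrow> (real \<Rightarrow> real^'n \<Rightarrow> real^'m \<Rightarrow> real^'n)
      \<Rightarrow> (real \<Rightarrow> real^'n \<Rightarrow> real) \<Rightarrow> real \<Rightarrow> real^'n \<Rightarrow> real" where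
  "nonlocal \<nu> \<eta> \<phi> t x = nonlocal_on UNIV \<nu> \<eta> \<phi> (grad (\<phi> t) x) t x"

definition nonlocal_inner ::
    "(real^'m) measure \<Rightarrow> (real \<Rightarrow> real^'n \<Rightarrow> real^'m \<Rightarrow> real^'n) \<Rightarrow> real
      \<Rightarrow> (real \<Rightarrow> real^'n \<Rightarrow> real) \<Rightarrow> real \<Rightarrow> real^'n \<Rightarrow> real" where
  "nonlocal_inner \<nu> \<eta> \<kappa> \<phi> t x = nonlocal_on {z. norm z < \<kappa>} \<nu> \<eta> \<phi> (grad (\<phi> t) x) t x"

definition nonlocal_outer ::
    "(real^'m) measure \<Rightarrow> (real \<Rightarrow> real^'n \<Rightarrow> real^'m \<Rightarrow> real^'n) \<Rightarrow> real
      \<Rightarrow> (real \<Rightarrow> real^'n \<Rightarrow> real) \<Rightarrow> real^'n \<Rightarrow> real \<Rightarrow> real^'n \<Rightarrow> real" where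
  "nonlocal_outer \<nu> \<eta> \<kappa> w p t x = nonlocal_on {z. \<kappa> \<le> norm z} \<nu> \<eta> w p t x"

definition visc_lhs ::
    "'a metric \<Rightarrow> 'b metric \<Rightarrow> real \<Rightarrow> ('a \<Rightarrow> 'b \<Rightarrow> real \<Rightarrow> real^'n \<Rightarrow> real)
      \<Rightarrow> ('a \<Rightarrow> 'b \<Rightarrow> real \<Rightarrow> real^'n \<Rightarrow> real) \<Rightarrow> ('a \<Rightarrow> 'b \<Rightarrow> real \<Rightarrow> real^'n \<Rightarrow> real^'n)
      \<Rightarrow> ('a \<Rightarrow> 'b \<Rightarrow> real \<Rightarrow> real^'n \<Rightarrow> real^'m \<Rightarrow> real^'n) \<Rightarrow> (real^'m) measure
      \<Rightarrow> real \<Rightarrow> (real \<Rightarrow> real^'n \<Rightarrow> real) \<Rightarrow> (real \<Rightarrow> real^'n \<Rightarrow> real) \<Rightarrow> real \<Rightarrow> real^'n \<Rightarrow> real" where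
  "visc_lhs A B T f c b \<eta> \<nu> \<kappa> u \<phi> t x =
     vector_derivative (\<lambda>s. \<phi> s x) (at t within {0<..T}) +
     (INF \<alpha>\<in>mspace A. SUP \<beta>\<in>mspace B.
        - f \<alpha> \<beta> t x + c \<alpha> \<beta> t x * u t x - b \<alpha> \<beta> t x \<bullet> grad (\<phi> t) x
        - nonlocal_inner \<nu> (\<eta> \<alpha> \<beta>) \<kappa> \<phi> t x
        - nonlocal_outer \<nu> (\<eta> \<alpha> \<beta>) \<kappa> u (grad (\<phi> t) x) t x)"

definition visc_subsolution ::
    "'a metric \<Rightarrow> 'b metric \<Rightarrow> real \<Rightarrow> ('a \<Rightarrow> 'b \<Rightarrow> real \<Rightarrow> real^'n \<Rightarrow> real)
      \<Rightarrow> ('a \<Rightarrow> 'b \<Rightarrow> real \<Rightarrow> real^'n \<Rightarrow> real) \<Rightarrow> ('a \<Rightarrow> 'b \<Rightarrow> real \<Rightarrow> real^'n \<Rightarrow> real^'n)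
      \<Rightarrow> ('a \<Rightarrow> 'b \<Rightarrow> real \<Rightarrow> real^'n \<Rightarrow> real^'m \<Rightarrow> real^'n) \<Rightarrow> (real^'m) measure
      \<Rightarrow> (real \<Rightarrow> real^'n \<Rightarrow> real) \<Rightarrow> bool" where
  "visc_subsolution A B T f c b \<eta> \<nu> u \<longleftrightarrow>
     bounded ((\<lambda>(t, x). u t x) ` Q_dom T) \<and> usc_on (Q_dom T) (\<lambda>(t, x). u t x) \<and>
     (\<forall>\<kappa> \<phi> t x. 0 < \<kappa> \<and> \<kappa> < 1 \<and> C2_on (Q_dom T) (\<lambda>(s, y). \<phi> s y) \<and> (t, x) \<in> Q_dom T \<and>
        (\<forall>(s, y) \<in> Q_dom T. u s y - \<phi> s y \<le> u t x - \<phi> t x)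
        \<longrightarrow> visc_lhs A B T f c b \<eta> \<nu> \<kappa> u \<phi> t x \<le> 0)"

definition visc_supersolution ::
    "'a metric \<Rightarrow> 'b metric \<Rightarrow> real \<Rightarrow> ('a \<Rightarrow> 'b \<Rightarrow> real \<Rightarrow> real^'n \<Rightarrow> real)
      \<Rightarrow> ('a \<Rightarrow> 'b \<Rightarrow> real \<Rightarrow> real^'n \<Rightarrow> real) \<Rightarrow> ('a \<Rightarrow> 'b \<Rightarrow> real \<Rightarrow> real^'n \<Rightarrow> real^'n)
      \<Rightarrow> ('a \<Rightarrow> 'b \<Rightarrow> real \<Rightarrow> real^'n \<Rightarrow> real^'m \<Rightarrow> real^'n) \<Rightarrow> (real^'m) measure
      \<Rightarrow> (real \<Rightarrow> real^'n \<Rightarrow> real) \<Rightarrow> bool" where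
  "visc_supersolution A B T f c b \<eta> \<nu> u \<longleftrightarrow>
     bounded ((\<lambda>(t, x). u t x) ` Q_dom T) \<and> lsc_on (Q_dom T) (\<lambda>(t, x). u t x) \<and>
     (\<forall>\<kappa> \<phi> t x. 0 < \<kappa> \<and> \<kappa> < 1 \<and> C2_on (Q_dom T) (\<lambda>(s, y). \<phi> s y) \<and> (t, x) \<in> Q_dom T \<and>
        (\<forall>(s, y) \<in> Q_dom T. u t x - \<phi> t x \<le> u s y - \<phi> s y)
        \<longrightarrow> 0 \<le> visc_lhs A B T f c b \<eta> \<nu> \<kappa> u \<phi> t x)"

definition ivp_visc_solution ::
    "'a metric \<Rightarrow> 'b metric \<Rightarrow> real \<Rightarrow> (real^'n \<Rightarrow> real)
      \<Rightarrow> ('a \<Rightarrow> 'b \<Rightarrow> real \<Rightarrow> real^'n \<Rightarrow> real) \<Rightarrow> ('a \<Rightarrow> 'b \<Rightarrow> real \<Rightarrow> real^'n \<Rightarrow> real)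
      \<Rightarrow> ('a \<Rightarrow> 'b \<Rightarrow> real \<Rightarrow> real^'n \<Rightarrow> real^'n)
      \<Rightarrow> ('a \<Rightarrow> 'b \<Rightarrow> real \<Rightarrow> real^'n \<Rightarrow> real^'m \<Rightarrow> real^'n) \<Rightarrow> (real^'m) measure
      \<Rightarrow> (real \<Rightarrow> real^'n \<Rightarrow> real) \<Rightarrow> bool" where
  "ivp_visc_solution A B T u0 f c b \<eta> \<nu> u \<longleftrightarrow>
     bounded ((\<lambda>(t, x). u t x) ` Qbar_dom T) \<and>
     continuous_on (Qbar_dom T) (\<lambda>(t, x). u t x) \<and>
     visc_subsolution A B T f c b \<eta> \<nu> u \<and> visc_supersolution A B T f c b \<eta> \<nu> u \<and>
     (\<forall>x. u 0 x = u0 x)"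

(* The supremum over alpha, beta of the L-infinity norms of the nonlocal operator applied to u0
   is at most K0.  At almost every (t,x) the gradient of u0 exists and the defining integral
   converges absolutely; the integrability clause is needed because the Bochner integral of a
   non-integrable function is 0.

   The last clause says that the truncated integrals converge to the operator applied to u0 not
   only almost everywhere (which is automatic) but also as distributions, so that the almost
   everywhere defined function represents the operator applied to u0.  The pointwise formula
   alone does not see singular parts: for N = M = 1 and eta = z, a suitably cut off Riesz
   potential of a Cantor-type measure mu is a Lipschitz function to which the fractional
   Laplacian assigns the singular measure mu (plus a bounded function), while the pointwise
   formula yields a bounded function off the null set supp mu. *)
definition nonlocal_initial_bound ::
    "'a metric \<Rightarrow> 'b metric \<Rightarrow> real \<Rightarrow> ('a \<Rightarrow> 'b \<Rightarrow> real \<Rightarrow> real^'n \<Rightarrow> real^'m \<Rightarrow> real^'n)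
      \<Rightarrow> (real^'m) measure \<Rightarrow> (real^'n \<Rightarrow> real) \<Rightarrow> real \<Rightarrow> bool" where
  "nonlocal_initial_bound A B T \<eta> \<nu> u0 K0 \<longleftrightarrow>
     (\<forall>\<alpha>\<in>mspace A. \<forall>\<beta>\<in>mspace B.
        (AE (t, x) in lborel. (t, x) \<in> Qbar_dom T \<longrightarrow>
           u0 differentiable (at x) \<and>
           integrable \<nu> (\<lambda>z. u0 (x + \<eta> \<alpha> \<beta> t x z) - u0 x - \<eta> \<alpha> \<beta> t x z \<bullet> grad u0 x) \<and>
           \<bar>nonlocal \<nu> (\<eta> \<alpha> \<beta>) (\<lambda>t. u0) t x\<bar> \<le> K0) \<and>
        (\<forall>\<psi>. C2_on UNIV \<psi> \<and> compact (closure {p. \<psi> p \<noteq> 0}) \<longrightarrow>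
           ((\<lambda>\<kappa>. LINT p:Qbar_dom T|lborel.
               \<psi> p * nonlocal_inner \<nu> (\<eta> \<alpha> \<beta>) \<kappa> (\<lambda>t. u0) (fst p) (snd p)) \<longlongrightarrow> 0) (at_right 0)))"


section \<open>The scheme\<close>

definition grid_pt :: "real \<Rightarrow> int^'n \<Rightarrow> real^'n" where
  "grid_pt dx j = (\<chi> i. real_of_int (j $ i) * dx)"

definition grid :: "real \<Rightarrow> nat \<Rightarrow> real \<Rightarrow> (real \<times> (real^'n)) set" where
  "grid dt MT dx = {(real n * dt, grid_pt dx j) | n j. n \<le> MT}"

(* The defining properties of the nodal basis of piecewise linear or multilinear interpolation
   on the grid of mesh size dx, at fixed dx; the constants cN, Cw, Kw do not depend on dx.  The
   functions are only piecewise differentiable, so the bound on their gradients is stated as a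
   Lipschitz bound. *)
definition tent_basis ::
    "real \<Rightarrow> real \<Rightarrow> real \<Rightarrow> real \<Rightarrow> (int^'n \<Rightarrow> real^'n \<Rightarrow> real) \<Rightarrow> bool" where
  "tent_basis cN Cw Kw dx \<omega> \<longleftrightarrow>
     (\<forall>j x. 0 \<le> \<omega> j x \<and> \<omega> j x \<le> 1) \<and>
     (\<forall>j k. \<omega> j (grid_pt dx k) = (if j = k then 1 else 0)) \<and>
     (\<forall>x. ((\<lambda>j. \<omega> j x) has_sum 1) UNIV) \<and>
     (\<forall>j. closure {x. \<omega> j x \<noteq> 0} \<subseteq> ball (grid_pt dx j) (cN * dx)) \<and>
     (\<forall>j. (Cw / dx)-lipschitz_on UNIV (\<omega> j)) \<and>
     (\<forall>\<phi> D D2 R. C2_with UNIV \<phi> D D2 \<and> (\<forall>x. norm (D2 x) \<le> R) \<longrightarrow>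
        (\<forall>x. \<bar>(\<Sum>\<^sub>\<infinity>j. \<phi> (grid_pt dx j) * \<omega> j x) - \<phi> x\<bar> \<le> Kw * R * dx\<^sup>2))"

definition b_tilde ::
    "(real \<Rightarrow> real^'n \<Rightarrow> real^'n) \<Rightarrow> (real \<Rightarrow> real^'n \<Rightarrow> real^'m \<Rightarrow> real^'n) \<Rightarrow> (real^'m) measure
      \<Rightarrow> real \<Rightarrow> real \<Rightarrow> real^'n \<Rightarrow> real^'n" where
  "b_tilde b \<eta> \<nu> \<delta> t x = b t x - (LINT z:{z. \<delta> < norm z}|\<nu>. \<eta> t x z)"

definition D_op ::
    "(real \<Rightarrow> real^'n \<Rightarrow> real^'n) \<Rightarrow> (real \<Rightarrow> real^'n \<Rightarrow> real^'m \<Rightarrow> real^'n) \<Rightarrow> (real^'m) measure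
      \<Rightarrow> real \<Rightarrow> real \<Rightarrow> (real \<Rightarrow> real^'n \<Rightarrow> real) \<Rightarrow> real \<Rightarrow> real^'n \<Rightarrow> real" where
  "D_op b \<eta> \<nu> \<delta> dx w t x =
     (\<Sum>i\<in>UNIV.
        max (b_tilde b \<eta> \<nu> \<delta> t x $ i) 0 * ((w t (x + dx *\<^sub>R axis i 1) - w t x) / dx) +
        max (- (b_tilde b \<eta> \<nu> \<delta> t x $ i)) 0 * ((w t (x - dx *\<^sub>R axis i 1) - w t x) / dx))"

(* The coefficient of w(t, x + x_j) - w(t, x) in D_op. *)
definition d_coeff ::
    "(real \<Rightarrow> real^'n \<Rightarrow> real^'n) \<Rightarrow> (real \<Rightarrow> real^'n \<Rightarrow> real^'m \<Rightarrow> real^'n) \<Rightarrow> (real^'m) measure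
      \<Rightarrow> real \<Rightarrow> real \<Rightarrow> int^'n \<Rightarrow> real \<Rightarrow> real^'n \<Rightarrow> real" where
  "d_coeff b \<eta> \<nu> \<delta> dx j t x =
     (\<Sum>i\<in>UNIV.
        (if j = axis i 1 then max (b_tilde b \<eta> \<nu> \<delta> t x $ i) 0 / dx else 0) +
        (if j = - axis i 1 then max (- (b_tilde b \<eta> \<nu> \<delta> t x $ i)) 0 / dx else 0))"

definition kappa_coeff ::
    "(int^'n \<Rightarrow> real^'n \<Rightarrow> real) \<Rightarrow> (real \<Rightarrow> real^'n \<Rightarrow> real^'m \<Rightarrow> real^'n) \<Rightarrow> (real^'m) measure
      \<Rightarrow> real \<Rightarrow> int^'n \<Rightarrow> real \<Rightarrow> real^'n \<Rightarrow> real" where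
  "kappa_coeff \<omega> \<eta> \<nu> \<delta> j t x = (LINT z:{z. \<delta> < norm z}|\<nu>. \<omega> j (\<eta> t x z))"

definition J_op ::
    "(int^'n \<Rightarrow> real^'n \<Rightarrow> real) \<Rightarrow> (real \<Rightarrow> real^'n \<Rightarrow> real^'m \<Rightarrow> real^'n) \<Rightarrow> (real^'m) measure
      \<Rightarrow> real \<Rightarrow> real \<Rightarrow> (real \<Rightarrow> real^'n \<Rightarrow> real) \<Rightarrow> real \<Rightarrow> real^'n \<Rightarrow> real" where
  "J_op \<omega> \<eta> \<nu> \<delta> dx w t x =
     (\<Sum>\<^sub>\<infinity>j. (w t (x + grid_pt dx j) - w t x) * kappa_coeff \<omega> \<eta> \<nu> \<delta> j t x)"

(* U is a function of (t,x) of which only the values on the grid matter. *)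
definition scheme_solution ::
    "'a metric \<Rightarrow> 'b metric \<Rightarrow> (real^'n \<Rightarrow> real)
      \<Rightarrow> ('a \<Rightarrow> 'b \<Rightarrow> real \<Rightarrow> real^'n \<Rightarrow> real) \<Rightarrow> ('a \<Rightarrow> 'b \<Rightarrow> real \<Rightarrow> real^'n \<Rightarrow> real)
      \<Rightarrow> ('a \<Rightarrow> 'b \<Rightarrow> real \<Rightarrow> real^'n \<Rightarrow> real^'n)
      \<Rightarrow> ('a \<Rightarrow> 'b \<Rightarrow> real \<Rightarrow> real^'n \<Rightarrow> real^'m \<Rightarrow> real^'n) \<Rightarrow> (real^'m) measure
      \<Rightarrow> (int^'n \<Rightarrow> real^'n \<Rightarrow> real) \<Rightarrow> real \<Rightarrow> real \<Rightarrow> real \<Rightarrow> real \<Rightarrow> nat \<Rightarrow> real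
      \<Rightarrow> (real \<Rightarrow> real^'n \<Rightarrow> real) \<Rightarrow> bool" where
  "scheme_solution A B u0 f c b \<eta> \<nu> \<omega> \<theta> \<theta>' \<delta> dt MT dx U \<longleftrightarrow>
     bounded ((\<lambda>(t, x). U t x) ` grid dt MT dx) \<and>
     (\<forall>j. U 0 (grid_pt dx j) = u0 (grid_pt dx j)) \<and>
     (\<forall>n\<in>{1..MT}. \<forall>j.
        let t = real n * dt; s = real (n - 1) * dt; x = grid_pt dx j in
        U t x = U s x - dt * (INF \<alpha>\<in>mspace A. SUP \<beta>\<in>mspace B.
           - f \<alpha> \<beta> s x + c \<alpha> \<beta> t x * U s x
           - \<theta> * D_op (b \<alpha> \<beta>) (\<eta> \<alpha> \<beta>) \<nu> \<delta> dx U t x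
           - (1 - \<theta>) * D_op (b \<alpha> \<beta>) (\<eta> \<alpha> \<beta>) \<nu> \<delta> dx U s x
           - \<theta>' * J_op \<omega> (\<eta> \<alpha> \<beta>) \<nu> \<delta> dx U t x
           - (1 - \<theta>') * J_op \<omega> (\<eta> \<alpha> \<beta>) \<nu> \<delta> dx U s x))"

definition CFL ::
    "'a metric \<Rightarrow> 'b metric \<Rightarrow> ('a \<Rightarrow> 'b \<Rightarrow> real \<Rightarrow> real^'n \<Rightarrow> real)
      \<Rightarrow> ('a \<Rightarrow> 'b \<Rightarrow> real \<Rightarrow> real^'n \<Rightarrow> real^'n)
      \<Rightarrow> ('a \<Rightarrow> 'b \<Rightarrow> real \<Rightarrow> real^'n \<Rightarrow> real^'m \<Rightarrow> real^'n) \<Rightarrow> (real^'m) measure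
      \<Rightarrow> (int^'n \<Rightarrow> real^'n \<Rightarrow> real) \<Rightarrow> real \<Rightarrow> real \<Rightarrow> real \<Rightarrow> real \<Rightarrow> nat \<Rightarrow> real \<Rightarrow> bool" where
  "CFL A B c b \<eta> \<nu> \<omega> \<theta> \<theta>' \<delta> dt MT dx \<longleftrightarrow>
     (\<forall>\<alpha>\<in>mspace A. \<forall>\<beta>\<in>mspace B. \<forall>j. \<forall>n\<in>{1..MT}.
        let t = real n * dt; s = real (n - 1) * dt; x = grid_pt dx j in
        dt * ((1 - \<theta>) * (\<Sum>\<^sub>\<infinity>k\<in>-{0}. d_coeff (b \<alpha> \<beta>) (\<eta> \<alpha> \<beta>) \<nu> \<delta> dx k s x)
            + (1 - \<theta>') * (\<Sum>\<^sub>\<infinity>k\<in>-{0}. kappa_coeff \<omega> (\<eta> \<alpha> \<beta>) \<nu> \<delta> k s x)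
            + c \<alpha> \<beta> t x) \<le> 1)"


section \<open>Rates\<close>

definition Gam :: "real \<Rightarrow> real \<Rightarrow> real" where
  "Gam \<sigma> \<delta> = (if \<sigma> > 1 then \<delta> powr (1 - \<sigma>) else if \<sigma> = 1 then - ln \<delta> else 1)"

(* For sigma = 1 the time term vanishes at dt = 1 although the scheme is not exact there (take
   nu = 0, u0 = 0, b = c = 0 and f depending on t only), so an estimate with this rate needs
   |ln dt| bounded away from 0. *)
definition rate_lipschitz :: "real \<Rightarrow> real \<Rightarrow> real \<Rightarrow> real \<Rightarrow> real \<Rightarrow> real" where
  "rate_lipschitz \<sigma> T dt dx \<delta> =
     (if \<sigma> < 1 then
        min T 1 powr (1/2) * (dt powr (1/2) + dx powr (1/2) + \<delta> powr (1 - \<sigma>/2))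
      else if \<sigma> = 1 then
        min T 1 powr (1/2) *
          (dt powr (1/2) * \<bar>ln dt\<bar> + dx powr (1/2) * \<bar>ln \<delta>\<bar> powr (1/2) + \<delta> powr (1/2))
      else
        min T 1 powr (1/(2*\<sigma>)) * dt powr (1/(2*\<sigma>)) +
        min T 1 powr (1/2) * (Gam \<sigma> \<delta> powr (1/2) * dx powr (1/2) + \<delta> powr (1 - \<sigma>/2)))"

definition rate_regular :: "real \<Rightarrow> real \<Rightarrow> real \<Rightarrow> real \<Rightarrow> real \<Rightarrow> real" where
  "rate_regular \<sigma> T dt dx \<delta> =
     min T 1 powr (1/2) *
       (dt powr (1/2) + Gam \<sigma> \<delta> powr (1/2) * dx powr (1/2) + \<delta> powr (1 - \<sigma>/2))"


section \<open>The standing hypotheses of the error estimates\<close>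

(* The Lipschitz constants in space of solutions grow exponentially in T (advection away from an
   unstable zero of b), so the constants of the error estimates are uniform in T only on bounded
   ranges of T. *)
definition error_estimate_setting ::
    "real \<Rightarrow> real \<Rightarrow> real \<Rightarrow> real \<Rightarrow> real \<Rightarrow> real \<Rightarrow> real
      \<Rightarrow> 'a metric \<Rightarrow> 'b metric \<Rightarrow> real \<Rightarrow> (real^'n \<Rightarrow> real)
      \<Rightarrow> ('a \<Rightarrow> 'b \<Rightarrow> real \<Rightarrow> real^'n \<Rightarrow> real) \<Rightarrow> ('a \<Rightarrow> 'b \<Rightarrow> real \<Rightarrow> real^'n \<Rightarrow> real)
      \<Rightarrow> ('a \<Rightarrow> 'b \<Rightarrow> real \<Rightarrow> real^'n \<Rightarrow> real^'n)
      \<Rightarrow> ('a \<Rightarrow> 'b \<Rightarrow> real \<Rightarrow> real^'n \<Rightarrow> real^'m \<Rightarrow> real^'n) \<Rightarrow> (real^'m \<Rightarrow> real)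
      \<Rightarrow> (real^'m) measure \<Rightarrow> (real \<Rightarrow> real^'n \<Rightarrow> real)
      \<Rightarrow> (int^'n \<Rightarrow> real^'n \<Rightarrow> real) \<Rightarrow> real \<Rightarrow> real \<Rightarrow> real \<Rightarrow> real \<Rightarrow> nat \<Rightarrow> real
      \<Rightarrow> (real \<Rightarrow> real^'n \<Rightarrow> real) \<Rightarrow> bool" where
  "error_estimate_setting \<sigma> K L C\<^sub>\<nu> cN Cw Kw A B T u0 f c b \<eta> \<rho> \<nu> u \<omega> \<theta> \<theta>' \<delta> dt MT dx U \<longleftrightarrow>
     0 < T \<and>
     assm_A1 A B T f c b \<eta> \<and> assm_A2 K A B T u0 f c b \<and> assm_A3 K A B T \<eta> \<rho> \<and>
     assm_A4 L \<nu> \<rho> \<and> assm_A5 \<sigma> C\<^sub>\<nu> \<nu> \<and>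
     (\<forall>\<alpha>\<in>mspace A. \<forall>\<beta>\<in>mspace B. \<forall>t\<in>{0..T}. \<forall>s\<in>{0..T}. \<forall>x y z. z \<noteq> 0 \<longrightarrow>
        \<eta> \<alpha> \<beta> t x z = \<eta> \<alpha> \<beta> s y z) \<and>
     0 \<le> \<theta> \<and> \<theta> \<le> 1 \<and> 0 \<le> \<theta>' \<and> \<theta>' \<le> 1 \<and>
     1 \<le> MT \<and> dt = T / real MT \<and> 0 < dx \<and> dx \<le> \<delta> \<and> \<delta> \<le> 1 \<and>
     tent_basis cN Cw Kw dx \<omega> \<and>
     CFL A B c b \<eta> \<nu> \<omega> \<theta> \<theta>' \<delta> dt MT dx \<and>
     ivp_visc_solution A B T u0 f c b \<eta> \<nu> u \<and>
     scheme_solution A B u0 f c b \<eta> \<nu> \<omega> \<theta> \<theta>' \<delta> dt MT dx U"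

end

theory Submission imports Defs begin

text \<open>
  The inf-sup of the equation enters only as a functional \<open>G\<close> on families indexed by the
  pairs of controls with \<open>G 0 = 0\<close> and \<open>G X \<le> G Y + e\<close> whenever \<open>X \<le> Y + e\<close>. The dual
  functional \<open>X \<mapsto> - G (- X)\<close> has the same property, so the bound for \<open>u - U\<close> is the bound for
  \<open>U - u\<close> applied to \<open>- U\<close>, \<open>- u\<close>, \<open>- f\<close>.

  To bound \<open>U - u\<close> one maximizes, over grid points \<open>(t\<^sub>n, x\<^sub>j)\<close> and points \<open>(s, y)\<close>,
  the difference \<open>U(t\<^sub>n, x\<^sub>j) - u(s, y)\<close> penalized by \<open>\<bar>x\<^sub>j - y\<bar>\<^sup>2 / 2\<epsilon> + (t\<^sub>n - s)\<^sup>2 / 2\<tau>\<close>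
  times the weight \<open>exp (\<lambda> s)\<close>. The weight absorbs the Lipschitz constants of the coefficients,
  so no regularity of \<open>u\<close> or \<open>U\<close> is needed. Since the jumps do not depend on \<open>(t, x)\<close>, the
  same jump moves both points and the nonlocal terms cancel up to truncation and interpolation
  errors, of order \<open>(\<Gamma>(\<sigma>, \<delta>) \<Delta>x + \<delta>\<^sup>2\<^sup>-\<^sup>\<sigma>) / \<epsilon>\<close>. When the maximum is attained at
  time zero, barriers built on smooth functions above and below \<open>u0\<close> take over: smoothed cones
  for Lipschitz data, mollifications when the nonlocal operator is bounded on \<open>u0\<close>.
\<close>

section \<open>Twice continuously differentiable functions\<close>

text \<open>A step of the scheme involves two time levels. At a discrete maximum the new level
  compares cleanly with the test function, but the old one may lag behind by some
  \<open>a \<ge> 0\<close>. This lag is multiplied by the weight of the explicit part plus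
  \<open>c\<close>; CFL keeps that below \<open>1 / dt\<close>, so the time difference quotient pays
  for it. All consistency errors have the size S = \<Gamma>(\<sigma>, \<delta>) dx + \<delta>^(2 -
  \<sigma>). With m = min T 1 and Lb the slope in time of the barriers, doubling yields \<epsilon> +
  m S / \<epsilon> and Lb^2 \<tau> + m dt / \<tau>. Hence \<epsilon> is about sqrt (S m), \<tau> =
  sqrt (dt m) / Lb, and the error is of order sqrt (S m) + Lb sqrt (dt m). For Lipschitz data a cone
  smoothed at radius e costs K e at time zero and has a slope of order 1 + \<Gamma>(\<sigma>, e).
  Balancing e against \<Gamma>(\<sigma>, e) sqrt (dt m) gives dt^(1 / (2 \<sigma>)) for \<sigma> > 1
  and the logarithm for \<sigma> = 1. If the nonlocal operator is bounded on \<open>u0\<close>, the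
  slope stays bounded as the smoothing radius shrinks, apart from a term of size S over that radius,
  whence the exponent 1/2 for all \<sigma>.\<close>

lemma C2_on_const: "C2_on S (\<lambda>p. k)"
  unfolding C2_on_def C2_with_def
  by (rule exI[of _ "\<lambda>_. 0"], rule exI[of _ "\<lambda>_. 0"]) (auto simp: zero_blinfun.rep_eq)

lemma C2_on_bounded_linear:
  assumes "bounded_linear l" shows "C2_on S l"
proof -
  have "(l has_derivative blinfun_apply (Blinfun l)) (at p within S)" for p
    using assms by (simp add: bounded_linear_Blinfun_apply bounded_linear_imp_has_derivative)
  then show ?thesis
    unfolding C2_on_def C2_with_def
    by (intro exI[of _ "\<lambda>_. Blinfun l"] exI[of _ "\<lambda>_. 0"]) (auto simp: zero_blinfun.rep_eq)
qed

lemma C2_on_add: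
  assumes "C2_on S \<phi>" "C2_on S \<psi>" shows "C2_on S (\<lambda>p. \<phi> p + \<psi> p)"
proof -
  obtain D D2 E E2 where *: "C2_with S \<phi> D D2" "C2_with S \<psi> E E2"
    using assms by (auto simp: C2_on_def)
  have "C2_with S (\<lambda>p. \<phi> p + \<psi> p) (\<lambda>p. D p + E p) (\<lambda>p. D2 p + E2 p)"
    using * unfolding C2_with_def
    by (auto simp: plus_blinfun.rep_eq intro!: has_derivative_add continuous_on_add)
  then show ?thesis by (auto simp: C2_on_def)
qed

lemma C2_on_cmul:
  assumes "C2_on S \<phi>" shows "C2_on S (\<lambda>p. k * \<phi> p)"
proof -
  obtain D D2 where *: "C2_with S \<phi> D D2" using assms by (auto simp: C2_on_def)
  have "C2_with S (\<lambda>p. k * \<phi> p) (\<lambda>p. k *\<^sub>R D p) (\<lambda>p. k *\<^sub>R D2 p)"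
    using * unfolding C2_with_def
    by (auto simp: scaleR_blinfun.rep_eq intro!: has_derivative_mult_right has_derivative_scaleR_right continuous_intros)
  then show ?thesis by (auto simp: C2_on_def)
qed

lemma C2_on_diff:
  assumes "C2_on S \<phi>" "C2_on S \<psi>" shows "C2_on S (\<lambda>p. \<phi> p - \<psi> p)"
  using C2_on_add[OF assms(1) C2_on_cmul[OF assms(2), of "-1"]] by simp

lemma C2_on_sum:
  assumes "finite A" "\<And>a. a \<in> A \<Longrightarrow> C2_on S (\<phi> a)" shows "C2_on S (\<lambda>p. \<Sum>a\<in>A. \<phi> a p)"
  using assms by (induction A rule: finite_induct) (auto intro: C2_on_const C2_on_add)

text \<open>The one chain rule behind squares, roots, exponentials and the bump. The second
  derivative is \<open>g''\<close> times the tensor square of \<open>D\<close> plus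
  \<open>g'\<close> times \<open>D2\<close>; the conditions on \<open>g\<close> are imposed on the
  image of \<open>S\<close> only, which admits the square root of a positive function.\<close>

lemma C2_on_compose_real:
  fixes g g' g'' :: "real \<Rightarrow> real"
  assumes "C2_on S \<phi>"
    and g: "\<And>x. x \<in> \<phi> ` S \<Longrightarrow> (g has_real_derivative g' x) (at x)"
    and g': "\<And>x. x \<in> \<phi> ` S \<Longrightarrow> (g' has_real_derivative g'' x) (at x)"
    and g'': "continuous_on (\<phi> ` S) g''"
  shows "C2_on S (\<lambda>p. g (\<phi> p))"
proof -
  obtain D D2 where "C2_with S \<phi> D D2" using assms by (auto simp: C2_on_def)
  then have D: "\<And>p. p \<in> S \<Longrightarrow> (\<phi> has_derivative blinfun_apply (D p)) (at p within S)"
    and D2: "\<And>p. p \<in> S \<Longrightarrow> (D has_derivative blinfun_apply (D2 p)) (at p within S)"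
    and D2c: "continuous_on S D2"
    by (auto simp: C2_with_def)
  define D' where "D' p = g' (\<phi> p) *\<^sub>R D p" for p
  define D2' where "D2' p = g'' (\<phi> p) *\<^sub>R (blinfun_scaleR_left (D p) o\<^sub>L D p) + g' (\<phi> p) *\<^sub>R D2 p" for p
  have c\<phi>: "continuous_on S \<phi>" and cD: "continuous_on S D"
    by (meson D D2 has_derivative_continuous_on)+
  have g'c: "continuous_on (\<phi> ` S) g'"
    using g' by (meson DERIV_continuous_on has_field_derivative_at_within)
  have "C2_with S (\<lambda>p. g (\<phi> p)) D' D2'"
    unfolding C2_with_def
  proof (intro conjI ballI)
    fix p assume p: "p \<in> S"
    have 1: "(g has_derivative (*) (g' (\<phi> p))) (at (\<phi> p))"
      using g[of "\<phi> p"] p by (auto simp: has_field_derivative_def)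
    show "((\<lambda>p. g (\<phi> p)) has_derivative blinfun_apply (D' p)) (at p within S)"
      using has_derivative_compose[OF D[OF p] 1] by (simp add: D'_def scaleR_blinfun.rep_eq)
    have 2: "(g' has_derivative (*) (g'' (\<phi> p))) (at (\<phi> p))"
      using g'[of "\<phi> p"] p by (auto simp: has_field_derivative_def)
    have 3: "((\<lambda>p. g' (\<phi> p)) has_derivative (\<lambda>h. g'' (\<phi> p) * D p h)) (at p within S)"
      using has_derivative_compose[OF D[OF p] 2] .
    have "(D' has_derivative (\<lambda>h. g' (\<phi> p) *\<^sub>R D2 p h + (g'' (\<phi> p) * D p h) *\<^sub>R D p)) (at p within S)"
      unfolding D'_def using has_derivative_scaleR[OF 3 D2[OF p]] by simp
    moreover have "blinfun_apply (D2' p) = (\<lambda>h. g' (\<phi> p) *\<^sub>R D2 p h + (g'' (\<phi> p) * D p h) *\<^sub>R D p)"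
      by (auto simp: D2'_def plus_blinfun.rep_eq scaleR_blinfun.rep_eq)
    ultimately show "(D' has_derivative blinfun_apply (D2' p)) (at p within S)" by simp
  next
    show "continuous_on S D2'"
      unfolding D2'_def
      using continuous_on_compose2[OF g'' c\<phi>] continuous_on_compose2[OF g'c c\<phi>] cD D2c
      by (auto intro!: continuous_intros)
  qed
  then show ?thesis by (auto simp: C2_on_def)
qed

lemma C2_on_power2:
  assumes "C2_on S \<phi>" shows "C2_on S (\<lambda>p. (\<phi> p)\<^sup>2)"
  by (rule C2_on_compose_real[OF assms, of _ "\<lambda>x. 2 * x" "\<lambda>x. 2"])
     (auto intro!: derivative_eq_intros)

text \<open>Polarization reduces a product to two squares, so no separate product rule for second
  derivatives is proved.\<close>

lemma C2_on_mult:
  assumes "C2_on S \<phi>" "C2_on S \<psi>" shows "C2_on S (\<lambda>p. \<phi> p * \<psi> p)"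
proof -
  have "(\<lambda>p. \<phi> p * \<psi> p) = (\<lambda>p. (1/4) * ((\<phi> p + \<psi> p)\<^sup>2 - (\<phi> p - \<psi> p)\<^sup>2))"
    by (auto simp: power2_eq_square algebra_simps)
  then show ?thesis
    by (simp only:) (intro C2_on_cmul C2_on_diff C2_on_power2 C2_on_add assms)
qed

lemma C2_on_exp:
  assumes "C2_on S \<phi>" shows "C2_on S (\<lambda>p. exp (\<phi> p))"
  by (rule C2_on_compose_real[OF assms, of _ exp exp])
     (auto intro!: derivative_eq_intros continuous_intros)

lemma C2_on_sqrt:
  assumes "C2_on S \<phi>" "\<And>p. p \<in> S \<Longrightarrow> 0 < \<phi> p" shows "C2_on S (\<lambda>p. sqrt (\<phi> p))"
proof (rule C2_on_compose_real[OF assms(1), of _ "\<lambda>x. inverse (sqrt x) / 2" "\<lambda>x. - (inverse (sqrt x) ^ 3) / 4"])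
  fix x assume "x \<in> \<phi> ` S" then have x: "0 < x" using assms(2) by auto
  show "(sqrt has_real_derivative inverse (sqrt x) / 2) (at x)"
    using x by (rule DERIV_real_sqrt)
  show "((\<lambda>x. inverse (sqrt x) / 2) has_real_derivative - (inverse (sqrt x) ^ 3) / 4) (at x)"
    using x by (auto intro!: derivative_eq_intros simp: power3_eq_cube power2_eq_square field_simps)
next
  have "\<phi> ` S \<subseteq> {0<..}" using assms(2) by auto
  then show "continuous_on (\<phi> ` S) (\<lambda>x. - (inverse (sqrt x) ^ 3) / 4)"
    by (auto intro!: continuous_intros)
qed

lemma C2_on_norm_power2:
  fixes l :: "'p::real_normed_vector \<Rightarrow> 'v::euclidean_space"
  assumes "bounded_linear l" shows "C2_on S (\<lambda>p. (norm (l p - a))\<^sup>2)"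
proof -
  have eq: "(\<lambda>p. (norm (l p - a))\<^sup>2) = (\<lambda>p. \<Sum>i\<in>Basis. (l p \<bullet> i - a \<bullet> i)\<^sup>2)"
    unfolding power2_norm_eq_inner by (subst euclidean_inner) (simp add: power2_eq_square inner_diff_left)
  show ?thesis
    unfolding eq
    by (intro C2_on_sum C2_on_power2 C2_on_diff C2_on_const C2_on_bounded_linear
          bounded_linear_compose[OF bounded_linear_inner_left assms]) simp
qed

text \<open>Lifts a barrier that depends on space alone to a test function on space-time.\<close>

lemma C2_on_snd:
  assumes "C2_on UNIV \<phi>" shows "C2_on S (\<lambda>p. \<phi> (snd p))"
proof -
  obtain D D2 where *: "C2_with UNIV \<phi> D D2" using assms by (auto simp: C2_on_def)
  let ?c = "\<lambda>d. d o\<^sub>L snd_blinfun"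
  have bl: "bounded_linear (\<lambda>d. d o\<^sub>L snd_blinfun)"
    by (rule bounded_bilinear.bounded_linear_left[OF bounded_bilinear_blinfun_compose])
  have sd: "(snd has_derivative snd) (at p within S)" for p :: "'b \<times> 'a"
    by (rule bounded_linear_imp_has_derivative[OF bounded_linear_snd])
  have "C2_with S (\<lambda>p. \<phi> (snd p)) (\<lambda>p. ?c (D (snd p)))
     (\<lambda>p. (Blinfun ?c o\<^sub>L D2 (snd p)) o\<^sub>L snd_blinfun)"
    unfolding C2_with_def
  proof (intro conjI ballI)
    fix p :: "'b \<times> 'a" assume "p \<in> S"
    have "(\<phi> has_derivative blinfun_apply (D (snd p))) (at (snd p))"
      "(D has_derivative blinfun_apply (D2 (snd p))) (at (snd p))"
      using * by (auto simp: C2_with_def)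
    note 1 = has_derivative_compose[OF sd this(1)] and 2 = has_derivative_compose[OF sd this(2)]
    show "((\<lambda>p. \<phi> (snd p)) has_derivative blinfun_apply (?c (D (snd p)))) (at p within S)"
      using 1 by (simp add: o_def blinfun_compose.rep_eq snd_blinfun.rep_eq)
    show "((\<lambda>p. ?c (D (snd p))) has_derivative blinfun_apply ((Blinfun ?c o\<^sub>L D2 (snd p)) o\<^sub>L snd_blinfun)) (at p within S)"
      using bounded_linear.has_derivative[OF bl 2]
      by (simp add: o_def blinfun_compose.rep_eq snd_blinfun.rep_eq bounded_linear_Blinfun_apply[OF bl])
  next
    have "continuous_on UNIV D2" using * by (auto simp: C2_with_def)
    then have "continuous_on S (\<lambda>p. D2 (snd p))"
      by (rule continuous_on_compose2) (auto intro!: continuous_intros)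
    then show "continuous_on S (\<lambda>p. (Blinfun ?c o\<^sub>L D2 (snd p)) o\<^sub>L snd_blinfun)"
      by (intro bounded_bilinear.continuous_on[OF bounded_bilinear_blinfun_compose] continuous_on_const)
  qed
  then show ?thesis by (auto simp: C2_on_def)
qed

text \<open>\<open>grad\<close> is a definite description, so evaluating it takes uniqueness: two
  gradients define the same linear form, and testing it on their difference identifies them.\<close>

lemma grad_eqI: "GDERIV \<phi> x :> g \<Longrightarrow> grad \<phi> x = g"
  unfolding grad_def
proof (rule the_equality)
  fix h assume "GDERIV \<phi> x :> g" "GDERIV \<phi> x :> h"
  then have "(\<lambda>v. v \<bullet> h) = (\<lambda>v. v \<bullet> g)"
    unfolding gderiv_def by (rule has_derivative_unique[rotated])
  then have "(h - g) \<bullet> h = (h - g) \<bullet> g" by metis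
  then have "(h - g) \<bullet> (h - g) = 0" by (simp add: inner_diff_right)
  then show "h = g" by simp
qed

text \<open>At \<open>t = T\<close> only the left derivative remains; it is unique because
  \<open>t\<close> is a limit point of the half-open interval.\<close>

lemma vector_derivative_within_half_open:
  assumes "(f has_vector_derivative d) (at t)" "0 < t" "t \<le> T"
  shows "vector_derivative f (at t within {0<..T}) = d"
proof (rule vector_derivative_within)
  have "t islimpt {0<..<t}"
    using assms(2) by (simp add: islimpt_greaterThanLessThan2)
  then have "t islimpt {0<..T}" by (rule islimpt_subset) (use assms in auto)
  then show "at t within {0<..T} \<noteq> bot" by (simp add: trivial_limit_within)
  show "(f has_vector_derivative d) (at t within {0<..T})"
    using assms(1) by (rule has_vector_derivative_at_within)
qed

section \<open>The grid and the nodal basis\<close>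

lemma grid_pt_nth [simp]: "grid_pt dx j $ i = real_of_int (j $ i) * dx"
  by (simp add: grid_pt_def)

lemma grid_pt_add: "grid_pt dx (j + k) = grid_pt dx j + grid_pt dx k"
  by (vector grid_pt_def algebra_simps)

lemma grid_pt_0 [simp]: "grid_pt dx 0 = 0"
  by (vector grid_pt_def)

lemma grid_pt_axis: "grid_pt dx (axis i 1) = dx *\<^sub>R axis i 1"
  by (simp add: vec_eq_iff axis_def)

lemma grid_pt_minus: "grid_pt dx (- j) = - grid_pt dx j"
  by (simp add: vec_eq_iff)

lemma finite_grid_bounded:
  assumes "0 < dx" shows "finite {j :: int^'n. norm (grid_pt dx j) \<le> r}"
proof -
  define A where "A = {- \<lceil>r / dx\<rceil> .. \<lceil>r / dx\<rceil>}"
  have "finite (vec_lambda ` (Pi\<^sub>E (UNIV :: 'n set) (\<lambda>_. A)))"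
    by (intro finite_imageI finite_PiE) (auto simp: A_def)
  moreover have "{j :: int^'n. norm (grid_pt dx j) \<le> r} \<subseteq> vec_lambda ` (Pi\<^sub>E UNIV (\<lambda>_. A))"
  proof
    fix j :: "int^'n" assume "j \<in> {j. norm (grid_pt dx j) \<le> r}"
    then have le: "\<bar>real_of_int (j $ i) * dx\<bar> \<le> r" for i
      using component_le_norm_cart[of "grid_pt dx j" i] by simp
    have "j $ i \<in> A" for i
    proof -
      have "real_of_int \<bar>j $ i\<bar> \<le> r / dx"
        using le[of i] assms by (simp add: abs_mult field_simps)
      then show ?thesis unfolding A_def by (auto simp: abs_le_iff) linarith+
    qed
    then show "j \<in> vec_lambda ` (Pi\<^sub>E UNIV (\<lambda>_. A))"
      by (intro image_eqI[of _ _ "vec_nth j"]) auto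
  qed
  ultimately show ?thesis by (rule finite_subset[rotated])
qed

locale tent =
  fixes cN Cw Kw dx :: real and \<omega> :: "int^'n \<Rightarrow> real^'n \<Rightarrow> real"
  assumes dx_pos: "0 < dx" and tent: "tent_basis cN Cw Kw dx \<omega>"
begin

lemma \<omega>_nonneg: "0 \<le> \<omega> k v" and \<omega>_has_sum: "((\<lambda>k. \<omega> k v) has_sum 1) UNIV"
  using tent by (auto simp: tent_basis_def)

lemma \<omega>_measurable [measurable]: "\<omega> k \<in> borel_measurable borel"
  using tent unfolding tent_basis_def
  by (meson borel_measurable_continuous_onI lipschitz_on_continuous_on)

lemma \<omega>_support: "\<omega> k v \<noteq> 0 \<Longrightarrow> norm (grid_pt dx k - v) \<le> cN * dx"
proof -
  assume "\<omega> k v \<noteq> 0"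
  then have "v \<in> closure {x. \<omega> k x \<noteq> 0}" by (simp add: closure_def)
  moreover have "closure {x. \<omega> k x \<noteq> 0} \<subseteq> ball (grid_pt dx k) (cN * dx)"
    by (rule tent[unfolded tent_basis_def, THEN conjunct2, THEN conjunct2, THEN conjunct2,
          THEN conjunct1, rule_format])
  ultimately have "v \<in> ball (grid_pt dx k) (cN * dx)" by blast
  then show ?thesis by (simp add: dist_norm)
qed

lemma finite_\<omega>_support: "finite {k. \<omega> k v \<noteq> 0}"
proof (rule finite_subset[OF _ finite_grid_bounded[OF dx_pos, of "norm v + cN * dx"]])
  show "{k. \<omega> k v \<noteq> 0} \<subseteq> {k. norm (grid_pt dx k) \<le> norm v + cN * dx}"
    using \<omega>_support[of _ v] norm_triangle_sub[of "grid_pt dx _" v] by (force intro: order_trans)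
qed

lemma has_sum_\<omega>: "((\<lambda>k. g k * \<omega> k v) has_sum (\<Sum>k | \<omega> k v \<noteq> 0. g k * \<omega> k v)) UNIV"
  for g :: "int^'n \<Rightarrow> real"
  by (rule has_sum_finite_neutralI[OF finite_\<omega>_support]) auto

lemma sum_\<omega>: "(\<Sum>k | \<omega> k v \<noteq> 0. \<omega> k v) = 1"
  using has_sum_unique[OF has_sum_\<omega>[of "\<lambda>_. 1" v]] \<omega>_has_sum[of v] by simp

text \<open>A linear function has second derivative zero, so the second-order interpolation estimate
  with bound 0 says that it is reproduced exactly.\<close>

lemma sum_\<omega>_linear: "(\<Sum>k | \<omega> k v \<noteq> 0. (p \<bullet> grid_pt dx k) * \<omega> k v) = p \<bullet> v"
proof -
  have "C2_with UNIV (\<lambda>x. p \<bullet> x) (\<lambda>_. blinfun_inner_right p) (\<lambda>_. 0)"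
    unfolding C2_with_def by (auto simp: blinfun_inner_right.rep_eq zero_blinfun.rep_eq
        intro!: derivative_eq_intros)
  moreover have "\<forall>x::real^'n. norm (0 :: (real^'n) \<Rightarrow>\<^sub>L ((real^'n) \<Rightarrow>\<^sub>L real)) \<le> 0" by simp
  ultimately have "\<bar>(\<Sum>\<^sub>\<infinity>k. (p \<bullet> grid_pt dx k) * \<omega> k v) - p \<bullet> v\<bar> \<le> Kw * 0 * dx\<^sup>2"
    by (rule tent[unfolded tent_basis_def, THEN conjunct2, THEN conjunct2, THEN conjunct2,
          THEN conjunct2, THEN conjunct2, rule_format, OF conjI])
  then have "(\<Sum>\<^sub>\<infinity>k. (p \<bullet> grid_pt dx k) * \<omega> k v) = p \<bullet> v" by simp
  with infsumI[OF has_sum_\<omega>[of "\<lambda>k. p \<bullet> grid_pt dx k" v]] show ?thesis by simp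
qed

text \<open>The weights \<open>\<omega> k v\<close> form a probability with barycentre
  \<open>v\<close> and support radius \<open>cN * dx\<close>: the linear term averages to zero and
  the quadratic one to at most \<open>R * cN^2 * dx^2\<close>. The excess \<open>a\<close> is
  charged to the nodes other than the origin only, because this is the weight that CFL
  counts.\<close>

lemma sum_\<omega>_le:
  assumes "\<And>k. C k \<le> V + P \<bullet> (grid_pt dx k - v) + R * (norm (grid_pt dx k - v))\<^sup>2 + (if k = 0 then 0 else a)"
    and "0 \<le> R"
  shows "(\<Sum>\<^sub>\<infinity>k. C k * \<omega> k v) \<le> V + R * cN\<^sup>2 * dx\<^sup>2 + a * (1 - \<omega> 0 v)"
proof -
  let ?F = "{k. \<omega> k v \<noteq> 0}"
  have "(\<Sum>\<^sub>\<infinity>k. C k * \<omega> k v) = (\<Sum>k\<in>?F. C k * \<omega> k v)"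
    by (rule infsumI[OF has_sum_\<omega>])
  also have "\<dots> \<le> (\<Sum>k\<in>?F. (V + P \<bullet> (grid_pt dx k - v) + R * (cN * dx)\<^sup>2 + (if k = 0 then 0 else a)) * \<omega> k v)"
  proof (intro sum_mono mult_right_mono \<omega>_nonneg)
    fix k assume "k \<in> ?F"
    then have "(norm (grid_pt dx k - v))\<^sup>2 \<le> (cN * dx)\<^sup>2"
      using \<omega>_support by (intro power_mono) auto
    then have "R * (norm (grid_pt dx k - v))\<^sup>2 \<le> R * (cN * dx)\<^sup>2"
      by (rule mult_left_mono[OF _ assms(2)])
    then show "C k \<le> V + P \<bullet> (grid_pt dx k - v) + R * (cN * dx)\<^sup>2 + (if k = 0 then 0 else a)"
      using assms(1)[of k] by linarith
  qed
  also have "\<dots> = (\<Sum>k\<in>?F. (V - P \<bullet> v + R * (cN * dx)\<^sup>2 + a) * \<omega> k v + (P \<bullet> grid_pt dx k) * \<omega> k v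
                     - (if k = 0 then a * \<omega> 0 v else 0))"
    by (intro sum.cong) (auto simp: algebra_simps)
  also have "\<dots> = (V - P \<bullet> v + R * (cN * dx)\<^sup>2 + a) + P \<bullet> v - a * \<omega> 0 v"
    using finite_\<omega>_support[of v]
    by (simp add: sum.distrib sum_subtractf sum_distrib_left[symmetric] sum_\<omega> sum_\<omega>_linear sum.delta)
  finally show ?thesis by (simp add: algebra_simps power_mult_distrib)
qed

text \<open>Exchange of the sum over nodes with the integral over jumps, along an enumeration of the
  lattice. Partial sums of the weights never exceed 1, so the integrals of the partial sums are
  bounded by \<open>B\<close> times the finite measure of \<open>S\<close>.\<close>

lemma has_sum_integral_\<omega>:
  assumes S: "S \<in> sets \<nu>" "emeasure \<nu> S < \<infinity>" and [measurable]: "\<eta> \<in> borel_measurable \<nu>"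
    and C: "\<And>k. \<bar>C k\<bar> \<le> B"
  shows "set_integrable \<nu> S (\<lambda>z. \<Sum>\<^sub>\<infinity>k. C k * \<omega> k (\<eta> z))"
    and "((\<lambda>k. C k * (LINT z:S|\<nu>. \<omega> k (\<eta> z))) has_sum (LINT z:S|\<nu>. (\<Sum>\<^sub>\<infinity>k. C k * \<omega> k (\<eta> z)))) UNIV"
proof -
  define e where "e = from_nat_into (UNIV :: (int^'n) set)"
  have inf: "infinite (UNIV :: (int^'n) set)"
  proof
    assume "finite (UNIV :: (int^'n) set)"
    then have "finite (range (\<lambda>n::int. (vec n :: int^'n)))" by (rule finite_subset[rotated]) auto
    moreover have "inj (\<lambda>n::int. (vec n :: int^'n))" by (auto simp: inj_def vec_eq_iff)
    ultimately show False using finite_imageD infinite_UNIV_int by blast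
  qed
  have e: "bij_betw e UNIV UNIV"
    unfolding e_def by (rule bij_betw_from_nat_into[OF _ inf]) auto
  then have inje: "inj e" by (simp add: bij_betw_def)
  have B: "0 \<le> B" using C[of 0] by linarith
  note S(1)[measurable]
  have [measurable]: "(\<lambda>z. \<omega> k (\<eta> z)) \<in> borel_measurable \<nu>" for k
    by (rule measurable_compose[OF _ \<omega>_measurable]) simp
  define g where "g n z = indicator S z *\<^sub>R (C (e n) * \<omega> (e n) (\<eta> z))" for n z
  have \<omega>1: "\<omega> k v \<le> 1" for k v using tent by (auto simp: tent_basis_def)
  have gint: "integrable \<nu> (g n)" for n
  proof -
    have "integrable \<nu> (\<lambda>z. indicator S z * B)"
      using S by (auto intro!: integrable_mult_left)
    then show ?thesis
    proof (rule Bochner_Integration.integrable_bound)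
      show "AE z in \<nu>. norm (g n z) \<le> norm (indicator S z * B)"
        using mult_mono[OF C \<omega>1 B \<omega>_nonneg] \<omega>_nonneg
        by (auto simp: g_def indicator_def abs_mult B)
      show "g n \<in> borel_measurable \<nu>" unfolding g_def by measurable
    qed
  qed
  have sums_pt: "(\<lambda>n. h (e n) * \<omega> (e n) v) sums (\<Sum>\<^sub>\<infinity>k. h k * \<omega> k v)" for h v
  proof -
    have "((\<lambda>k. h k * \<omega> k v) has_sum (\<Sum>\<^sub>\<infinity>k. h k * \<omega> k v)) UNIV"
      by (rule has_sum_infsum[OF has_sum_imp_summable[OF has_sum_\<omega>]])
    then have "((\<lambda>n. h (e n) * \<omega> (e n) v) has_sum (\<Sum>\<^sub>\<infinity>k. h k * \<omega> k v)) UNIV"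
      using has_sum_reindex_bij_betw[OF e, of "\<lambda>k. h k * \<omega> k v"] by simp
    then show ?thesis by (rule has_sum_imp_sums)
  qed
  have part: "(\<Sum>n<m. \<omega> (e n) v) \<le> 1" for m v
  proof -
    have "(\<Sum>n<m. \<omega> (e n) v) = (\<Sum>k\<in>e ` {..<m}. \<omega> k v)"
      using inje by (subst sum.reindex) (auto intro: inj_on_subset)
    also have "\<dots> \<le> 1"
      by (rule has_sum_mono2[OF has_sum_finite \<omega>_has_sum]) (auto simp: \<omega>_nonneg)
    finally show ?thesis .
  qed
  have ns: "AE z in \<nu>. summable (\<lambda>n. norm (g n z))"
  proof (rule AE_I2)
    fix z
    have "summable (\<lambda>n. \<bar>C (e n)\<bar> * \<omega> (e n) (\<eta> z))"
      using sums_pt[of "\<lambda>k. \<bar>C k\<bar>" "\<eta> z"] by (simp add: sums_iff)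
    then have "summable (\<lambda>n. indicator S z * (\<bar>C (e n)\<bar> * \<omega> (e n) (\<eta> z)))"
      by (rule summable_mult)
    then show "summable (\<lambda>n. norm (g n z))"
      by (simp add: g_def abs_mult \<omega>_nonneg)
  qed
  have si: "summable (\<lambda>n. \<integral>z. norm (g n z) \<partial>\<nu>)"
  proof (rule summableI_nonneg_bounded)
    show "0 \<le> (\<integral>z. norm (g n z) \<partial>\<nu>)" for n by simp
    fix m
    have "(\<Sum>n<m. \<integral>z. norm (g n z) \<partial>\<nu>) = (\<integral>z. (\<Sum>n<m. norm (g n z)) \<partial>\<nu>)"
      using gint by (subst Bochner_Integration.integral_sum) auto
    also have "\<dots> \<le> (\<integral>z. indicator S z * B \<partial>\<nu>)"
    proof (rule integral_mono)
      show "integrable \<nu> (\<lambda>z. \<Sum>n<m. norm (g n z))" using gint by auto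
      show "integrable \<nu> (\<lambda>z. indicator S z * B)" using S by (auto intro!: integrable_mult_left)
      fix z
      have "(\<Sum>n<m. norm (g n z)) \<le> (\<Sum>n<m. indicator S z * (B * \<omega> (e n) (\<eta> z)))"
        using C by (intro sum_mono) (auto simp: g_def abs_mult \<omega>_nonneg indicator_def intro!: mult_right_mono)
      also have "\<dots> = indicator S z * (B * (\<Sum>n<m. \<omega> (e n) (\<eta> z)))"
        by (simp add: sum_distrib_left)
      also have "\<dots> \<le> indicator S z * (B * 1)"
        by (intro mult_left_mono part B) auto
      finally show "(\<Sum>n<m. norm (g n z)) \<le> indicator S z * B" by simp
    qed
    finally show "(\<Sum>n<m. \<integral>z. norm (g n z) \<partial>\<nu>) \<le> (\<integral>z. indicator S z * B \<partial>\<nu>)" .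
  qed
  have gsum: "(\<Sum>n. g n z) = indicator S z *\<^sub>R (\<Sum>\<^sub>\<infinity>k. C k * \<omega> k (\<eta> z))" for z
    unfolding g_def using sums_pt[of C "\<eta> z"]
    by (auto simp: sums_iff suminf_mult)
  show "set_integrable \<nu> S (\<lambda>z. \<Sum>\<^sub>\<infinity>k. C k * \<omega> k (\<eta> z))"
    using integrable_suminf[OF gint ns si] unfolding set_integrable_def gsum .
  have gi: "integral\<^sup>L \<nu> (g n) = C (e n) * (LINT z:S|\<nu>. \<omega> (e n) (\<eta> z))" for n
    unfolding g_def set_lebesgue_integral_def
    by (simp add: mult.left_commute[of _ "C _"])
  have "(\<lambda>n. C (e n) * (LINT z:S|\<nu>. \<omega> (e n) (\<eta> z))) sums (LINT z:S|\<nu>. (\<Sum>\<^sub>\<infinity>k. C k * \<omega> k (\<eta> z)))"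
    using sums_integral[OF gint ns si] unfolding gi gsum set_lebesgue_integral_def .
  moreover have "summable (\<lambda>n. norm (C (e n) * (LINT z:S|\<nu>. \<omega> (e n) (\<eta> z))))"
  proof (rule summable_comparison_test'[OF si, of 0])
    fix n
    show "norm (norm (C (e n) * (LINT z:S|\<nu>. \<omega> (e n) (\<eta> z)))) \<le> (\<integral>z. norm (g n z) \<partial>\<nu>)"
      unfolding gi[symmetric] by (simp only: real_norm_def abs_idempotent) (rule integral_norm_bound[of \<nu> "g n", unfolded real_norm_def])
  qed
  ultimately have "((\<lambda>n. C (e n) * (LINT z:S|\<nu>. \<omega> (e n) (\<eta> z))) has_sum (LINT z:S|\<nu>. (\<Sum>\<^sub>\<infinity>k. C k * \<omega> k (\<eta> z)))) UNIV"
    by (rule norm_summable_imp_has_sum[rotated])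
  then show "((\<lambda>k. C k * (LINT z:S|\<nu>. \<omega> k (\<eta> z))) has_sum (LINT z:S|\<nu>. (\<Sum>\<^sub>\<infinity>k. C k * \<omega> k (\<eta> z)))) UNIV"
    using has_sum_reindex_bij_betw[OF e, of "\<lambda>k. C k * (LINT z:S|\<nu>. \<omega> k (\<eta> z))"] by simp
qed

end

section \<open>Jump integrals and the discrete operators\<close>

lemma set_integral_dominated:
  fixes g h :: "'z \<Rightarrow> real"
  assumes h: "set_integrable M A h" and g: "set_borel_measurable M A g"
    and le: "\<And>z. z \<in> space M \<Longrightarrow> z \<in> A \<Longrightarrow> \<bar>g z\<bar> \<le> h z"
  shows "set_integrable M A g" and "\<bar>LINT z:A|M. g z\<bar> \<le> (LINT z:A|M. h z)"
proof -
  have *: "norm (indicator A z *\<^sub>R g z) \<le> indicator A z *\<^sub>R h z" if "z \<in> space M" for z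
    using le[OF that] by (auto simp: indicator_def)
  show gi: "set_integrable M A g"
    unfolding set_integrable_def
  proof (rule Bochner_Integration.integrable_bound[OF h[unfolded set_integrable_def]])
    show "(\<lambda>z. indicator A z *\<^sub>R g z) \<in> borel_measurable M"
      using g by (simp add: set_borel_measurable_def)
    show "AE z in M. norm (indicator A z *\<^sub>R g z) \<le> norm (indicator A z *\<^sub>R h z)"
      using * by (intro AE_I2) (force intro: order_trans)
  qed
  have "\<bar>LINT z:A|M. g z\<bar> \<le> (\<integral>z. norm (indicator A z *\<^sub>R g z) \<partial>M)"
    unfolding set_lebesgue_integral_def using integral_norm_bound by fastforce
  also have "\<dots> \<le> (LINT z:A|M. h z)"
    unfolding set_lebesgue_integral_def
    using * gi h by (intro integral_mono integrable_norm) (auto simp: set_integrable_def)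
  finally show "\<bar>LINT z:A|M. g z\<bar> \<le> (LINT z:A|M. h z)" .
qed

section \<open>Monotone functionals that stand for the inf-sup\<close>

definition bounded_family :: "'i set \<Rightarrow> ('i \<Rightarrow> real) \<Rightarrow> bool" where
  "bounded_family I X \<longleftrightarrow> (\<exists>M. \<forall>i\<in>I. \<bar>X i\<bar> \<le> M)"

text \<open>Bounded families only: on these the real infimum and supremum are the genuine ones.
  Since \<open>e\<close> may be any real, the clause contains monotonicity and the control of
  additive constants at once.\<close>

definition game_operator :: "'i set \<Rightarrow> (('i \<Rightarrow> real) \<Rightarrow> real) \<Rightarrow> bool" where
  "game_operator I G \<longleftrightarrow> G (\<lambda>_. 0) = 0 \<and>
     (\<forall>X Y e. bounded_family I X \<and> bounded_family I Y \<and> (\<forall>i\<in>I. X i \<le> Y i + e) \<longrightarrow> G X \<le> G Y + e)"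

lemma game_operatorD:
  assumes "game_operator I G" "\<And>i. i \<in> I \<Longrightarrow> \<bar>X i\<bar> \<le> M" "\<And>i. i \<in> I \<Longrightarrow> \<bar>Y i\<bar> \<le> M'"
    "\<And>i. i \<in> I \<Longrightarrow> X i \<le> Y i + e"
  shows "G X \<le> G Y + e"
  using assms unfolding game_operator_def bounded_family_def by blast

lemma game_operator_lower:
  assumes "game_operator I G" "\<And>i. i \<in> I \<Longrightarrow> \<bar>X i\<bar> \<le> M" "\<And>i. i \<in> I \<Longrightarrow> - e \<le> X i"
  shows "- e \<le> G X"
  using game_operatorD[OF assms(1), of "\<lambda>_. 0" 0 X M e] assms by (force simp: game_operator_def)

lemma game_operator_upper:
  assumes "game_operator I G" "\<And>i. i \<in> I \<Longrightarrow> \<bar>X i\<bar> \<le> M" "\<And>i. i \<in> I \<Longrightarrow> X i \<le> e"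
  shows "G X \<le> e"
  using game_operatorD[OF assms(1), of X M "\<lambda>_. 0" 0 e] assms by (force simp: game_operator_def)

lemma abs_sum_le:
  fixes x y :: real assumes "\<bar>x\<bar> \<le> A" "\<bar>y\<bar> \<le> B"
  shows "\<bar>x + y\<bar> \<le> A + B" "\<bar>x - y\<bar> \<le> A + B" using assms by linarith+

lemma abs_mult_le:
  fixes x y :: real assumes "\<bar>x\<bar> \<le> A" "\<bar>y\<bar> \<le> B"
  shows "\<bar>x * y\<bar> \<le> A * B" using assms by (simp add: abs_mult mult_mono')

lemma abs_inner_le:
  assumes "norm x \<le> A" "norm y \<le> B"
  shows "\<bar>x \<bullet> y\<bar> \<le> A * B"
  using Cauchy_Schwarz_ineq2[of x y] mult_mono'[OF assms] by (auto intro: order_trans)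

text \<open>\<open>r\<close> bounds all jumps simultaneously. Near the origin only its square is
  integrable, so zeroth and first moments are taken outside a ball.\<close>

locale levy_jumps =
  fixes I :: "'i set" and \<nu> :: "(real^'m) measure" and \<eta> :: "'i \<Rightarrow> real^'m \<Rightarrow> real^'n"
    and r :: "real^'m \<Rightarrow> real" and \<delta> :: real
  assumes \<delta>: "0 < \<delta>" "\<delta> \<le> 1"
    and sets_\<nu>: "sets \<nu> = sets (restrict_space borel (- {0}))"
    and \<eta>_measurable [measurable]: "i \<in> I \<Longrightarrow> \<eta> i \<in> borel_measurable \<nu>"
    and \<eta>_le: "i \<in> I \<Longrightarrow> z \<noteq> 0 \<Longrightarrow> norm (\<eta> i z) \<le> r z"
    and r_measurable [measurable]: "r \<in> borel_measurable \<nu>"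
    and r_square_integrable: "integrable \<nu> (\<lambda>z. (r z)\<^sup>2)"
    and r_tail_integrable: "0 < \<kappa> \<Longrightarrow> set_integrable \<nu> {z. \<kappa> \<le> norm z} r"
    and finite_tail: "0 < \<kappa> \<Longrightarrow> emeasure \<nu> {z. \<kappa> \<le> norm z} < \<infinity>"
begin

lemma space_\<nu>: "space \<nu> = - {0}"
  using sets_eq_imp_space_eq[OF sets_\<nu>] by (simp add: space_restrict_space)

lemma r_nonneg: "i \<in> I \<Longrightarrow> z \<noteq> 0 \<Longrightarrow> 0 \<le> r z"
  using \<eta>_le norm_ge_zero order_trans by blast

lemma norm_measurable [measurable]: "(\<lambda>z. norm z) \<in> borel_measurable \<nu>"
  by (subst measurable_cong_sets[OF sets_\<nu> refl]) (auto intro: measurable_restrict_space1)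

lemma tail_sets [measurable]: "0 < \<kappa> \<Longrightarrow> {z. \<kappa> \<le> norm z} \<in> sets \<nu>" "0 < \<kappa> \<Longrightarrow> {z. \<kappa> < norm z} \<in> sets \<nu>"
  unfolding sets_\<nu> by (auto simp: sets_restrict_space_iff)

text \<open>The jumps kept by the scheme. Their mass and first moment are \<open>m0\<close> and
  \<open>m1\<close>; the dropped ones are paid for with their second moment
  \<open>m2\<close>.\<close>

definition "jumps = {z::real^'m. \<delta> < norm z}"

lemma jumps_sets [measurable]: "jumps \<in> sets \<nu>"
  unfolding jumps_def by (rule tail_sets[OF \<delta>(1)])

lemma jumps_nonzero: "z \<in> jumps \<Longrightarrow> z \<noteq> 0"
  using \<delta> by (auto simp: jumps_def)

lemma finite_jumps: "emeasure \<nu> jumps < \<infinity>"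
proof -
  have "emeasure \<nu> jumps \<le> emeasure \<nu> {z. \<delta> \<le> norm z}"
    using tail_sets \<delta> by (intro emeasure_mono) (auto simp: jumps_def)
  then show ?thesis using finite_tail[OF \<delta>(1)] by (rule order_le_less_trans)
qed

lemma const_jumps_integral: "(LINT z:jumps|\<nu>. A) = A * measure \<nu> jumps" for A :: real
  unfolding set_lebesgue_integral_def using finite_jumps by (simp add: mult.commute)

lemma r_jumps_integrable: "set_integrable \<nu> jumps r"
  by (rule set_integrable_subset[OF r_tail_integrable[OF \<delta>(1)] jumps_sets]) (auto simp: jumps_def)

lemma const_jumps_integrable: "set_integrable \<nu> jumps (\<lambda>_. A :: real)"
  using finite_jumps unfolding set_integrable_def by (auto intro!: integrable_mult_left)

definition "m0 = measure \<nu> jumps"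
definition "m1 = (LINT z:jumps|\<nu>. r z)"
definition "m2 = (LINT z:{z. norm z \<le> \<delta>}|\<nu>. (r z)\<^sup>2)"

lemma small_square_integrable: "set_integrable \<nu> {z. norm z \<le> \<kappa>} (\<lambda>z. (r z)\<^sup>2)"
proof -
  have "(\<lambda>z. indicator {z. norm z \<le> \<kappa>} z *\<^sub>R (r z)\<^sup>2) = (\<lambda>z. if norm z \<le> \<kappa> then (r z)\<^sup>2 else 0)"
    by auto
  then have "(\<lambda>z. indicator {z. norm z \<le> \<kappa>} z *\<^sub>R (r z)\<^sup>2) \<in> borel_measurable \<nu>" by simp
  then show ?thesis
    unfolding set_integrable_def
    by (rule Bochner_Integration.integrable_bound[OF r_square_integrable]) (auto simp: indicator_def)
qed

lemma jumps_integral_bound: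
  fixes g :: "real^'m \<Rightarrow> real"
  assumes [measurable]: "g \<in> borel_measurable \<nu>"
    and le: "\<And>z. z \<in> jumps \<Longrightarrow> \<bar>g z\<bar> \<le> A + B * r z"
  shows "set_integrable \<nu> jumps g" "\<bar>LINT z:jumps|\<nu>. g z\<bar> \<le> A * m0 + B * m1"
proof -
  have h: "set_integrable \<nu> jumps (\<lambda>z. A + B * r z)"
    by (intro set_integral_add const_jumps_integrable set_integrable_mult_right r_jumps_integrable)
  have g: "set_borel_measurable \<nu> jumps g"
    unfolding set_borel_measurable_def by measurable
  show "set_integrable \<nu> jumps g" "\<bar>LINT z:jumps|\<nu>. g z\<bar> \<le> A * m0 + B * m1"
    using set_integral_dominated[OF h g le] finite_jumps r_jumps_integrable const_jumps_integrable
    by (auto simp: set_integral_add const_jumps_integral m0_def m1_def mult.commute)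
qed

lemma m_nonneg: "i \<in> I \<Longrightarrow> 0 \<le> m0" "i \<in> I \<Longrightarrow> 0 \<le> m1" "0 \<le> m2"
  unfolding m0_def m1_def m2_def set_lebesgue_integral_def
  using r_nonneg jumps_nonzero by (auto intro!: integral_nonneg_AE AE_I2 simp: indicator_def)

definition "drift i = (LINT z:jumps|\<nu>. \<eta> i z)"

lemma \<eta>_jumps_integrable: assumes "i \<in> I" shows "set_integrable \<nu> jumps (\<eta> i)"
  unfolding set_integrable_def
proof (rule Bochner_Integration.integrable_bound[OF r_jumps_integrable[unfolded set_integrable_def]])
  show "(\<lambda>z. indicator jumps z *\<^sub>R \<eta> i z) \<in> borel_measurable \<nu>"
    using assms by measurable
  show "AE z in \<nu>. norm (indicator jumps z *\<^sub>R \<eta> i z) \<le> norm (indicator jumps z *\<^sub>R r z)"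
    using \<eta>_le[OF assms] by (intro AE_I2) (force simp: indicator_def space_\<nu> intro: order_trans)
qed

lemma drift_inner: "i \<in> I \<Longrightarrow> drift i \<bullet> p = (LINT z:jumps|\<nu>. \<eta> i z \<bullet> p)"
  using \<eta>_jumps_integrable[of i] unfolding drift_def set_lebesgue_integral_def set_integrable_def
  by (simp flip: integral_inner_left)

lemma norm_drift: assumes "i \<in> I" shows "norm (drift i) \<le> m1"
proof -
  have "norm (drift i) \<le> (\<integral>z. norm (indicator jumps z *\<^sub>R \<eta> i z) \<partial>\<nu>)"
    unfolding drift_def set_lebesgue_integral_def by (rule integral_norm_bound)
  also have "\<dots> \<le> m1"
    unfolding m1_def set_lebesgue_integral_def
    using \<eta>_jumps_integrable[OF assms] r_jumps_integrable \<eta>_le[OF assms]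
    by (intro integral_mono integrable_norm) (auto simp: set_integrable_def indicator_def space_\<nu>)
  finally show ?thesis .
qed

end

locale isaacs_data = levy_jumps I \<nu> \<eta> r \<delta>
  for I :: "'i set" and \<nu> :: "(real^'m) measure" and \<eta> :: "'i \<Rightarrow> real^'m \<Rightarrow> real^'n" and r \<delta> +
  fixes b :: "'i \<Rightarrow> real \<Rightarrow> real^'n \<Rightarrow> real^'n" and c :: "'i \<Rightarrow> real \<Rightarrow> real^'n \<Rightarrow> real" and K T :: real
  assumes K_pos: "0 < K" and T_pos: "0 < T" and I_nonempty: "I \<noteq> {}"
    and b_bound: "i \<in> I \<Longrightarrow> t \<in> {0..T} \<Longrightarrow> norm (b i t x) \<le> K"
    and b_lip: "i \<in> I \<Longrightarrow> t \<in> {0..T} \<Longrightarrow> s \<in> {0..T} \<Longrightarrow> norm (b i t x - b i s y) \<le> K * (\<bar>t - s\<bar> + norm (x - y))"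
    and c_bound: "i \<in> I \<Longrightarrow> t \<in> {0..T} \<Longrightarrow> 0 \<le> c i t x \<and> c i t x \<le> K"
    and c_lip: "i \<in> I \<Longrightarrow> t \<in> {0..T} \<Longrightarrow> s \<in> {0..T} \<Longrightarrow> \<bar>c i t x - c i s y\<bar> \<le> K * (\<bar>t - s\<bar> + norm (x - y))"
begin

lemma m_nonneg': "0 \<le> m0" "0 \<le> m1" using m_nonneg I_nonempty by auto

text \<open>A predicate rather than part of the locale, because duality replaces \<open>f\<close> by
  its negative while \<open>b\<close> and \<open>c\<close> stay fixed.\<close>

definition source :: "('i \<Rightarrow> real \<Rightarrow> real^'n \<Rightarrow> real) \<Rightarrow> bool" where
  "source f \<longleftrightarrow> (\<forall>i\<in>I. \<forall>t\<in>{0..T}. \<forall>x. \<bar>f i t x\<bar> \<le> K \<and>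
     (\<forall>s\<in>{0..T}. \<forall>y. \<bar>f i t x - f i s y\<bar> \<le> K * (\<bar>t - s\<bar> + norm (x - y))))"

end

section \<open>The monotone scheme in abstract form\<close>

locale isaacs_scheme = isaacs_data I \<nu> \<eta> r \<delta> b c K T + tent cN Cw Kw dx \<omega>
  for I :: "'i set" and \<nu> :: "(real^'m) measure" and \<eta> :: "'i \<Rightarrow> real^'m \<Rightarrow> real^'n" and r \<delta>
    and b :: "'i \<Rightarrow> real \<Rightarrow> real^'n \<Rightarrow> real^'n" and c :: "'i \<Rightarrow> real \<Rightarrow> real^'n \<Rightarrow> real" and K T :: real
    and cN Cw Kw dx :: real and \<omega> :: "int^'n \<Rightarrow> real^'n \<Rightarrow> real" +
  fixes \<theta> \<theta>' dt :: real and MT :: nat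
  assumes \<theta>: "0 \<le> \<theta>" "\<theta> \<le> 1" "0 \<le> \<theta>'" "\<theta>' \<le> 1" and MT: "1 \<le> MT" "dt = T / real MT"
    and CFL: "i \<in> I \<Longrightarrow> n \<in> {1..MT} \<Longrightarrow>
      dt * ((1 - \<theta>) * (\<Sum>\<^sub>\<infinity>k\<in>-{0}. d_coeff (b i) (\<lambda>_ _. \<eta> i) \<nu> \<delta> dx k (real (n - 1) * dt) (grid_pt dx j))
          + (1 - \<theta>') * (\<Sum>\<^sub>\<infinity>k\<in>-{0}. kappa_coeff \<omega> (\<lambda>_ _. \<eta> i) \<nu> \<delta> k (real (n - 1) * dt) (grid_pt dx j))
          + c i (real n * dt) (grid_pt dx j)) \<le> 1"
begin

lemma dt_pos: "0 < dt" using MT T_pos by simp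

lemma grid_time: "n \<le> MT \<Longrightarrow> real n * dt \<in> {0..T}"
  using MT dt_pos by (auto simp: field_simps)

definition grid_bounded :: "real \<Rightarrow> (real \<Rightarrow> real^'n \<Rightarrow> real) \<Rightarrow> bool" where
  "grid_bounded M U \<longleftrightarrow> (\<forall>n\<le>MT. \<forall>j. \<bar>U (real n * dt) (grid_pt dx j)\<bar> \<le> M)"

definition scheme :: "(('i \<Rightarrow> real) \<Rightarrow> real) \<Rightarrow> ('i \<Rightarrow> real \<Rightarrow> real^'n \<Rightarrow> real) \<Rightarrow> (real \<Rightarrow> real^'n \<Rightarrow> real) \<Rightarrow> bool" where
  "scheme G f U \<longleftrightarrow> (\<forall>n\<in>{1..MT}. \<forall>j.
     let t = real n * dt; s = real (n - 1) * dt; x = grid_pt dx j in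
        U t x = U s x - dt * G (\<lambda>i. - f i s x + c i t x * U s x
           - \<theta> * D_op (b i) (\<lambda>_ _. \<eta> i) \<nu> \<delta> dx U t x
           - (1 - \<theta>) * D_op (b i) (\<lambda>_ _. \<eta> i) \<nu> \<delta> dx U s x
           - \<theta>' * J_op \<omega> (\<lambda>_ _. \<eta> i) \<nu> \<delta> dx U t x
           - (1 - \<theta>') * J_op \<omega> (\<lambda>_ _. \<eta> i) \<nu> \<delta> dx U s x))"

text \<open>The l1 norm of the compensated drift; divided by \<open>dx\<close> it is the total
  weight of the upwind differences, the quantity that CFL restricts.\<close>

definition bsum :: "'i \<Rightarrow> real \<Rightarrow> real^'n \<Rightarrow> real" where
  "bsum i t x = (\<Sum>l\<in>UNIV. \<bar>b_tilde (b i) (\<lambda>_ _. \<eta> i) \<nu> \<delta> t x $ l\<bar>)"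

lemma b_tilde_eq: "b_tilde (b i) (\<lambda>_ _. \<eta> i) \<nu> \<delta> t x = b i t x - drift i"
  by (simp add: b_tilde_def drift_def jumps_def)

lemma bsum_bound:
  assumes "i \<in> I" "t \<in> {0..T}" shows "0 \<le> bsum i t x" "bsum i t x \<le> real CARD('n) * (K + m1)"
proof -
  show "0 \<le> bsum i t x" unfolding bsum_def by (intro sum_nonneg) auto
  have "bsum i t x \<le> (\<Sum>l\<in>(UNIV::'n set). K + m1)"
    unfolding bsum_def
  proof (rule sum_mono)
    fix l
    have "\<bar>b_tilde (b i) (\<lambda>_ _. \<eta> i) \<nu> \<delta> t x $ l\<bar> \<le> norm (b i t x - drift i)"
      unfolding b_tilde_eq by (rule component_le_norm_cart)
    also have "\<dots> \<le> K + m1"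
      using norm_triangle_ineq4[of "b i t x" "drift i"] b_bound[OF assms] norm_drift[OF assms(1)]
      by (smt (verit))
    finally show "\<bar>b_tilde (b i) (\<lambda>_ _. \<eta> i) \<nu> \<delta> t x $ l\<bar> \<le> K + m1" .
  qed
  then show "bsum i t x \<le> real CARD('n) * (K + m1)" by simp
qed

text \<open>The upwind coefficients are nonnegative, so an upper bound on increments passes to the
  operator. The linear part reproduces the drift exactly, the quadratic part leaves the numerical
  diffusion \<open>R * dx\<close>, and a constant excess \<open>a\<close> is multiplied by the total
  weight.\<close>

lemma D_op_le:
  assumes "\<And>k. w t (x + grid_pt dx k) - w t x \<le> p \<bullet> grid_pt dx k + R * (norm (grid_pt dx k))\<^sup>2 + a"
  shows "D_op (b i) (\<lambda>_ _. \<eta> i) \<nu> \<delta> dx w t x \<le> (b i t x - drift i) \<bullet> p + (R * dx + a / dx) * bsum i t x"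
proof -
  let ?B = "\<lambda>l. b_tilde (b i) (\<lambda>_ _. \<eta> i) \<nu> \<delta> t x $ l"
  have "D_op (b i) (\<lambda>_ _. \<eta> i) \<nu> \<delta> dx w t x \<le> (\<Sum>l\<in>UNIV. ?B l * p $ l + (R * dx + a / dx) * \<bar>?B l\<bar>)"
    unfolding D_op_def
  proof (rule sum_mono)
    fix l
    have "w t (x + dx *\<^sub>R axis l 1) - w t x \<le> p $ l * dx + R * dx\<^sup>2 + a"
      using assms[of "axis l 1"] by (simp add: grid_pt_axis inner_axis mult.commute)
    then have 1: "(w t (x + dx *\<^sub>R axis l 1) - w t x) / dx \<le> p $ l + R * dx + a / dx"
      using dx_pos divide_right_mono[of _ "p $ l * dx + R * dx\<^sup>2 + a" dx]
      by (auto simp: add_divide_distrib power2_eq_square)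
    have "w t (x - dx *\<^sub>R axis l 1) - w t x \<le> - p $ l * dx + R * dx\<^sup>2 + a"
      using assms[of "- axis l 1"] by (simp add: grid_pt_minus grid_pt_axis inner_axis mult.commute)
    then have 2: "(w t (x - dx *\<^sub>R axis l 1) - w t x) / dx \<le> - p $ l + R * dx + a / dx"
    proof -
      have "(- p $ l * dx + R * dx\<^sup>2 + a) / dx = - p $ l + R * dx + a / dx"
        using dx_pos by (simp add: field_simps power2_eq_square)
      moreover assume "w t (x - dx *\<^sub>R axis l 1) - w t x \<le> - p $ l * dx + R * dx\<^sup>2 + a"
      ultimately show ?thesis using dx_pos by (metis divide_right_mono less_imp_le)
    qed
    have "max (?B l) 0 * ((w t (x + dx *\<^sub>R axis l 1) - w t x) / dx)
        + max (- ?B l) 0 * ((w t (x - dx *\<^sub>R axis l 1) - w t x) / dx)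
        \<le> max (?B l) 0 * (p $ l + R * dx + a / dx) + max (- ?B l) 0 * (- p $ l + R * dx + a / dx)"
      using 1 2 by (intro add_mono mult_left_mono) auto
    also have "\<dots> = ?B l * p $ l + (R * dx + a / dx) * \<bar>?B l\<bar>"
      by (auto simp: max_def algebra_simps)
    finally show "max (?B l) 0 * ((w t (x + dx *\<^sub>R axis l 1) - w t x) / dx)
        + max (- ?B l) 0 * ((w t (x - dx *\<^sub>R axis l 1) - w t x) / dx)
        \<le> ?B l * p $ l + (R * dx + a / dx) * \<bar>?B l\<bar>" .
  qed
  also have "\<dots> = (b i t x - drift i) \<bullet> p + (R * dx + a / dx) * bsum i t x"
    unfolding sum.distrib bsum_def sum_distrib_left b_tilde_eq by (simp add: inner_vec_def)
  finally show ?thesis .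
qed

lemma d_coeff_sum: "(\<Sum>\<^sub>\<infinity>k\<in>-{0}. d_coeff (b i) (\<lambda>_ _. \<eta> i) \<nu> \<delta> dx k t x) = bsum i t x / dx"
proof -
  let ?d = "\<lambda>k. d_coeff (b i) (\<lambda>_ _. \<eta> i) \<nu> \<delta> dx k t x"
  let ?B = "\<lambda>l. b_tilde (b i) (\<lambda>_ _. \<eta> i) \<nu> \<delta> t x $ l"
  define F where "F = range (\<lambda>l. axis l 1 :: int^'n) \<union> range (\<lambda>l. - axis l 1)"
  have F: "finite F" "F \<subseteq> - {0}" by (auto simp: F_def axis_eq_0_iff)
  have "(?d has_sum sum ?d F) (-{0})"
    by (rule has_sum_finite_neutralI[OF F]) (auto simp: d_coeff_def F_def intro!: sum.neutral)
  then have "(\<Sum>\<^sub>\<infinity>k\<in>-{0}. ?d k) = sum ?d F" by (rule infsumI)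
  also have "\<dots> = (\<Sum>l\<in>UNIV. \<Sum>k\<in>F. (if k = axis l 1 then max (?B l) 0 / dx else 0) +
        (if k = - axis l 1 then max (- ?B l) 0 / dx else 0))"
    unfolding d_coeff_def by (rule sum.swap)
  also have "\<dots> = (\<Sum>l\<in>UNIV. max (?B l) 0 / dx + max (- ?B l) 0 / dx)"
    using F by (intro sum.cong refl) (auto simp: sum.distrib F_def)
  also have "\<dots> = bsum i t x / dx"
    unfolding bsum_def sum_divide_distrib by (intro sum.cong refl) (auto simp: max_def)
  finally show ?thesis .
qed

text \<open>The tent functions sum to 1, so removing the node 0 leaves
  \<open>1 - \<omega> 0\<close>: a jump counts only with the mass that it carries away from the
  origin.\<close>

lemma kappa_coeff_sum:
  assumes "i \<in> I"
  shows "(\<Sum>\<^sub>\<infinity>k\<in>-{0}. kappa_coeff \<omega> (\<lambda>_ _. \<eta> i) \<nu> \<delta> k t x) = (LINT z:jumps|\<nu>. 1 - \<omega> 0 (\<eta> i z))"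
proof -
  have "(\<Sum>\<^sub>\<infinity>k\<in>-{0}. kappa_coeff \<omega> (\<lambda>_ _. \<eta> i) \<nu> \<delta> k t x)
      = (\<Sum>\<^sub>\<infinity>k. (if k = 0 then 0 else 1) * (LINT z:jumps|\<nu>. \<omega> k (\<eta> i z)))"
    by (rule infsum_cong_neutral) (auto simp: kappa_coeff_def jumps_def)
  also have "\<dots> = (LINT z:jumps|\<nu>. (\<Sum>\<^sub>\<infinity>k. (if k = 0 then 0 else 1) * \<omega> k (\<eta> i z)))"
    using assms by (intro infsumI has_sum_integral_\<omega>(2)[where B=1] finite_jumps) auto
  also have "\<dots> = (LINT z:jumps|\<nu>. 1 - \<omega> 0 (\<eta> i z))"
  proof -
    have "(\<Sum>\<^sub>\<infinity>k. (if k = 0 then 0 else 1) * \<omega> k v) = 1 - \<omega> 0 v" for v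
    proof -
      have "(\<Sum>\<^sub>\<infinity>k. (if k = 0 then 0 else 1) * \<omega> k v) = (\<Sum>k | \<omega> k v \<noteq> 0. (if k = 0 then 0 else 1) * \<omega> k v)"
        by (rule infsumI[OF has_sum_\<omega>])
      also have "\<dots> = (\<Sum>k | \<omega> k v \<noteq> 0. \<omega> k v - (if k = 0 then \<omega> 0 v else 0))"
        by (intro sum.cong) auto
      finally show ?thesis
        using finite_\<omega>_support[of v] by (simp add: sum_subtractf sum_\<omega> sum.delta)
    qed
    then show ?thesis by simp
  qed
  finally show ?thesis .
qed

text \<open>After the exchange of sum and integral the operator integrates interpolants at
  \<open>\<eta> i z\<close>. The expansion is made around the landing point of each jump, not around
  \<open>x\<close>, so the error is of second order in \<open>dx\<close> for long jumps too.\<close>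

lemma J_op_le:
  assumes i: "i \<in> I" and bd: "\<And>k. \<bar>w t (x + grid_pt dx k)\<bar> \<le> M" and R: "0 \<le> R"
    and V: "set_integrable \<nu> jumps V"
    and le: "\<And>z k. z \<in> jumps \<Longrightarrow> w t (x + grid_pt dx k) - w t x
        \<le> V z + P z \<bullet> (grid_pt dx k - \<eta> i z) + R * (norm (grid_pt dx k - \<eta> i z))\<^sup>2 + (if k = 0 then 0 else a)"
  shows "J_op \<omega> (\<lambda>_ _. \<eta> i) \<nu> \<delta> dx w t x \<le> (LINT z:jumps|\<nu>. V z) + R * cN\<^sup>2 * dx\<^sup>2 * m0
    + a * (\<Sum>\<^sub>\<infinity>k\<in>-{0}. kappa_coeff \<omega> (\<lambda>_ _. \<eta> i) \<nu> \<delta> k t x)"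
proof -
  let ?C = "\<lambda>k. w t (x + grid_pt dx k) - w t x"
  have C: "\<bar>?C k\<bar> \<le> 2 * M" for k using bd[of k] bd[of 0] by (simp add: abs_le_iff)
  note * = has_sum_integral_\<omega>[OF jumps_sets finite_jumps \<eta>_measurable[OF i] C]
  have [measurable]: "(\<lambda>z. \<omega> 0 (\<eta> i z)) \<in> borel_measurable \<nu>"
    by (rule measurable_compose[OF \<eta>_measurable[OF i] \<omega>_measurable])
  have \<omega>1: "\<omega> 0 v \<le> 1" for v using tent by (auto simp: tent_basis_def)
  have om: "set_integrable \<nu> jumps (\<lambda>z. 1 - \<omega> 0 (\<eta> i z))"
  proof (rule jumps_integral_bound(1)[of _ 1 0])
    show "\<bar>1 - \<omega> 0 (\<eta> i z)\<bar> \<le> 1 + 0 * r z" for z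
      using \<omega>_nonneg[of 0 "\<eta> i z"] \<omega>1[of "\<eta> i z"] by simp
  qed auto
  have "J_op \<omega> (\<lambda>_ _. \<eta> i) \<nu> \<delta> dx w t x = (\<Sum>\<^sub>\<infinity>k. ?C k * (LINT z:jumps|\<nu>. \<omega> k (\<eta> i z)))"
    by (simp add: J_op_def kappa_coeff_def jumps_def)
  also have "\<dots> = (LINT z:jumps|\<nu>. (\<Sum>\<^sub>\<infinity>k. ?C k * \<omega> k (\<eta> i z)))"
    by (rule infsumI[OF *(2)])
  also have "\<dots> \<le> (LINT z:jumps|\<nu>. V z + R * cN\<^sup>2 * dx\<^sup>2 + a * (1 - \<omega> 0 (\<eta> i z)))"
    using sum_\<omega>_le[OF le R]
    by (intro set_integral_mono *(1) set_integral_add V const_jumps_integrable set_integrable_mult_right om) auto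
  also have "\<dots> = (LINT z:jumps|\<nu>. V z) + R * cN\<^sup>2 * dx\<^sup>2 * m0 + a * (LINT z:jumps|\<nu>. 1 - \<omega> 0 (\<eta> i z))"
    using V om
    by (simp add: set_integral_add const_jumps_integrable const_jumps_integral m0_def)
  finally show ?thesis unfolding kappa_coeff_sum[OF i] .
qed

lemma op_uminus:
  "D_op (b i) (\<lambda>_ _. \<eta> i) \<nu> \<delta> dx (\<lambda>t x. - U t x) t x = - D_op (b i) (\<lambda>_ _. \<eta> i) \<nu> \<delta> dx U t x"
  "J_op \<omega> (\<lambda>_ _. \<eta> i) \<nu> \<delta> dx (\<lambda>t x. - U t x) t x = - J_op \<omega> (\<lambda>_ _. \<eta> i) \<nu> \<delta> dx U t x"
proof -
  show "D_op (b i) (\<lambda>_ _. \<eta> i) \<nu> \<delta> dx (\<lambda>t x. - U t x) t x = - D_op (b i) (\<lambda>_ _. \<eta> i) \<nu> \<delta> dx U t x"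
    unfolding D_op_def sum_negf[symmetric] by (intro sum.cong refl) (simp add: algebra_simps diff_divide_distrib)
  show "J_op \<omega> (\<lambda>_ _. \<eta> i) \<nu> \<delta> dx (\<lambda>t x. - U t x) t x = - J_op \<omega> (\<lambda>_ _. \<eta> i) \<nu> \<delta> dx U t x"
    unfolding J_op_def infsum_uminus[symmetric] by (rule infsum_cong) (simp add: algebra_simps)
qed

text \<open>Crude bounds that serve to put families into the domain where \<open>G\<close> is
  monotone.\<close>

lemma op_bounds:
  assumes i: "i \<in> I" and t: "t \<in> {0..T}" and bd: "\<And>k. \<bar>w t (x + grid_pt dx k)\<bar> \<le> M"
  shows "\<bar>D_op (b i) (\<lambda>_ _. \<eta> i) \<nu> \<delta> dx w t x\<bar> \<le> 2 * M / dx * (real CARD('n) * (K + m1))"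
    and "\<bar>J_op \<omega> (\<lambda>_ _. \<eta> i) \<nu> \<delta> dx w t x\<bar> \<le> 2 * M * m0"
proof -
  have M: "0 \<le> M" using bd[of 0] by linarith
  have C: "w t (x + grid_pt dx k) - w t x \<le> 2 * M" "- w t (x + grid_pt dx k) - (- w t x) \<le> 2 * M" for k
    using bd[of k] bd[of 0] by (simp_all add: abs_le_iff)
  have 1: "D_op (b i) (\<lambda>_ _. \<eta> i) \<nu> \<delta> dx w t x \<le> 2 * M / dx * bsum i t x"
    using D_op_le[of w t x 0 0 "2*M" i] C by simp
  have 2: "- D_op (b i) (\<lambda>_ _. \<eta> i) \<nu> \<delta> dx w t x \<le> 2 * M / dx * bsum i t x"
    using D_op_le[of "\<lambda>t x. - w t x" t x 0 0 "2*M" i] C by (simp add: op_uminus)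
  have "2 * M / dx * bsum i t x \<le> 2 * M / dx * (real CARD('n) * (K + m1))"
    using bsum_bound[OF i t] M dx_pos by (intro mult_left_mono) auto
  with 1 2 show "\<bar>D_op (b i) (\<lambda>_ _. \<eta> i) \<nu> \<delta> dx w t x\<bar> \<le> 2 * M / dx * (real CARD('n) * (K + m1))"
    by linarith
  have "J_op \<omega> (\<lambda>_ _. \<eta> i) \<nu> \<delta> dx w t x \<le> (LINT z:jumps|\<nu>. 2 * M) + 0 * cN\<^sup>2 * dx\<^sup>2 * m0
    + 0 * (\<Sum>\<^sub>\<infinity>k\<in>-{0}. kappa_coeff \<omega> (\<lambda>_ _. \<eta> i) \<nu> \<delta> k t x)"
    by (rule J_op_le[OF i, of w t x M, where P = "\<lambda>_. 0"]) (use bd C const_jumps_integrable in auto)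
  moreover have "J_op \<omega> (\<lambda>_ _. \<eta> i) \<nu> \<delta> dx (\<lambda>t x. - w t x) t x \<le> (LINT z:jumps|\<nu>. 2 * M) + 0 * cN\<^sup>2 * dx\<^sup>2 * m0
    + 0 * (\<Sum>\<^sub>\<infinity>k\<in>-{0}. kappa_coeff \<omega> (\<lambda>_ _. \<eta> i) \<nu> \<delta> k t x)"
    by (rule J_op_le[OF i, of _ _ _ M, where P = "\<lambda>_. 0"]) (use bd C const_jumps_integrable in auto)
  moreover have "J_op \<omega> (\<lambda>_ _. \<eta> i) \<nu> \<delta> dx (\<lambda>t x. - w t x) t x = - J_op \<omega> (\<lambda>_ _. \<eta> i) \<nu> \<delta> dx w t x"
    by (rule op_uminus)
  moreover have "(LINT z:jumps|\<nu>. 2 * M) = 2 * M * m0"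
    by (simp add: m0_def const_jumps_integral)
  ultimately show "\<bar>J_op \<omega> (\<lambda>_ _. \<eta> i) \<nu> \<delta> dx w t x\<bar> \<le> 2 * M * m0"
    unfolding abs_le_iff mult_zero_left by (intro conjI) linarith+
qed

text \<open>Per unit of the curvature bound \<open>R\<close>: the numerical diffusion of the upwind
  differences and the interpolation error of the jump part.\<close>

definition "mesh_error = dx * (real CARD('n) * (K + m1)) + cN\<^sup>2 * dx\<^sup>2 * m0"

text \<open>Increments at the old level \<open>s\<close> may exceed those of the test function by
  \<open>a\<close>. Replacing \<open>U s x\<close> by \<open>U s x + a\<close> changes the time
  quotient by \<open>a / dt\<close> and the zeroth order term by \<open>c * a\<close>; by CFL the
  former covers the latter together with \<open>a\<close> times the explicit weights.\<close>

lemma discrete_subsolution: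
  assumes G: "game_operator I G" and f: "source f" and U: "scheme G f U" "grid_bounded M U"
    and n: "n \<in> {1..MT}"
    and t_def: "t = real n * dt" and s_def: "s = real (n - 1) * dt" and x_def: "x = grid_pt dx j"
    and a: "0 \<le> a" and R: "0 \<le> R"
    and Dt: "\<And>k. U t (x + grid_pt dx k) - U t x \<le> p \<bullet> grid_pt dx k + R * (norm (grid_pt dx k))\<^sup>2"
    and Ds: "\<And>k. U s (x + grid_pt dx k) - U s x \<le> p \<bullet> grid_pt dx k + R * (norm (grid_pt dx k))\<^sup>2 + a"
    and Jt: "\<And>i z k. i \<in> I \<Longrightarrow> z \<in> jumps \<Longrightarrow> U t (x + grid_pt dx k) - U t x
       \<le> V i z + P i z \<bullet> (grid_pt dx k - \<eta> i z) + R * (norm (grid_pt dx k - \<eta> i z))\<^sup>2"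
    and Js: "\<And>i z k. i \<in> I \<Longrightarrow> z \<in> jumps \<Longrightarrow> U s (x + grid_pt dx k) - U s x
       \<le> V i z + P i z \<bullet> (grid_pt dx k - \<eta> i z) + R * (norm (grid_pt dx k - \<eta> i z))\<^sup>2 + a"
    and V: "\<And>i. i \<in> I \<Longrightarrow> V i \<in> borel_measurable \<nu>" "\<And>i z. i \<in> I \<Longrightarrow> z \<in> jumps \<Longrightarrow> \<bar>V i z\<bar> \<le> A + B * r z"
  shows "(U t x - U s x - a) / dt
      + G (\<lambda>i. - f i s x + c i t x * (U s x + a) - (\<theta> *\<^sub>R b i t x + (1 - \<theta>) *\<^sub>R b i s x) \<bullet> p
                + drift i \<bullet> p - (LINT z:jumps|\<nu>. V i z)) \<le> R * mesh_error"
proof -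
  let ?D = "\<lambda>i t. D_op (b i) (\<lambda>_ _. \<eta> i) \<nu> \<delta> dx U t x"
  let ?J = "\<lambda>i t. J_op \<omega> (\<lambda>_ _. \<eta> i) \<nu> \<delta> dx U t x"
  define X where "X i = - f i s x + c i t x * U s x - \<theta> * ?D i t - (1 - \<theta>) * ?D i s
     - \<theta>' * ?J i t - (1 - \<theta>') * ?J i s" for i
  define Y where "Y i = - f i s x + c i t x * (U s x + a) - (\<theta> *\<^sub>R b i t x + (1 - \<theta>) *\<^sub>R b i s x) \<bullet> p
     + drift i \<bullet> p - (LINT z:jumps|\<nu>. V i z)" for i
  have t: "t \<in> {0..T}" and s: "s \<in> {0..T}"
    using n grid_time[of n] grid_time[of "n - 1"] by (auto simp: t_def s_def)
  have bd: "\<bar>U t (x + grid_pt dx k)\<bar> \<le> M" "\<bar>U s (x + grid_pt dx k)\<bar> \<le> M" for k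
    using U(2) n unfolding grid_bounded_def t_def s_def x_def grid_pt_add[symmetric]
    by (auto simp del: of_nat_diff)
  have M: "0 \<le> M" using bd(1)[of 0] by linarith
  have Vi: "set_integrable \<nu> jumps (V i)" "\<bar>LINT z:jumps|\<nu>. V i z\<bar> \<le> A * m0 + B * m1" if "i \<in> I" for i
    using jumps_integral_bound V that by blast+
  have fb: "\<bar>f i s x\<bar> \<le> K" if "i \<in> I" for i using f that s by (auto simp: source_def)
  have cb: "\<bar>c i t x\<bar> \<le> K" if "i \<in> I" for i using c_bound[OF that t] by auto
  have \<theta>b: "\<bar>\<theta>\<bar> \<le> 1" "\<bar>1 - \<theta>\<bar> \<le> 1" "\<bar>\<theta>'\<bar> \<le> 1" "\<bar>1 - \<theta>'\<bar> \<le> 1" using \<theta> by auto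
  have Xb: "\<bar>X i\<bar> \<le> K + K * M + 1 * (2 * M / dx * (real CARD('n) * (K + m1)))
     + 1 * (2 * M / dx * (real CARD('n) * (K + m1))) + 1 * (2 * M * m0) + 1 * (2 * M * m0)" if i: "i \<in> I" for i
    unfolding X_def using fb[OF i] bd(2)[of 0]
    by (intro abs_sum_le abs_mult_le op_bounds[OF i t, of U x M] op_bounds[OF i s, of U x M] bd \<theta>b cb[OF i]) auto
  have bb: "norm (\<theta> *\<^sub>R b i t x + (1 - \<theta>) *\<^sub>R b i s x) \<le> K" if i: "i \<in> I" for i
  proof -
    have "norm (\<theta> *\<^sub>R b i t x + (1 - \<theta>) *\<^sub>R b i s x) \<le> \<theta> * norm (b i t x) + (1 - \<theta>) * norm (b i s x)"
      using norm_triangle_ineq[of "\<theta> *\<^sub>R b i t x" "(1 - \<theta>) *\<^sub>R b i s x"] \<theta> by simp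
    also have "\<dots> \<le> \<theta> * K + (1 - \<theta>) * K"
      using \<theta> b_bound[OF i t] b_bound[OF i s] by (intro add_mono mult_left_mono) auto
    finally show ?thesis by (simp add: algebra_simps)
  qed
  have Yb: "\<bar>Y i\<bar> \<le> K + K * (M + a) + K * norm p + m1 * norm p + (A * m0 + B * m1)" if i: "i \<in> I" for i
    unfolding Y_def using fb[OF i] bd(2)[of 0] a
    by (intro abs_sum_le abs_mult_le abs_inner_le cb[OF i] norm_drift[OF i] bb[OF i] Vi(2)[OF i]) auto
  have YX: "Y i \<le> X i + (R * mesh_error + a / dt)" if i: "i \<in> I" for i
  proof -
    let ?\<kappa> = "\<Sum>\<^sub>\<infinity>k\<in>-{0}. kappa_coeff \<omega> (\<lambda>_ _. \<eta> i) \<nu> \<delta> k s x"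
    let ?N = "real CARD('n) * (K + m1)"
    let ?E = "R * cN\<^sup>2 * dx\<^sup>2 * m0" and ?LV = "LINT z:jumps|\<nu>. V i z"
    have "?D i t \<le> (b i t x - drift i) \<bullet> p + (R * dx + 0 / dx) * bsum i t x"
      by (rule D_op_le) (use Dt in simp)
    moreover have "R * dx * bsum i t x \<le> R * dx * ?N"
      using bsum_bound[OF i t] R dx_pos by (intro mult_left_mono) auto
    ultimately have D1: "?D i t \<le> (b i t x - drift i) \<bullet> p + R * dx * ?N" by simp
    have "?D i s \<le> (b i s x - drift i) \<bullet> p + (R * dx + a / dx) * bsum i s x"
      by (rule D_op_le) (use Ds in simp)
    moreover have "R * dx * bsum i s x \<le> R * dx * ?N"
      using bsum_bound[OF i s] R dx_pos by (intro mult_left_mono) auto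
    ultimately have D2: "?D i s \<le> (b i s x - drift i) \<bullet> p + R * dx * ?N + a * (bsum i s x / dx)"
      by (simp add: algebra_simps)
    have J1: "?J i t \<le> ?LV + ?E + 0 * (\<Sum>\<^sub>\<infinity>k\<in>-{0}. kappa_coeff \<omega> (\<lambda>_ _. \<eta> i) \<nu> \<delta> k t x)"
      by (rule J_op_le[OF i, of U t x M R "V i" "P i" 0]) (use bd R Vi(1)[OF i] Jt[OF i] in simp_all)
    have J2: "?J i s \<le> ?LV + ?E + a * ?\<kappa>"
    proof (rule J_op_le[OF i, of U s x M R "V i" "P i" a, OF bd(2) R Vi(1)[OF i]])
      fix z k assume z: "z \<in> jumps"
      \<comment> \<open>At the node 0 both increments vanish, so the bound of the new level, free of
        \<open>a\<close>, serves there. Thus \<open>a\<close> is multiplied only by the weight off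
        the origin.\<close>
      have "U s (x + grid_pt dx 0) - U s x \<le> V i z + P i z \<bullet> (grid_pt dx 0 - \<eta> i z)
          + R * (norm (grid_pt dx 0 - \<eta> i z))\<^sup>2"
        using Jt[OF i z, of 0] by simp
      then show "U s (x + grid_pt dx k) - U s x \<le> V i z + P i z \<bullet> (grid_pt dx k - \<eta> i z)
          + R * (norm (grid_pt dx k - \<eta> i z))\<^sup>2 + (if k = 0 then 0 else a)"
        using Js[OF i z, of k] by auto
    qed
    have "dt * ((1 - \<theta>) * (bsum i s x / dx) + (1 - \<theta>') * ?\<kappa> + c i t x) \<le> 1"
      using CFL[OF i n, of j] unfolding d_coeff_sum t_def s_def x_def .
    then have cfl: "(1 - \<theta>) * (bsum i s x / dx) + (1 - \<theta>') * ?\<kappa> + c i t x \<le> 1 / dt"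
      using dt_pos by (simp add: pos_le_divide_eq mult.commute)
    have "a * ((1 - \<theta>) * (bsum i s x / dx) + (1 - \<theta>') * ?\<kappa> + c i t x) \<le> a * (1 / dt)"
      by (rule mult_left_mono[OF cfl a])
    moreover have "\<theta> * ?D i t \<le> \<theta> * ((b i t x - drift i) \<bullet> p + R * dx * ?N)"
      "(1 - \<theta>) * ?D i s \<le> (1 - \<theta>) * ((b i s x - drift i) \<bullet> p + R * dx * ?N + a * (bsum i s x / dx))"
      "\<theta>' * ?J i t \<le> \<theta>' * (?LV + ?E)"
      "(1 - \<theta>') * ?J i s \<le> (1 - \<theta>') * (?LV + ?E + a * ?\<kappa>)"
      using D1 D2 J1 J2 \<theta> by (intro mult_left_mono; simp)+
    ultimately show ?thesis
      unfolding X_def Y_def mesh_error_def by (simp add: algebra_simps inner_diff_left inner_add_left)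
  qed
  have "G Y \<le> G X + (R * mesh_error + a / dt)"
    by (rule game_operatorD[OF G Yb Xb YX])
  moreover have "U t x = U s x - dt * G X"
    using U(1) n unfolding scheme_def Let_def t_def s_def x_def X_def by blast
  ultimately show ?thesis
    unfolding Y_def[symmetric] using dt_pos by (simp add: field_simps)
qed

end

section \<open>Supersolutions and test functions\<close>

lemma attains_max_of_bounded_superlevel:
  fixes h :: "'p::heine_borel \<Rightarrow> real"
  assumes D: "closed D" "p0 \<in> D" and h: "continuous_on D h" and bd: "bounded {p \<in> D. h p0 \<le> h p}"
  shows "\<exists>p\<in>D. \<forall>q\<in>D. h q \<le> h p"
proof -
  have eq: "{p \<in> D. h p0 \<le> h p} = D \<inter> h -` {h p0..}" by auto
  have "closed {p \<in> D. h p0 \<le> h p}"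
    unfolding eq by (rule continuous_closed_preimage[OF h D(1)]) simp
  with bd have "compact {p \<in> D. h p0 \<le> h p}" by (simp add: compact_eq_bounded_closed)
  moreover have "{p \<in> D. h p0 \<le> h p} \<noteq> {}" using D by auto
  moreover have "continuous_on {p \<in> D. h p0 \<le> h p} h" by (rule continuous_on_subset[OF h]) auto
  ultimately obtain p where "p \<in> D" "h p0 \<le> h p" "\<And>q. q \<in> D \<Longrightarrow> h p0 \<le> h q \<Longrightarrow> h q \<le> h p"
    using continuous_attains_sup[of "{p \<in> D. h p0 \<le> h p}" h] by auto
  then show ?thesis by (intro bexI[of _ p]) force+
qed

lemma attains_max_of_finite_superlevel:
  fixes h :: "'p \<Rightarrow> real"
  assumes "p0 \<in> D" and fin: "finite {p \<in> D. h p0 \<le> h p}"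
  shows "\<exists>p\<in>D. \<forall>q\<in>D. h q \<le> h p"
proof -
  let ?S = "{p \<in> D. h p0 \<le> h p}"
  have "?S \<noteq> {}" using assms by auto
  then obtain p where p: "p \<in> ?S" "Max (h ` ?S) = h p"
    using obtains_MAX[OF fin, of h thesis] by blast
  have "h q \<le> h p" if "q \<in> D" for q
  proof (cases "h p0 \<le> h q")
    case True
    then show ?thesis using Max_ge[of "h ` ?S" "h q"] fin p(2) that by auto
  next
    case False
    then show ?thesis using p(1) by auto
  qed
  then show ?thesis using p(1) by auto
qed

text \<open>For a fixed grid point, coercivity in \<open>y\<close> gives compactness; afterwards
  coercivity in \<open>grid_pt dx j\<close> leaves finitely many grid points to compete.\<close>

lemma attains_max_grid_continuum:
  fixes \<Phi> :: "nat \<Rightarrow> int^'n \<Rightarrow> real \<times> (real^'n) \<Rightarrow> real"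
  assumes dx: "0 < dx" and T: "0 \<le> T" and k: "0 < k"
    and cont: "\<And>n j. n \<le> N \<Longrightarrow> continuous_on (Qbar_dom T) (\<Phi> n j)"
    and le: "\<And>n j s y. n \<le> N \<Longrightarrow> s \<in> {0..T} \<Longrightarrow>
       \<Phi> n j (s, y) \<le> C - k * norm (grid_pt dx j - y) - k * norm (grid_pt dx j)"
  obtains n j s y where "n \<le> N" "s \<in> {0..T}"
    "\<And>n' j' s' y'. n' \<le> N \<Longrightarrow> s' \<in> {0..T} \<Longrightarrow> \<Phi> n' j' (s', y') \<le> \<Phi> n j (s, y)"
proof -
  have Q: "closed (Qbar_dom T :: (real \<times> (real^'n)) set)"
    unfolding Qbar_dom_def by (intro closed_Times) auto
  have "\<exists>p\<in>Qbar_dom T. \<forall>q\<in>Qbar_dom T. \<Phi> n j q \<le> \<Phi> n j p" if n: "n \<le> N" for n j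
  proof (rule attains_max_of_bounded_superlevel[OF Q _ cont[OF n]])
    show "(0, 0) \<in> Qbar_dom T" using T by (auto simp: Qbar_dom_def)
    define B where "B = norm (grid_pt dx j) + \<bar>C - \<Phi> n j (0, 0)\<bar> / k"
    have "{p \<in> Qbar_dom T. \<Phi> n j (0, 0) \<le> \<Phi> n j p} \<subseteq> {0..T} \<times> cball 0 B"
    proof clarify
      fix s and y :: "real^'n" assume p: "(s, y) \<in> Qbar_dom T" "\<Phi> n j (0, 0) \<le> \<Phi> n j (s, y)"
      then have s: "s \<in> {0..T}" by (auto simp: Qbar_dom_def)
      have "k * norm (grid_pt dx j - y) + k * norm (grid_pt dx j) \<le> \<bar>C - \<Phi> n j (0, 0)\<bar>"
        using le[OF n s, of j y] p(2) by linarith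
      moreover have "0 \<le> k * norm (grid_pt dx j)" using k by simp
      ultimately have "k * norm (grid_pt dx j - y) \<le> \<bar>C - \<Phi> n j (0, 0)\<bar>" by linarith
      then have "norm (grid_pt dx j - y) \<le> \<bar>C - \<Phi> n j (0, 0)\<bar> / k"
        using k by (simp add: pos_le_divide_eq mult.commute)
      then have "norm y \<le> B"
        using norm_triangle_ineq3[of y "grid_pt dx j"] by (simp add: B_def norm_minus_commute)
      then show "s \<in> {0..T} \<and> y \<in> cball 0 B" using s by auto
    qed
    then show "bounded {p \<in> Qbar_dom T. \<Phi> n j (0, 0) \<le> \<Phi> n j p}"
      by (rule bounded_subset[rotated]) (intro bounded_Times bounded_closed_interval bounded_cball)
  qed
  then obtain P where P: "\<And>n j. n \<le> N \<Longrightarrow> P n j \<in> Qbar_dom T"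
    "\<And>n j q. n \<le> N \<Longrightarrow> q \<in> Qbar_dom T \<Longrightarrow> \<Phi> n j q \<le> \<Phi> n j (P n j)" by metis
  define m where "m = (\<lambda>(n, j). \<Phi> n j (P n j))"
  have "\<exists>p\<in>{..N} \<times> UNIV. \<forall>q\<in>{..N} \<times> UNIV. m q \<le> m p"
  proof (rule attains_max_of_finite_superlevel)
    show "(0, 0) \<in> {..N} \<times> UNIV" by auto
    have "norm (grid_pt dx j) \<le> (C - m (0, 0)) / k" if n: "n \<le> N" "m (0, 0) \<le> m (n, j)" for n j
    proof -
      obtain s y where sy: "P n j = (s, y)" by force
      then have s: "s \<in> {0..T}" using P(1)[of n j] n by (auto simp: Qbar_dom_def)
      have "0 \<le> k * norm (grid_pt dx j - y)" using k by simp
      with le[of n s j y] n s sy have "k * norm (grid_pt dx j) \<le> C - m (0, 0)" by (auto simp: m_def)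
      then show ?thesis using k by (simp add: pos_le_divide_eq mult.commute)
    qed
    then have "{p \<in> {..N} \<times> UNIV. m (0, 0) \<le> m p} \<subseteq> {..N} \<times> {j. norm (grid_pt dx j) \<le> (C - m (0, 0)) / k}"
      by auto
    then show "finite {p \<in> {..N} \<times> (UNIV :: (int^'n) set). m (0, 0) \<le> m p}"
      by (rule finite_subset) (intro finite_cartesian_product finite_atMost finite_grid_bounded[OF dx])
  qed
  then obtain n j where nj: "n \<le> N" "\<And>n' j'. n' \<le> N \<Longrightarrow> m (n', j') \<le> m (n, j)" by auto
  obtain s y where sy: "P n j = (s, y)" by force
  show ?thesis
  proof (rule that[of n s j y])
    show "n \<le> N" "s \<in> {0..T}" using nj P(1)[of n j] sy by (auto simp: Qbar_dom_def)
    fix n' j' s' and y' :: "real^'n" assume "n' \<le> N" "s' \<in> {0..T}"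
    then show "\<Phi> n' j' (s', y') \<le> \<Phi> n j (s, y)"
      using P(2)[of n' "(s', y')" j'] nj(2)[of n' j'] sy by (auto simp: Qbar_dom_def m_def)
  qed
qed

lemma lipschitz_of_gderiv_bound:
  fixes w :: "real^'n \<Rightarrow> real"
  assumes "\<And>y. GDERIV w y :> g y" "\<And>y. norm (g y) \<le> P"
  shows "\<bar>w (y + h) - w y\<bar> \<le> P * norm h"
proof -
  have "norm (w (y + h) - w y) \<le> P * norm (y + h - y)"
  proof (rule differentiable_bound[of UNIV w "\<lambda>x h. h \<bullet> g x"])
    show "onorm (\<lambda>h. h \<bullet> g x) \<le> P" for x
      using Cauchy_Schwarz_ineq2[of _ "g x"] mult_left_mono[OF assms(2)[of x] norm_ge_zero]
      by (intro onorm_le) (auto simp: mult.commute intro: order_trans)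
  qed (use assms(1) in \<open>auto simp: gderiv_def\<close>)
  then show ?thesis by simp
qed

section \<open>Smooth profiles, the class of functions from which barriers are built\<close>

context levy_jumps begin

text \<open>Slope \<open>P\<close>, curvature \<open>R\<close> and a bound \<open>L0\<close> on the
  compensated integral over the kept jumps. Keeping the compensator inside allows \<open>L0\<close>
  to stay bounded while the first moment \<open>m1\<close> blows up as \<delta> tends to 0.\<close>

definition smooth_profile :: "(real^'n \<Rightarrow> real) \<Rightarrow> (real^'n \<Rightarrow> real^'n) \<Rightarrow> real \<Rightarrow> real \<Rightarrow> real \<Rightarrow> bool" where
  "smooth_profile w g P R L0 \<longleftrightarrow> C2_on UNIV w \<and> (\<forall>y. GDERIV w y :> g y \<and> norm (g y) \<le> P)
     \<and> (\<forall>y h. \<bar>w (y + h) - w y - h \<bullet> g y\<bar> \<le> R * (norm h)\<^sup>2)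
     \<and> (\<forall>i\<in>I. \<forall>y. \<bar>(LINT z:jumps|\<nu>. w (y + \<eta> i z) - w y) - drift i \<bullet> g y\<bar> \<le> L0)"

lemma smooth_profileD:
  assumes "smooth_profile w g P R L0"
  shows "C2_on UNIV w" "GDERIV w y :> g y" "norm (g y) \<le> P" "0 \<le> P" "0 \<le> R"
    "\<bar>w (y + h) - w y - h \<bullet> g y\<bar> \<le> R * (norm h)\<^sup>2"
    "i \<in> I \<Longrightarrow> \<bar>(LINT z:jumps|\<nu>. w (y + \<eta> i z) - w y) - drift i \<bullet> g y\<bar> \<le> L0"
    "\<bar>w (y + h) - w y\<bar> \<le> P * norm h" "continuous_on S w"
proof -
  show *: "C2_on UNIV w" "GDERIV w y :> g y" "norm (g y) \<le> P"
    "\<bar>w (y + h) - w y - h \<bullet> g y\<bar> \<le> R * (norm h)\<^sup>2" for y h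
    using assms by (auto simp: smooth_profile_def)
  show "i \<in> I \<Longrightarrow> \<bar>(LINT z:jumps|\<nu>. w (y + \<eta> i z) - w y) - drift i \<bullet> g y\<bar> \<le> L0"
    using assms by (auto simp: smooth_profile_def)
  show "0 \<le> P" using *(3) norm_ge_zero order_trans by blast
  \<comment> \<open>Testing the remainder bound on a unit vector.\<close>
  show "0 \<le> R" using order_trans[OF abs_ge_zero *(4)[of 0 "axis undefined 1"]] by simp
  show "\<bar>w (y + h) - w y\<bar> \<le> P * norm h"
    by (rule lipschitz_of_gderiv_bound[of w g]) (rule *)+
  show "continuous_on S w"
    using has_derivative_continuous[OF *(2)[unfolded gderiv_def]]
    by (simp add: continuous_at_imp_continuous_on)
qed

end

context isaacs_data begin

definition visc_super :: "(('i \<Rightarrow> real) \<Rightarrow> real) \<Rightarrow> ('i \<Rightarrow> real \<Rightarrow> real^'n \<Rightarrow> real) \<Rightarrow> (real \<Rightarrow> real^'n \<Rightarrow> real) \<Rightarrow> bool" where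
  "visc_super G f u \<longleftrightarrow> (\<forall>\<kappa> \<phi> t x. 0 < \<kappa> \<and> \<kappa> < 1 \<and> C2_on (Q_dom T) (\<lambda>(s, y). \<phi> s y) \<and> (t, x) \<in> Q_dom T \<and>
        (\<forall>(s, y) \<in> Q_dom T. u t x - \<phi> t x \<le> u s y - \<phi> s y)
     \<longrightarrow> 0 \<le> vector_derivative (\<lambda>s. \<phi> s x) (at t within {0<..T}) +
       G (\<lambda>i. - f i t x + c i t x * u t x - b i t x \<bullet> grad (\<phi> t) x
        - nonlocal_inner \<nu> (\<lambda>_ _. \<eta> i) \<kappa> \<phi> t x
        - nonlocal_outer \<nu> (\<lambda>_ _. \<eta> i) \<kappa> u (grad (\<phi> t) x) t x))"

definition bounded_cont :: "real \<Rightarrow> (real \<Rightarrow> real^'n \<Rightarrow> real) \<Rightarrow> bool" where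
  "bounded_cont M u \<longleftrightarrow> (\<forall>t\<in>{0..T}. \<forall>x. \<bar>u t x\<bar> \<le> M) \<and> continuous_on (Qbar_dom T) (\<lambda>(t, x). u t x)"

lemma bounded_cont_slice:
  assumes "bounded_cont M u" "t \<in> {0..T}" shows "continuous_on UNIV (u t)"
proof -
  have "continuous_on UNIV (\<lambda>x :: real^'n. (t, x))" by (intro continuous_intros)
  moreover have "(\<lambda>x. (t, x)) ` UNIV \<subseteq> Qbar_dom T" using assms(2) by (auto simp: Qbar_dom_def)
  ultimately have "continuous_on UNIV (\<lambda>x. (\<lambda>(t, x). u t x) (t, x))"
    using assms(1) by (intro continuous_on_compose2[of "Qbar_dom T" "\<lambda>(t, x). u t x" UNIV "\<lambda>x. (t, x)"])
      (auto simp: bounded_cont_def)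
  then show ?thesis by simp
qed

text \<open>Moves the cut of the viscosity inequality from \<open>\<kappa>\<close> to
  \<open>\<delta>\<close>, where the scheme has it. Jumps of norm at most \<open>\<delta>\<close>
  cost \<open>R * m2\<close>: below \<open>\<kappa>\<close> by the Taylor bound on \<phi>, and
  between the two radii because minimality makes the increments of \<open>u\<close> at least those
  of \<phi>. Beyond \<open>\<delta>\<close> the compensator is split off as the drift.\<close>

lemma visc_super_ineq:
  assumes G: "game_operator I G" and f: "source f" and u: "visc_super G f u" "bounded_cont M u"
    and s: "0 < s" "s \<le> T" and C2: "C2_on (Q_dom T) (\<lambda>(s, y). \<phi> s y)"
    and min: "\<And>s' y'. 0 < s' \<Longrightarrow> s' \<le> T \<Longrightarrow> u s y - \<phi> s y \<le> u s' y' - \<phi> s' y'"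
    and d: "((\<lambda>s. \<phi> s y) has_vector_derivative d) (at s)" and p: "GDERIV (\<phi> s) y :> p"
    and R: "\<And>h. \<bar>\<phi> s (y + h) - \<phi> s y - h \<bullet> p\<bar> \<le> R * (norm h)\<^sup>2"
  shows "0 \<le> d + G (\<lambda>i. - f i s y + c i s y * u s y - b i s y \<bullet> p + drift i \<bullet> p
     - (LINT z:jumps|\<nu>. u s (y + \<eta> i z) - u s y)) + R * m2"
proof -
  define \<kappa> where "\<kappa> = \<delta> / 2"
  have \<kappa>: "0 < \<kappa>" "\<kappa> < 1" "\<kappa> < \<delta>" using \<delta> by (auto simp: \<kappa>_def)
  have gr: "grad (\<phi> s) y = p" by (rule grad_eqI[OF p])
  have sT: "s \<in> {0..T}" using s by auto
  have R0: "0 \<le> R" using order_trans[OF abs_ge_zero R[of "axis undefined 1"]] by simp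
  have ub: "\<bar>u s x\<bar> \<le> M" for x using u(2) sT by (auto simp: bounded_cont_def)
  have [measurable]: "u s \<in> borel_measurable borel"
    using bounded_cont_slice[OF u(2) sT] by (rule borel_measurable_continuous_onI)
  have "continuous_on (Q_dom T) (\<lambda>(s, y). \<phi> s y)"
  proof -
    from C2 obtain D D2 where "C2_with (Q_dom T) (\<lambda>(s, y). \<phi> s y) D D2" by (auto simp: C2_on_def)
    then show ?thesis
      by (intro has_derivative_continuous_on[of _ _ "\<lambda>p. blinfun_apply (D p)"]) (simp add: C2_with_def)
  qed
  moreover have "continuous_on UNIV (\<lambda>x :: real^'n. (s, x))" by (intro continuous_intros)
  moreover have "(\<lambda>x. (s, x)) ` UNIV \<subseteq> Q_dom T" using s by (auto simp: Q_dom_def)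
  ultimately have "continuous_on UNIV (\<lambda>x. (\<lambda>(s, y). \<phi> s y) (s, x))"
    by (rule continuous_on_compose2)
  then have [measurable]: "\<phi> s \<in> borel_measurable borel"
    by (intro borel_measurable_continuous_onI) simp
  define X where "X i = - f i s y + c i s y * u s y - b i s y \<bullet> p
     - nonlocal_inner \<nu> (\<lambda>_ _. \<eta> i) \<kappa> \<phi> s y - nonlocal_outer \<nu> (\<lambda>_ _. \<eta> i) \<kappa> u p s y" for i
  define Y where "Y i = - f i s y + c i s y * u s y - b i s y \<bullet> p + drift i \<bullet> p
     - (LINT z:jumps|\<nu>. u s (y + \<eta> i z) - u s y)" for i
  have fb: "\<bar>f i s y\<bar> \<le> K" if "i \<in> I" for i using f that sT by (auto simp: source_def)
  have cb: "\<bar>c i s y\<bar> \<le> K" if "i \<in> I" for i using c_bound[OF that sT] by auto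
  define g1 where "g1 i z = \<phi> s (y + \<eta> i z) - \<phi> s y - \<eta> i z \<bullet> p" for i z
  define g2 where "g2 i z = u s (y + \<eta> i z) - u s y - \<eta> i z \<bullet> p" for i z
  have [measurable]: "g1 i \<in> borel_measurable \<nu>" "g2 i \<in> borel_measurable \<nu>" if "i \<in> I" for i
    using \<eta>_measurable[OF that] unfolding g1_def g2_def by measurable
  let ?in = "{z::real^'m. norm z < \<kappa>}" and ?out = "{z::real^'m. \<kappa> \<le> norm z}"
  have g1le: "\<bar>g1 i z\<bar> \<le> R * (r z)\<^sup>2" if "i \<in> I" "z \<noteq> 0" for i z
  proof -
    have "(norm (\<eta> i z))\<^sup>2 \<le> (r z)\<^sup>2" using \<eta>_le[OF that] by (intro power_mono) auto
    then show ?thesis using R[of "\<eta> i z"] R0 unfolding g1_def by (meson mult_left_mono order_trans)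
  qed
  have g2le: "\<bar>g2 i z\<bar> \<le> 2 * M + norm p * r z" if "i \<in> I" "z \<noteq> 0" for i z
  proof -
    have "\<bar>\<eta> i z \<bullet> p\<bar> \<le> r z * norm p" using \<eta>_le[OF that] by (intro abs_inner_le) auto
    then show ?thesis using ub[of y] ub[of "y + \<eta> i z"] unfolding g2_def by (simp add: mult.commute abs_le_iff)
  qed
  have dom1: "set_integrable \<nu> ?in (\<lambda>z. R * (r z)\<^sup>2)"
  proof -
    have "(\<lambda>z. indicator ?in z *\<^sub>R (R * (r z)\<^sup>2)) = (\<lambda>z. if norm z < \<kappa> then R * (r z)\<^sup>2 else 0)" by auto
    then have "(\<lambda>z. indicator ?in z *\<^sub>R (R * (r z)\<^sup>2)) \<in> borel_measurable \<nu>" by simp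
    then show ?thesis unfolding set_integrable_def
      by (rule Bochner_Integration.integrable_bound[OF integrable_mult_right[OF r_square_integrable, of R]]) (auto simp: indicator_def)
  qed
  have dom2: "set_integrable \<nu> ?out (\<lambda>z. 2 * M + norm p * r z)"
    by (intro set_integral_add set_integrable_mult_right r_tail_integrable \<kappa>)
       (use finite_tail[OF \<kappa>(1)] tail_sets(1)[OF \<kappa>(1)] in \<open>auto simp: set_integrable_def intro!: integrable_mult_left\<close>)
  have sm1: "set_borel_measurable \<nu> ?in (g1 i)" if "i \<in> I" for i
  proof -
    have "(\<lambda>z. indicator ?in z *\<^sub>R g1 i z) = (\<lambda>z. if norm z < \<kappa> then g1 i z else 0)" by auto
    then show ?thesis unfolding set_borel_measurable_def using that by simp
  qed
  have sm2: "set_borel_measurable \<nu> ?out (g2 i)" if "i \<in> I" for i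
    unfolding set_borel_measurable_def using that tail_sets(1)[OF \<kappa>(1)] by measurable
  have int1: "set_integrable \<nu> ?in (g1 i)" "\<bar>LINT z:?in|\<nu>. g1 i z\<bar> \<le> (LINT z:?in|\<nu>. R * (r z)\<^sup>2)" if "i \<in> I" for i
    using set_integral_dominated[OF dom1 sm1 g1le] that by (auto simp: space_\<nu>)
  have int2: "set_integrable \<nu> ?out (g2 i)" "\<bar>LINT z:?out|\<nu>. g2 i z\<bar> \<le> (LINT z:?out|\<nu>. 2 * M + norm p * r z)" if "i \<in> I" for i
    using set_integral_dominated[OF dom2 sm2 g2le] that by (auto simp: space_\<nu>)
  have inner: "nonlocal_inner \<nu> (\<lambda>_ _. \<eta> i) \<kappa> \<phi> s y = (LINT z:?in|\<nu>. g1 i z)"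
    and outer: "nonlocal_outer \<nu> (\<lambda>_ _. \<eta> i) \<kappa> u p s y = (LINT z:?out|\<nu>. g2 i z)" for i
    by (simp_all add: nonlocal_inner_def nonlocal_outer_def nonlocal_on_def gr g1_def g2_def)
  have Xb: "\<bar>X i\<bar> \<le> K + K * M + K * norm p + (LINT z:?in|\<nu>. R * (r z)\<^sup>2) + (LINT z:?out|\<nu>. 2 * M + norm p * r z)" if i: "i \<in> I" for i
    unfolding X_def inner outer using fb[OF i] ub[of y]
    by (intro abs_sum_le abs_mult_le abs_inner_le cb[OF i] b_bound[OF i sT] int1[OF i] int2[OF i]) auto
  have jm: "(\<lambda>z. u s (y + \<eta> i z) - u s y) \<in> borel_measurable \<nu>" if "i \<in> I" for i
    using \<eta>_measurable[OF that] by measurable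
  have jint: "set_integrable \<nu> jumps (\<lambda>z. u s (y + \<eta> i z) - u s y)"
    "\<bar>LINT z:jumps|\<nu>. u s (y + \<eta> i z) - u s y\<bar> \<le> (2 * M) * m0 + 0 * m1" if "i \<in> I" for i
  proof -
    have "\<bar>u s (y + v) - u s y\<bar> \<le> 2 * M + 0 * x" for v x
      using ub[of y] ub[of "y + v"] by (simp add: abs_le_iff)
    from jumps_integral_bound[OF jm[OF that] this]
    show "set_integrable \<nu> jumps (\<lambda>z. u s (y + \<eta> i z) - u s y)"
      "\<bar>LINT z:jumps|\<nu>. u s (y + \<eta> i z) - u s y\<bar> \<le> (2 * M) * m0 + 0 * m1" by auto
  qed
  have Yb: "\<bar>Y i\<bar> \<le> K + K * M + K * norm p + m1 * norm p + ((2 * M) * m0 + 0 * m1)" if i: "i \<in> I" for i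
    unfolding Y_def using fb[OF i] ub[of y]
    by (intro abs_sum_le abs_mult_le abs_inner_le cb[OF i] b_bound[OF i sT] norm_drift[OF i] jint(2)[OF i]) auto
  have XY: "X i \<le> Y i + R * m2" if i: "i \<in> I" for i
  proof -
    have jint2: "set_integrable \<nu> jumps (g2 i)"
      unfolding g2_def by (intro set_integral_diff jint[OF i])
        (use \<eta>_jumps_integrable[OF i] in \<open>auto simp: set_integrable_def simp flip: inner_scaleR_left\<close>)
    have "(LINT z:jumps|\<nu>. g2 i z) - R * m2
       = (\<integral>z. indicator jumps z *\<^sub>R g2 i z - R * (indicator {z. norm z \<le> \<delta>} z *\<^sub>R (r z)\<^sup>2) \<partial>\<nu>)"
      unfolding m2_def set_lebesgue_integral_def
      using jint2 small_square_integrable[of \<delta>] by (simp add: set_integrable_def)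
    also have "\<dots> \<le> (\<integral>z. indicator ?in z *\<^sub>R g1 i z + indicator ?out z *\<^sub>R g2 i z \<partial>\<nu>)"
    proof (rule integral_mono)
      show "integrable \<nu> (\<lambda>z. indicator jumps z *\<^sub>R g2 i z - R * (indicator {z. norm z \<le> \<delta>} z *\<^sub>R (r z)\<^sup>2))"
        using jint2 small_square_integrable[of \<delta>] by (simp add: set_integrable_def)
      show "integrable \<nu> (\<lambda>z. indicator ?in z *\<^sub>R g1 i z + indicator ?out z *\<^sub>R g2 i z)"
        using int1[OF i] int2[OF i] by (simp add: set_integrable_def)
      fix z assume "z \<in> space \<nu>"
      then have z: "z \<noteq> 0" by (simp add: space_\<nu>)
      have "g1 i z \<le> g2 i z" using min[OF s, of "y + \<eta> i z"] by (simp add: g1_def g2_def)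
      then have "- (R * (r z)\<^sup>2) \<le> g2 i z" "- (R * (r z)\<^sup>2) \<le> g1 i z" using g1le[OF i z] by auto
      then show "indicator jumps z *\<^sub>R g2 i z - R * (indicator {z. norm z \<le> \<delta>} z *\<^sub>R (r z)\<^sup>2)
         \<le> indicator ?in z *\<^sub>R g1 i z + indicator ?out z *\<^sub>R g2 i z"
        using \<kappa> by (auto simp: indicator_def jumps_def)
    qed
    also have "\<dots> = (LINT z:?in|\<nu>. g1 i z) + (LINT z:?out|\<nu>. g2 i z)"
      unfolding set_lebesgue_integral_def using int1[OF i] int2[OF i] by (simp add: set_integrable_def)
    finally have "(LINT z:jumps|\<nu>. g2 i z) - R * m2 \<le> (LINT z:?in|\<nu>. g1 i z) + (LINT z:?out|\<nu>. g2 i z)" .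
    moreover have "(LINT z:jumps|\<nu>. g2 i z) = (LINT z:jumps|\<nu>. u s (y + \<eta> i z) - u s y) - drift i \<bullet> p"
      unfolding g2_def drift_inner[OF i]
      by (intro set_integral_diff jint[OF i])
        (use \<eta>_jumps_integrable[OF i] in \<open>auto simp: set_integrable_def simp flip: inner_scaleR_left\<close>)
    ultimately show ?thesis unfolding X_def Y_def inner outer by linarith
  qed
  have "G X \<le> G Y + R * m2" by (rule game_operatorD[OF G Xb Yb XY])
  moreover have "0 \<le> vector_derivative (\<lambda>s. \<phi> s y) (at s within {0<..T}) + G X"
  proof -
    have "0 < \<kappa> \<and> \<kappa> < 1 \<and> C2_on (Q_dom T) (\<lambda>(s, y). \<phi> s y) \<and> (s, y) \<in> Q_dom T \<and>
        (\<forall>(s', y') \<in> Q_dom T. u s y - \<phi> s y \<le> u s' y' - \<phi> s' y')"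
    proof (intro conjI ballI)
      show "(s, y) \<in> Q_dom T" using s by (simp add: Q_dom_def)
      show "case q of (s', y') \<Rightarrow> u s y - \<phi> s y \<le> u s' y' - \<phi> s' y'" if "q \<in> Q_dom T" for q
        using that min by (auto simp: Q_dom_def)
    qed (rule \<kappa> C2)+
    from u(1)[unfolded visc_super_def, THEN spec, THEN spec, THEN spec, THEN spec, THEN mp, OF this]
    show ?thesis unfolding gr X_def .
  qed
  ultimately show ?thesis
    unfolding vector_derivative_within_half_open[OF d s] Y_def by linarith
qed

end

section \<open>Barriers\<close>

context isaacs_data begin

lemma profile_jump_integrable:
  assumes w: "smooth_profile w g P R L0" and i: "i \<in> I"
  shows "(\<lambda>z. w (y + \<eta> i z) - w y) \<in> borel_measurable \<nu>" "set_integrable \<nu> jumps (\<lambda>z. w (y + \<eta> i z) - w y)"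
    "z \<in> jumps \<Longrightarrow> \<bar>w (y + \<eta> i z) - w y\<bar> \<le> 0 + P * r z"
proof -
  have [measurable]: "w \<in> borel_measurable borel"
    by (rule borel_measurable_continuous_onI[OF smooth_profileD(9)[OF w]])
  show m: "(\<lambda>z. w (y + \<eta> i z) - w y) \<in> borel_measurable \<nu>"
    using \<eta>_measurable[OF i] by measurable
  have *: "\<bar>w (y + \<eta> i z) - w y\<bar> \<le> 0 + P * r z" if "z \<in> jumps" for z
    using smooth_profileD(8)[OF w, of y "\<eta> i z"] mult_left_mono[OF \<eta>_le[OF i jumps_nonzero[OF that]] smooth_profileD(4)[OF w]]
    by linarith
  then show "z \<in> jumps \<Longrightarrow> \<bar>w (y + \<eta> i z) - w y\<bar> \<le> 0 + P * r z" .
  show "set_integrable \<nu> jumps (\<lambda>z. w (y + \<eta> i z) - w y)"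
    by (rule jumps_integral_bound(1)[OF m *])
qed

text \<open>Otherwise a barrier with a slightly larger rate \<open>L'\<close> exceeds
  \<open>u\<close> somewhere. Coercivity of \<open>w\<close> gives a maximum of the difference, and
  \<open>w0\<close> puts it at a positive time. There the barrier itself is an admissible test
  function, and the equation bounds \<open>L'\<close> by the stated rate.\<close>

lemma visc_lower_barrier:
  assumes G: "game_operator I G" and f: "source f" and u: "visc_super G f u" "bounded_cont M u"
    and w: "smooth_profile w g P R L0" and w0: "\<And>y. w y \<le> u 0 y" and wK: "\<And>y. w y \<le> K"
    and coercive: "\<And>B. bounded {y. B \<le> w y}"
    and L: "K + K * K + K * P + L0 + R * m2 \<le> L"
    and s: "s \<in> {0..T}"
  shows "w y - L * s \<le> u s y"
proof -
  have P0: "0 \<le> P" and R0: "0 \<le> R" using smooth_profileD[OF w] by auto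
  have "w y - L' * s \<le> u s y" if L': "K + K * K + K * P + L0 + R * m2 < L'" for L'
  proof (rule ccontr)
    assume neg: "\<not> w y - L' * s \<le> u s y"
    have "0 \<le> L0" using smooth_profileD(7)[OF w] I_nonempty by (meson abs_ge_zero all_not_in_conv order_trans)
    then have L0: "0 \<le> L'" using L' P0 R0 K_pos m_nonneg by (smt (verit) mult_nonneg_nonneg)
    define h where "h = (\<lambda>(s, y). w y - L' * s - u s y)"
    have Q: "closed (Qbar_dom T :: (real \<times> (real^'n)) set)"
      unfolding Qbar_dom_def by (intro closed_Times) auto
    have hc: "continuous_on (Qbar_dom T) h"
    proof -
      have "continuous_on (Qbar_dom T) (\<lambda>p. w (snd p))"
        by (rule continuous_on_compose2[OF smooth_profileD(9)[OF w, of UNIV]]) (auto intro!: continuous_on_snd continuous_on_id)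
      moreover have "continuous_on (Qbar_dom T) (\<lambda>p. L' * fst p)"
        by (intro continuous_intros)
      moreover have "continuous_on (Qbar_dom T) (\<lambda>(t, x). u t x)" using u by (simp add: bounded_cont_def)
      ultimately show ?thesis
        unfolding h_def case_prod_beta' by (intro continuous_on_diff)
    qed
    have "\<exists>p\<in>Qbar_dom T. \<forall>q\<in>Qbar_dom T. h q \<le> h p"
    proof (rule attains_max_of_bounded_superlevel[OF Q _ hc])
      show "(s, y) \<in> Qbar_dom T" using s by (simp add: Qbar_dom_def)
      have "{p \<in> Qbar_dom T. h (s, y) \<le> h p} \<subseteq> {0..T} \<times> {y'. h (s, y) - M \<le> w y'}"
      proof clarify
        fix s' and y' :: "real^'n" assume *: "(s', y') \<in> Qbar_dom T" "h (s, y) \<le> h (s', y')"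
        then have s': "s' \<in> {0..T}" by (simp add: Qbar_dom_def)
        have "\<bar>u s' y'\<bar> \<le> M" using u s' by (simp add: bounded_cont_def)
        moreover have "0 \<le> L' * s'" using L0 s' by simp
        ultimately have "h (s, y) - M \<le> w y'" using *(2) unfolding h_def by simp
        then show "s' \<in> {0..T} \<and> y' \<in> {y'. h (s, y) - M \<le> w y'}" using s' by simp
      qed
      then show "bounded {p \<in> Qbar_dom T. h (s, y) \<le> h p}"
        by (rule bounded_subset[rotated]) (intro bounded_Times bounded_closed_interval coercive)
    qed
    then obtain p1 where p1: "p1 \<in> Qbar_dom T" "\<And>q. q \<in> Qbar_dom T \<Longrightarrow> h q \<le> h p1" by blast
    obtain s1 y1 where "p1 = (s1, y1)" by force
    with p1 have s1: "s1 \<in> {0..T}" and max: "\<And>s' y'. s' \<in> {0..T} \<Longrightarrow> h (s', y') \<le> h (s1, y1)"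
      by (simp_all add: Qbar_dom_def)
    have pos: "0 < h (s1, y1)" using max[OF s, of y] neg by (simp add: h_def)
    have s1p: "0 < s1"
    proof (rule ccontr)
      assume "\<not> 0 < s1"
      then have "s1 = 0" using s1 by auto
      then show False using pos w0[of y1] by (simp add: h_def)
    qed
    let ?\<phi> = "\<lambda>s y. w y - L' * s"
    have d: "((\<lambda>s. ?\<phi> s y1) has_vector_derivative - L') (at s1)"
      by (auto intro!: derivative_eq_intros simp: has_real_derivative_iff_has_vector_derivative[symmetric])
    have gd: "GDERIV (?\<phi> s1) y1 :> g y1"
      using GDERIV_diff[OF smooth_profileD(2)[OF w] GDERIV_const] by simp
    have C2: "C2_on (Q_dom T) (\<lambda>(s, y). ?\<phi> s y)"
      unfolding case_prod_beta'
      by (intro C2_on_diff C2_on_snd smooth_profileD(1)[OF w] C2_on_cmul C2_on_bounded_linear bounded_linear_fst)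
    have "0 \<le> - L' + G (\<lambda>i. - f i s1 y1 + c i s1 y1 * u s1 y1 - b i s1 y1 \<bullet> g y1 + drift i \<bullet> g y1
       - (LINT z:jumps|\<nu>. u s1 (y1 + \<eta> i z) - u s1 y1)) + R * m2"
    proof (rule visc_super_ineq[OF G f u s1p _ C2 _ d gd])
      show "s1 \<le> T" using s1 by simp
      show "u s1 y1 - ?\<phi> s1 y1 \<le> u s' y' - ?\<phi> s' y'" if "0 < s'" "s' \<le> T" for s' y'
        using max[of s' y'] that by (simp add: h_def)
      show "\<bar>?\<phi> s1 (y1 + h) - ?\<phi> s1 y1 - h \<bullet> g y1\<bar> \<le> R * (norm h)\<^sup>2" for h
        using smooth_profileD(6)[OF w, of y1 h] by simp
    qed
    moreover have "G (\<lambda>i. - f i s1 y1 + c i s1 y1 * u s1 y1 - b i s1 y1 \<bullet> g y1 + drift i \<bullet> g y1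
       - (LINT z:jumps|\<nu>. u s1 (y1 + \<eta> i z) - u s1 y1)) \<le> K + K * K + K * P + L0"
    proof (rule game_operator_upper[OF G])
      fix i assume i: "i \<in> I"
      have uM: "\<bar>u s1 x\<bar> \<le> M" for x using u s1 by (simp add: bounded_cont_def)
      have [measurable]: "u s1 \<in> borel_measurable borel"
        using bounded_cont_slice[OF u(2) s1] by (rule borel_measurable_continuous_onI)
      have jm: "(\<lambda>z. u s1 (y1 + \<eta> i z) - u s1 y1) \<in> borel_measurable \<nu>"
        using \<eta>_measurable[OF i] by measurable
      have "\<bar>u s1 (y1 + v) - u s1 y1\<bar> \<le> 2 * M + 0 * x" for v x
        using uM[of y1] uM[of "y1 + v"] by (simp add: abs_le_iff)
      note ji = jumps_integral_bound[OF jm this]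
      have fb: "\<bar>f i s1 y1\<bar> \<le> K" using f i s1 by (auto simp: source_def)
      have cb: "0 \<le> c i s1 y1" "c i s1 y1 \<le> K" using c_bound[OF i s1] by auto
      have bb: "\<bar>b i s1 y1 \<bullet> g y1\<bar> \<le> K * P"
        by (intro abs_inner_le b_bound[OF i s1] smooth_profileD(3)[OF w])
      show "\<bar>- f i s1 y1 + c i s1 y1 * u s1 y1 - b i s1 y1 \<bullet> g y1 + drift i \<bullet> g y1
         - (LINT z:jumps|\<nu>. u s1 (y1 + \<eta> i z) - u s1 y1)\<bar> \<le> K + K * M + K * P + m1 * P + ((2 * M) * m0 + 0 * m1)"
        by (intro abs_sum_le abs_mult_le abs_inner_le b_bound[OF i s1] smooth_profileD(3)[OF w] norm_drift[OF i] ji(2))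
          (use fb cb uM[of y1] in auto)
      have "(LINT z:jumps|\<nu>. w (y1 + \<eta> i z) - w y1) \<le> (LINT z:jumps|\<nu>. u s1 (y1 + \<eta> i z) - u s1 y1)"
      proof (intro set_integral_mono profile_jump_integrable(2)[OF w i] ji(1))
        show "w (y1 + \<eta> i z) - w y1 \<le> u s1 (y1 + \<eta> i z) - u s1 y1" for z
          using max[OF s1, of "y1 + \<eta> i z"] by (simp add: h_def)
      qed
      moreover have "\<bar>(LINT z:jumps|\<nu>. w (y1 + \<eta> i z) - w y1) - drift i \<bullet> g y1\<bar> \<le> L0"
        by (rule smooth_profileD(7)[OF w i])
      \<comment> \<open>Where the barrier exceeds \<open>u\<close>, the bound on \<open>w\<close>
        bounds \<open>u\<close> from above. The rate therefore depends on the data and not on the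
        bound \<open>M\<close> of the solution.\<close>
      moreover have "c i s1 y1 * u s1 y1 \<le> K * K"
      proof -
        have "0 \<le> L' * s1" using L0 s1 by simp
        then have "u s1 y1 \<le> K" using pos wK[of y1] by (simp add: h_def)
        then have "c i s1 y1 * u s1 y1 \<le> c i s1 y1 * K" by (rule mult_left_mono[OF _ cb(1)])
        also have "\<dots> \<le> K * K" using cb K_pos by (intro mult_right_mono) auto
        finally show ?thesis .
      qed
      ultimately show "- f i s1 y1 + c i s1 y1 * u s1 y1 - b i s1 y1 \<bullet> g y1 + drift i \<bullet> g y1
         - (LINT z:jumps|\<nu>. u s1 (y1 + \<eta> i z) - u s1 y1) \<le> K + K * K + K * P + L0"
        using fb bb by linarith
    qed
    ultimately show False using L' by linarith
  qed
  then have "w y - (L + e) * s \<le> u s y" if "0 < e" for e using L that by simp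
  then have "w y - L * s \<le> u s y + e" if "0 < e" for e
  proof -
    have sT: "0 \<le> s" "s \<le> T" using s by auto
    \<comment> \<open>The strict excess over \<open>L\<close> is spread over the time interval, so
      that it amounts to at most \<open>e\<close> in total.\<close>
    have "w y - (L + e / T) * s \<le> u s y" using that T_pos \<open>\<And>e. 0 < e \<Longrightarrow> w y - (L + e) * s \<le> u s y\<close> by simp
    moreover have "e / T * s \<le> e" using sT that T_pos by (simp add: field_simps)
    ultimately show ?thesis by (simp add: algebra_simps)
  qed
  then show ?thesis by (rule field_le_epsilon)
qed

end

context isaacs_scheme begin

text \<open>The discrete counterpart, with a maximum over the finitely many competing nodes.
  \<open>mesh_error\<close> takes the place of \<open>m2\<close>, since the scheme drops the small
  jumps altogether.\<close>

lemma scheme_upper_barrier: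
  assumes G: "game_operator I G" and f: "source f" and U: "scheme G f U" "grid_bounded M U"
    and w: "smooth_profile w g P R L0" and w0: "\<And>j. U 0 (grid_pt dx j) \<le> w (grid_pt dx j)" and wK: "\<And>y. - K \<le> w y"
    and coercive: "\<And>B. bounded {y. w y \<le> B}"
    and L: "K + K * K + K * P + L0 + R * mesh_error \<le> L"
    and n: "n \<le> MT"
  shows "U (real n * dt) (grid_pt dx j) \<le> w (grid_pt dx j) + L * (real n * dt)"
proof -
  have P0: "0 \<le> P" and R0: "0 \<le> R" using smooth_profileD[OF w] by auto
  have me: "0 \<le> mesh_error" unfolding mesh_error_def using dx_pos K_pos m_nonneg' by simp
  have "U (real n * dt) (grid_pt dx j) \<le> w (grid_pt dx j) + L' * (real n * dt)"
    if L': "K + K * K + K * P + L0 + R * mesh_error < L'" for L'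
  proof (rule ccontr)
    assume neg: "\<not> ?thesis"
    have "0 \<le> L0" using smooth_profileD(7)[OF w] I_nonempty by (meson abs_ge_zero all_not_in_conv order_trans)
    then have L0: "0 \<le> L'" using L' P0 R0 K_pos me by (smt (verit) mult_nonneg_nonneg)
    define h where "h = (\<lambda>(n, j). U (real n * dt) (grid_pt dx j) - w (grid_pt dx j) - L' * (real n * dt))"
    have "\<exists>p\<in>{..MT} \<times> UNIV. \<forall>q\<in>{..MT} \<times> UNIV. h q \<le> h p"
    proof (rule attains_max_of_finite_superlevel)
      show "(n, j) \<in> {..MT} \<times> UNIV" using n by simp
      obtain B where B: "\<And>y. w y \<le> M - h (n, j) \<Longrightarrow> norm y \<le> B"
        using coercive[of "M - h (n, j)"] by (auto simp: bounded_iff)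
      have "{p \<in> {..MT} \<times> UNIV. h (n, j) \<le> h p} \<subseteq> {..MT} \<times> {j. norm (grid_pt dx j) \<le> B}"
      proof -
        have "norm (grid_pt dx j') \<le> B" if "n' \<le> MT" "h (n, j) \<le> h (n', j')" for n' j'
        proof (rule B)
          have "\<bar>U (real n' * dt) (grid_pt dx j')\<bar> \<le> M" using U that by (simp add: grid_bounded_def)
          moreover have "0 \<le> L' * (real n' * dt)" using L0 dt_pos by simp
          ultimately show "w (grid_pt dx j') \<le> M - h (n, j)"
            using that(2) by (simp add: h_def[of] split: prod.splits)
        qed
        then show ?thesis by auto
      qed
      then show "finite {p \<in> {..MT} \<times> (UNIV :: (int^'n) set). h (n, j) \<le> h p}"
        by (rule finite_subset) (intro finite_cartesian_product finite_atMost finite_grid_bounded[OF dx_pos])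
    qed
    then obtain n1 j1 where n1: "n1 \<le> MT" and max: "\<And>n' j'. n' \<le> MT \<Longrightarrow> h (n', j') \<le> h (n1, j1)" by auto
    have pos: "0 < h (n1, j1)" using max[OF n, of j] neg by (simp add: h_def)
    have "n1 \<noteq> 0"
    proof
      assume "n1 = 0"
      then show False using pos w0[of j1] by (simp add: h_def)
    qed
    then have n1': "n1 \<in> {1..MT}" using n1 by simp
    define t s x where "t = real n1 * dt" and "s = real (n1 - 1) * dt" and "x = grid_pt dx j1"
    have ts: "t = s + dt" using \<open>n1 \<noteq> 0\<close> by (simp add: t_def s_def of_nat_diff algebra_simps)
    have tT: "t \<in> {0..T}" "s \<in> {0..T}" using grid_time[of n1] grid_time[of "n1 - 1"] n1 by (simp_all add: t_def s_def)
    have maxt: "U t (x + grid_pt dx k) - U t x \<le> w (x + grid_pt dx k) - w x" for k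
      using max[OF n1, of "j1 + k"] by (simp add: h_def t_def x_def grid_pt_add)
    have maxs: "U s (x + grid_pt dx k) \<le> U t x - L' * dt + (w (x + grid_pt dx k) - w x)" for k
    proof -
      have "h (n1 - 1, j1 + k) = U s (x + grid_pt dx k) - w (x + grid_pt dx k) - L' * s"
        "h (n1, j1) = U t x - w x - L' * t"
        by (simp_all add: h_def s_def t_def x_def grid_pt_add)
      moreover have "L' * t = L' * s + L' * dt" unfolding ts by (simp add: algebra_simps)
      moreover have "h (n1 - 1, j1 + k) \<le> h (n1, j1)" using n1 by (intro max) simp
      ultimately show ?thesis by linarith
    qed
    \<comment> \<open>The amount by which the maximum allows the old level to exceed
      \<open>U s x\<close>. With this lag the time quotient is exactly \<open>L'\<close>.\<close>
    define a where "a = U t x - L' * dt - U s x"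
    have a: "0 \<le> a" using maxs[of 0] by (simp add: a_def)
    have tay: "w (y + h) - w y \<le> g y \<bullet> h + R * (norm h)\<^sup>2" for y h
      using smooth_profileD(6)[OF w, of y h] by (simp add: inner_commute abs_le_iff)
    have tay2: "w (x + grid_pt dx k) - w x \<le> w (x + v) - w x + g (x + v) \<bullet> (grid_pt dx k - v) + R * (norm (grid_pt dx k - v))\<^sup>2" for k v
      using tay[of "x + v" "grid_pt dx k - v"] by simp
    have "(U t x - U s x - a) / dt
      + G (\<lambda>i. - f i s x + c i t x * (U s x + a) - (\<theta> *\<^sub>R b i t x + (1 - \<theta>) *\<^sub>R b i s x) \<bullet> g x
                + drift i \<bullet> g x - (LINT z:jumps|\<nu>. w (x + \<eta> i z) - w x)) \<le> R * mesh_error"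
    proof (rule discrete_subsolution[OF G f U n1' t_def s_def x_def a R0, where V = "\<lambda>i z. w (x + \<eta> i z) - w x"
          and P = "\<lambda>i z. g (x + \<eta> i z)"])
      show "U t (x + grid_pt dx k) - U t x \<le> g x \<bullet> grid_pt dx k + R * (norm (grid_pt dx k))\<^sup>2" for k
        using maxt[of k] tay[of x "grid_pt dx k"] by linarith
      show "U s (x + grid_pt dx k) - U s x \<le> g x \<bullet> grid_pt dx k + R * (norm (grid_pt dx k))\<^sup>2 + a" for k
        using maxs[of k] tay[of x "grid_pt dx k"] unfolding a_def by linarith
      show "U t (x + grid_pt dx k) - U t x \<le> w (x + \<eta> i z) - w x + g (x + \<eta> i z) \<bullet> (grid_pt dx k - \<eta> i z)
        + R * (norm (grid_pt dx k - \<eta> i z))\<^sup>2" for i z k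
        using maxt[of k] tay2[of k "\<eta> i z"] by linarith
      show "U s (x + grid_pt dx k) - U s x \<le> w (x + \<eta> i z) - w x + g (x + \<eta> i z) \<bullet> (grid_pt dx k - \<eta> i z)
        + R * (norm (grid_pt dx k - \<eta> i z))\<^sup>2 + a" for i z k
        using maxs[of k] tay2[of k "\<eta> i z"] unfolding a_def by linarith
    qed (use profile_jump_integrable[OF w] in blast)+
    moreover have "(U t x - U s x - a) / dt = L'" using dt_pos by (simp add: a_def)
    moreover have "- (K + K * K + K * P + L0) \<le> G (\<lambda>i. - f i s x + c i t x * (U s x + a) - (\<theta> *\<^sub>R b i t x + (1 - \<theta>) *\<^sub>R b i s x) \<bullet> g x
                + drift i \<bullet> g x - (LINT z:jumps|\<nu>. w (x + \<eta> i z) - w x))"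
    proof (rule game_operator_lower[OF G])
      fix i assume i: "i \<in> I"
      have fb: "\<bar>f i s x\<bar> \<le> K" using f i tT by (auto simp: source_def)
      have cb: "0 \<le> c i t x" "c i t x \<le> K" using c_bound[OF i tT(1)] by auto
      have bb: "norm (\<theta> *\<^sub>R b i t x + (1 - \<theta>) *\<^sub>R b i s x) \<le> K"
      proof -
        have "norm (\<theta> *\<^sub>R b i t x + (1 - \<theta>) *\<^sub>R b i s x) \<le> \<theta> * norm (b i t x) + (1 - \<theta>) * norm (b i s x)"
          using norm_triangle_ineq[of "\<theta> *\<^sub>R b i t x" "(1 - \<theta>) *\<^sub>R b i s x"] \<theta> by simp
        also have "\<dots> \<le> \<theta> * K + (1 - \<theta>) * K"
          using \<theta> b_bound[OF i tT(1)] b_bound[OF i tT(2)] by (intro add_mono mult_left_mono) auto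
        finally show ?thesis by (simp add: algebra_simps)
      qed
      have bg: "\<bar>(\<theta> *\<^sub>R b i t x + (1 - \<theta>) *\<^sub>R b i s x) \<bullet> g x\<bar> \<le> K * P"
        by (intro abs_inner_le bb smooth_profileD(3)[OF w])
      \<comment> \<open>\<open>U s x + a\<close> equals \<open>U t x - L' * dt\<close>, which
        positivity of the maximum keeps above \<open>w x + L' * s\<close>.\<close>
      have "- K \<le> U s x + a"
      proof -
        have "L' * s = L' * t - L' * dt" unfolding ts by (simp add: algebra_simps)
        moreover have "0 \<le> L' * s" using L0 tT by simp
        moreover have "U t x - w x - L' * t > 0" using pos by (simp add: h_def t_def x_def)
        ultimately show ?thesis using wK[of x] by (simp add: a_def)
      qed
      then have "c i t x * - K \<le> c i t x * (U s x + a)" by (rule mult_left_mono[OF _ cb(1)])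
      moreover have "c i t x * K \<le> K * K" using cb K_pos by (intro mult_right_mono) auto
      ultimately have ca: "- (K * K) \<le> c i t x * (U s x + a)" by simp
      have wj: "\<bar>(LINT z:jumps|\<nu>. w (x + \<eta> i z) - w x) - drift i \<bullet> g x\<bar> \<le> L0"
        by (rule smooth_profileD(7)[OF w i])
      show "\<bar>- f i s x + c i t x * (U s x + a) - (\<theta> *\<^sub>R b i t x + (1 - \<theta>) *\<^sub>R b i s x) \<bullet> g x
                + drift i \<bullet> g x - (LINT z:jumps|\<nu>. w (x + \<eta> i z) - w x)\<bar>
          \<le> K + K * \<bar>U s x + a\<bar> + K * P + m1 * P + (0 * m0 + P * m1)"
        by (intro abs_sum_le abs_mult_le bg abs_inner_le smooth_profileD(3)[OF w] norm_drift[OF i]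
            jumps_integral_bound(2) profile_jump_integrable[OF w i]) (use fb cb in auto)
      show "- (K + K * K + K * P + L0) \<le> - f i s x + c i t x * (U s x + a) - (\<theta> *\<^sub>R b i t x + (1 - \<theta>) *\<^sub>R b i s x) \<bullet> g x
                + drift i \<bullet> g x - (LINT z:jumps|\<nu>. w (x + \<eta> i z) - w x)"
        using fb bg ca wj by linarith
    qed
    ultimately show False using L' by linarith
  qed
  then have *: "U (real n * dt) (grid_pt dx j) \<le> w (grid_pt dx j) + (L + e) * (real n * dt)" if "0 < e" for e
    using L that by simp
  have "U (real n * dt) (grid_pt dx j) \<le> w (grid_pt dx j) + L * (real n * dt) + e" if "0 < e" for e
  proof -
    have sT: "0 \<le> real n * dt" "real n * dt \<le> T" using grid_time[OF n] by auto
    have "U (real n * dt) (grid_pt dx j) \<le> w (grid_pt dx j) + (L + e / T) * (real n * dt)" using that T_pos * by simp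
    moreover have "e / T * (real n * dt) \<le> e" using sT that T_pos by (simp add: field_simps)
    ultimately show ?thesis by (simp add: algebra_simps)
  qed
  then show ?thesis by (rule field_le_epsilon)
qed

end

section \<open>Weighted doubling of variables\<close>

lemma norm_add_square: "(norm (d + h))\<^sup>2 = (norm d)\<^sup>2 + 2 * (d \<bullet> h) + (norm h)\<^sup>2"
  by (simp add: power2_norm_eq_inner inner_add_left inner_add_right inner_commute)

lemma GDERIV_of_quadratic_bound:
  fixes \<phi> :: "'v::real_inner \<Rightarrow> real"
  assumes "\<And>h. \<bar>\<phi> (y + h) - \<phi> y - h \<bullet> p\<bar> \<le> R * (norm h)\<^sup>2"
  shows "GDERIV \<phi> y :> p"
  unfolding gderiv_def has_derivative_at
proof
  show "bounded_linear (\<lambda>h. h \<bullet> p)" by (rule bounded_linear_inner_left)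
  show "(\<lambda>h. norm (\<phi> (y + h) - \<phi> y - h \<bullet> p) / norm h) \<midarrow>0\<rightarrow> 0"
  proof (rule Lim_null_comparison)
    show "\<forall>\<^sub>F h in at 0. norm (norm (\<phi> (y + h) - \<phi> y - h \<bullet> p) / norm h) \<le> R * norm h"
      unfolding eventually_at_filter
      by (rule always_eventually) (use assms in \<open>simp add: power2_eq_square pos_divide_le_eq mult.assoc\<close>)
    show "((\<lambda>h. R * norm h) \<longlongrightarrow> 0) (at 0)" by (auto intro!: tendsto_eq_intros)
  qed
qed

text \<open>Young's inequality, with \<open>X\<close> and \<open>Y\<close> the distances in space
  and time. In the factor \<open>6 + M\<close>, the part \<open>1 + M\<close> comes from
  \<open>f\<close> and \<open>c\<close>, 1 from shifting the zeroth order term by a time step, and 4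
  from the drift. \<open>\<tau> \<le> \<epsilon>\<close> permits squares of time distances over
  \<epsilon> to be bounded by those over \<tau>.\<close>

lemma doubling_error_arith:
  fixes X Y dt e \<epsilon> \<tau> K M Q :: real
  assumes X: "0 \<le> X" and Y: "0 \<le> Y" and dt: "0 \<le> dt" and e: "1 \<le> e" and \<tau>: "0 < \<tau>" "\<tau> \<le> \<epsilon>"
    and K: "0 \<le> K" and M: "0 \<le> M" and Q: "Q = X\<^sup>2 / (2 * \<epsilon>) + Y\<^sup>2 / (2 * \<tau>)"
  shows "K * (1 + M) * (X + Y) + K * dt + K * (e * (Y * dt / \<tau>)) + K * (dt + Y + X) * (e / \<epsilon> * X)
    \<le> K * (6 + M) * (e * Q) + K * (1 + M) * ((\<epsilon> + \<tau>) / 2) + K * dt + K * (e * (dt\<^sup>2 / \<tau>))"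
proof -
  have \<epsilon>: "0 < \<epsilon>" using \<tau> by simp
  define AX AY AD H where "AX = X\<^sup>2 / (2 * \<epsilon>)" and "AY = Y\<^sup>2 / (2 * \<tau>)" and "AD = dt\<^sup>2 / (2 * \<tau>)" and "H = (\<epsilon> + \<tau>) / 2"
  have young: "a * c / k \<le> a\<^sup>2 / (2 * k) + c\<^sup>2 / (2 * k)" if "0 < k" for a c k :: real
  proof -
    have "2 * a * c \<le> a\<^sup>2 + c\<^sup>2" by (rule sum_squares_bound)
    then show ?thesis using that by (simp add: field_simps)
  qed
  have mono: "a\<^sup>2 / (2 * \<epsilon>) \<le> a\<^sup>2 / (2 * \<tau>)" for a :: real
    using \<tau> by (intro frac_le) auto
  have A0: "0 \<le> AX" "0 \<le> AY" "0 \<le> AD" using \<tau> \<epsilon> by (simp_all add: AX_def AY_def AD_def)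
  have QA: "Q = AX + AY" using Q by (simp add: AX_def AY_def)
  have eQ: "Q \<le> e * Q" using mult_right_mono[OF e, of Q] A0 QA by simp
  have hX: "X \<le> AX + \<epsilon> / 2"
    using young[OF \<epsilon>, of X \<epsilon>] \<epsilon> by (simp add: AX_def power2_eq_square)
  have hY: "Y \<le> AY + \<tau> / 2"
    using young[OF \<tau>(1), of Y \<tau>] \<tau>(1) by (simp add: AY_def power2_eq_square)
  have "H = \<epsilon> / 2 + \<tau> / 2" by (simp add: H_def add_divide_distrib)
  then have XY: "X + Y \<le> e * Q + H" using hX hY eQ QA by linarith
  have 1: "K * (1 + M) * (X + Y) \<le> K * (1 + M) * (e * Q + H)"
    using K M by (intro mult_left_mono[OF XY]) simp
  have B1: "Y * dt / \<tau> \<le> Q + AD"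
    using young[OF \<tau>(1), of Y dt] A0 QA unfolding AY_def[symmetric] AD_def[symmetric] by linarith
  have e0: "0 \<le> e" using e by simp
  have 2: "K * (e * (Y * dt / \<tau>)) \<le> K * (e * (Q + AD))"
    by (rule mult_left_mono[OF mult_left_mono[OF B1 e0] K])
  have C1: "dt * X / \<epsilon> \<le> AD + AX"
    using young[OF \<epsilon>, of dt X] mono[of dt] unfolding AX_def[symmetric] AD_def[symmetric] by linarith
  have C2: "Y * X / \<epsilon> \<le> AY + AX"
    using young[OF \<epsilon>, of Y X] mono[of Y] unfolding AX_def[symmetric] AY_def[symmetric] by linarith
  have "(dt + Y + X) * X / \<epsilon> = dt * X / \<epsilon> + Y * X / \<epsilon> + 2 * AX"
    by (simp add: AX_def add_divide_distrib algebra_simps power2_eq_square)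
  then have B2: "(dt + Y + X) * X / \<epsilon> \<le> 4 * Q + AD" using C1 C2 A0 QA by linarith
  have 3: "K * (dt + Y + X) * (e / \<epsilon> * X) \<le> K * (e * (4 * Q + AD))"
    using mult_left_mono[OF mult_left_mono[OF B2 e0] K] by (simp add: mult_ac)
  define P1 P2 P3 P4 where "P1 = K * (1 + M) * (e * Q)" and "P2 = K * (e * Q)" and "P3 = K * (e * AD)" and "P4 = K * (1 + M) * H"
  have 4: "K * (e * (dt\<^sup>2 / \<tau>)) = 2 * P3" by (simp add: AD_def P3_def)
  have 5: "K * (6 + M) * (e * Q) = P1 + 5 * P2" by (simp add: P1_def P2_def algebra_simps)
  have 6: "K * (1 + M) * (e * Q + H) = P1 + P4" unfolding P1_def P4_def by (rule distrib_left)
  have 7: "K * (e * (Q + AD)) = P2 + P3" "K * (e * (4 * Q + AD)) = 4 * P2 + P3"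
    by (simp_all add: P2_def P3_def distrib_left)
  show ?thesis
    using 1 2 3 unfolding H_def[symmetric] P4_def[symmetric] 4 5 6 7 by linarith
qed

section \<open>Comparison of the scheme with the viscosity solution\<close>

context isaacs_scheme begin

text \<open>Suppose that the bound fails by \<open>gap\<close>. Besides the quadratic penalty, the
  functional contains \<open>\<mu> * q\<close>, which makes its maximum exist, and
  \<open>\<Lambda> * s\<close>, whose slope is the claimed rate plus a margin
  \<open>\<zeta>\<close>. At a maximum with both times positive the two inequalities bound
  \<open>\<Lambda>\<close> by the claimed rate plus a multiple of \<mu>, smaller than the
  margin.\<close>

lemma doubling_comparison:
  assumes G: "game_operator I G" and f: "source f" and U: "scheme G f U" "grid_bounded MU U"
    and u: "visc_super G f u" "bounded_cont Mu u"
    and u0: "\<And>x y. \<bar>u0 x - u0 y\<bar> \<le> K * norm (x - y)"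
    and bU: "\<And>n j. n \<le> MT \<Longrightarrow> U (real n * dt) (grid_pt dx j) \<le> u0 (grid_pt dx j) + E0 + Lb * (real n * dt)"
    and bu: "\<And>s y. s \<in> {0..T} \<Longrightarrow> u0 y - E0 - Lb * s \<le> u s y"
    and M: "0 \<le> M" "\<And>n j. n \<le> MT \<Longrightarrow> U (real n * dt) (grid_pt dx j) \<le> M" "\<And>s y. s \<in> {0..T} \<Longrightarrow> - M \<le> u s y"
    and pos: "0 \<le> E0" "0 < \<tau>" "\<tau> \<le> \<epsilon>"
    and q: "smooth_profile q gq 1 1 Lq" and q_ge: "\<And>x. norm x \<le> q x"
    and n: "n \<le> MT"
  defines "Em \<equiv> exp (K * (6 + M) * T)"
  shows "U (real n * dt) (grid_pt dx j) - u (real n * dt) (grid_pt dx j)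
    \<le> 2 * E0 + Lb\<^sup>2 * \<tau> / 2 + K\<^sup>2 * \<epsilon> / 2
      + T * (K * (1 + M) * ((\<epsilon> + \<tau>) / 2) + K * dt + Em * ((K * T + 1 / 2) * (dt / \<tau>)) + Em * ((m2 + mesh_error) / (2 * \<epsilon>)))"
    (is "_ \<le> ?E + T * ?\<Lambda>")
proof (rule ccontr)
  \<comment> \<open>The largest value that the barriers allow when one of the times is zero. Its
    quadratic terms come from Young's inequality for \<open>Lb * t\<close> and
    \<open>K * norm (x - y)\<close> against the penalty.\<close>
  define E1 where "E1 = ?E"
  \<comment> \<open>The factor of the penalty in \<open>doubling_error_arith\<close>:
    differentiating the weight in \<open>s\<close> produces this multiple with the opposite
    sign.\<close>
  define lam where "lam = K * (6 + M)"
  have \<epsilon>: "0 < \<epsilon>" using pos by simp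
  have me: "0 \<le> mesh_error" unfolding mesh_error_def using dx_pos K_pos m_nonneg' by simp
  have m2: "0 \<le> m2" by (rule m_nonneg)
  have lam0: "0 \<le> lam" using K_pos M by (simp add: lam_def)
  have Em1: "1 \<le> Em" using K_pos M T_pos unfolding Em_def by simp
  have Lq: "0 \<le> Lq" using smooth_profileD(7)[OF q] I_nonempty by (meson abs_ge_zero all_not_in_conv order_trans)
  have E0: "0 \<le> E1" using pos \<epsilon> by (simp add: E1_def)
  define \<Lambda>0 where "\<Lambda>0 = ?\<Lambda>"
  have \<Lambda>0: "0 \<le> \<Lambda>0" unfolding \<Lambda>0_def using K_pos M pos \<epsilon> dt_pos Em1 T_pos m2 me by (intro add_nonneg_nonneg mult_nonneg_nonneg divide_nonneg_nonneg) auto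
  define z where "z = grid_pt dx j"
  define gap where "gap = U (real n * dt) z - u (real n * dt) z - (E1 + T * \<Lambda>0)"
  assume "\<not> ?thesis"
  then have gap: "0 < gap" by (simp add: gap_def \<Lambda>0_def z_def E1_def)
  define \<zeta> where "\<zeta> = gap / (4 * T)"
  have \<zeta>: "0 < \<zeta>" "T * \<zeta> = gap / 4" using gap T_pos by (simp_all add: \<zeta>_def)
  \<comment> \<open>The first entry keeps the weight at the bad node below \<open>gap / 4\<close>,
    the second keeps all errors caused by the weight below \<open>\<zeta>\<close>. As
    \<open>T * \<zeta>\<close> also equals \<open>gap / 4\<close>, half of the gap survives.\<close>
  define \<mu> where "\<mu> = min (gap / (4 * (1 + q z))) (\<zeta> / (2 * (1 + K + Lq + mesh_error)))"
  have qz: "0 \<le> q x" for x using q_ge[of x] norm_ge_zero order_trans by blast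
  have \<mu>: "0 < \<mu>" unfolding \<mu>_def using gap \<zeta> K_pos Lq me qz[of z] by (auto intro!: divide_pos_pos)
  have \<mu>1: "\<mu> * q z \<le> gap / 4"
  proof -
    have "\<mu> * q z \<le> gap / (4 * (1 + q z)) * q z" using qz by (intro mult_right_mono) (auto simp: \<mu>_def)
    also have "\<dots> \<le> gap / 4" using qz[of z] gap by (simp add: field_simps)
    finally show ?thesis .
  qed
  have \<mu>2: "\<mu> * (K + Lq + mesh_error) < \<zeta>"
  proof -
    have "\<mu> * (K + Lq + mesh_error) \<le> \<zeta> / (2 * (1 + K + Lq + mesh_error)) * (K + Lq + mesh_error)"
      using K_pos Lq me by (intro mult_right_mono) (auto simp: \<mu>_def)
    also have "\<dots> < \<zeta>" using K_pos Lq me \<zeta> by (simp add: field_simps add_pos_nonneg)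
    finally show ?thesis .
  qed
  define \<Lambda> where "\<Lambda> = \<Lambda>0 + \<zeta>"
  have \<Lambda>: "0 \<le> \<Lambda>" using \<Lambda>0 \<zeta> by (simp add: \<Lambda>_def)
  \<comment> \<open>The exponential weight depends on the continuum time \<open>s\<close> and not on
    the grid time, because only the viscosity inequality differentiates the penalty; in the discrete
    inequality \<open>s\<close> is frozen.\<close>
  define \<Phi> where "\<Phi> n j = (\<lambda>(s, y). U (real n * dt) (grid_pt dx j) - u s y
     - exp (lam * s) * ((norm (grid_pt dx j - y))\<^sup>2 / (2 * \<epsilon>) + (real n * dt - s)\<^sup>2 / (2 * \<tau>))
     - \<mu> * q (grid_pt dx j) - \<Lambda> * s)" for n j
  have cont: "continuous_on (Qbar_dom T) (\<Phi> n j)" if "n \<le> MT" for n j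
  proof -
    have "continuous_on (Qbar_dom T) (\<lambda>(t, x). u t x)" using u by (simp add: bounded_cont_def)
    then show ?thesis unfolding \<Phi>_def case_prod_beta' by (intro continuous_intros) (use pos \<epsilon> in auto)
  qed
  have weight: "a \<le> exp (lam * s) * a" if "0 \<le> a" "0 \<le> s" for a s
    using mult_right_mono[of 1 "exp (lam * s)" a] that lam0 by simp
  define k where "k = min 1 \<mu>"
  have k: "0 < k" using \<mu> by (simp add: k_def)
  have le: "\<Phi> n j (s, y) \<le> (MU + Mu + \<epsilon> / 2) - k * norm (grid_pt dx j - y) - k * norm (grid_pt dx j)"
    if "n \<le> MT" "s \<in> {0..T}" for n j s y
  proof -
    let ?X = "norm (grid_pt dx j - y)"
    define A B where "A = ?X\<^sup>2 / (2 * \<epsilon>)" and "B = (real n * dt - s)\<^sup>2 / (2 * \<tau>)"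
    have "\<bar>U (real n * dt) (grid_pt dx j)\<bar> \<le> MU" "\<bar>u s y\<bar> \<le> Mu"
      using U(2) u(2) that by (auto simp: grid_bounded_def bounded_cont_def)
    moreover have "?X - \<epsilon> / 2 \<le> A"
      using sum_squares_bound[of ?X \<epsilon>] \<epsilon> by (simp add: A_def field_simps power2_eq_square)
    moreover have AB: "0 \<le> A" "0 \<le> B" using pos \<epsilon> by (simp_all add: A_def B_def)
    moreover have "A + B \<le> exp (lam * s) * (A + B)"
      using AB that by (intro weight) auto
    moreover have "\<mu> * norm (grid_pt dx j) \<le> \<mu> * q (grid_pt dx j)" using \<mu> q_ge by simp
    moreover have "0 \<le> \<Lambda> * s" using \<Lambda> that by simp
    moreover have "k * ?X \<le> 1 * ?X" "k * norm (grid_pt dx j) \<le> \<mu> * norm (grid_pt dx j)"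
      by (intro mult_right_mono; simp add: k_def)+
    ultimately show ?thesis unfolding \<Phi>_def prod.case A_def[symmetric] B_def[symmetric] by linarith
  qed
  obtain n1 j1 s y where n1: "n1 \<le> MT" and s: "s \<in> {0..T}"
    and max: "\<And>n' j' s' y'. n' \<le> MT \<Longrightarrow> s' \<in> {0..T} \<Longrightarrow> \<Phi> n' j' (s', y') \<le> \<Phi> n1 j1 (s, y)"
    by (rule attains_max_grid_continuum[where \<Phi> = \<Phi> and N = MT and C = "MU + Mu + \<epsilon> / 2", OF dx_pos less_imp_le[OF T_pos] k cont le])
      (assumption | rule that)+
  define t t' x where "t = real n1 * dt" and "t' = real (n1 - 1) * dt" and "x = grid_pt dx j1"
  have tT: "t \<in> {0..T}" "t' \<in> {0..T}" using grid_time[of n1] grid_time[of "n1 - 1"] n1 by (simp_all add: t_def t'_def)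
  define e where "e = exp (lam * s)"
  have e1: "1 \<le> e" using lam0 s by (simp add: e_def)
  have eE: "e \<le> Em" unfolding e_def Em_def lam_def[symmetric] using lam0 s by (simp add: mult_left_mono)
  have \<Phi>1: "\<Phi> n1 j1 (s, y) = U t x - u s y - e * ((norm (x - y))\<^sup>2 / (2 * \<epsilon>) + (t - s)\<^sup>2 / (2 * \<tau>)) - \<mu> * q x - \<Lambda> * s"
    by (simp add: \<Phi>_def t_def x_def e_def)
  have big: "E1 < \<Phi> n1 j1 (s, y)"
  proof -
    have nT: "real n * dt \<in> {0..T}" by (rule grid_time[OF n])
    have "\<Phi> n j (real n * dt, z) \<le> \<Phi> n1 j1 (s, y)" by (rule max[OF n nT])
    moreover have "\<Phi> n j (real n * dt, z) = U (real n * dt) z - u (real n * dt) z - \<mu> * q z - \<Lambda> * (real n * dt)"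
      by (simp add: \<Phi>_def z_def)
    moreover have "\<Lambda> * (real n * dt) \<le> \<Lambda> * T" using \<Lambda> nT by (intro mult_left_mono) auto
    moreover have "\<Lambda> * T = T * \<Lambda>0 + gap / 4" using \<zeta>(2) by (simp add: \<Lambda>_def algebra_simps)
    moreover have "U (real n * dt) z - u (real n * dt) z = gap + E1 + T * \<Lambda>0" by (simp add: gap_def)
    ultimately show ?thesis using \<mu>1 gap by linarith
  qed
  define Q where "Q = (norm (x - y))\<^sup>2 / (2 * \<epsilon>) + (t - s)\<^sup>2 / (2 * \<tau>)"
  have Q0: "0 \<le> Q" using pos \<epsilon> by (simp add: Q_def)
  have Qe: "Q \<le> e * Q" using mult_right_mono[OF e1 Q0] by simp
  have diff: "E1 < U t x - u s y - Q"
  proof -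
    have "0 \<le> \<mu> * q x" "0 \<le> \<Lambda> * s" using \<mu> qz[of x] \<Lambda> s by simp_all
    then show ?thesis using big \<Phi>1[folded Q_def] Qe by linarith
  qed
  have bnd: "a * X \<le> a\<^sup>2 * k / 2 + X\<^sup>2 / (2 * k)" if "0 < k" for a X k :: real
  proof -
    have "2 * (a * k) * X \<le> (a * k)\<^sup>2 + X\<^sup>2" by (rule sum_squares_bound)
    then show ?thesis using that by (simp add: field_simps power2_eq_square)
  qed
  have lipxy: "u0 x - u0 y \<le> K * norm (x - y)" using u0[of x y] by linarith
  have Kx: "K * norm (x - y) \<le> K\<^sup>2 * \<epsilon> / 2 + (norm (x - y))\<^sup>2 / (2 * \<epsilon>)" by (rule bnd[OF \<epsilon>])
  \<comment> \<open>At \<open>s = 0\<close> the barriers bound \<open>U t x - u 0 y\<close> by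
    \<open>u0 x - u0 y + 2 * E0 + Lb * t\<close>, and after subtraction of the penalty at most
    \<open>E1\<close> is left.\<close>
  have sp: "0 < s"
  proof (rule ccontr)
    assume "\<not> 0 < s"
    then have s0: "s = 0" using s by auto
    have "U t x \<le> u0 x + E0 + Lb * t" using bU[OF n1] by (simp add: t_def x_def)
    moreover have "u0 y - E0 \<le> u s y" using bu[OF s, of y] s0 by simp
    moreover have "Lb * t \<le> Lb\<^sup>2 * \<tau> / 2 + t\<^sup>2 / (2 * \<tau>)" by (rule bnd[OF pos(2)])
    ultimately show False using diff lipxy Kx unfolding Q_def s0 E1_def by simp
  qed
  have "n1 \<noteq> 0"
  proof
    assume "n1 = 0"
    then have t0: "t = 0" by (simp add: t_def)
    have "U t x \<le> u0 x + E0 + Lb * t" using bU[OF n1] by (simp add: t_def x_def)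
    moreover have "u0 y - E0 - Lb * s \<le> u s y" by (rule bu[OF s])
    moreover have "Lb * s \<le> Lb\<^sup>2 * \<tau> / 2 + s\<^sup>2 / (2 * \<tau>)" by (rule bnd[OF pos(2)])
    ultimately show False using diff lipxy Kx unfolding Q_def t0 E1_def by simp
  qed
  then have n1': "n1 \<in> {1..MT}" and tt': "t = t' + dt" using n1 by (auto simp: t_def t'_def of_nat_diff algebra_simps)
  have sT: "s \<le> T" using s by simp
  have Uu: "u s y < U t x" using diff E0 Q0 by linarith
  define d where "d = x - y"
  define p where "p = (e / \<epsilon>) *\<^sub>R d"
  have np: "norm p = e / \<epsilon> * norm d" using \<epsilon> e1 by (simp add: p_def)
  have sq: "(e / (2 * \<epsilon>)) * (norm (d + h))\<^sup>2 = (e / (2 * \<epsilon>)) * (norm d)\<^sup>2 + p \<bullet> h + (e / (2 * \<epsilon>)) * (norm h)\<^sup>2" for h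
    unfolding norm_add_square p_def using \<epsilon> by (simp add: field_simps)
  have ed: "e * (A / (2 * \<epsilon>) + B / (2 * \<tau>)) = (e / (2 * \<epsilon>)) * A + e * B / (2 * \<tau>)" for A B
    by (simp add: distrib_left)
  \<comment> \<open>The grid point moves by a node and the continuum point by an arbitrary vector
    \<open>v\<close>, later a jump \<open>\<eta> i z\<close>. The distance vector then changes only
    by \<open>grid_pt dx k - v\<close>, which is of interpolation size on the support of the
    weights.\<close>
  have maxU: "U (real n' * dt) (x + grid_pt dx k) - u s (y + v)
       - (e / (2 * \<epsilon>)) * (norm (d + (grid_pt dx k - v)))\<^sup>2 - e * (real n' * dt - s)\<^sup>2 / (2 * \<tau>) - \<mu> * q (x + grid_pt dx k)
      \<le> U t x - u s y - (e / (2 * \<epsilon>)) * (norm d)\<^sup>2 - e * (t - s)\<^sup>2 / (2 * \<tau>) - \<mu> * q x" if "n' \<le> MT" for n' k v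
  proof -
    have eq: "x + grid_pt dx k - (y + v) = d + (grid_pt dx k - v)" by (simp add: d_def)
    have "\<Phi> n' (j1 + k) (s, y + v) = U (real n' * dt) (x + grid_pt dx k) - u s (y + v)
       - e * ((norm (d + (grid_pt dx k - v)))\<^sup>2 / (2 * \<epsilon>) + (real n' * dt - s)\<^sup>2 / (2 * \<tau>)) - \<mu> * q (x + grid_pt dx k) - \<Lambda> * s"
      unfolding \<Phi>_def prod.case grid_pt_add x_def[symmetric] e_def[symmetric] eq ..
    with max[OF that s, of "j1 + k" "y + v"] show ?thesis unfolding \<Phi>1 d_def[symmetric] ed by linarith
  qed
  \<comment> \<open>The lag includes the change of the time penalty between \<open>t'\<close> and
    \<open>t\<close>, so that this change, and not the unknown difference of \<open>U\<close>,
    becomes the time quotient.\<close>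
  define a where "a = U t x - U t' x - e * (t - s)\<^sup>2 / (2 * \<tau>) + e * (t' - s)\<^sup>2 / (2 * \<tau>)"
  have n1m: "n1 - 1 \<le> MT" using n1 by simp
  have a0: "0 \<le> a" using maxU[OF n1m, of 0 0] by (simp add: a_def t'_def)
  have stept: "U t (x + grid_pt dx k) - U t x \<le> u s (y + v) - u s y + p \<bullet> (grid_pt dx k - v)
      + (e / (2 * \<epsilon>)) * (norm (grid_pt dx k - v))\<^sup>2 + \<mu> * (q (x + grid_pt dx k) - q x)" for k v
    using maxU[OF n1, of k v] unfolding sq t_def[symmetric] by (simp add: algebra_simps)
  have steps: "U t' (x + grid_pt dx k) - U t' x \<le> u s (y + v) - u s y + p \<bullet> (grid_pt dx k - v)
      + (e / (2 * \<epsilon>)) * (norm (grid_pt dx k - v))\<^sup>2 + \<mu> * (q (x + grid_pt dx k) - q x) + a" for k v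
    using maxU[OF n1m, of k v] unfolding sq t'_def[symmetric] a_def by (simp add: algebra_simps)
  define R where "R = e / (2 * \<epsilon>) + \<mu>"
  have R0: "0 \<le> R" using e1 \<epsilon> \<mu> by (simp add: R_def)
  have qtay: "\<mu> * (q (x' + h) - q x') \<le> (\<mu> *\<^sub>R gq x') \<bullet> h + \<mu> * (norm h)\<^sup>2" for x' h
  proof -
    have "q (x' + h) - q x' \<le> gq x' \<bullet> h + (norm h)\<^sup>2"
      using smooth_profileD(6)[OF q, of x' h] by (simp add: inner_commute abs_le_iff)
    then have "\<mu> * (q (x' + h) - q x') \<le> \<mu> * (gq x' \<bullet> h + (norm h)\<^sup>2)" using \<mu> by (intro mult_left_mono) auto
    then show ?thesis by (simp add: algebra_simps)
  qed
  have Rsplit: "R * w = e / (2 * \<epsilon>) * w + \<mu> * w" for w by (simp add: R_def distrib_right)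
  \<comment> \<open>Both points take the same jump: the increment of \<open>u\<close> enters the
    discrete inequality in the very form that it has in the viscosity inequality, where it
    cancels.\<close>
  define V where "V i z = u s (y + \<eta> i z) - u s y + \<mu> * (q (x + \<eta> i z) - q x)" for i z
  define P where "P i z = p + \<mu> *\<^sub>R gq (x + \<eta> i z)" for i z
  have VP: "u s (y + \<eta> i z) - u s y + p \<bullet> (grid_pt dx k - \<eta> i z)
      + (e / (2 * \<epsilon>)) * (norm (grid_pt dx k - \<eta> i z))\<^sup>2 + \<mu> * (q (x + grid_pt dx k) - q x)
     \<le> V i z + P i z \<bullet> (grid_pt dx k - \<eta> i z) + R * (norm (grid_pt dx k - \<eta> i z))\<^sup>2" for i z k
  proof -
    have "\<mu> * (q (x + grid_pt dx k) - q x)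
       = \<mu> * (q ((x + \<eta> i z) + (grid_pt dx k - \<eta> i z)) - q (x + \<eta> i z)) + \<mu> * (q (x + \<eta> i z) - q x)"
      by (simp add: algebra_simps)
    then show ?thesis
      using qtay[of "x + \<eta> i z" "grid_pt dx k - \<eta> i z"] unfolding V_def P_def Rsplit inner_add_left by linarith
  qed
  have uM: "\<bar>u s v\<bar> \<le> Mu" for v using u s by (simp add: bounded_cont_def)
  have [measurable]: "u s \<in> borel_measurable borel"
    using bounded_cont_slice[OF u(2) s] by (rule borel_measurable_continuous_onI)
  have jm: "(\<lambda>z. u s (y + \<eta> i z) - u s y) \<in> borel_measurable \<nu>" if "i \<in> I" for i
    using \<eta>_measurable[OF that] by measurable
  have ub: "\<bar>u s (y + v) - u s y\<bar> \<le> 2 * Mu + 0 * w" for v w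
    using uM[of y] uM[of "y + v"] by (simp add: abs_le_iff)
  have ji: "set_integrable \<nu> jumps (\<lambda>z. u s (y + \<eta> i z) - u s y)"
    "\<bar>LINT z:jumps|\<nu>. u s (y + \<eta> i z) - u s y\<bar> \<le> 2 * Mu * m0 + 0 * m1" if "i \<in> I" for i
    using jumps_integral_bound[OF jm[OF that] ub] by auto
  note qj = profile_jump_integrable[OF q]
  have Vm: "V i \<in> borel_measurable \<nu>" if "i \<in> I" for i
    unfolding V_def using jm[OF that] qj(1)[OF that, of x] by measurable
  have Vb: "\<bar>V i z\<bar> \<le> 2 * Mu + \<mu> * r z" if "i \<in> I" "z \<in> jumps" for i z
  proof -
    have "\<bar>\<mu> * (q (x + \<eta> i z) - q x)\<bar> \<le> \<mu> * r z" using qj(3)[OF that, of x] \<mu> by (simp add: abs_mult)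
    then show ?thesis using ub[of "\<eta> i z" 0] unfolding V_def by linarith
  qed
  have Vint: "(LINT z:jumps|\<nu>. V i z) = (LINT z:jumps|\<nu>. u s (y + \<eta> i z) - u s y) + \<mu> * (LINT z:jumps|\<nu>. q (x + \<eta> i z) - q x)" if "i \<in> I" for i
    unfolding V_def using ji(1)[OF that] qj(2)[OF that, of x] by (simp add: set_integral_add)
  define X1 where "X1 i = - f i t' x + c i t x * (U t' x + a) - (\<theta> *\<^sub>R b i t x + (1 - \<theta>) *\<^sub>R b i t' x) \<bullet> (p + \<mu> *\<^sub>R gq x)
                + drift i \<bullet> (p + \<mu> *\<^sub>R gq x) - (LINT z:jumps|\<nu>. V i z)" for i
  define X2 where "X2 i = - f i s y + c i s y * u s y - b i s y \<bullet> p + drift i \<bullet> p - (LINT z:jumps|\<nu>. u s (y + \<eta> i z) - u s y)" for i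
  have disc: "(U t x - U t' x - a) / dt + G X1 \<le> R * mesh_error"
    unfolding X1_def
  proof (rule discrete_subsolution[OF G f U n1' t_def t'_def x_def a0 R0, where P = P])
    show "U t (x + grid_pt dx k) - U t x \<le> (p + \<mu> *\<^sub>R gq x) \<bullet> grid_pt dx k + R * (norm (grid_pt dx k))\<^sup>2" for k
      using stept[of k 0] qtay[of x "grid_pt dx k"] unfolding Rsplit inner_add_left by simp
    show "U t' (x + grid_pt dx k) - U t' x \<le> (p + \<mu> *\<^sub>R gq x) \<bullet> grid_pt dx k + R * (norm (grid_pt dx k))\<^sup>2 + a" for k
      using steps[of k 0] qtay[of x "grid_pt dx k"] unfolding Rsplit inner_add_left by simp
    show "U t (x + grid_pt dx k) - U t x \<le> V i z + P i z \<bullet> (grid_pt dx k - \<eta> i z) + R * (norm (grid_pt dx k - \<eta> i z))\<^sup>2" for i z k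
      using stept[of k "\<eta> i z"] VP[of i z k] by linarith
    show "U t' (x + grid_pt dx k) - U t' x \<le> V i z + P i z \<bullet> (grid_pt dx k - \<eta> i z) + R * (norm (grid_pt dx k - \<eta> i z))\<^sup>2 + a" for i z k
      using steps[of k "\<eta> i z"] VP[of i z k] by linarith
  qed (rule Vm Vb, assumption+)+
  \<comment> \<open>The backward difference quotient of the weighted time penalty. It misses the
    derivative with respect to \<open>s\<close>, up to sign, by the second-order term
    \<open>e * (dt / (2 * \<tau>))\<close>.\<close>
  have step: "(U t x - U t' x - a) / dt = e * (t - s) / \<tau> - e * (dt / (2 * \<tau>))"
  proof -
    have "(t' - s)\<^sup>2 = (t - s)\<^sup>2 - dt * (2 * (t - s) - dt)" by (simp add: tt' power2_eq_square algebra_simps)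
    then have "U t x - U t' x - a = e * (dt * (2 * (t - s) - dt)) / (2 * \<tau>)"
      by (simp add: a_def diff_divide_distrib right_diff_distrib)
    also have "\<dots> = dt * (e * (t - s) / \<tau> - e * (dt / (2 * \<tau>)))"
      using pos by (simp add: field_simps)
    finally show ?thesis using dt_pos by simp
  qed
  define \<phi> where "\<phi> s' y' = - (exp (lam * s') * ((norm (x - y'))\<^sup>2 / (2 * \<epsilon>) + (t - s')\<^sup>2 / (2 * \<tau>)) + \<Lambda> * s')" for s' y'
  have tay: "\<phi> s (y + h) - \<phi> s y - h \<bullet> p = - (e / (2 * \<epsilon>)) * (norm h)\<^sup>2" for h
  proof -
    have "x - (y + h) = d + (- h)" by (simp add: d_def)
    then have "\<phi> s (y + h) = - ((e / (2 * \<epsilon>)) * (norm (d + (- h)))\<^sup>2 + e * (t - s)\<^sup>2 / (2 * \<tau>) + \<Lambda> * s)"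
      by (simp add: \<phi>_def e_def algebra_simps)
    moreover have "\<phi> s y = - ((e / (2 * \<epsilon>)) * (norm d)\<^sup>2 + e * (t - s)\<^sup>2 / (2 * \<tau>) + \<Lambda> * s)"
      by (simp add: \<phi>_def e_def d_def algebra_simps)
    ultimately show ?thesis unfolding sq by (simp add: inner_commute)
  qed
  have visc: "0 \<le> (- lam * e * Q + e * (t - s) / \<tau> - \<Lambda>) + G X2 + e / (2 * \<epsilon>) * m2"
    unfolding X2_def
  proof (rule visc_super_ineq[OF G f u sp sT, where \<phi> = \<phi>])
    have "(\<lambda>(s, y). \<phi> s y) = (\<lambda>p. (- 1) * (exp (lam * fst p) * ((1 / (2 * \<epsilon>)) * (norm (snd p - x))\<^sup>2 + (1 / (2 * \<tau>)) * (norm (fst p - t))\<^sup>2) + \<Lambda> * fst p))"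
      by (auto simp: \<phi>_def fun_eq_iff norm_minus_commute power2_commute)
    then show "C2_on (Q_dom T) (\<lambda>(s, y). \<phi> s y)"
      by (simp only:) (intro C2_on_cmul C2_on_add C2_on_mult C2_on_exp C2_on_norm_power2 bounded_linear_fst bounded_linear_snd
          C2_on_bounded_linear[OF bounded_linear_fst])
    show "u s y - \<phi> s y \<le> u s' y' - \<phi> s' y'" if "0 < s'" "s' \<le> T" for s' y'
      using max[OF n1, of s' j1 y'] that by (simp add: \<Phi>_def \<phi>_def t_def x_def)
    have "((\<lambda>s'. \<phi> s' y) has_real_derivative - (lam * e * Q - e * (t - s) / \<tau> + \<Lambda>)) (at s)"
      unfolding \<phi>_def using pos
      by (auto intro!: derivative_eq_intros simp: Q_def e_def field_simps)
    then show "((\<lambda>s'. \<phi> s' y) has_vector_derivative - lam * e * Q + e * (t - s) / \<tau> - \<Lambda>) (at s)"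
      by (simp add: has_real_derivative_iff_has_vector_derivative)
    show *: "\<bar>\<phi> s (y + h) - \<phi> s y - h \<bullet> p\<bar> \<le> e / (2 * \<epsilon>) * (norm h)\<^sup>2" for h
      unfolding tay using e1 \<epsilon> by simp
    then show "GDERIV (\<phi> s) y :> p" by (rule GDERIV_of_quadratic_bound)
  qed
  define X Y where "X = norm d" and "Y = \<bar>t - s\<bar>"
  define Err where "Err = K * (1 + M) * (X + Y) + K * dt + K * (e * (Y * dt / \<tau>)) + K * (dt + Y + X) * (e / \<epsilon> * X) + \<mu> * (K + Lq)"
  have bt: "norm (\<theta> *\<^sub>R b i t x + (1 - \<theta>) *\<^sub>R b i t' x) \<le> K" if i: "i \<in> I" for i
  proof -
    have "norm (\<theta> *\<^sub>R b i t x + (1 - \<theta>) *\<^sub>R b i t' x) \<le> \<theta> * norm (b i t x) + (1 - \<theta>) * norm (b i t' x)"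
      using norm_triangle_ineq[of "\<theta> *\<^sub>R b i t x" "(1 - \<theta>) *\<^sub>R b i t' x"] \<theta> by simp
    also have "\<dots> \<le> \<theta> * K + (1 - \<theta>) * K"
      using \<theta> b_bound[OF i tT(1)] b_bound[OF i tT(2)] by (intro add_mono mult_left_mono) auto
    finally show ?thesis by (simp add: algebra_simps)
  qed
  have ts': "\<bar>t' - s\<bar> \<le> dt + Y" unfolding Y_def tt' using dt_pos by linarith
  have X21: "X2 i \<le> X1 i + Err" if i: "i \<in> I" for i
  proof -
    let ?b\<theta> = "\<theta> *\<^sub>R b i t x + (1 - \<theta>) *\<^sub>R b i t' x"
    have "\<bar>f i t' x - f i s y\<bar> \<le> K * (\<bar>t' - s\<bar> + norm (x - y))" using f i tT s by (auto simp: source_def)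
    also have "\<dots> \<le> K * (dt + Y + X)" using ts' K_pos by (intro mult_left_mono) (auto simp: X_def d_def)
    finally have 1: "f i t' x - f i s y \<le> K * (dt + Y + X)" by linarith
    have cd: "\<bar>c i t x - c i s y\<bar> \<le> K * (Y + X)" using c_lip[OF i tT(1) s] by (simp add: X_def Y_def d_def)
    have ct: "0 \<le> c i t x" "c i t x \<le> K" "0 \<le> c i s y" using c_bound[OF i tT(1)] c_bound[OF i s] by auto
    have UM: "U t x \<le> M" using M(2)[OF n1] by (simp add: t_def x_def)
    have uM': "- M \<le> u s y" by (rule M(3)[OF s])
    \<comment> \<open>Only \<open>U \<le> M\<close> and \<open>- M \<le> u\<close> are available, so
      the splitting depends on which coefficient is larger. In both cases the first summand is
      nonpositive, by \<open>u s y < U t x\<close> and \<open>c \<ge> 0\<close>.\<close>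
    have 2: "c i s y * u s y - c i t x * U t x \<le> K * (Y + X) * M"
    proof (cases "c i s y \<le> c i t x")
      case True
      have "c i s y * u s y - c i t x * U t x = - (c i t x * (U t x - u s y)) + (c i t x - c i s y) * (- u s y)" by (simp add: algebra_simps)
      also have "\<dots> \<le> 0 + (c i t x - c i s y) * M"
        using ct Uu uM' True by (intro add_mono mult_left_mono) auto
      also have "\<dots> \<le> K * (Y + X) * M" using cd M(1) by (simp) (intro mult_right_mono; linarith)
      finally show ?thesis .
    next
      case False
      have "c i s y * u s y - c i t x * U t x = - (c i s y * (U t x - u s y)) + (c i s y - c i t x) * U t x" by (simp add: algebra_simps)
      also have "\<dots> \<le> 0 + (c i s y - c i t x) * M"
        using ct Uu UM False by (intro add_mono mult_left_mono) auto
      also have "\<dots> \<le> K * (Y + X) * M" using cd M(1) by (simp) (intro mult_right_mono; linarith)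
      finally show ?thesis .
    qed
    \<comment> \<open>The discrete inequality evaluates \<open>c\<close> times the lagged value
      \<open>U t' x + a\<close>; its distance from \<open>U t x\<close> is \<open>dt\<close> times
      the quotient found in \<open>step\<close>.\<close>
    have 3: "c i t x * U t x - c i t x * (U t' x + a) \<le> K * (e * (Y * dt / \<tau>))"
    proof -
      have "U t x - (U t' x + a) = dt * (e * (t - s) / \<tau> - e * (dt / (2 * \<tau>)))"
        using step dt_pos by (simp add: field_simps)
      also have "\<dots> = e * ((t - s) * dt / \<tau>) - e * (dt\<^sup>2 / (2 * \<tau>))" by (simp add: algebra_simps power2_eq_square)
      also have "\<dots> \<le> e * (Y * dt / \<tau>)"
      proof -
        have "(t - s) * dt / \<tau> \<le> Y * dt / \<tau>" using dt_pos pos by (intro divide_right_mono mult_right_mono) (auto simp: Y_def)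
        then have "e * ((t - s) * dt / \<tau>) \<le> e * (Y * dt / \<tau>)" using e1 by (intro mult_left_mono) auto
        moreover have "0 \<le> e * (dt\<^sup>2 / (2 * \<tau>))" using e1 pos by simp
        ultimately show ?thesis by linarith
      qed
      finally have *: "U t x - (U t' x + a) \<le> e * (Y * dt / \<tau>)" .
      have "c i t x * (U t x - (U t' x + a)) \<le> c i t x * (e * (Y * dt / \<tau>))" by (rule mult_left_mono[OF * ct(1)])
      also have "\<dots> \<le> K * (e * (Y * dt / \<tau>))"
        using ct e1 dt_pos pos by (intro mult_right_mono) (auto simp: Y_def)
      finally show ?thesis by (simp add: algebra_simps)
    qed
    have 4: "?b\<theta> \<bullet> p - b i s y \<bullet> p \<le> K * (dt + Y + X) * (e / \<epsilon> * X)"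
    proof -
      have "?b\<theta> - b i s y = \<theta> *\<^sub>R (b i t x - b i s y) + (1 - \<theta>) *\<^sub>R (b i t' x - b i s y)" by (simp add: algebra_simps)
      then have "norm (?b\<theta> - b i s y) \<le> norm (\<theta> *\<^sub>R (b i t x - b i s y)) + norm ((1 - \<theta>) *\<^sub>R (b i t' x - b i s y))"
        by (simp only: norm_triangle_ineq)
      also have "\<dots> = \<theta> * norm (b i t x - b i s y) + (1 - \<theta>) * norm (b i t' x - b i s y)" using \<theta> by simp
      also have "\<dots> \<le> \<theta> * (K * (dt + Y + X)) + (1 - \<theta>) * (K * (dt + Y + X))"
      proof (intro add_mono mult_left_mono)
        have "K * (\<bar>t - s\<bar> + norm (x - y)) \<le> K * (dt + Y + X)" "K * (\<bar>t' - s\<bar> + norm (x - y)) \<le> K * (dt + Y + X)"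
          using K_pos ts' dt_pos by (intro mult_left_mono; simp add: X_def Y_def d_def)+
        then show "norm (b i t x - b i s y) \<le> K * (dt + Y + X)" "norm (b i t' x - b i s y) \<le> K * (dt + Y + X)"
          using b_lip[OF i tT(1) s, of x y] b_lip[OF i tT(2) s, of x y] by linarith+
      qed (use \<theta> in auto)
      finally have nb: "norm (?b\<theta> - b i s y) \<le> K * (dt + Y + X)" by (simp add: algebra_simps)
      have "\<bar>(?b\<theta> - b i s y) \<bullet> p\<bar> \<le> K * (dt + Y + X) * (e / \<epsilon> * X)"
        by (rule abs_inner_le[OF nb]) (simp add: np X_def)
      then show ?thesis by (simp add: inner_diff_left)
    qed
    have 5: "?b\<theta> \<bullet> (\<mu> *\<^sub>R gq x) \<le> \<mu> * K"
    proof -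
      have "\<bar>?b\<theta> \<bullet> gq x\<bar> \<le> K * 1" by (rule abs_inner_le[OF bt[OF i] smooth_profileD(3)[OF q]])
      then have "?b\<theta> \<bullet> gq x \<le> K" by linarith
      then have "\<mu> * (?b\<theta> \<bullet> gq x) \<le> \<mu> * K" using \<mu> by (intro mult_left_mono) auto
      then show ?thesis by simp
    qed
    have 6: "\<mu> * (LINT z:jumps|\<nu>. q (x + \<eta> i z) - q x) - drift i \<bullet> (\<mu> *\<^sub>R gq x) \<le> \<mu> * Lq"
    proof -
      have "(LINT z:jumps|\<nu>. q (x + \<eta> i z) - q x) - drift i \<bullet> gq x \<le> Lq"
        using smooth_profileD(7)[OF q i, of x] by linarith
      then have "\<mu> * ((LINT z:jumps|\<nu>. q (x + \<eta> i z) - q x) - drift i \<bullet> gq x) \<le> \<mu> * Lq" using \<mu> by (intro mult_left_mono) auto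
      then show ?thesis by (simp add: algebra_simps)
    qed
    have "K * (dt + Y + X) + K * (Y + X) * M = K * (1 + M) * (X + Y) + K * dt" by (simp add: algebra_simps)
    then show ?thesis
      using 1 2 3 4 5 6 unfolding X1_def X2_def Vint[OF i] Err_def inner_add_right distrib_left[of \<mu>] by linarith
  qed
  have X2b: "\<bar>X2 i\<bar> \<le> K + K * Mu + K * norm p + m1 * norm p + (2 * Mu * m0 + 0 * m1)" if i: "i \<in> I" for i
  proof -
    have "\<bar>f i s y\<bar> \<le> K" using f i s by (auto simp: source_def)
    moreover have "\<bar>c i s y\<bar> \<le> K" using c_bound[OF i s] by auto
    ultimately show ?thesis
      unfolding X2_def by (intro abs_sum_le abs_mult_le abs_inner_le b_bound[OF i s] norm_drift[OF i] ji(2)[OF i] uM) auto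
  qed
  have X1b: "\<bar>X1 i\<bar> \<le> K + K * \<bar>U t' x + a\<bar> + K * norm (p + \<mu> *\<^sub>R gq x) + m1 * norm (p + \<mu> *\<^sub>R gq x) + (2 * Mu * m0 + \<mu> * m1)" if i: "i \<in> I" for i
  proof -
    have "\<bar>f i t' x\<bar> \<le> K" using f i tT by (auto simp: source_def)
    moreover have "\<bar>c i t x\<bar> \<le> K" using c_bound[OF i tT(1)] by auto
    ultimately show ?thesis
      unfolding X1_def by (intro abs_sum_le abs_mult_le abs_inner_le bt[OF i] norm_drift[OF i]
          jumps_integral_bound(2)[OF Vm[OF i] Vb[OF i]]) auto
  qed
  have GX: "G X2 \<le> G X1 + Err" by (rule game_operatorD[OF G X2b X1b X21])
  have QXY: "Q = X\<^sup>2 / (2 * \<epsilon>) + Y\<^sup>2 / (2 * \<tau>)" by (simp add: Q_def X_def Y_def d_def)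
  have "Err - \<mu> * (K + Lq) \<le> K * (6 + M) * (e * Q) + K * (1 + M) * ((\<epsilon> + \<tau>) / 2) + K * dt + K * (e * (dt\<^sup>2 / \<tau>))"
    using doubling_error_arith[OF _ _ _ e1 pos(2,3) _ M(1) QXY, of dt K] K_pos dt_pos
    by (simp add: Err_def X_def Y_def)
  then have errb: "Err \<le> lam * e * Q + K * (1 + M) * ((\<epsilon> + \<tau>) / 2) + K * dt + K * (e * (dt\<^sup>2 / \<tau>)) + \<mu> * (K + Lq)"
    by (simp add: lam_def)
  have dtT: "dt \<le> T"
  proof -
    have "T = dt * real MT" using MT by simp
    then show ?thesis using mult_left_mono[of 1 "real MT" dt] MT dt_pos by simp
  qed
  define w c1 c2 c3 c4 where "w = e * (t - s) / \<tau>" and "c1 = K * (1 + M) * ((\<epsilon> + \<tau>) / 2)" and "c2 = K * (e * (dt\<^sup>2 / \<tau>))"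
    and "c3 = e * (dt / (2 * \<tau>))" and "c4 = e * ((m2 + mesh_error) / (2 * \<epsilon>))"
  have c4: "e / (2 * \<epsilon>) * mesh_error + e / (2 * \<epsilon>) * m2 = c4"
    by (simp add: c4_def add_divide_distrib distrib_left)
  have "w - c3 + G X1 \<le> R * mesh_error" using disc unfolding step w_def c3_def .
  moreover have "R * mesh_error = e / (2 * \<epsilon>) * mesh_error + \<mu> * mesh_error" by (rule Rsplit)
  moreover have "0 \<le> - (lam * e * Q) + w - \<Lambda> + G X2 + e / (2 * \<epsilon>) * m2"
    using visc unfolding w_def by (simp only: mult_minus_left)
  moreover have "Err \<le> lam * e * Q + c1 + K * dt + c2 + \<mu> * (K + Lq)"
    using errb unfolding c1_def c2_def .
  moreover have "\<mu> * (K + Lq + mesh_error) = \<mu> * (K + Lq) + \<mu> * mesh_error" by (rule distrib_left)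
  ultimately have \<Lambda>le: "\<Lambda> \<le> c1 + K * dt + c2 + c3 + c4 + \<mu> * (K + Lq + mesh_error)"
    using GX c4 by linarith
  have "e * ((m2 + mesh_error) / (2 * \<epsilon>)) \<le> Em * ((m2 + mesh_error) / (2 * \<epsilon>))"
    using eE m2 me \<epsilon> by (intro mult_right_mono) auto
  moreover have "K * (e * (dt\<^sup>2 / \<tau>)) + e * (dt / (2 * \<tau>)) \<le> Em * ((K * T + 1 / 2) * (dt / \<tau>))"
  proof -
    have "dt\<^sup>2 / \<tau> \<le> T * (dt / \<tau>)" using dtT dt_pos pos by (simp add: power2_eq_square divide_right_mono)
    then have "K * (dt\<^sup>2 / \<tau>) \<le> K * (T * (dt / \<tau>))" using K_pos by (intro mult_left_mono) auto
    then have "e * (K * (dt\<^sup>2 / \<tau>) + dt / (2 * \<tau>)) \<le> e * (K * (T * (dt / \<tau>)) + dt / (2 * \<tau>))"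
      using e1 by (intro mult_left_mono) auto
    also have "\<dots> \<le> Em * (K * (T * (dt / \<tau>)) + dt / (2 * \<tau>))"
      using eE K_pos T_pos dt_pos pos by (intro mult_right_mono) auto
    finally show ?thesis by (simp add: algebra_simps)
  qed
  ultimately have "\<Lambda> \<le> \<Lambda>0 + \<mu> * (K + Lq + mesh_error)" using \<Lambda>le unfolding \<Lambda>0_def c1_def c2_def c3_def c4_def by linarith
  then show False using \<mu>2 by (simp add: \<Lambda>_def)
qed

end

section \<open>A smoothed norm\<close>

definition smoothed_norm :: "real \<Rightarrow> 'v::real_normed_vector \<Rightarrow> real" where
  "smoothed_norm e y = sqrt (e\<^sup>2 + (norm y)\<^sup>2)"

lemma smoothed_norm_bounds:
  assumes "0 < e"
  shows "norm y \<le> smoothed_norm e y" "e \<le> smoothed_norm e y" "smoothed_norm e y \<le> e + norm y" "smoothed_norm e 0 = e"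
proof -
  show "norm y \<le> smoothed_norm e y" "e \<le> smoothed_norm e y" unfolding smoothed_norm_def by (auto intro!: real_le_rsqrt)
  show "smoothed_norm e y \<le> e + norm y" "smoothed_norm e 0 = e"
    using assms sqrt_sum_squares_le_sum[of e "norm y"] by (simp_all add: smoothed_norm_def)
qed

text \<open>With values \<open>a\<close>, \<open>b\<close> and \<open>s = y \<bullet> h\<close>, the
  remainder is \<open>(a * b - a^2 - s) / a\<close>. Cauchy-Schwarz for the vectors (e, y) and (e, y
  + h) makes it nonnegative, and \<open>2 * a * b \<le> a^2 + b^2\<close> bounds it by half the
  square of \<open>norm h\<close> over \<open>a\<close>.\<close>

lemma smoothed_norm_taylor:
  fixes y h :: "'v::real_inner"
  assumes e: "0 < e"
  shows "\<bar>smoothed_norm e (y + h) - smoothed_norm e y - h \<bullet> (y /\<^sub>R smoothed_norm e y)\<bar> \<le> (1 / e) * (norm h)\<^sup>2"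
proof -
  define a b s where "a = smoothed_norm e y" and "b = smoothed_norm e (y + h)" and "s = y \<bullet> h"
  have ae: "e \<le> a" and be: "e \<le> b" by (simp_all add: a_def b_def smoothed_norm_bounds[OF e])
  have a: "0 < a" and b: "0 < b" using e ae be by auto
  have a2: "a\<^sup>2 = e\<^sup>2 + (norm y)\<^sup>2" by (simp add: a_def smoothed_norm_def)
  have "b\<^sup>2 = e\<^sup>2 + (norm (y + h))\<^sup>2" by (simp add: b_def smoothed_norm_def)
  then have b2: "b\<^sup>2 = a\<^sup>2 + 2 * s + (norm h)\<^sup>2" by (simp add: a2 norm_add_square s_def)
  have low: "a\<^sup>2 + s \<le> a * b"
  proof -
    have "a\<^sup>2 + s = e * e + y \<bullet> (y + h)" unfolding a2 s_def by (simp add: power2_norm_eq_inner inner_add_right power2_eq_square[of e])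
    also have "\<dots> \<le> e * e + norm y * norm (y + h)" using norm_cauchy_schwarz by simp
    also have "\<dots> \<le> sqrt (e\<^sup>2 + (norm y)\<^sup>2) * sqrt (e\<^sup>2 + (norm (y + h))\<^sup>2)"
      unfolding real_sqrt_mult[symmetric]
    proof (rule real_le_rsqrt)
      have "0 \<le> (e * norm (y + h) - e * norm y)\<^sup>2" by simp
      then show "(e * e + norm y * norm (y + h))\<^sup>2 \<le> (e\<^sup>2 + (norm y)\<^sup>2) * (e\<^sup>2 + (norm (y + h))\<^sup>2)"
        by (simp add: power2_eq_square algebra_simps)
    qed
    finally show ?thesis by (simp add: a_def b_def smoothed_norm_def)
  qed
  have up: "a * b \<le> a\<^sup>2 + s + (norm h)\<^sup>2 / 2"
    using sum_squares_bound[of a b] b2 by linarith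
  have inner: "h \<bullet> (y /\<^sub>R a) = s / a" by (simp add: s_def inner_commute divide_inverse)
  have eq: "b - a - s / a = (a * b - a\<^sup>2 - s) / a" using a by (simp add: field_simps power2_eq_square)
  have "\<bar>b - a - s / a\<bar> \<le> ((norm h)\<^sup>2 / 2) / a"
  proof -
    have "\<bar>(a * b - a\<^sup>2 - s) / a\<bar> = (a * b - a\<^sup>2 - s) / a" using low a by simp
    moreover have "(a * b - a\<^sup>2 - s) / a \<le> ((norm h)\<^sup>2 / 2) / a" by (rule divide_right_mono) (use up a in auto)
    ultimately show ?thesis unfolding eq by simp
  qed
  also have "\<dots> \<le> (norm h)\<^sup>2 / e"
    using ae e by (intro frac_le) auto
  finally show ?thesis unfolding a_def[symmetric] b_def[symmetric] inner by simp
qed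

lemma C2_on_smoothed_norm:
  fixes y0 :: "'v::euclidean_space" assumes "0 < e" shows "C2_on S (\<lambda>y. smoothed_norm e (y - y0))"
  unfolding smoothed_norm_def
  by (intro C2_on_sqrt C2_on_add C2_on_const C2_on_norm_power2 bounded_linear_ident)
     (use assms in \<open>simp add: add_pos_nonneg\<close>)

section \<open>Profiles obtained from slope and curvature\<close>

context isaacs_data begin

text \<open>For each jump the better of the slope bound and the curvature bound. The crossover at
  jump size about \<open>P / R\<close> is the reason why for \<open>R = 1 / e\<close> it grows no
  faster than \<open>1 + Gam \<sigma> e\<close>.\<close>

definition "jump_modulus P R = (LINT z:jumps|\<nu>. min (2 * P * r z) (R * (r z)\<^sup>2))"

lemma jump_modulus_integrable:
  assumes "0 \<le> P" "0 \<le> R" shows "set_integrable \<nu> jumps (\<lambda>z. min (2 * P * r z) (R * (r z)\<^sup>2))"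
proof -
  obtain i where "i \<in> I" using I_nonempty by blast
  show ?thesis
  proof (rule jumps_integral_bound(1)[of _ 0 "2 * P"])
    fix z assume "z \<in> jumps"
    then have "0 \<le> r z" using r_nonneg[OF \<open>i \<in> I\<close>] jumps_nonzero by blast
    then show "\<bar>min (2 * P * r z) (R * (r z)\<^sup>2)\<bar> \<le> 0 + 2 * P * r z" using assms by (simp add: min_def)
  qed simp
qed

lemma smooth_profileI:
  assumes C2: "C2_on UNIV w" and g: "\<And>y. GDERIV w y :> g y" "\<And>y. norm (g y) \<le> P"
    and R: "0 \<le> R" "\<And>y h. \<bar>w (y + h) - w y - h \<bullet> g y\<bar> \<le> R * (norm h)\<^sup>2"
  shows "smooth_profile w g P R (jump_modulus P R)"
proof -
  have P: "0 \<le> P" using g(2) norm_ge_zero order_trans by blast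
  have lip: "\<bar>w (y + h) - w y\<bar> \<le> P * norm h" for y h by (rule lipschitz_of_gderiv_bound[OF g])
  have "continuous_on UNIV w"
    using has_derivative_continuous[OF g(1)[unfolded gderiv_def]] by (simp add: continuous_at_imp_continuous_on)
  then have [measurable]: "w \<in> borel_measurable borel" by (rule borel_measurable_continuous_onI)
  have "\<bar>(LINT z:jumps|\<nu>. w (y + \<eta> i z) - w y) - drift i \<bullet> g y\<bar> \<le> jump_modulus P R" if i: "i \<in> I" for i y
  proof -
    have m: "(\<lambda>z. w (y + \<eta> i z) - w y) \<in> borel_measurable \<nu>" "(\<lambda>z. \<eta> i z \<bullet> g y) \<in> borel_measurable \<nu>"
      using \<eta>_measurable[OF i] by measurable
    have b1: "\<bar>w (y + \<eta> i z) - w y\<bar> \<le> P * r z" and b2: "\<bar>\<eta> i z \<bullet> g y\<bar> \<le> P * r z" if "z \<in> jumps" for z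
    proof -
      note le = \<eta>_le[OF i jumps_nonzero[OF that]]
      show "\<bar>w (y + \<eta> i z) - w y\<bar> \<le> P * r z"
        using lip[of y "\<eta> i z"] mult_left_mono[OF le P] by linarith
      show "\<bar>\<eta> i z \<bullet> g y\<bar> \<le> P * r z" using abs_inner_le[OF le g(2)] by (simp add: mult.commute)
    qed
    have i1: "set_integrable \<nu> jumps (\<lambda>z. w (y + \<eta> i z) - w y)" "set_integrable \<nu> jumps (\<lambda>z. \<eta> i z \<bullet> g y)"
      using jumps_integral_bound(1)[OF m(1), of 0 P] jumps_integral_bound(1)[OF m(2), of 0 P] b1 b2 by auto
    have "(LINT z:jumps|\<nu>. w (y + \<eta> i z) - w y) - drift i \<bullet> g y = (LINT z:jumps|\<nu>. w (y + \<eta> i z) - w y - \<eta> i z \<bullet> g y)"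
      unfolding drift_inner[OF i] using set_integral_diff(2)[OF i1] by simp
    moreover have "\<bar>LINT z:jumps|\<nu>. w (y + \<eta> i z) - w y - \<eta> i z \<bullet> g y\<bar> \<le> jump_modulus P R"
      unfolding jump_modulus_def
    proof (rule set_integral_dominated(2)[OF jump_modulus_integrable[OF P R(1)]])
      show "set_borel_measurable \<nu> jumps (\<lambda>z. w (y + \<eta> i z) - w y - \<eta> i z \<bullet> g y)"
        unfolding set_borel_measurable_def using m by measurable
      fix z assume z: "z \<in> jumps"
      have "(norm (\<eta> i z))\<^sup>2 \<le> (r z)\<^sup>2" using \<eta>_le[OF i jumps_nonzero[OF z]] by (intro power_mono) auto
      then have "R * (norm (\<eta> i z))\<^sup>2 \<le> R * (r z)\<^sup>2" using R(1) by (rule mult_left_mono)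
      then show "\<bar>w (y + \<eta> i z) - w y - \<eta> i z \<bullet> g y\<bar> \<le> min (2 * P * r z) (R * (r z)\<^sup>2)"
        using R(2)[of y "\<eta> i z"] b1[OF z] b2[OF z] by linarith
    qed
    ultimately show ?thesis by simp
  qed
  then show ?thesis using assms by (auto simp: smooth_profile_def)
qed

lemma smooth_profile_affine:
  assumes "smooth_profile w g P R L0"
  shows "smooth_profile (\<lambda>y. k + m * w y) (\<lambda>y. m *\<^sub>R g y) (\<bar>m\<bar> * P) (\<bar>m\<bar> * R) (\<bar>m\<bar> * L0)"
  unfolding smooth_profile_def
proof (intro conjI allI ballI)
  note D = smooth_profileD[OF assms]
  show "C2_on UNIV (\<lambda>y. k + m * w y)" by (intro C2_on_add C2_on_const C2_on_cmul D)
  fix y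
  show "GDERIV (\<lambda>y. k + m * w y) y :> m *\<^sub>R g y"
    using GDERIV_add[OF GDERIV_const GDERIV_mult[OF GDERIV_const D(2)]] by simp
  show "norm (m *\<^sub>R g y) \<le> \<bar>m\<bar> * P" using D(3) by (simp add: mult_left_mono)
  show "\<bar>k + m * w (y + h) - (k + m * w y) - h \<bullet> m *\<^sub>R g y\<bar> \<le> \<bar>m\<bar> * R * (norm h)\<^sup>2" for h
  proof -
    have "k + m * w (y + h) - (k + m * w y) - h \<bullet> m *\<^sub>R g y = m * (w (y + h) - w y - h \<bullet> g y)" by (simp add: algebra_simps)
    then show ?thesis using mult_left_mono[OF D(6), of "\<bar>m\<bar>"] by (simp add: abs_mult mult.assoc)
  qed
  fix i assume "i \<in> I"
  have "(LINT z:jumps|\<nu>. k + m * w (y + \<eta> i z) - (k + m * w y)) = m * (LINT z:jumps|\<nu>. w (y + \<eta> i z) - w y)"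
    by (simp add: set_integral_mult_right[symmetric] right_diff_distrib)
  then have "(LINT z:jumps|\<nu>. k + m * w (y + \<eta> i z) - (k + m * w y)) - drift i \<bullet> m *\<^sub>R g y
    = m * ((LINT z:jumps|\<nu>. w (y + \<eta> i z) - w y) - drift i \<bullet> g y)" by (simp add: algebra_simps)
  then show "\<bar>(LINT z:jumps|\<nu>. k + m * w (y + \<eta> i z) - (k + m * w y)) - drift i \<bullet> m *\<^sub>R g y\<bar> \<le> \<bar>m\<bar> * L0"
    using mult_left_mono[OF D(7)[OF \<open>i \<in> I\<close>], of "\<bar>m\<bar>"] by (simp add: abs_mult)
qed

lemma smooth_profile_add:
  assumes "smooth_profile w g P R L0" "smooth_profile w' g' P' R' L0'"
  shows "smooth_profile (\<lambda>y. w y + w' y) (\<lambda>y. g y + g' y) (P + P') (R + R') (L0 + L0')"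
  unfolding smooth_profile_def
proof (intro conjI allI ballI)
  note D = smooth_profileD[OF assms(1)] and D' = smooth_profileD[OF assms(2)]
  show "C2_on UNIV (\<lambda>y. w y + w' y)" by (intro C2_on_add D(1) D'(1))
  fix y
  show "GDERIV (\<lambda>y. w y + w' y) y :> g y + g' y" by (intro GDERIV_add D(2) D'(2))
  show "norm (g y + g' y) \<le> P + P'" by (rule norm_triangle_mono[OF D(3) D'(3)])
  show "\<bar>w (y + h) + w' (y + h) - (w y + w' y) - h \<bullet> (g y + g' y)\<bar> \<le> (R + R') * (norm h)\<^sup>2" for h
    using D(6)[of y h] D'(6)[of y h] unfolding inner_add_right distrib_right by linarith
  fix i assume i: "i \<in> I"
  have "(LINT z:jumps|\<nu>. w (y + \<eta> i z) + w' (y + \<eta> i z) - (w y + w' y))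
     = (LINT z:jumps|\<nu>. w (y + \<eta> i z) - w y) + (LINT z:jumps|\<nu>. w' (y + \<eta> i z) - w' y)"
    using profile_jump_integrable(2)[OF assms(1) i, of y] profile_jump_integrable(2)[OF assms(2) i, of y]
    by (subst set_integral_add(2)[symmetric]) (auto simp: algebra_simps)
  then show "\<bar>(LINT z:jumps|\<nu>. w (y + \<eta> i z) + w' (y + \<eta> i z) - (w y + w' y)) - drift i \<bullet> (g y + g' y)\<bar> \<le> L0 + L0'"
    using D(7)[OF i, of y] D'(7)[OF i, of y] unfolding inner_add_right by linarith
qed

lemma smooth_profile_smoothed_norm:
  assumes e: "0 < e"
  shows "smooth_profile (\<lambda>y. smoothed_norm e (y - y0)) (\<lambda>y. (y - y0) /\<^sub>R smoothed_norm e (y - y0)) 1 (1 / e) (jump_modulus 1 (1 / e))"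
proof (rule smooth_profileI[OF C2_on_smoothed_norm[OF e]])
  show t: "\<bar>smoothed_norm e (y + h - y0) - smoothed_norm e (y - y0) - h \<bullet> ((y - y0) /\<^sub>R smoothed_norm e (y - y0))\<bar> \<le> (1 / e) * (norm h)\<^sup>2" for y h
    using smoothed_norm_taylor[OF e, of "y - y0" h] by (simp add: algebra_simps)
  show "GDERIV (\<lambda>y. smoothed_norm e (y - y0)) y :> (y - y0) /\<^sub>R smoothed_norm e (y - y0)" for y
    by (rule GDERIV_of_quadratic_bound[OF t])
  show "norm ((y - y0) /\<^sub>R smoothed_norm e (y - y0)) \<le> 1" for y
    using smoothed_norm_bounds(1,2)[OF e, of "y - y0"] e by (simp add: divide_inverse[symmetric] mult.commute)
  show "0 \<le> 1 / e" using e by simp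
qed

end

section \<open>Moments of the Levy measure\<close>

text \<open>Dyadic shells: those of radii \<open>a / 2 ^ k\<close> are disjoint and exhaust the
  punctured ball, and on each of them the density bound varies by a fixed factor only.\<close>

definition annulus :: "real \<Rightarrow> (real^'m) set" where
  "annulus a = {z. a / 2 \<le> norm z \<and> norm z < a}"

text \<open>\<open>2 powr (M + \<sigma>)\<close>, for dimension \<open>M\<close>, is the ratio of
  the density bounds at the inner and the outer radius of a shell; the volume of the shell is
  bounded by that of the ball.\<close>

definition levy_const :: "'m itself \<Rightarrow> real \<Rightarrow> real \<Rightarrow> real" where
  "levy_const _ \<sigma> C = C * 2 powr (real CARD('m) + \<sigma>) * unit_ball_vol (real CARD('m))"

lemma norm_in_annulus:
  assumes "norm z < a" "a / 2 ^ n \<le> norm z" "0 < a"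
  shows "\<exists>k<n. z \<in> annulus (a / 2 ^ k)"
  using assms(2)
proof (induction n)
  case 0
  then show ?case using assms by simp
next
  case (Suc n)
  show ?case
  proof (cases "a / 2 ^ n \<le> norm z")
    case True
    then show ?thesis using Suc.IH less_Suc_eq by blast
  next
    case False
    then have "z \<in> annulus (a / 2 ^ n)" using Suc.prems by (simp add: annulus_def field_simps)
    then show ?thesis by blast
  qed
qed

lemma annulus_term:
  fixes a s :: real
  assumes "0 < a"
  shows "(a / 2 ^ k) powr s = a powr s * (2 powr (- s)) ^ k"
proof -
  have "(a / 2 ^ k) powr s = a powr s / (2 ^ k) powr s" using assms by (simp add: powr_divide)
  also have "(2 ^ k :: real) powr s = (2 powr s) ^ k" by (simp add: powr_powr powr_realpow[symmetric] mult.commute)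
  finally show ?thesis by (simp add: powr_minus power_inverse divide_inverse)
qed

context
  fixes \<nu> :: "(real^'m) measure" and \<sigma> C B :: real
  assumes sets: "sets \<nu> = sets (restrict_space borel (- {0}))" and A5: "assm_A5 \<sigma> C \<nu>"
    and C: "0 < C" and \<sigma>: "0 < \<sigma>" "\<sigma> < 2"
    and B: "B = levy_const TYPE('m) \<sigma> C"
begin

lemma levy_const_nonneg: "0 \<le> B"
  using C by (simp add: B levy_const_def unit_ball_vol_nonneg)

lemma space_levy: "space \<nu> = - {0}"
  using sets_eq_imp_space_eq[OF sets] by (simp add: space_restrict_space)

lemma norm_measurable_levy [measurable]: "(\<lambda>z. norm z) \<in> borel_measurable \<nu>"
  by (subst measurable_cong_sets[OF sets refl]) (auto intro: measurable_restrict_space1)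

lemma annulus_sets: "0 < a \<Longrightarrow> annulus a \<in> sets \<nu>"
  unfolding sets by (auto simp: sets_restrict_space_iff annulus_def)

lemma emeasure_annulus:
  assumes a: "0 < a" "a \<le> 1"
  shows "emeasure \<nu> (annulus a) \<le> ennreal (B * a powr (- \<sigma>))"
proof -
  from A5 obtain k where k: "k \<in> borel_measurable borel"
    "\<And>z. z \<noteq> 0 \<Longrightarrow> norm z < 1 \<Longrightarrow> 0 \<le> k z \<and> k z \<le> C * norm z powr (- real CARD('m) - \<sigma>)"
    "\<And>S. S \<in> sets \<nu> \<Longrightarrow> S \<subseteq> {z. norm z < 1} \<Longrightarrow> emeasure \<nu> S = (\<integral>\<^sup>+z\<in>S. ennreal (k z) \<partial>lborel)"
    unfolding assm_A5_def by blast
  define M where "M = real CARD('m)"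
  define A where "A = C * (a / 2) powr (- M - \<sigma>)"
  have A0: "0 \<le> A" using C by (simp add: A_def)
  have M0: "0 \<le> M" by (simp add: M_def)
  have le: "k z \<le> A" if "z \<in> annulus a" for z
  proof -
    have z: "a / 2 \<le> norm z" "norm z < 1" using that a by (auto simp: annulus_def)
    then have "z \<noteq> 0" using a by auto
    then have "k z \<le> C * norm z powr (- M - \<sigma>)" using k(2)[of z] z by (simp add: M_def)
    also have "norm z powr (- M - \<sigma>) \<le> (a / 2) powr (- M - \<sigma>)"
      using z a M0 \<sigma> by (intro powr_mono2') auto
    finally show ?thesis using C by (simp add: A_def)
  qed
  have "emeasure \<nu> (annulus a) = (\<integral>\<^sup>+z\<in>annulus a. ennreal (k z) \<partial>lborel)"
    using a by (intro k(3) annulus_sets) (auto simp: annulus_def)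
  also have "\<dots> \<le> (\<integral>\<^sup>+z. ennreal A * indicator (ball 0 a) z \<partial>(lborel :: (real^'m) measure))"
  proof (rule nn_integral_mono)
    fix z :: "real^'m"
    show "ennreal (k z) * indicator (annulus a) z \<le> ennreal A * indicator (ball 0 a) z"
    proof (cases "z \<in> annulus a")
      case True
      then have "z \<in> ball 0 a" by (simp add: annulus_def)
      then show ?thesis using le[OF True] True by (simp add: ennreal_leI)
    qed simp
  qed
  also have "\<dots> = ennreal A * emeasure lborel (ball (0 :: real^'m) a)"
    by (simp add: nn_integral_cmult_indicator)
  also have "emeasure lborel (ball (0 :: real^'m) a) = ennreal (unit_ball_vol M * a powr M)"
    using a by (simp add: emeasure_ball M_def powr_realpow)
  also have "ennreal A * ennreal (unit_ball_vol M * a powr M) = ennreal (A * (unit_ball_vol M * a powr M))"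
    using A0 by (simp add: ennreal_mult')
  also have "A * (unit_ball_vol M * a powr M) = B * a powr (- \<sigma>)"
  proof -
    have e: "- M - \<sigma> = - (M + \<sigma>)" by simp
    have "(a / 2) powr (- M - \<sigma>) = a powr (- M - \<sigma>) * 2 powr (M + \<sigma>)"
    proof -
      have "(a / 2) powr - (M + \<sigma>) = a powr - (M + \<sigma>) / 2 powr - (M + \<sigma>)" by (rule powr_divide)
      also have "\<dots> = a powr - (M + \<sigma>) * inverse (inverse (2 powr (M + \<sigma>)))"
        unfolding powr_minus[of 2 "M + \<sigma>"] divide_inverse ..
      finally show ?thesis unfolding e inverse_inverse_eq .
    qed
    moreover have "a powr (- M - \<sigma>) * a powr M = a powr (- \<sigma>)" by (simp add: powr_add[symmetric])
    ultimately show ?thesis unfolding A_def B levy_const_def M_def[symmetric] by (simp add: mult_ac)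
  qed
  finally show ?thesis .
qed

lemma nn_integral_annulus:
  assumes a: "0 < a" "a \<le> 1"
  shows "(\<integral>\<^sup>+z. ennreal (norm z ^ p) * indicator (annulus a) z \<partial>\<nu>) \<le> ennreal (B * a powr (real p - \<sigma>))"
proof -
  have "(\<integral>\<^sup>+z. ennreal (norm z ^ p) * indicator (annulus a) z \<partial>\<nu>) \<le> (\<integral>\<^sup>+z. ennreal (a ^ p) * indicator (annulus a) z \<partial>\<nu>)"
    by (intro nn_integral_mono) (auto simp: annulus_def indicator_def intro!: ennreal_leI power_mono)
  also have "\<dots> = ennreal (a ^ p) * emeasure \<nu> (annulus a)"
    by (rule nn_integral_cmult_indicator[OF annulus_sets[OF a(1)]])
  also have "\<dots> \<le> ennreal (a ^ p) * ennreal (B * a powr (- \<sigma>))"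
    by (intro mult_left_mono emeasure_annulus a) simp
  also have "\<dots> = ennreal (a ^ p * (B * a powr (- \<sigma>)))"
    using a by (simp add: ennreal_mult')
  also have "a ^ p * (B * a powr (- \<sigma>)) = B * a powr (real p - \<sigma>)"
    using a by (simp add: powr_realpow[symmetric] powr_add[symmetric])
  finally show ?thesis .
qed

lemma annulus_measurable [measurable]: "0 < a \<Longrightarrow> (\<lambda>z. ennreal (norm z ^ p) * indicator (annulus a) z) \<in> borel_measurable \<nu>"
  using annulus_sets[of a] by measurable

text \<open>The shell of radius \<open>a / 2 ^ k\<close> contributes at most
  \<open>B * (a / 2 ^ k) powr (2 - \<sigma>)\<close>, a geometric series with ratio
  \<open>2 powr (\<sigma> - 2) < 1\<close>.\<close>

lemma inner_moment:
  assumes a: "0 < a" "a \<le> 1"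
  shows "(\<integral>\<^sup>+z. ennreal ((norm z)\<^sup>2) * indicator {z. norm z < a} z \<partial>\<nu>)
    \<le> ennreal (B / (1 - 2 powr (\<sigma> - 2)) * a powr (2 - \<sigma>))"
proof -
  define x :: real where "x = 2 powr (\<sigma> - 2)"
  have x: "0 \<le> x" "x < 1" using \<sigma> by (auto simp: x_def powr_less_one)
  let ?f = "\<lambda>k z. ennreal ((norm z)\<^sup>2) * indicator (annulus (a / 2 ^ k)) z"
  have "(\<integral>\<^sup>+z. ennreal ((norm z)\<^sup>2) * indicator {z. norm z < a} z \<partial>\<nu>) \<le> (\<integral>\<^sup>+z. (\<Sum>k. ?f k z) \<partial>\<nu>)"
  proof (rule nn_integral_mono)
    fix z assume "z \<in> space \<nu>"
    then have z: "0 < norm z" by (simp add: space_levy)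
    show "ennreal ((norm z)\<^sup>2) * indicator {z. norm z < a} z \<le> (\<Sum>k. ?f k z)"
    proof (cases "norm z < a")
      case True
      obtain n where "a / norm z < 2 ^ n" using real_arch_pow[of 2 "a / norm z"] by auto
      then have "a / 2 ^ n \<le> norm z" using z by (simp add: field_simps)
      then obtain k where "z \<in> annulus (a / 2 ^ k)" using norm_in_annulus[OF True _ a(1)] by blast
      then have "ennreal ((norm z)\<^sup>2) * indicator {z. norm z < a} z = ?f k z" using True by simp
      also have "\<dots> = (\<Sum>j\<in>{k}. ?f j z)"
        by (simp only: sum.insert[OF finite.emptyI] empty_iff not_False_eq_True sum.empty add_0_right)
      also have "\<dots> \<le> (\<Sum>k. ?f k z)" by (rule sum_le_suminf) auto
      finally show ?thesis .
    qed simp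
  qed
  also have "\<dots> = (\<Sum>k. \<integral>\<^sup>+z. ?f k z \<partial>\<nu>)" using a by (intro nn_integral_suminf annulus_measurable) simp
  also have "\<dots> \<le> (\<Sum>k. ennreal (B * a powr (2 - \<sigma>) * x ^ k))"
  proof (rule suminf_le)
    fix k :: nat
    have ak: "0 < a / 2 ^ k" "a / 2 ^ k \<le> 1" using a by (auto simp: field_simps intro: order_trans[of a 1])
    have "(\<integral>\<^sup>+z. ?f k z \<partial>\<nu>) \<le> ennreal (B * (a / 2 ^ k) powr (real 2 - \<sigma>))" by (rule nn_integral_annulus[OF ak])
    also have "B * (a / 2 ^ k) powr (real 2 - \<sigma>) = B * a powr (2 - \<sigma>) * x ^ k"
      unfolding annulus_term[OF a(1)] by (simp add: x_def)
    finally show "(\<integral>\<^sup>+z. ?f k z \<partial>\<nu>) \<le> ennreal (B * a powr (2 - \<sigma>) * x ^ k)" .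
  qed auto
  also have "\<dots> = ennreal (B * a powr (2 - \<sigma>) * (1 / (1 - x)))"
    using x levy_const_nonneg geometric_sums[of x]
    by (intro suminf_ennreal_eq sums_mult) auto
  finally show ?thesis by (simp add: x_def)
qed

text \<open>The exponent \<open>\<sigma> - p\<close> may have either sign, so the geometric sum
  stays finite and unevaluated. For \<open>p = 1\<close> its three possible growth rates are the
  three cases of \<open>Gam\<close>.\<close>

lemma tail_moment:
  assumes a: "1 / 2 ^ n \<le> a"
  shows "(\<integral>\<^sup>+z. ennreal (norm z ^ p) * indicator {z. a \<le> norm z \<and> norm z < 1} z \<partial>\<nu>)
    \<le> ennreal (B * (\<Sum>k<n. (2 powr (\<sigma> - real p)) ^ k))"
proof -
  let ?f = "\<lambda>k z. ennreal (norm z ^ p) * indicator (annulus (1 / 2 ^ k)) z"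
  have "(\<integral>\<^sup>+z. ennreal (norm z ^ p) * indicator {z. a \<le> norm z \<and> norm z < 1} z \<partial>\<nu>) \<le> (\<integral>\<^sup>+z. (\<Sum>k<n. ?f k z) \<partial>\<nu>)"
  proof (rule nn_integral_mono)
    fix z :: "real^'m"
    show "ennreal (norm z ^ p) * indicator {z. a \<le> norm z \<and> norm z < 1} z \<le> (\<Sum>k<n. ?f k z)"
    proof (cases "a \<le> norm z \<and> norm z < 1")
      case True
      then obtain k where k: "k < n" "z \<in> annulus (1 / 2 ^ k)"
        using norm_in_annulus[of z 1 n] a by auto
      then have "ennreal (norm z ^ p) * indicator {z. a \<le> norm z \<and> norm z < 1} z = ?f k z" using True by simp
      also have "\<dots> \<le> (\<Sum>k<n. ?f k z)" using k by (intro member_le_sum) auto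
      finally show ?thesis .
    qed simp
  qed
  also have "\<dots> = (\<Sum>k<n. \<integral>\<^sup>+z. ?f k z \<partial>\<nu>)" by (intro nn_integral_sum annulus_measurable) simp
  also have "\<dots> \<le> (\<Sum>k<n. ennreal (B * (2 powr (\<sigma> - real p)) ^ k))"
  proof (rule sum_mono)
    fix k :: nat
    have "(\<integral>\<^sup>+z. ?f k z \<partial>\<nu>) \<le> ennreal (B * (1 / 2 ^ k) powr (real p - \<sigma>))" by (rule nn_integral_annulus) auto
    also have "B * (1 / 2 ^ k) powr (real p - \<sigma>) = B * (2 powr (\<sigma> - real p)) ^ k"
      using annulus_term[of 1 k "real p - \<sigma>"] by simp
    finally show "(\<integral>\<^sup>+z. ?f k z \<partial>\<nu>) \<le> ennreal (B * (2 powr (\<sigma> - real p)) ^ k)" .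
  qed
  also have "\<dots> = ennreal (B * (\<Sum>k<n. (2 powr (\<sigma> - real p)) ^ k))"
    using levy_const_nonneg by (simp add: sum_distrib_left sum_ennreal)
  finally show ?thesis .
qed

end

text \<open>The least admissible level. Then \<open>2 ^ n\<close> is smaller than
  \<open>2 / a\<close>, which converts a geometric sum into a power of \<open>a\<close>.\<close>

lemma dyadic_level:
  fixes a :: real assumes a: "0 < a" "a \<le> 1"
  obtains n where "1 / 2 ^ n \<le> a" "n = 0 \<or> 2 ^ (n - 1) < 1 / a"
proof -
  define n where "n = (LEAST n. 1 / a \<le> 2 ^ n)"
  obtain m where "1 / a < 2 ^ m" using real_arch_pow[of 2 "1 / a"] by auto
  then have n: "1 / a \<le> 2 ^ n" unfolding n_def by (rule LeastI[OF less_imp_le])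
  show ?thesis
  proof (rule that[of n])
    show "1 / 2 ^ n \<le> a" using n a by (simp add: field_simps)
    show "n = 0 \<or> 2 ^ (n - 1) < 1 / a"
      using not_less_Least[of "n - 1" "\<lambda>n. 1 / a \<le> 2 ^ n"] unfolding n_def[symmetric] by force
  qed
qed

lemma geometric_sum_le:
  fixes a s :: real
  assumes a: "0 < a" and n: "n = 0 \<or> 2 ^ (n - 1) < 1 / a" and s: "0 < s"
  shows "(\<Sum>k<n. (2 powr s) ^ k) \<le> 2 powr s / (2 powr s - 1) * a powr (- s)"
proof (cases "n = 0")
  case False
  have x: "1 < (2::real) powr s" using s by simp
  have "(\<Sum>k<n. (2 powr s) ^ k) = ((2 powr s) ^ n - 1) / (2 powr s - 1)" using x by (subst geometric_sum) auto
  also have "\<dots> \<le> (2 powr s) ^ n / (2 powr s - 1)" using x by (intro divide_right_mono) auto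
  also have "(2 powr s) ^ n = 2 powr s * (2 powr s) ^ (n - 1)" using False by (metis power_eq_if)
  also have "(2 powr s) ^ (n - 1) = (2 ^ (n - 1)) powr s" by (simp add: powr_powr powr_realpow[symmetric] mult.commute)
  also have "2 powr s * (2 ^ (n - 1)) powr s / (2 powr s - 1) \<le> 2 powr s * (1 / a) powr s / (2 powr s - 1)"
    using x n False s less_imp_le[OF x] by (intro divide_right_mono mult_left_mono powr_mono2) (auto)
  also have "(1 / a) powr s = a powr (- s)" using a by (simp add: powr_divide powr_minus_divide)
  finally show ?thesis by simp
next
  case True
  have "1 < (2::real) powr s" using s by simp
  then show ?thesis using True by simp
qed

text \<open>\<open>D\<close> is obtained before the measure, so it depends on \<sigma>,
  \<open>C\<close> and the dimension only. The first moment is bounded by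
  \<open>1 + Gam \<sigma> a\<close> and not by \<open>Gam \<sigma> a\<close>: for
  \<open>a < 1\<close> at least one shell is counted, whereas \<open>Gam 1 a\<close> tends to 0 as
  \<open>a\<close> tends to 1.\<close>

lemma levy_moment_bounds:
  fixes \<sigma> C :: real
  assumes C: "0 < C" and \<sigma>: "0 < \<sigma>" "\<sigma> < 2"
  obtains D where "0 < D"
    "\<And>(\<nu> :: (real^'m) measure) a. sets \<nu> = sets (restrict_space borel (- {0})) \<Longrightarrow> assm_A5 \<sigma> C \<nu> \<Longrightarrow> 0 < a \<Longrightarrow> a \<le> 1 \<Longrightarrow>
      (\<integral>\<^sup>+z. ennreal ((norm z)\<^sup>2) * indicator {z. norm z < a} z \<partial>\<nu>) \<le> ennreal (D * a powr (2 - \<sigma>))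
    \<and> (\<integral>\<^sup>+z. ennreal (norm z) * indicator {z. a \<le> norm z \<and> norm z < 1} z \<partial>\<nu>) \<le> ennreal (D * (1 + Gam \<sigma> a))
    \<and> (\<integral>\<^sup>+z. indicator {z. a \<le> norm z \<and> norm z < 1} z \<partial>\<nu>) \<le> ennreal (D * a powr (- \<sigma>))"
proof -
  define B where "B = levy_const TYPE('m) \<sigma> C"
  have B: "0 \<le> B" using C by (simp add: B_def levy_const_def unit_ball_vol_nonneg)
  define D2 where "D2 = B / (1 - 2 powr (\<sigma> - 2))"
  define D0 where "D0 = B * (2 powr \<sigma> / (2 powr \<sigma> - 1))"
  \<comment> \<open>A geometric sum of ratio \<open>2 powr (\<sigma> - 1)\<close> in units of
    \<open>1 + Gam\<close>: it is governed by its last term, by the number of its terms, or by its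
    infinite total, according as the ratio is above, at or below 1.\<close>
  define E where "E = (if \<sigma> > 1 then 2 powr (\<sigma> - 1) / (2 powr (\<sigma> - 1) - 1) else if \<sigma> = 1 then 1 + 1 / ln 2 else 1 / (1 - 2 powr (\<sigma> - 1)))"
  define D where "D = D2 + D0 + B * E + 1"
  have x2: "(2::real) powr (\<sigma> - 2) < 1" using \<sigma> by (simp add: powr_less_one)
  have D2: "0 \<le> D2" using B x2 by (simp add: D2_def)
  have "(1::real) < 2 powr \<sigma>" using \<sigma> by simp
  then have D0: "0 \<le> D0" using B by (simp add: D0_def)
  have "(2::real) powr (\<sigma> - 1) < 1" if "\<sigma> < 1" using that by (simp add: powr_less_one)
  moreover have "(1::real) < 2 powr (\<sigma> - 1)" if "1 < \<sigma>" using that by simp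
  ultimately have E: "0 \<le> E" by (auto simp: E_def intro!: divide_nonneg_pos add_nonneg_nonneg)
  have BE: "0 \<le> B * E" using B E by simp
  show ?thesis
  proof (rule that[of D])
    show "0 < D" using D2 D0 BE by (simp add: D_def)
    fix \<nu> :: "(real^'m) measure" and a :: real
    assume nu: "sets \<nu> = sets (restrict_space borel (- {0}))" "assm_A5 \<sigma> C \<nu>" and a: "0 < a" "a \<le> 1"
    obtain n where n: "1 / 2 ^ n \<le> a" "n = 0 \<or> 2 ^ (n - 1) < 1 / a" by (rule dyadic_level[OF a])
    note tail = tail_moment[OF nu C \<sigma> B_def n(1)]
    have Gam: "0 \<le> Gam \<sigma> a" using a by (auto simp: Gam_def ln_le_zero_iff)
    have sumE: "(\<Sum>k<n. (2 powr (\<sigma> - 1)) ^ k) \<le> E * (1 + Gam \<sigma> a)"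
    proof -
      consider "\<sigma> > 1" | "\<sigma> = 1" | "\<sigma> < 1" by linarith
      then show ?thesis
      proof cases
        case 1
        then have "(\<Sum>k<n. (2 powr (\<sigma> - 1)) ^ k) \<le> E * Gam \<sigma> a"
          using geometric_sum_le[OF a(1) n(2), of "\<sigma> - 1"] by (simp add: E_def Gam_def)
        then show ?thesis using E by (simp add: distrib_left)
      next
        case 2
        have "real n \<le> 1 + (- ln a) / ln 2"
        proof (cases "n = 0")
          case True
          have "0 \<le> (- ln a) / ln 2" using a by (intro divide_nonneg_pos) (auto simp: ln_le_zero_iff)
          then show ?thesis unfolding True by linarith
        next
          case False
          then have "ln (2 ^ (n - 1)) \<le> ln (1 / a)" using n(2) a by (subst ln_le_cancel_iff) auto
          then have "real (n - 1) * ln 2 \<le> - ln a" using a by (simp add: ln_realpow ln_div)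
          then have "real (n - 1) \<le> (- ln a) / ln 2" by (subst pos_le_divide_eq) auto
          then show ?thesis using False by (simp add: of_nat_diff)
        qed
        also have "\<dots> \<le> (1 + 1 / ln 2) * (1 + (- ln a))"
        proof -
          have "(1 + 1 / ln 2) * (1 + (- ln a)) = 1 + (- ln a) / ln 2 + (1 / ln 2 + (- ln a))" by (simp add: field_simps)
          moreover have "0 \<le> 1 / ln (2::real) + (- ln a)" using a by (intro add_nonneg_nonneg) (auto simp: ln_le_zero_iff)
          ultimately show ?thesis by linarith
        qed
        finally show ?thesis using 2 by (simp add: E_def Gam_def)
      next
        case 3
        let ?x = "(2::real) powr (\<sigma> - 1)"
        have x: "?x < 1" using 3 by (simp add: powr_less_one)
        have "(\<Sum>k<n. ?x ^ k) = (1 - ?x ^ n) / (1 - ?x)" using x by (subst sum_gp_strict) auto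
        also have "\<dots> \<le> 1 / (1 - ?x)" using x by (intro divide_right_mono) auto
        also have "\<dots> = E" using 3 by (simp add: E_def)
        also have "\<dots> \<le> E * (1 + Gam \<sigma> a)" using mult_left_mono[OF _ E, of 1 "1 + Gam \<sigma> a"] Gam by simp
        finally show ?thesis .
      qed
    qed
    have m2: "(\<integral>\<^sup>+z. ennreal ((norm z)\<^sup>2) * indicator {z. norm z < a} z \<partial>\<nu>) \<le> ennreal (D * a powr (2 - \<sigma>))"
    proof (rule order_trans[OF inner_moment[OF nu C \<sigma> B_def a] ennreal_leI])
      show "B / (1 - 2 powr (\<sigma> - 2)) * a powr (2 - \<sigma>) \<le> D * a powr (2 - \<sigma>)"
        unfolding D2_def[symmetric] using D0 BE by (intro mult_right_mono) (auto simp: D_def)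
    qed
    have m1: "(\<integral>\<^sup>+z. ennreal (norm z) * indicator {z. a \<le> norm z \<and> norm z < 1} z \<partial>\<nu>) \<le> ennreal (D * (1 + Gam \<sigma> a))"
    proof -
      have "B * (\<Sum>k<n. (2 powr (\<sigma> - 1)) ^ k) \<le> B * (E * (1 + Gam \<sigma> a))" by (rule mult_left_mono[OF sumE B])
      also have "\<dots> \<le> D * (1 + Gam \<sigma> a)"
        unfolding mult.assoc[symmetric] using D2 D0 Gam by (intro mult_right_mono) (auto simp: D_def)
      finally show ?thesis using order_trans[OF tail[of 1] ennreal_leI] by simp
    qed
    have m0: "(\<integral>\<^sup>+z. indicator {z. a \<le> norm z \<and> norm z < 1} z \<partial>\<nu>) \<le> ennreal (D * a powr (- \<sigma>))"
    proof -
      have "B * (\<Sum>k<n. (2 powr \<sigma>) ^ k) \<le> B * (2 powr \<sigma> / (2 powr \<sigma> - 1) * a powr (- \<sigma>))"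
        by (rule mult_left_mono[OF geometric_sum_le[OF a(1) n(2) \<sigma>(1)] B])
      also have "\<dots> = D0 * a powr (- \<sigma>)" by (simp add: D0_def)
      also have "\<dots> \<le> D * a powr (- \<sigma>)" using D2 BE by (intro mult_right_mono) (auto simp: D_def)
      finally show ?thesis using order_trans[OF tail[of 0] ennreal_leI] by simp
    qed
    show "(\<integral>\<^sup>+z. ennreal ((norm z)\<^sup>2) * indicator {z. norm z < a} z \<partial>\<nu>) \<le> ennreal (D * a powr (2 - \<sigma>))
    \<and> (\<integral>\<^sup>+z. ennreal (norm z) * indicator {z. a \<le> norm z \<and> norm z < 1} z \<partial>\<nu>) \<le> ennreal (D * (1 + Gam \<sigma> a))
    \<and> (\<integral>\<^sup>+z. indicator {z. a \<le> norm z \<and> norm z < 1} z \<partial>\<nu>) \<le> ennreal (D * a powr (- \<sigma>))"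
      using m2 m1 m0 by blast
  qed
qed

section \<open>Convolution with a bump function\<close>

lemma lborel_integral_affine:
  fixes f :: "'v::euclidean_space \<Rightarrow> real"
  assumes c: "c \<noteq> 0" and [measurable]: "f \<in> borel_measurable borel"
  shows "(\<integral>x. f x \<partial>lborel) = \<bar>c\<bar> ^ DIM('v) * (\<integral>x. f (t + c *\<^sub>R x) \<partial>lborel)"
proof -
  have "(\<integral>x. f x \<partial>lborel) = (\<integral>x. f x \<partial>density (distr lborel borel (\<lambda>x. t + c *\<^sub>R x)) (\<lambda>_. ennreal (\<bar>c\<bar> ^ DIM('v))))"
    using lborel_affine[OF c, of t] by simp
  also have "\<dots> = (\<integral>x. \<bar>c\<bar> ^ DIM('v) *\<^sub>R f x \<partial>distr lborel borel (\<lambda>x. t + c *\<^sub>R x))"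
    by (subst integral_density) auto
  also have "\<dots> = (\<integral>x. \<bar>c\<bar> ^ DIM('v) *\<^sub>R f (t + c *\<^sub>R x) \<partial>lborel)"
    by (subst integral_distr) auto
  finally show ?thesis by simp
qed

lemma lborel_integrable_affine:
  fixes f :: "'v::euclidean_space \<Rightarrow> real"
  assumes c: "c \<noteq> 0" and f: "integrable lborel f"
  shows "integrable lborel (\<lambda>x. f (t + c *\<^sub>R x))"
proof -
  have [measurable]: "f \<in> borel_measurable borel" using f by auto
  have "integrable (density (distr lborel borel (\<lambda>x. t + c *\<^sub>R x)) (\<lambda>_. ennreal (\<bar>c\<bar> ^ DIM('v)))) f"
    using lborel_affine[OF c, of t] f by simp
  then have "integrable (distr lborel borel (\<lambda>x. t + c *\<^sub>R x)) (\<lambda>x. \<bar>c\<bar> ^ DIM('v) *\<^sub>R f x)"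
    by (subst (asm) integrable_density) auto
  then have "integrable lborel (\<lambda>x. \<bar>c\<bar> ^ DIM('v) *\<^sub>R f (t + c *\<^sub>R x))"
    by (subst (asm) integrable_distr_eq) auto
  then show ?thesis using c by simp
qed

lemma integrable_compact_support:
  fixes f :: "'v::euclidean_space \<Rightarrow> real"
  assumes "continuous_on UNIV f" and supp: "\<And>x. \<rho> < norm (x - a) \<Longrightarrow> f x = 0"
  shows "integrable lborel f"
proof -
  have "integrable lborel (\<lambda>x. indicator (cball a \<rho>) x *\<^sub>R f x)"
    by (rule borel_integrable_compact) (auto intro: continuous_on_subset[OF assms(1)])
  moreover have "(\<lambda>x. indicator (cball a \<rho>) x *\<^sub>R f x) = f"
    using supp by (auto simp: indicator_def fun_eq_iff dist_norm norm_minus_commute not_le)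
  ultimately show ?thesis by simp
qed

lemma has_derivative_zero_outside:
  fixes g :: "'v::real_normed_vector \<Rightarrow> 'c::real_normed_vector"
  assumes "(g has_derivative blinfun_apply D) (at x)" "\<And>x. \<rho> < norm x \<Longrightarrow> g x = 0" "\<rho> < norm x"
  shows "D = 0"
proof -
  have "open {x :: 'v. \<rho> < norm x}" by (intro open_Collect_less continuous_intros)
  then have "\<forall>\<^sub>F y in nhds x. \<rho> < norm y" using assms(3) by (simp add: eventually_nhds) blast
  then have "\<forall>\<^sub>F y in nhds x. g y = 0" by eventually_elim (rule assms(2))
  then have "((\<lambda>_. 0) has_derivative blinfun_apply D) (at x)"
    using has_derivative_transform_eventually[OF assms(1), of "\<lambda>_. 0"] assms(2,3)
    by (auto simp: eventually_nhds_conv_at)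
  then have "blinfun_apply D = (\<lambda>_. 0)" using has_derivative_const has_derivative_unique by blast
  then show ?thesis by (intro blinfun_eqI) (simp add: zero_blinfun.rep_eq)
qed

lemma integral_cbox_eq_UNIV:
  fixes F :: "'v::euclidean_space \<Rightarrow> 'c::banach"
  assumes "\<And>y. y \<notin> S \<Longrightarrow> F y = 0" shows "integral UNIV F = integral S F"
proof -
  have "F = (\<lambda>y. if y \<in> S then F y else 0)" using assms by auto
  then show ?thesis using Henstock_Kurzweil_Integration.integral_restrict_UNIV[of S F] by metis
qed

lemma cball_in_cbox:
  fixes x0 :: "'v::euclidean_space"
  obtains a b where "\<And>x y. norm (x - x0) < 1 \<Longrightarrow> norm (x - y) \<le> \<rho> \<Longrightarrow> y \<in> cbox a b"
proof -
  have "bounded (cball x0 (\<rho> + 1))" by simp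
  then obtain a where a: "cball x0 (\<rho> + 1) \<subseteq> cbox (- a) a" using bounded_subset_cbox_symmetric by blast
  show ?thesis
  proof (rule that[of "- a" a])
    fix x y assume "norm (x - x0) < 1" "norm (x - y) \<le> \<rho>"
    then have "dist x0 y \<le> \<rho> + 1"
      using norm_triangle_ineq[of "x0 - x" "x - y"] by (simp add: dist_norm norm_minus_commute)
    then show "y \<in> cbox (- a) a" using a by auto
  qed
qed

text \<open>\<open>v\<close> is continuous but need not decay. The support of \<open>g\<close>
  confines the integrals for all \<open>x\<close> near \<open>x0\<close> to one box, on which
  differentiation under the integral sign applies.\<close>

lemma convolution_has_derivative:
  fixes g :: "'v::euclidean_space \<Rightarrow> 'c::banach" and D :: "'v \<Rightarrow> 'v \<Rightarrow>\<^sub>L 'c" and v :: "'v \<Rightarrow> real"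
  assumes g: "\<And>x. (g has_derivative blinfun_apply (D x)) (at x)" and D: "continuous_on UNIV D"
    and supp: "\<And>x. \<rho> < norm x \<Longrightarrow> g x = 0" and v: "continuous_on UNIV v"
  shows "((\<lambda>x. integral UNIV (\<lambda>y. v y *\<^sub>R g (x - y))) has_derivative
    blinfun_apply (integral UNIV (\<lambda>y. v y *\<^sub>R D (x0 - y)))) (at x0)"
proof -
  have suppD: "D x = 0" if "\<rho> < norm x" for x by (rule has_derivative_zero_outside[OF g supp that])
  obtain a b where ab: "\<And>x y. norm (x - x0) < 1 \<Longrightarrow> norm (x - y) \<le> \<rho> \<Longrightarrow> y \<in> cbox a b"
    using cball_in_cbox[of x0 \<rho> thesis] by blast
  have gc: "continuous_on UNIV g" by (intro continuous_at_imp_continuous_on ballI has_derivative_continuous[OF g])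
  have eq: "integral UNIV (\<lambda>y. v y *\<^sub>R g (x - y)) = integral (cbox a b) (\<lambda>y. v y *\<^sub>R g (x - y))"
    "integral UNIV (\<lambda>y. v y *\<^sub>R D (x - y)) = integral (cbox a b) (\<lambda>y. v y *\<^sub>R D (x - y))" if "x \<in> ball x0 1" for x
  proof -
    have "norm (x - x0) < 1" using that by (simp add: dist_norm norm_minus_commute)
    then have "\<rho> < norm (x - y)" if "y \<notin> cbox a b" for y using ab that by force
    then show "integral UNIV (\<lambda>y. v y *\<^sub>R g (x - y)) = integral (cbox a b) (\<lambda>y. v y *\<^sub>R g (x - y))"
      "integral UNIV (\<lambda>y. v y *\<^sub>R D (x - y)) = integral (cbox a b) (\<lambda>y. v y *\<^sub>R D (x - y))"
      using supp suppD by (auto intro!: integral_cbox_eq_UNIV)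
  qed
  have x0: "x0 \<in> ball x0 1" by simp
  have "((\<lambda>x. integral (cbox a b) (\<lambda>y. v y *\<^sub>R g (x - y))) has_derivative
     blinfun_apply (integral (cbox a b) (\<lambda>y. v y *\<^sub>R D (x0 - y)))) (at x0 within ball x0 1)"
  proof (rule leibniz_rule)
    fix x y :: 'v
    have "((\<lambda>x. x - y) has_derivative (\<lambda>h. h)) (at x)" by (auto intro!: derivative_eq_intros)
    from has_derivative_compose[OF this g[of "x - y"]] have "((\<lambda>x. g (x - y)) has_derivative blinfun_apply (D (x - y))) (at x)" .
    then have "((\<lambda>x. v y *\<^sub>R g (x - y)) has_derivative (\<lambda>h. v y *\<^sub>R blinfun_apply (D (x - y)) h)) (at x)"
      by (rule has_derivative_scaleR_right)
    moreover have "blinfun_apply (v y *\<^sub>R D (x - y)) = (\<lambda>h. v y *\<^sub>R blinfun_apply (D (x - y)) h)"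
      by (simp add: scaleR_blinfun.rep_eq)
    ultimately show "((\<lambda>x. v y *\<^sub>R g (x - y)) has_derivative blinfun_apply (v y *\<^sub>R D (x - y))) (at x within ball x0 1)"
      using has_derivative_at_withinI by fastforce
  next
    fix x :: 'v
    have "continuous_on (cbox a b) (\<lambda>y. g (x - y))"
      by (rule continuous_on_compose2[OF gc]) (auto intro!: continuous_intros)
    then show "(\<lambda>y. v y *\<^sub>R g (x - y)) integrable_on cbox a b"
      by (intro integrable_continuous continuous_on_scaleR continuous_on_subset[OF v]) auto
  next
    have "continuous_on (ball x0 1 \<times> cbox a b) (\<lambda>p. D (fst p - snd p))"
      by (rule continuous_on_compose2[OF D]) (auto intro!: continuous_intros)
    moreover have "continuous_on (ball x0 1 \<times> cbox a b) (\<lambda>p. v (snd p))"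
      by (rule continuous_on_compose2[OF v]) (auto intro!: continuous_intros)
    ultimately show "continuous_on (ball x0 1 \<times> cbox a b) (\<lambda>(x, y). v y *\<^sub>R D (x - y))"
      unfolding case_prod_beta' by (rule continuous_on_scaleR[rotated])
  qed auto
  then have "((\<lambda>x. integral UNIV (\<lambda>y. v y *\<^sub>R g (x - y))) has_derivative
     blinfun_apply (integral (cbox a b) (\<lambda>y. v y *\<^sub>R D (x0 - y)))) (at x0 within ball x0 1)"
    by (rule has_derivative_transform[OF x0, rotated]) (simp add: eq)
  then show ?thesis
    unfolding eq(2)[OF x0] by (simp add: at_within_open[OF x0])
qed

lemma continuous_on_convolution:
  fixes g :: "'v::euclidean_space \<Rightarrow> 'c::banach" and v :: "'v \<Rightarrow> real"
  assumes g: "continuous_on UNIV g" and supp: "\<And>x. \<rho> < norm x \<Longrightarrow> g x = 0" and v: "continuous_on UNIV v"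
  shows "continuous_on UNIV (\<lambda>x. integral UNIV (\<lambda>y. v y *\<^sub>R g (x - y)))"
proof (rule continuous_at_imp_continuous_on, rule ballI)
  fix x0 :: 'v
  obtain a b where ab: "\<And>x y. norm (x - x0) < 1 \<Longrightarrow> norm (x - y) \<le> \<rho> \<Longrightarrow> y \<in> cbox a b"
    using cball_in_cbox[of x0 \<rho> thesis] by blast
  have eq: "integral UNIV (\<lambda>y. v y *\<^sub>R g (x - y)) = integral (cbox a b) (\<lambda>y. v y *\<^sub>R g (x - y))" if "x \<in> ball x0 1" for x
  proof -
    have "norm (x - x0) < 1" using that by (simp add: dist_norm norm_minus_commute)
    then have "\<rho> < norm (x - y)" if "y \<notin> cbox a b" for y using ab that by force
    then show ?thesis using supp by (auto intro!: integral_cbox_eq_UNIV)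
  qed
  have "continuous_on (ball x0 1 \<times> cbox a b) (\<lambda>p. g (fst p - snd p))"
    by (rule continuous_on_compose2[OF g]) (auto intro!: continuous_intros)
  moreover have "continuous_on (ball x0 1 \<times> cbox a b) (\<lambda>p. v (snd p))"
    by (rule continuous_on_compose2[OF v]) (auto intro!: continuous_intros)
  ultimately have "continuous_on (ball x0 1 \<times> cbox a b) (\<lambda>(x, y). v y *\<^sub>R g (x - y))"
    unfolding case_prod_beta' by (rule continuous_on_scaleR[rotated])
  then have "continuous_on (ball x0 1) (\<lambda>x. integral (cbox a b) (\<lambda>y. v y *\<^sub>R g (x - y)))"
    by (rule integral_continuous_on_param)
  then have "continuous_on (ball x0 1) (\<lambda>x. integral UNIV (\<lambda>y. v y *\<^sub>R g (x - y)))"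
    by (rule continuous_on_cong[THEN iffD1, OF refl, rotated]) (simp add: eq)
  then show "isCont (\<lambda>x. integral UNIV (\<lambda>y. v y *\<^sub>R g (x - y))) x0"
    by (auto simp: continuous_on_eq_continuous_at)
qed

lemma C2_on_convolution:
  fixes k v :: "'v::euclidean_space \<Rightarrow> real"
  assumes k: "C2_on UNIV k" and supp: "\<And>x. \<rho> < norm x \<Longrightarrow> k x = 0" and v: "continuous_on UNIV v"
  shows "C2_on UNIV (\<lambda>x. integral UNIV (\<lambda>y. v y *\<^sub>R k (x - y)))"
proof -
  obtain D D2 where "C2_with UNIV k D D2" using k by (auto simp: C2_on_def)
  then have D: "\<And>p. (k has_derivative blinfun_apply (D p)) (at p)"
    and D2: "\<And>p. (D has_derivative blinfun_apply (D2 p)) (at p)" and D2c: "continuous_on UNIV D2"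
    by (auto simp: C2_with_def)
  have Dc: "continuous_on UNIV D" by (intro continuous_at_imp_continuous_on ballI has_derivative_continuous[OF D2])
  have sD: "D x = 0" if "\<rho> < norm x" for x by (rule has_derivative_zero_outside[OF D supp that])
  have sD2: "D2 x = 0" if "\<rho> < norm x" for x by (rule has_derivative_zero_outside[OF D2 sD that])
  have "C2_with UNIV (\<lambda>x. integral UNIV (\<lambda>y. v y *\<^sub>R k (x - y))) (\<lambda>x. integral UNIV (\<lambda>y. v y *\<^sub>R D (x - y)))
     (\<lambda>x. integral UNIV (\<lambda>y. v y *\<^sub>R D2 (x - y)))"
    unfolding C2_with_def
    using convolution_has_derivative[OF D Dc supp v] convolution_has_derivative[OF D2 D2c sD v]
      continuous_on_convolution[OF D2c sD2 v] by auto
  then show ?thesis by (auto simp: C2_on_def)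
qed

lemma DERIV_pos_part_power:
  "((\<lambda>x::real. (max 0 x) ^ Suc (Suc n)) has_real_derivative real (Suc (Suc n)) * (max 0 x) ^ Suc n) (at x)"
proof -
  consider "0 < x" | "x < 0" | "x = 0" by linarith
  then show ?thesis
  proof cases
    case 1
    have "((\<lambda>x. x ^ Suc (Suc n)) has_real_derivative real (Suc (Suc n)) * x ^ Suc n) (at x)"
      by (rule derivative_eq_intros refl | simp)+
    moreover have "\<forall>\<^sub>F y in nhds x. x ^ Suc (Suc n) = x ^ Suc (Suc n) \<and> max 0 y ^ Suc (Suc n) = y ^ Suc (Suc n)"
      using eventually_nhds_in_open[of "{0<..}" x] 1 by (auto elim!: eventually_mono simp: max_def)
    ultimately show ?thesis using 1 by (subst DERIV_cong_ev[OF refl, of _ "\<lambda>x. x ^ Suc (Suc n)"]) (auto elim: eventually_mono)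
  next
    case 2
    have "((\<lambda>x. 0) has_real_derivative 0) (at x)" by simp
    moreover have "\<forall>\<^sub>F y in nhds x. max 0 y ^ Suc (Suc n) = 0"
      using eventually_nhds_in_open[of "{..<0}" x] 2 by (auto elim!: eventually_mono)
    ultimately show ?thesis using 2 by (subst DERIV_cong_ev[OF refl, of _ "\<lambda>x. 0"]) auto
  next
    case 3
    have "(\<lambda>h. ((max 0 (0 + h)) ^ Suc (Suc n) - (max 0 0) ^ Suc (Suc n)) / h) \<midarrow>0\<rightarrow> (0::real)"
    proof (rule Lim_null_comparison)
      have "norm (((max 0 (0 + h)) ^ Suc (Suc n) - (max 0 0) ^ Suc (Suc n)) / h) \<le> \<bar>h\<bar> ^ Suc n" for h :: real
        by (auto simp: max_def intro!: mult_nonpos_nonneg)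
      then show "\<forall>\<^sub>F h in at 0. norm (((max 0 (0 + h)) ^ Suc (Suc n) - (max 0 0) ^ Suc (Suc n)) / h) \<le> \<bar>h::real\<bar> ^ Suc n" by auto
      show "((\<lambda>h::real. \<bar>h\<bar> ^ Suc n) \<longlongrightarrow> 0) (at 0)" by (auto intro!: tendsto_eq_intros)
    qed
    then show ?thesis using 3 by (simp add: DERIV_def)
  qed
qed

text \<open>The cube is the smallest integer power of the positive part whose second derivative is
  continuous across the unit sphere.\<close>

definition bump :: "'v::real_normed_vector \<Rightarrow> real" where
  "bump x = (max 0 (1 - (norm x)\<^sup>2)) ^ 3"

lemma C2_on_bump:
  fixes l :: "'p::real_normed_vector \<Rightarrow> 'v::euclidean_space"
  assumes "bounded_linear l" shows "C2_on S (\<lambda>p. bump (l p - a))"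
  unfolding bump_def
proof (rule C2_on_compose_real[OF C2_on_norm_power2[OF assms], where g = "\<lambda>r. (max 0 (1 - r)) ^ 3"
      and g' = "\<lambda>r. - 3 * (max 0 (1 - r))\<^sup>2" and g'' = "\<lambda>r. 6 * max 0 (1 - r)"])
  fix x :: real
  have d: "((\<lambda>r. 1 - r) has_real_derivative - 1) (at x)" by (auto intro!: derivative_eq_intros)
  show "((\<lambda>r. (max 0 (1 - r)) ^ 3) has_real_derivative - 3 * (max 0 (1 - x))\<^sup>2) (at x)"
    using DERIV_chain2[OF DERIV_pos_part_power[of 1 "1 - x"] d] by (simp add: numeral_3_eq_3 numeral_2_eq_2)
  show "((\<lambda>r. - 3 * (max 0 (1 - r))\<^sup>2) has_real_derivative 6 * max 0 (1 - x)) (at x)"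
    using DERIV_cmult[OF DERIV_chain2[OF DERIV_pos_part_power[of 0 "1 - x"] d], of "- 3"] by (simp add: numeral_2_eq_2)
qed (auto intro!: continuous_intros)

lemma bump_nonneg: "0 \<le> bump x" and bump_le_1: "bump x \<le> 1" and bump_support: "1 < norm x \<Longrightarrow> bump x = 0"
proof -
  show "0 \<le> bump x" by (simp add: bump_def)
  show "bump x \<le> 1" unfolding bump_def by (rule power_le_one) auto
  show "1 < norm x \<Longrightarrow> bump x = 0" by (simp add: bump_def max_def power2_eq_square) (smt (verit) mult_le_cancel_left1)
qed

text \<open>Before cubing the function is 2-Lipschitz, and on [0, 1] the cube is
  3-Lipschitz.\<close>

lemma bump_lipschitz: "\<bar>bump x - bump y\<bar> \<le> 6 * norm (x - y)"
proof -
  define p where "p x = max 0 (1 - (norm x)\<^sup>2)" for x :: 'a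
  have p: "0 \<le> p x" "p x \<le> 1" for x by (auto simp: p_def)
  have half: "p x - p y \<le> 2 * norm (x - y)" for x y :: 'a
  proof -
    have tri: "norm y - norm x \<le> norm (x - y)" using norm_triangle_sub[of y x] by (simp add: norm_minus_commute)
    show ?thesis
    proof (cases "norm x \<le> 1 \<and> norm x \<le> norm y")
      case True
      define m where "m = min 1 (norm y)"
      have m: "norm x \<le> m" "m \<le> 1" "m \<le> norm y" using True by (auto simp: m_def)
      define a c where "a = m\<^sup>2" and "c = (norm x)\<^sup>2"
      have pa: "1 - a \<le> p y" by (auto simp: a_def m_def p_def min_def)
      have px: "p x = 1 - c" using True by (simp add: c_def p_def power_le_one)
      have ac: "a - c \<le> 2 * (m - norm x)"
        unfolding a_def c_def using mult_right_mono[of "m + norm x" 2 "m - norm x"] m by (simp add: power2_eq_square algebra_simps)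
      have "p x - p y \<le> a - c" using pa px by linarith
      also have "\<dots> \<le> 2 * (m - norm x)" by (rule ac)
      also have "\<dots> \<le> 2 * norm (x - y)" by (rule mult_left_mono) (use tri m(3) in linarith, simp)
      finally show ?thesis .
    next
      case False
      then have "p x \<le> p y"
      proof (cases "norm x \<le> 1")
        case True
        then have "(norm y)\<^sup>2 \<le> (norm x)\<^sup>2" using False by (intro power_mono) auto
        then show ?thesis unfolding p_def by (intro max.mono) linarith+
      next
        case False
        then have "1 \<le> (norm x)\<^sup>2" by (simp add: one_le_power)
        then have "p x = 0" by (simp add: p_def)
        then show ?thesis using p(1)[of y] by simp
      qed
      then show ?thesis using norm_ge_zero[of "x - y"] by linarith
    qed
  qed
  have "\<bar>p x - p y\<bar> \<le> 2 * norm (x - y)" using half[of x y] half[of y x] by (simp add: norm_minus_commute abs_le_iff)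
  moreover have "\<bar>p x ^ 3 - p y ^ 3\<bar> \<le> 3 * \<bar>p x - p y\<bar>"
  proof -
    have "p x ^ 3 - p y ^ 3 = (p x - p y) * (p x * p x + p x * p y + p y * p y)" by (simp add: power3_eq_cube algebra_simps)
    moreover have "p x * p x + p x * p y + p y * p y \<le> 3" "0 \<le> p x * p x + p x * p y + p y * p y"
      using mult_le_one[OF p(2) p(1) p(2)] p by (smt (verit), simp)
    ultimately show ?thesis
      using mult_left_mono[of "p x * p x + p x * p y + p y * p y" 3 "\<bar>p x - p y\<bar>"] by (simp add: abs_mult mult.commute)
  qed
  ultimately show ?thesis by (simp add: bump_def p_def)
qed

section \<open>Mollification\<close>

definition bump_mass :: "'v::euclidean_space itself \<Rightarrow> real" where
  "bump_mass _ = (\<integral>x. bump (x :: 'v) \<partial>lborel)"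

lemma continuous_bump: "continuous_on S (bump :: 'v::euclidean_space \<Rightarrow> real)"
  unfolding bump_def by (intro continuous_intros)

lemma bump_measurable [measurable]: "(bump :: 'v::euclidean_space \<Rightarrow> real) \<in> borel_measurable borel"
  by (rule borel_measurable_continuous_onI[OF continuous_bump])

lemma integrable_bump: "integrable lborel (bump :: 'v::euclidean_space \<Rightarrow> real)"
  by (rule integrable_compact_support[OF continuous_bump, of 1 0]) (simp add: bump_support)

lemma bump_mass_pos: "0 < bump_mass TYPE('v::euclidean_space)"
proof -
  let ?S = "ball (0::'v) (1/2)"
  have le: "indicator ?S x * (1 / 8) \<le> bump x" for x :: 'v
  proof (cases "x \<in> ?S")
    case True
    then have "(norm x)\<^sup>2 \<le> (1/2)\<^sup>2" by (intro power_mono) auto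
    then have "(norm x)\<^sup>2 \<le> 1 / 4" by (simp add: power2_eq_square)
    then have "1 / 2 \<le> max 0 (1 - (norm x)\<^sup>2)" by linarith
    then have "(1/2) ^ 3 \<le> bump x" unfolding bump_def by (rule power_mono) simp
    then show ?thesis using True by (simp add: power3_eq_cube)
  qed (simp add: bump_nonneg)
  have fin: "emeasure lborel ?S < \<infinity>" by (rule emeasure_lborel_ball_finite)
  have "0 < measure lborel ?S" by (simp add: content_ball unit_ball_vol_pos)
  then have "0 < measure lborel ?S * (1 / 8)" by simp
  also have "\<dots> = (\<integral>x. indicator ?S x * (1 / 8) \<partial>lborel)" using fin by simp
  also have "\<dots> \<le> bump_mass TYPE('v)"
    unfolding bump_mass_def using fin le by (intro integral_mono integrable_bump integrable_mult_left) auto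
  finally show ?thesis .
qed

definition mollifier :: "real \<Rightarrow> 'v::euclidean_space \<Rightarrow> real" where
  "mollifier \<epsilon> x = (1 / (\<epsilon> ^ DIM('v) * bump_mass TYPE('v))) * bump (x /\<^sub>R \<epsilon>)"

text \<open>The Lipschitz constant 6 of the bump times the volume of a ball of radius 2, over the
  mass of the bump: the constant of the L1 estimate for translates of the mollifier.\<close>

definition mollifier_const :: "'v::euclidean_space itself \<Rightarrow> real" where
  "mollifier_const _ = 6 * 2 ^ DIM('v) * unit_ball_vol (real DIM('v)) / bump_mass TYPE('v)"

lemma mollifier_const_nonneg: "0 \<le> mollifier_const TYPE('v::euclidean_space)"
  using bump_mass_pos[where 'v = 'v] by (simp add: mollifier_const_def unit_ball_vol_nonneg)

context
  fixes \<epsilon> :: real assumes \<epsilon>: "0 < \<epsilon>"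
begin

lemma C2_on_mollifier: "C2_on S (mollifier \<epsilon> :: 'v::euclidean_space \<Rightarrow> real)"
proof -
  have "C2_on S (\<lambda>x :: 'v. (1 / (\<epsilon> ^ DIM('v) * bump_mass TYPE('v))) * bump (x /\<^sub>R \<epsilon> - 0))"
    by (intro C2_on_cmul C2_on_bump bounded_linear_scaleR_right)
  then show ?thesis by (simp add: mollifier_def[abs_def])
qed

lemma mollifier_nonneg: "0 \<le> mollifier \<epsilon> x"
  using bump_mass_pos[where 'v = 'a] \<epsilon> by (simp add: mollifier_def bump_nonneg)

lemma mollifier_support: "\<epsilon> < norm x \<Longrightarrow> mollifier \<epsilon> x = 0"
  using \<epsilon> bump_support[of "x /\<^sub>R \<epsilon>"] by (simp add: mollifier_def field_simps)

lemma continuous_mollifier: "continuous_on S (mollifier \<epsilon> :: 'v::euclidean_space \<Rightarrow> real)"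
  unfolding mollifier_def[abs_def]
  by (intro continuous_intros continuous_on_compose2[OF continuous_bump[of UNIV]]) auto

lemma mollifier_measurable [measurable]: "(mollifier \<epsilon> :: 'v::euclidean_space \<Rightarrow> real) \<in> borel_measurable borel"
  by (rule borel_measurable_continuous_onI[OF continuous_mollifier])

lemma integrable_mollifier_mult:
  fixes f :: "'v::euclidean_space \<Rightarrow> real"
  assumes "continuous_on UNIV f"
  shows "integrable lborel (\<lambda>v. mollifier \<epsilon> v * f v)" "integrable lborel (\<lambda>v. mollifier \<epsilon> (v + h) * f v)"
proof -
  show "integrable lborel (\<lambda>v. mollifier \<epsilon> v * f v)"
    by (rule integrable_compact_support[of _ \<epsilon> 0]) (auto intro!: continuous_intros continuous_mollifier assms simp: mollifier_support)
  have "continuous_on UNIV (\<lambda>v. mollifier \<epsilon> (v + h))"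
    by (rule continuous_on_compose2[OF continuous_mollifier[of UNIV]]) (auto intro!: continuous_intros)
  then show "integrable lborel (\<lambda>v. mollifier \<epsilon> (v + h) * f v)"
    by (intro integrable_compact_support[of _ \<epsilon> "- h"] continuous_on_mult assms) (auto simp: mollifier_support)
qed

lemma integrable_mollifier: "integrable lborel (mollifier \<epsilon> :: 'v::euclidean_space \<Rightarrow> real)"
  using integrable_mollifier_mult(1)[of "\<lambda>_. 1"] by simp

lemma integral_mollifier: "(\<integral>x. mollifier \<epsilon> (x::'v::euclidean_space) \<partial>lborel) = 1"
proof -
  have "(\<integral>x. mollifier \<epsilon> (x::'v) \<partial>lborel) = \<epsilon> ^ DIM('v) * (\<integral>x. mollifier \<epsilon> (0 + \<epsilon> *\<^sub>R (x::'v)) \<partial>lborel)"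
    using \<epsilon> by (subst lborel_integral_affine[of \<epsilon> _ 0]) auto
  also have "(\<integral>x. mollifier \<epsilon> (0 + \<epsilon> *\<^sub>R (x::'v)) \<partial>lborel) = (1 / (\<epsilon> ^ DIM('v) * bump_mass TYPE('v))) * bump_mass TYPE('v)"
    using \<epsilon> by (simp add: mollifier_def bump_mass_def)
  finally show ?thesis using \<epsilon> bump_mass_pos[where 'v = 'v] by simp
qed

text \<open>The difference of the two translates is supported in the ball of radius
  \<open>2 * \<epsilon>\<close>, where the Lipschitz bound is integrated. The factor
  \<open>1 / \<epsilon>\<close> is the price of one derivative of the kernel.\<close>

lemma mollifier_translation:
  fixes h :: "'v::euclidean_space"
  assumes h: "norm h \<le> \<epsilon>"
  shows "(\<integral>v. \<bar>mollifier \<epsilon> (v + h) - mollifier \<epsilon> v\<bar> \<partial>lborel) \<le> mollifier_const TYPE('v) * norm h / \<epsilon>"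
proof -
  let ?Z = "bump_mass TYPE('v)" and ?n = "DIM('v)"
  have Z: "0 < ?Z" by (rule bump_mass_pos)
  let ?A = "6 * (norm h / \<epsilon>) / (\<epsilon> ^ ?n * ?Z)"
  have le: "\<bar>mollifier \<epsilon> (v + h) - mollifier \<epsilon> v\<bar> \<le> indicator (cball 0 (2 * \<epsilon>)) v * ?A" for v
  proof (cases "norm v \<le> 2 * \<epsilon>")
    case True
    have "mollifier \<epsilon> (v + h) - mollifier \<epsilon> v = (bump ((v + h) /\<^sub>R \<epsilon>) - bump (v /\<^sub>R \<epsilon>)) / (\<epsilon> ^ ?n * ?Z)"
      by (simp add: mollifier_def diff_divide_distrib)
    moreover have "\<bar>bump ((v + h) /\<^sub>R \<epsilon>) - bump (v /\<^sub>R \<epsilon>)\<bar> \<le> 6 * (norm h / \<epsilon>)"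
      using bump_lipschitz[of "(v + h) /\<^sub>R \<epsilon>" "v /\<^sub>R \<epsilon>"] \<epsilon> by (simp add: scaleR_diff_right[symmetric] divide_inverse mult.commute)
    moreover have pos: "0 < \<epsilon> ^ ?n * ?Z" using \<epsilon> Z by simp
    ultimately have "\<bar>mollifier \<epsilon> (v + h) - mollifier \<epsilon> v\<bar> \<le> ?A"
      using divide_right_mono[OF _ less_imp_le[OF pos]] by (simp only: abs_divide abs_of_pos[OF pos])
    then show ?thesis using True by (auto simp: indicator_def)
  next
    case False
    then have "\<epsilon> < norm v" "\<epsilon> < norm (v + h)" using h \<epsilon> norm_triangle_ineq4[of "v + h" h] by auto
    then show ?thesis using \<epsilon> Z by (simp add: mollifier_support)
  qed
  have "(\<integral>v. \<bar>mollifier \<epsilon> (v + h) - mollifier \<epsilon> v\<bar> \<partial>lborel) \<le> (\<integral>v. indicator (cball 0 (2 * \<epsilon>)) v * ?A \<partial>(lborel :: 'v measure))"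
  proof (rule integral_mono)
    show "integrable lborel (\<lambda>v. \<bar>mollifier \<epsilon> (v + h) - mollifier \<epsilon> v\<bar>)"
      using integrable_mollifier_mult(2)[of "\<lambda>_. 1" h] integrable_mollifier[where 'v='v] by (intro integrable_abs Bochner_Integration.integrable_diff) auto
    show "integrable lborel (\<lambda>v :: 'v. indicator (cball 0 (2 * \<epsilon>)) v * ?A)"
      using emeasure_lborel_cball_finite[of "0 :: 'v" "2 * \<epsilon>"]
      by (intro integrable_mult_left integrable_real_indicator) auto
    show "\<bar>mollifier \<epsilon> (v + h) - mollifier \<epsilon> v\<bar> \<le> indicator (cball 0 (2 * \<epsilon>)) v * ?A" for v
      by (rule le)
  qed
  also have "\<dots> = measure lborel (cball (0::'v) (2 * \<epsilon>)) * ?A"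
    by (simp add: emeasure_lborel_cball_finite)
  also have "measure lborel (cball (0::'v) (2 * \<epsilon>)) = unit_ball_vol (real ?n) * (2 * \<epsilon>) ^ ?n"
    using \<epsilon> by (simp add: content_cball)
  also have "unit_ball_vol (real ?n) * (2 * \<epsilon>) ^ ?n * ?A = mollifier_const TYPE('v) * norm h / \<epsilon>"
    using \<epsilon> Z by (simp add: mollifier_const_def power_mult_distrib field_simps)
  finally show ?thesis .
qed

definition mollify :: "('v::euclidean_space \<Rightarrow> real) \<Rightarrow> 'v \<Rightarrow> real" where
  "mollify u x = (\<integral>v. mollifier \<epsilon> v * u (x - v) \<partial>lborel)"

lemma mollify_eq:
  assumes "continuous_on UNIV u"
  shows "mollify u x = (\<integral>y. mollifier \<epsilon> (x - y) * u y \<partial>lborel)"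
proof -
  have [measurable]: "u \<in> borel_measurable borel" by (rule borel_measurable_continuous_onI[OF assms])
  have "mollify u x = (\<integral>y. mollifier \<epsilon> (x + (-1) *\<^sub>R y) * u (x - (x + (-1) *\<^sub>R y)) \<partial>lborel)"
    unfolding mollify_def by (subst lborel_integral_affine[of "- 1" _ x]) auto
  then show ?thesis by simp
qed

text \<open>Carries a translation over to the kernel, so that the difference in the other argument
  remains available to the Lipschitz bound of \<open>u\<close>.\<close>

lemma mollify_shift:
  assumes u: "continuous_on UNIV u"
  shows "mollify u (x + h) = (\<integral>v. mollifier \<epsilon> (v + h) * u (x - v) \<partial>lborel)"
proof -
  have [measurable]: "u \<in> borel_measurable borel" by (rule borel_measurable_continuous_onI[OF u])
  have "mollify u (x + h) = (\<integral>v. mollifier \<epsilon> (h + 1 *\<^sub>R v) * u (x + h - (h + 1 *\<^sub>R v)) \<partial>lborel)"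
    unfolding mollify_def by (subst lborel_integral_affine[of 1 _ h]) auto
  then show ?thesis by (simp add: add.commute)
qed

lemma C2_on_mollify:
  assumes u: "continuous_on UNIV u"
  shows "C2_on UNIV (mollify u)"
proof -
  have "mollify u x = integral UNIV (\<lambda>y. u y *\<^sub>R mollifier \<epsilon> (x - y))" for x
  proof -
    have "integrable lborel (\<lambda>y. mollifier \<epsilon> (x - y) * u y)"
    proof (rule integrable_compact_support[of _ \<epsilon> x])
      have "continuous_on UNIV (\<lambda>y. mollifier \<epsilon> (x - y))"
        by (rule continuous_on_compose2[OF continuous_mollifier[of UNIV]]) (auto intro!: continuous_intros)
      then show "continuous_on UNIV (\<lambda>y. mollifier \<epsilon> (x - y) * u y)" by (intro continuous_on_mult u)
    qed (simp add: mollifier_support norm_minus_commute)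
    then show ?thesis unfolding mollify_eq[OF u] by (subst integral_lborel[symmetric]) (auto simp: mult.commute)
  qed
  then have "mollify u = (\<lambda>x. integral UNIV (\<lambda>y. u y *\<^sub>R mollifier \<epsilon> (x - y)))" by auto
  moreover have "C2_on UNIV (\<lambda>x. integral UNIV (\<lambda>y. u y *\<^sub>R mollifier \<epsilon> (x - y)))"
    by (rule C2_on_convolution[OF C2_on_mollifier mollifier_support u])
  ultimately show ?thesis by simp
qed

lemma mollifier_average_le:
  fixes f :: "'v::euclidean_space \<Rightarrow> real"
  assumes "continuous_on UNIV f" "\<And>v. norm v \<le> \<epsilon> \<Longrightarrow> \<bar>f v\<bar> \<le> A"
  shows "\<bar>\<integral>v. mollifier \<epsilon> v * f v \<partial>lborel\<bar> \<le> A"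
proof -
  have "\<bar>\<integral>v. mollifier \<epsilon> v * f v \<partial>lborel\<bar> \<le> (\<integral>v. \<bar>mollifier \<epsilon> v * f v\<bar> \<partial>lborel)" by (rule integral_abs_bound)
  also have "\<dots> \<le> (\<integral>v. mollifier \<epsilon> v * A \<partial>(lborel :: 'v measure))"
  proof (rule integral_mono)
    show "integrable lborel (\<lambda>v. \<bar>mollifier \<epsilon> v * f v\<bar>)" by (intro integrable_abs integrable_mollifier_mult(1) assms)
    show "integrable lborel (\<lambda>v :: 'v. mollifier \<epsilon> v * A)" by (intro integrable_mult_left integrable_mollifier)
    fix v
    show "\<bar>mollifier \<epsilon> v * f v\<bar> \<le> mollifier \<epsilon> v * A"
    proof (cases "norm v \<le> \<epsilon>")
      case True
      then show ?thesis using assms(2)[OF True] mollifier_nonneg[of v] by (simp add: abs_mult mult_left_mono)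
    next
      case False
      then show ?thesis by (simp add: mollifier_support)
    qed
  qed
  also have "\<dots> = A" using integral_mollifier[where 'v='v] by simp
  finally show ?thesis .
qed

text \<open>Of two derivatives, one falls on \<open>u\<close> and costs \<open>K\<close>, the other
  falls on the kernel and costs \<open>1 / \<epsilon>\<close>. Both bounds are read off difference
  quotients, which stay meaningful for merely Lipschitz \<open>u\<close>.\<close>

lemma mollify_profile:
  fixes u :: "real^'n \<Rightarrow> real"
  assumes lip: "\<And>x y. \<bar>u x - u y\<bar> \<le> K * norm (x - y)" and K: "0 \<le> K"
  obtains g where "\<And>y. GDERIV (mollify u) y :> g y" "\<And>y. norm (g y) \<le> K"
    "\<And>y h. \<bar>mollify u (y + h) - mollify u y - h \<bullet> g y\<bar> \<le> mollifier_const TYPE(real^'n) * K / \<epsilon> * (norm h)\<^sup>2"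
    "\<And>y. \<bar>mollify u y - u y\<bar> \<le> K * \<epsilon>"
proof -
  let ?w = "mollify u" and ?C = "mollifier_const TYPE(real^'n)"
  have "K-lipschitz_on UNIV u" using lip K by (auto simp: lipschitz_on_def dist_norm)
  then have u: "continuous_on UNIV u" by (rule lipschitz_on_continuous_on)
  have us: "continuous_on UNIV (\<lambda>v. u (x - v))" for x
    by (rule continuous_on_compose2[OF u]) (auto intro!: continuous_intros)
  note mi = integrable_mollifier_mult
  obtain D D2 where "C2_with UNIV ?w D D2" using C2_on_mollify[OF u] by (auto simp: C2_on_def)
  then have D: "(?w has_derivative blinfun_apply (D p)) (at p)" for p by (auto simp: C2_with_def)
  define g where "g y = (\<Sum>i\<in>Basis. D y i *\<^sub>R i)" for y
  have Dg: "D y h = h \<bullet> g y" for y h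
  proof -
    have "D y h = D y (\<Sum>i\<in>Basis. (h \<bullet> i) *\<^sub>R i)" by (simp add: euclidean_representation)
    also have "\<dots> = (\<Sum>i\<in>Basis. (h \<bullet> i) * D y i)" by (simp add: blinfun.sum_right blinfun.scaleR_right)
    also have "\<dots> = h \<bullet> g y" by (simp add: g_def inner_sum_right mult.commute)
    finally show ?thesis .
  qed
  have "blinfun_apply (D y) = (\<lambda>h. h \<bullet> g y)" for y using Dg by auto
  then have gd: "GDERIV ?w y :> g y" for y using D[of y] by (simp add: gderiv_def)
  have close: "\<bar>?w y - u y\<bar> \<le> K * \<epsilon>" for y
  proof -
    have "u y = (\<integral>v. mollifier \<epsilon> v * u y \<partial>(lborel :: (real^'n) measure))" using integral_mollifier[where 'v="real^'n"] by simp
    then have "?w y - u y = (\<integral>v. mollifier \<epsilon> v * u (y - v) \<partial>lborel) - (\<integral>v. mollifier \<epsilon> v * u y \<partial>(lborel :: (real^'n) measure))"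
      unfolding mollify_def by simp
    also have "\<dots> = (\<integral>v. mollifier \<epsilon> v * (u (y - v) - u y) \<partial>lborel)"
      by (subst Bochner_Integration.integral_diff[symmetric])
        (auto simp: right_diff_distrib intro!: mi(1) us integrable_mult_left integrable_mollifier)
    also have "\<bar>\<dots>\<bar> \<le> K * \<epsilon>"
    proof (rule mollifier_average_le)
      show "continuous_on UNIV (\<lambda>v. u (y - v) - u y)" by (intro continuous_intros us)
      show "\<bar>u (y - v) - u y\<bar> \<le> K * \<epsilon>" if "norm v \<le> \<epsilon>" for v
        using lip[of "y - v" y] mult_left_mono[OF that K] by simp
    qed
    finally show ?thesis .
  qed
  have wlip: "\<bar>?w (y + h) - ?w y\<bar> \<le> K * norm h" for y h
  proof -
    have "?w (y + h) - ?w y = (\<integral>v. mollifier \<epsilon> v * (u (y + h - v) - u (y - v)) \<partial>lborel)"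
      unfolding mollify_def using mi(1)[OF us] by (simp add: right_diff_distrib)
    also have "\<bar>\<dots>\<bar> \<le> K * norm h"
    proof (rule mollifier_average_le)
      show "continuous_on UNIV (\<lambda>v. u (y + h - v) - u (y - v))" by (intro continuous_intros us)
      show "\<bar>u (y + h - v) - u (y - v)\<bar> \<le> K * norm h" for v
        using lip[of "y + h - v" "y - v"] by simp
    qed
    finally show ?thesis .
  qed
  have quot: "((\<lambda>s. (?w (y + s *\<^sub>R h) - ?w y) / s) \<longlongrightarrow> h \<bullet> g y) (at_right 0)" for y h
  proof -
    have "((\<lambda>s. y + s *\<^sub>R h) has_derivative (\<lambda>s. s *\<^sub>R h)) (at 0)" by (auto intro!: derivative_eq_intros)
    moreover have "(?w has_derivative (\<lambda>h. h \<bullet> g y)) (at (y + 0 *\<^sub>R h))" using gd[of y] by (simp add: gderiv_def)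
    ultimately have "((\<lambda>s. ?w (y + s *\<^sub>R h)) has_derivative (\<lambda>s. (s *\<^sub>R h) \<bullet> g y)) (at 0)"
      by (rule has_derivative_compose)
    then have "((\<lambda>s. ?w (y + s *\<^sub>R h)) has_real_derivative h \<bullet> g y) (at 0)"
      by (simp add: has_field_derivative_def mult_commute_abs)
    then have "((\<lambda>s. (?w (y + s *\<^sub>R h) - ?w y) / s) \<longlongrightarrow> h \<bullet> g y) (at 0)"
      by (simp add: DERIV_def)
    then show ?thesis by (rule tendsto_within_subset) auto
  qed
  have gb: "norm (g y) \<le> K" for y
  proof -
    have "g y \<bullet> g y \<le> K * norm (g y)"
    proof (rule tendsto_upperbound[OF quot[of y "g y"]])
      show "\<forall>\<^sub>F s in at_right 0. (?w (y + s *\<^sub>R g y) - ?w y) / s \<le> K * norm (g y)"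
        using eventually_at_right_less[of 0]
      proof eventually_elim
        case (elim s)
        have "?w (y + s *\<^sub>R g y) - ?w y \<le> K * (s * norm (g y))" using wlip[of y "s *\<^sub>R g y"] elim by simp
        then show ?case using elim by (simp add: pos_divide_le_eq mult_ac)
      qed
    qed simp
    then have "norm (g y) * norm (g y) \<le> K * norm (g y)" by (simp add: power2_norm_eq_inner[symmetric] power2_eq_square)
    then show ?thesis by (cases "norm (g y) = 0") (use K in auto)
  qed
  \<comment> \<open>Tested in the direction \<open>g x - g y\<close>: the mixed second difference of
    the mollification is the integral of a translation difference of the kernel against
    \<open>u (x - v) - u (y - v)\<close>.\<close>
  have glip: "norm (g x - g y) \<le> ?C * K / \<epsilon> * norm (x - y)" for x y
  proof -
    let ?h = "g x - g y"
    have lim: "((\<lambda>s. (?w (x + s *\<^sub>R ?h) - ?w x) / s - (?w (y + s *\<^sub>R ?h) - ?w y) / s) \<longlongrightarrow> ?h \<bullet> g x - ?h \<bullet> g y) (at_right 0)"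
      by (intro tendsto_diff quot)
    have "?h \<bullet> g x - ?h \<bullet> g y \<le> ?C * K / \<epsilon> * norm (x - y) * norm ?h"
    proof (rule tendsto_upperbound[OF lim])
      have "\<forall>\<^sub>F s in at_right 0. s \<in> {0<..<\<epsilon> / (norm ?h + 1)}"
        using \<epsilon> by (intro eventually_at_right_real) (simp add: add_nonneg_pos)
      then show "\<forall>\<^sub>F s in at_right 0. (?w (x + s *\<^sub>R ?h) - ?w x) / s - (?w (y + s *\<^sub>R ?h) - ?w y) / s \<le> ?C * K / \<epsilon> * norm (x - y) * norm ?h"
      proof eventually_elim
        case (elim s)
        let ?k = "s *\<^sub>R ?h"
        have s: "0 < s" and "s * (norm ?h + 1) < \<epsilon>" using elim by (auto simp: pos_less_divide_eq add_nonneg_pos)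
        then have hk: "norm ?k \<le> \<epsilon>" by (simp add: distrib_left)
        have "(?w (x + ?k) - ?w x) - (?w (y + ?k) - ?w y)
           = (\<integral>v. (mollifier \<epsilon> (v + ?k) - mollifier \<epsilon> v) * (u (x - v) - u (y - v)) \<partial>lborel)"
          unfolding mollify_shift[OF u] mollify_def[of u x] mollify_def[of u y]
          using mi(1)[OF us] mi(2)[OF us] by (simp add: left_diff_distrib right_diff_distrib)
        also have "\<dots> \<le> (\<integral>v. \<bar>mollifier \<epsilon> (v + ?k) - mollifier \<epsilon> v\<bar> * (K * norm (x - y)) \<partial>lborel)"
        proof (rule integral_mono)
          show "integrable lborel (\<lambda>v. (mollifier \<epsilon> (v + ?k) - mollifier \<epsilon> v) * (u (x - v) - u (y - v)))"
            using mi(1)[OF us] mi(2)[OF us] by (simp add: left_diff_distrib right_diff_distrib)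
          show "integrable lborel (\<lambda>v. \<bar>mollifier \<epsilon> (v + ?k) - mollifier \<epsilon> v\<bar> * (K * norm (x - y)))"
            using mi(2)[of "\<lambda>_. 1" ?k] integrable_mollifier[where 'v="real^'n"]
            by (intro integrable_mult_left integrable_abs Bochner_Integration.integrable_diff) auto
          fix v
          have "\<bar>u (x - v) - u (y - v)\<bar> \<le> K * norm (x - y)" using lip[of "x - v" "y - v"] by simp
          then have "\<bar>(mollifier \<epsilon> (v + ?k) - mollifier \<epsilon> v) * (u (x - v) - u (y - v))\<bar>
             \<le> \<bar>mollifier \<epsilon> (v + ?k) - mollifier \<epsilon> v\<bar> * (K * norm (x - y))"
            unfolding abs_mult by (rule mult_left_mono) simp
          then show "(mollifier \<epsilon> (v + ?k) - mollifier \<epsilon> v) * (u (x - v) - u (y - v))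
             \<le> \<bar>mollifier \<epsilon> (v + ?k) - mollifier \<epsilon> v\<bar> * (K * norm (x - y))" by linarith
        qed
        also have "\<dots> = (\<integral>v. \<bar>mollifier \<epsilon> (v + ?k) - mollifier \<epsilon> v\<bar> \<partial>lborel) * (K * norm (x - y))" by simp
        also have "\<dots> \<le> (?C * norm ?k / \<epsilon>) * (K * norm (x - y))"
          by (rule mult_right_mono[OF mollifier_translation[OF hk]]) (use K in simp)
        also have "\<dots> = (?C * K / \<epsilon> * norm (x - y) * norm ?h) * s" using s by simp
        finally have "((?w (x + ?k) - ?w x) - (?w (y + ?k) - ?w y)) / s \<le> ?C * K / \<epsilon> * norm (x - y) * norm ?h"
          using s by (simp add: pos_divide_le_eq)
        then show ?case by (simp add: diff_divide_distrib)
      qed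
    qed simp
    then have "norm ?h * norm ?h \<le> (?C * K / \<epsilon> * norm (x - y)) * norm ?h"
      by (simp add: inner_diff_right[symmetric] power2_norm_eq_inner[symmetric] power2_eq_square)
    moreover have "0 \<le> ?C * K / \<epsilon> * norm (x - y)"
      using mollifier_const_nonneg[where 'v="real^'n"] K \<epsilon> by (intro mult_nonneg_nonneg divide_nonneg_pos) auto
    ultimately show ?thesis
      using mult_right_le_imp_le[of "norm ?h" "norm ?h" "?C * K / \<epsilon> * norm (x - y)"] by (cases "norm ?h = 0") (metis, metis norm_ge_zero less_eq_real_def)
  qed
  have tay: "\<bar>?w (y + h) - ?w y - h \<bullet> g y\<bar> \<le> ?C * K / \<epsilon> * (norm h)\<^sup>2" for y h
  proof -
    let ?f = "\<lambda>x. ?w x - x \<bullet> g y" and ?B = "?C * K / \<epsilon> * norm h"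
    have "norm (?f (y + h) - ?f y) \<le> ?B * norm (y + h - y)"
    proof (rule differentiable_bound[of "cball y (norm h)" ?f "\<lambda>x h. h \<bullet> (g x - g y)"])
      fix x assume x: "x \<in> cball y (norm h)"
      have "(?f has_derivative (\<lambda>h. h \<bullet> g x - h \<bullet> g y)) (at x)"
        using gd[of x] by (auto simp: gderiv_def intro!: derivative_eq_intros)
      then show "(?f has_derivative (\<lambda>h. h \<bullet> (g x - g y))) (at x within cball y (norm h))"
        by (simp add: inner_diff_right has_derivative_at_withinI)
      have "norm (g x - g y) \<le> ?B"
      proof -
        have "norm (x - y) \<le> norm h" using x by (simp add: dist_norm norm_minus_commute)
        then have "?C * K / \<epsilon> * norm (x - y) \<le> ?B"
          using mollifier_const_nonneg[where 'v="real^'n"] K \<epsilon> by (intro mult_left_mono) auto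
        then show ?thesis using glip[of x y] by linarith
      qed
      then have "norm (k \<bullet> (g x - g y)) \<le> ?B * norm k" for k
        using abs_inner_le[OF order_refl, of "g x - g y" ?B k] by (simp add: mult.commute)
      then show "onorm (\<lambda>h. h \<bullet> (g x - g y)) \<le> ?B" by (rule onorm_le)
    qed (auto simp: dist_norm)
    then show ?thesis by (simp add: inner_add_left power2_eq_square algebra_simps)
  qed
  show ?thesis by (rule that[OF gd gb tay close])
qed

end

section \<open>The nonlocal operator on mollified initial data\<close>

text \<open>Partial derivatives as limits along the steps \<open>1 / real (Suc n)\<close>. It agrees
  with the gradient where that exists and is visibly Borel, unlike the definite description
  \<open>grad\<close>.\<close>

definition dq_grad :: "(real^'n \<Rightarrow> real) \<Rightarrow> real^'n \<Rightarrow> real^'n" where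
  "dq_grad u x = (\<Sum>i\<in>Basis. lim (\<lambda>n. (u (x + (1 / real (Suc n)) *\<^sub>R i) - u x) / (1 / real (Suc n))) *\<^sub>R i)"

lemma GDERIV_quotient:
  fixes u :: "real^'n \<Rightarrow> real"
  assumes "GDERIV u x :> g"
  shows "(\<lambda>n. (u (x + (1 / real (Suc n)) *\<^sub>R h) - u x) / (1 / real (Suc n))) \<longlonglongrightarrow> h \<bullet> g"
proof -
  have "((\<lambda>s. x + s *\<^sub>R h) has_derivative (\<lambda>s. s *\<^sub>R h)) (at 0)" by (auto intro!: derivative_eq_intros)
  moreover have "(u has_derivative (\<lambda>h. h \<bullet> g)) (at (x + 0 *\<^sub>R h))" using assms by (simp add: gderiv_def)
  ultimately have "((\<lambda>s. u (x + s *\<^sub>R h)) has_derivative (\<lambda>s. (s *\<^sub>R h) \<bullet> g)) (at 0)"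
    by (rule has_derivative_compose)
  then have "((\<lambda>s. u (x + s *\<^sub>R h)) has_real_derivative h \<bullet> g) (at 0)"
    by (simp add: has_field_derivative_def mult_commute_abs)
  then have lim: "((\<lambda>s. (u (x + s *\<^sub>R h) - u x) / s) \<longlongrightarrow> h \<bullet> g) (at 0)"
    by (simp add: DERIV_def)
  have "filterlim (\<lambda>n. 1 / real (Suc n)) (at 0) sequentially"
    unfolding filterlim_at using LIMSEQ_Suc[OF lim_1_over_n[where 'a = real]] by simp
  from filterlim_compose[OF lim this] show ?thesis .
qed

lemma differentiable_GDERIV:
  fixes u :: "real^'n \<Rightarrow> real"
  assumes "u differentiable (at x)"
  shows "GDERIV u x :> dq_grad u x"
proof -
  from assms obtain D where D: "(u has_derivative D) (at x)" by (auto simp: differentiable_def)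
  then interpret D: bounded_linear D by (rule has_derivative_bounded_linear)
  define g where "g = (\<Sum>i\<in>Basis. D i *\<^sub>R i)"
  have "D h = h \<bullet> g" for h
  proof -
    have "D h = D (\<Sum>i\<in>Basis. (h \<bullet> i) *\<^sub>R i)" by (simp add: euclidean_representation)
    also have "\<dots> = (\<Sum>i\<in>Basis. (h \<bullet> i) * D i)" by (simp add: D.sum D.scaleR)
    also have "\<dots> = h \<bullet> g" by (simp add: g_def inner_sum_right mult.commute)
    finally show ?thesis .
  qed
  then have "D = (\<lambda>h. h \<bullet> g)" by auto
  with D have g: "GDERIV u x :> g" by (simp add: gderiv_def)
  have "dq_grad u x = (\<Sum>i\<in>Basis. (i \<bullet> g) *\<^sub>R i)"
    unfolding dq_grad_def using limI[OF GDERIV_quotient[OF g]] by simp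
  also have "\<dots> = g" using euclidean_representation[of g] by (simp only: inner_commute)
  finally show ?thesis using g by simp
qed

text \<open>By continuity the differentiability estimate may be tested on a dense sequence of
  increments, with tolerances \<open>1 / real (Suc m)\<close>. This writes the set of
  differentiability with countably many quantifiers.\<close>

lemma differentiable_iff_rational:
  fixes u :: "real^'n \<Rightarrow> real" and q :: "nat \<Rightarrow> real^'n"
  assumes u: "continuous_on UNIV u" and q: "\<And>S. open S \<Longrightarrow> S \<noteq> {} \<Longrightarrow> \<exists>j. q j \<in> S"
  shows "u differentiable (at x) \<longleftrightarrow> (\<forall>m. \<exists>k. \<forall>j. norm (q j) < 1 / real (Suc k) \<longrightarrow>
     \<bar>u (x + q j) - u x - q j \<bullet> dq_grad u x\<bar> \<le> norm (q j) / real (Suc m))" (is "_ \<longleftrightarrow> ?R")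
proof
  assume "u differentiable (at x)"
  from differentiable_GDERIV[OF this] have D: "(u has_derivative (\<lambda>h. h \<bullet> dq_grad u x)) (at x)" by (simp add: gderiv_def)
  show ?R
  proof
    fix m
    obtain d where d: "0 < d" "\<And>y. norm (y - x) < d \<Longrightarrow> norm (u y - u x - (y - x) \<bullet> dq_grad u x) \<le> 1 / real (Suc m) * norm (y - x)"
      using D[unfolded has_derivative_at_alt, THEN conjunct2, rule_format, of "1 / real (Suc m)"] by auto
    obtain k where k: "1 / real (Suc k) < d" using nat_approx_posE[OF d(1)] by auto
    have "\<bar>u (x + q j) - u x - q j \<bullet> dq_grad u x\<bar> \<le> norm (q j) / real (Suc m)" if "norm (q j) < 1 / real (Suc k)" for j
      using d(2)[of "x + q j"] that k by simp
    then show "\<exists>k. \<forall>j. norm (q j) < 1 / real (Suc k) \<longrightarrow> \<bar>u (x + q j) - u x - q j \<bullet> dq_grad u x\<bar> \<le> norm (q j) / real (Suc m)"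
      by blast
  qed
next
  assume R: ?R
  have "(u has_derivative (\<lambda>h. h \<bullet> dq_grad u x)) (at x)"
    unfolding has_derivative_at_alt
  proof (intro conjI allI impI bounded_linear_inner_left)
    fix e :: real assume "0 < e"
    then obtain m where m: "1 / real (Suc m) < e" using nat_approx_posE by auto
    from R obtain k where k: "\<And>j. norm (q j) < 1 / real (Suc k) \<Longrightarrow> \<bar>u (x + q j) - u x - q j \<bullet> dq_grad u x\<bar> \<le> norm (q j) / real (Suc m)"
      by blast
    define f where "f h = \<bar>u (x + h) - u x - h \<bullet> dq_grad u x\<bar> - norm h / real (Suc m)" for h
    have "continuous_on UNIV (\<lambda>h. u (x + h))" by (rule continuous_on_compose2[OF u]) (auto intro!: continuous_intros)
    then have fc: "continuous_on UNIV f" unfolding f_def by (intro continuous_intros) auto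
    have f0: "f h \<le> 0" if "norm h < 1 / real (Suc k)" for h
    proof (rule ccontr)
      assume "\<not> f h \<le> 0"
      define S where "S = f -` {0<..} \<inter> ball 0 (1 / real (Suc k))"
      have "open S" unfolding S_def by (intro open_Int open_vimage fc) auto
      moreover have "h \<in> S" using that \<open>\<not> f h \<le> 0\<close> by (simp add: S_def)
      ultimately obtain j where "q j \<in> S" using q by blast
      then show False using k[of j] by (simp add: S_def f_def)
    qed
    show "\<exists>d>0. \<forall>y. norm (y - x) < d \<longrightarrow> norm (u y - u x - (y - x) \<bullet> dq_grad u x) \<le> e * norm (y - x)"
    proof (intro exI[of _ "1 / real (Suc k)"] conjI allI impI)
      fix y assume "norm (y - x) < 1 / real (Suc k)"
      then have "f (y - x) \<le> 0" by (rule f0)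
      then have "\<bar>u y - u x - (y - x) \<bullet> dq_grad u x\<bar> \<le> (1 / real (Suc m)) * norm (y - x)" by (simp add: f_def)
      also have "\<dots> \<le> e * norm (y - x)" using m by (intro mult_right_mono) auto
      finally show "norm (u y - u x - (y - x) \<bullet> dq_grad u x) \<le> e * norm (y - x)" by simp
    qed simp
  qed
  then show "u differentiable (at x)" by (auto simp: differentiable_def)
qed

text \<open>Where \<open>u\<close> is not differentiable the description has no witness, so
  \<open>grad u\<close> takes one fixed unspecified value there. It is thus Borel everywhere and not
  only up to a null set.\<close>

lemma grad_measurable:
  fixes u :: "real^'n \<Rightarrow> real"
  assumes u: "continuous_on UNIV u"
  shows "grad u \<in> borel_measurable borel"
proof -
  obtain Dn :: "(real^'n) set" where Dn: "countable Dn" "\<And>S. open S \<Longrightarrow> S \<noteq> {} \<Longrightarrow> \<exists>d\<in>Dn. d \<in> S"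
    using countable_dense_exists by blast
  define q where "q = from_nat_into Dn"
  have "Dn \<noteq> {}" using Dn(2)[of UNIV] by auto
  then have q: "\<exists>j. q j \<in> S" if "open S" "S \<noteq> {}" for S
    using Dn(2)[OF that] from_nat_into_surj[OF Dn(1)] unfolding q_def by metis
  have [measurable]: "u \<in> borel_measurable borel" by (rule borel_measurable_continuous_onI[OF u])
  have [measurable]: "dq_grad u \<in> borel_measurable borel"
    unfolding dq_grad_def[abs_def] by measurable
  have [measurable]: "Measurable.pred borel (\<lambda>x. u differentiable (at x))"
  proof -
    have "(\<lambda>x. u differentiable (at x)) = (\<lambda>x. \<forall>m. \<exists>k. \<forall>j. norm (q j) < 1 / real (Suc k) \<longrightarrow>
       \<bar>u (x + q j) - u x - q j \<bullet> dq_grad u x\<bar> \<le> norm (q j) / real (Suc m))"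
      by (intro ext differentiable_iff_rational[OF u]) (rule q)
    then show ?thesis by simp
  qed
  have "grad u = (\<lambda>x. if u differentiable (at x) then dq_grad u x else (THE g. False))"
  proof
    fix x
    show "grad u x = (if u differentiable (at x) then dq_grad u x else (THE g. False))"
    proof (cases "u differentiable (at x)")
      case True
      then show ?thesis using grad_eqI[OF differentiable_GDERIV[OF True]] by simp
    next
      case False
      then have "\<not> GDERIV u x :> g" for g by (auto simp: gderiv_def differentiable_def)
      then show ?thesis using False by (simp add: grad_def)
    qed
  qed
  then show ?thesis by simp
qed

section \<open>Mollification against the Levy integral\<close>

context isaacs_data begin

lemma r_pos_part: "z \<noteq> 0 \<Longrightarrow> 0 \<le> r z" using r_nonneg I_nonempty by blast

lemma sigma_finite_\<nu>: "sigma_finite_measure \<nu>"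
proof
  let ?A = "range (\<lambda>n. {z :: real^'m. 1 / real (Suc n) \<le> norm z})"
  show "\<exists>A. countable A \<and> A \<subseteq> sets \<nu> \<and> \<Union> A = space \<nu> \<and> (\<forall>a\<in>A. emeasure \<nu> a \<noteq> \<infinity>)"
  proof (intro exI[of _ ?A] conjI ballI)
    show "?A \<subseteq> sets \<nu>" by (auto intro!: tail_sets)
    show "emeasure \<nu> a \<noteq> \<infinity>" if "a \<in> ?A" for a
    proof -
      from that obtain n where "a = {z. 1 / real (Suc n) \<le> norm z}" by blast
      then show ?thesis using finite_tail[of "1 / real (Suc n)"] by (simp only: less_top[symmetric]) simp
    qed
    show "\<Union> ?A = space \<nu>"
    proof
      show "\<Union> ?A \<subseteq> space \<nu>" by (auto simp: space_\<nu> not_le)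
      show "space \<nu> \<subseteq> \<Union> ?A"
      proof
        fix z assume "z \<in> space \<nu>"
        then have "0 < norm z" by (simp add: space_\<nu>)
        then obtain n where "1 / real (Suc n) < norm z" using nat_approx_posE by blast
        then show "z \<in> \<Union> ?A" by (auto intro: less_imp_le)
      qed
    qed
  qed simp
qed

text \<open>On jumps bounded away from the origin the nonlocal operator commutes with the mollification;
  the contribution of small jumps vanishes by the distributional hypothesis.\<close>

lemma mollify_nonlocal_bound:
  fixes u0 :: "real^'n \<Rightarrow> real"
  assumes i: "i \<in> I" and \<epsilon>: "0 < \<epsilon>"
    and lip: "\<And>x y. \<bar>u0 x - u0 y\<bar> \<le> K * norm (x - y)"
    and ae: "AE y in lborel. u0 differentiable (at y) \<and>
       integrable \<nu> (\<lambda>z. u0 (y + \<eta> i z) - u0 y - \<eta> i z \<bullet> grad u0 y) \<and>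
       \<bar>\<integral>z. u0 (y + \<eta> i z) - u0 y - \<eta> i z \<bullet> grad u0 y \<partial>\<nu>\<bar> \<le> K0"
    and distr: "((\<lambda>\<kappa>. \<integral>y. mollifier \<epsilon> (x - y) * (LINT z:{z. norm z < \<kappa>}|\<nu>. u0 (y + \<eta> i z) - u0 y - \<eta> i z \<bullet> grad u0 y) \<partial>lborel)
       \<longlongrightarrow> 0) (at_right 0)"
    and g: "GDERIV (mollify \<epsilon> u0) x :> g"
    and tay: "\<And>h. \<bar>mollify \<epsilon> u0 (x + h) - mollify \<epsilon> u0 x - h \<bullet> g\<bar> \<le> R * (norm h)\<^sup>2" and R: "0 \<le> R"
  shows "\<bar>LINT z:jumps|\<nu>. mollify \<epsilon> u0 (x + \<eta> i z) - mollify \<epsilon> u0 x - \<eta> i z \<bullet> g\<bar> \<le> K0 + R * m2"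
proof -
  let ?w = "mollify \<epsilon> u0"
  have K: "0 \<le> K" using K_pos by simp
  have "K-lipschitz_on UNIV u0" using lip K by (auto simp: lipschitz_on_def dist_norm)
  then have uc: "continuous_on UNIV u0" by (rule lipschitz_on_continuous_on)
  note [measurable] = borel_measurable_continuous_onI[OF uc] grad_measurable[OF uc] \<eta>_measurable[OF i]
  define \<psi> where "\<psi> y = mollifier \<epsilon> (x - y)" for y
  have \<psi>0: "0 \<le> \<psi> y" for y by (simp add: \<psi>_def mollifier_nonneg[OF \<epsilon>])
  have [measurable]: "\<psi> \<in> borel_measurable borel" unfolding \<psi>_def[abs_def] using mollifier_measurable[OF \<epsilon>] by measurable
  have \<psi>i: "integrable lborel \<psi>"
    using lborel_integrable_affine[OF _ integrable_mollifier[OF \<epsilon>, where 'v="real^'n"], of "- 1" x] by (simp add: \<psi>_def[abs_def])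
  have \<psi>1: "(\<integral>y. \<psi> y \<partial>lborel) = 1"
    using lborel_integral_affine[of "- 1" "mollifier \<epsilon> :: real^'n \<Rightarrow> real" x] mollifier_measurable[OF \<epsilon>] integral_mollifier[OF \<epsilon>, where 'v="real^'n"]
    by (simp add: \<psi>_def)
  define G where "G = grad u0"
  have [measurable]: "G \<in> borel_measurable borel" by (simp add: G_def)
  have aeD: "AE y in lborel. u0 differentiable (at y)" using ae by eventually_elim simp
  have GD: "GDERIV u0 y :> G y" if "u0 differentiable (at y)" for y
    using differentiable_GDERIV[OF that] grad_eqI by (metis G_def)
  have dq: "\<bar>(u0 (y + s *\<^sub>R h) - u0 y) / s\<bar> \<le> K * norm h" if "0 < s" for y h s
    using lip[of "y + s *\<^sub>R h" y] that by (simp add: abs_divide pos_divide_le_eq mult_ac)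
  \<comment> \<open>The norm of the value that \<open>grad\<close> takes at points of
    non-differentiability. Including it makes the bounds below hold at every point, without an
    exceptional set.\<close>
  define c0 where "c0 = norm (THE g :: real^'n. False)"
  have Gb: "norm (G y) \<le> K + c0" for y
  proof (cases "u0 differentiable (at y)")
    case True
    have "G y \<bullet> G y \<le> K * norm (G y)"
    proof (rule LIMSEQ_le_const2[OF GDERIV_quotient[OF GD[OF True], of "G y"]])
      have "(u0 (y + (1 / real (Suc n)) *\<^sub>R G y) - u0 y) / (1 / real (Suc n)) \<le> K * norm (G y)" for n
        using dq[of "1 / real (Suc n)" y "G y"] by (rule order_trans[OF abs_ge_self]) simp
      then show "\<exists>N. \<forall>n\<ge>N. (u0 (y + (1 / real (Suc n)) *\<^sub>R G y) - u0 y) / (1 / real (Suc n)) \<le> K * norm (G y)" by blast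
    qed
    then have "norm (G y) * norm (G y) \<le> K * norm (G y)" by (simp add: power2_norm_eq_inner[symmetric] power2_eq_square)
    then have "norm (G y) \<le> K" by (cases "norm (G y) = 0") (use K in auto)
    then show ?thesis by (simp add: c0_def add_increasing2)
  next
    case False
    then have "\<not> GDERIV u0 y :> g" for g by (auto simp: gderiv_def differentiable_def)
    then show ?thesis using K by (simp add: G_def grad_def c0_def)
  qed
  define B where "B = 2 * K + c0"
  have B0: "0 \<le> B" using K by (simp add: B_def c0_def)
  define H where "H y z = u0 (y + \<eta> i z) - u0 y - \<eta> i z \<bullet> G y" for y z
  have [measurable]: "case_prod H \<in> borel_measurable (lborel \<Otimes>\<^sub>M \<nu>)"
    unfolding H_def case_prod_beta' by measurable
  have Hm[measurable]: "H y \<in> borel_measurable \<nu>" for y unfolding H_def by measurable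
  \<comment> \<open>For Lipschitz \<open>u0\<close> the integrand is only of first order in the
    jump, and \<open>r\<close> is known to be integrable only away from the origin. This is why
    Fubini is applied for \<open>norm z \<ge> \<kappa>\<close> alone.\<close>
  have Hb: "\<bar>H y z\<bar> \<le> B * r z" if "z \<noteq> 0" for y z
  proof -
    have 1: "\<bar>u0 (y + \<eta> i z) - u0 y\<bar> \<le> K * norm (\<eta> i z)" using lip[of "y + \<eta> i z" y] by simp
    have 2: "\<bar>\<eta> i z \<bullet> G y\<bar> \<le> norm (\<eta> i z) * (K + c0)" by (rule abs_inner_le[OF order_refl Gb])
    have "\<bar>H y z\<bar> \<le> B * norm (\<eta> i z)" using 1 2 unfolding H_def B_def by (simp add: algebra_simps)
    also have "\<dots> \<le> B * r z" by (rule mult_left_mono[OF \<eta>_le[OF i that] B0])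
    finally show ?thesis .
  qed
  have wx: "?w (x + h) = (\<integral>y. \<psi> y * u0 (y + h) \<partial>lborel)" for h
  proof -
    have mm: "mollifier \<epsilon> \<in> borel_measurable (borel :: (real^'n) measure)" by (rule mollifier_measurable[OF \<epsilon>])
    have "?w (x + h) = (\<integral>y. mollifier \<epsilon> (x + h - (h + 1 *\<^sub>R y)) * u0 (h + 1 *\<^sub>R y) \<partial>lborel)"
      unfolding mollify_eq[OF \<epsilon> uc] using mm by (subst lborel_integral_affine[of 1 _ h]) auto
    then show ?thesis by (simp add: \<psi>_def add.commute)
  qed
  have shift_c: "continuous_on UNIV (\<lambda>y. u0 (y + h))" for h
    by (rule continuous_on_compose2[OF uc]) (auto intro!: continuous_intros)
  have \<psi>u: "integrable lborel (\<lambda>y. \<psi> y * u0 (y + h))" for h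
  proof (rule integrable_compact_support[of _ \<epsilon> x])
    have "continuous_on UNIV \<psi>" unfolding \<psi>_def[abs_def]
      by (rule continuous_on_compose2[OF continuous_mollifier[OF \<epsilon>, of UNIV]]) (auto intro!: continuous_intros)
    then show "continuous_on UNIV (\<lambda>y. \<psi> y * u0 (y + h))" by (intro continuous_on_mult shift_c)
  qed (simp add: \<psi>_def mollifier_support[OF \<epsilon>] norm_minus_commute)
  have \<psi>G: "integrable lborel (\<lambda>y. \<psi> y * (h \<bullet> G y))" for h
  proof (rule Bochner_Integration.integrable_bound[of _ "\<lambda>y. \<psi> y * (norm h * (K + c0))"])
    show "integrable lborel (\<lambda>y. \<psi> y * (norm h * (K + c0)))" by (intro integrable_mult_left \<psi>i)
    have le: "\<bar>\<psi> y * (h \<bullet> G y)\<bar> \<le> \<psi> y * (norm h * (K + c0))" for y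
      using mult_left_mono[OF abs_inner_le[OF order_refl Gb, of h y] \<psi>0[of y]] by (simp add: abs_mult \<psi>0)
    show "AE y in lborel. norm (\<psi> y * (h \<bullet> G y)) \<le> norm (\<psi> y * (norm h * (K + c0)))"
      unfolding real_norm_def by (intro AE_I2 order_trans[OF le abs_ge_self])
  qed measurable
  \<comment> \<open>The gradient passes under the mollification: difference quotients of
    \<open>u0\<close> converge almost everywhere and are dominated by
    \<open>K * norm h\<close>.\<close>
  have wg: "h \<bullet> g = (\<integral>y. \<psi> y * (h \<bullet> G y) \<partial>lborel)" for h
  proof (rule LIMSEQ_unique[OF GDERIV_quotient[OF g, of h]])
    let ?s = "\<lambda>n. 1 / real (Suc n)"
    let ?q = "\<lambda>n y. \<psi> y * ((u0 (y + ?s n *\<^sub>R h) - u0 y) / ?s n)"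
    have "(?w (x + ?s n *\<^sub>R h) - ?w x) / ?s n = (\<integral>y. ?q n y \<partial>lborel)" for n
    proof -
      have "?w (x + ?s n *\<^sub>R h) - ?w x = (\<integral>y. \<psi> y * (u0 (y + ?s n *\<^sub>R h) - u0 y) \<partial>lborel)"
        using wx[of "?s n *\<^sub>R h"] wx[of 0] \<psi>u[of "?s n *\<^sub>R h"] \<psi>u[of 0] by (simp add: right_diff_distrib)
      then have "(?w (x + ?s n *\<^sub>R h) - ?w x) / ?s n = (\<integral>y. \<psi> y * (u0 (y + ?s n *\<^sub>R h) - u0 y) / ?s n \<partial>lborel)"
        by (simp only: integral_divide_zero)
      then show ?thesis by (simp only: times_divide_eq_right)
    qed
    moreover have "(\<lambda>n. \<integral>y. ?q n y \<partial>lborel) \<longlonglongrightarrow> (\<integral>y. \<psi> y * (h \<bullet> G y) \<partial>lborel)"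
    proof (rule integral_dominated_convergence[where w = "\<lambda>y. \<psi> y * (K * norm h)"])
      show "integrable lborel (\<lambda>y. \<psi> y * (K * norm h))" by (intro integrable_mult_left \<psi>i)
      show "AE y in lborel. (\<lambda>n. ?q n y) \<longlonglongrightarrow> \<psi> y * (h \<bullet> G y)"
        using aeD by eventually_elim (intro tendsto_mult tendsto_const GDERIV_quotient GD)
      show "AE y in lborel. norm (?q n y) \<le> \<psi> y * (K * norm h)" for n
      proof (rule AE_I2)
        fix y
        have "\<bar>(u0 (y + ?s n *\<^sub>R h) - u0 y) / ?s n\<bar> \<le> K * norm h"
          by (rule dq) simp
        from mult_left_mono[OF this \<psi>0[of y]] show "norm (?q n y) \<le> \<psi> y * (K * norm h)"
          by (simp only: real_norm_def abs_mult abs_of_nonneg[OF \<psi>0])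
      qed
    qed measurable
    ultimately show "(\<lambda>n. (?w (x + ?s n *\<^sub>R h) - ?w x) / ?s n) \<longlonglongrightarrow> (\<integral>y. \<psi> y * (h \<bullet> G y) \<partial>lborel)" by simp
  qed
  have wH: "?w (x + \<eta> i z) - ?w x - \<eta> i z \<bullet> g = (\<integral>y. \<psi> y * H y z \<partial>lborel)" for z
    using wx[of "\<eta> i z"] wx[of 0] \<psi>u[of "\<eta> i z"] \<psi>u[of 0] \<psi>G[of "\<eta> i z"]
    by (simp add: wg H_def right_diff_distrib)
  interpret nu: sigma_finite_measure \<nu> by (rule sigma_finite_\<nu>)
  interpret P: pair_sigma_finite "lborel :: (real^'n) measure" \<nu> ..
  define Il where "Il y = (\<integral>z. H y z \<partial>\<nu>)" for y
  define Ik where "Ik \<kappa> y = (LINT z:{z. norm z < \<kappa>}|\<nu>. H y z)" for \<kappa> y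
  define Jk where "Jk \<kappa> y = (LINT z:{z. \<kappa> \<le> norm z}|\<nu>. H y z)" for \<kappa> y
  have [measurable]: "Il \<in> borel_measurable borel"
    unfolding Il_def[abs_def] using nu.borel_measurable_lebesgue_integral[of H lborel] by simp
  have K0: "0 \<le> K0"
  proof -
    have "\<exists>y. \<bar>Il y\<bar> \<le> K0"
    proof (rule ccontr)
      assume "\<not> ?thesis"
      with ae have "AE y in (lborel :: (real^'n) measure). False" unfolding Il_def H_def G_def by auto
      then have "ae_filter (lborel :: (real^'n) measure) = bot" by (simp add: trivial_limit_def)
      then show False by (simp add: ae_filter_eq_bot_iff emeasure_lborel_UNIV)
    qed
    then show ?thesis using abs_ge_zero order_trans by blast
  qed
  \<comment> \<open>Fubini yields the \<psi>-average of \<open>Jk \<kappa>\<close>, which almost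
    everywhere is \<open>Il - Ik \<kappa>\<close>. The average of \<open>Il\<close> is at most
    \<open>K0\<close>; that of \<open>Ik \<kappa>\<close> is left over and vanishes in the
    limit.\<close>
  have F: "\<bar>LINT z:{z. \<kappa> \<le> norm z}|\<nu>. ?w (x + \<eta> i z) - ?w x - \<eta> i z \<bullet> g\<bar> \<le> K0 + \<bar>\<integral>y. \<psi> y * Ik \<kappa> y \<partial>lborel\<bar>"
    if \<kappa>: "0 < \<kappa>" for \<kappa>
  proof -
    let ?T = "{z. \<kappa> \<le> norm z}"
    note [measurable] = tail_sets(1)[OF \<kappa>]
    define R1 where "R1 = (LINT z:?T|\<nu>. r z)"
    have Ti: "integrable \<nu> (\<lambda>z. indicator ?T z * H y z)" and Tb: "(\<integral>z. \<bar>indicator ?T z * H y z\<bar> \<partial>\<nu>) \<le> B * R1" for y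
    proof -
      have ri: "integrable \<nu> (\<lambda>z. B * (indicator ?T z * r z))"
        using r_tail_integrable[OF \<kappa>] by (simp add: set_integrable_def)
      have le: "\<bar>indicator ?T z * H y z\<bar> \<le> B * (indicator ?T z * r z)" if "z \<in> space \<nu>" for z
        using Hb[of z y] that by (auto simp: space_\<nu> indicator_def)
      show i1: "integrable \<nu> (\<lambda>z. indicator ?T z * H y z)"
      proof (rule Bochner_Integration.integrable_bound[OF ri])
        show "AE z in \<nu>. norm (indicator ?T z * H y z) \<le> norm (B * (indicator ?T z * r z))"
          using le by (intro AE_I2) (force intro: order_trans)
      qed measurable
      have "(\<integral>z. \<bar>indicator ?T z * H y z\<bar> \<partial>\<nu>) \<le> (\<integral>z. B * (indicator ?T z * r z) \<partial>\<nu>)"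
        using le i1 ri by (intro integral_mono integrable_abs) auto
      then show "(\<integral>z. \<bar>indicator ?T z * H y z\<bar> \<partial>\<nu>) \<le> B * R1"
        by (simp add: R1_def set_lebesgue_integral_def)
    qed
    let ?f = "\<lambda>y z. \<psi> y * (indicator ?T z * H y z)"
    have fm[measurable]: "case_prod ?f \<in> borel_measurable (lborel \<Otimes>\<^sub>M \<nu>)" unfolding case_prod_beta' by measurable
    have nm: "(\<integral>z. norm (?f y z) \<partial>\<nu>) = \<psi> y * (\<integral>z. \<bar>indicator ?T z * H y z\<bar> \<partial>\<nu>)" for y
      by (simp add: abs_mult \<psi>0)
    have fi: "integrable (lborel \<Otimes>\<^sub>M \<nu>) (case_prod ?f)"
    proof (rule P.Fubini_integrable[OF fm])
      show "integrable lborel (\<lambda>y. \<integral>z. norm (case_prod ?f (y, z)) \<partial>\<nu>)"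
      proof (rule Bochner_Integration.integrable_bound[of _ "\<lambda>y. \<psi> y * (B * R1)"])
        show "integrable lborel (\<lambda>y. \<psi> y * (B * R1))" by (intro integrable_mult_left \<psi>i)
        show "AE y in lborel. norm (\<integral>z. norm (case_prod ?f (y, z)) \<partial>\<nu>) \<le> norm (\<psi> y * (B * R1))"
        proof (rule AE_I2)
          fix y
          have "0 \<le> (\<integral>z. norm (?f y z) \<partial>\<nu>)" by simp
          moreover have "(\<integral>z. norm (?f y z) \<partial>\<nu>) \<le> \<psi> y * (B * R1)" unfolding nm by (rule mult_left_mono[OF Tb \<psi>0])
          ultimately show "norm (\<integral>z. norm (case_prod ?f (y, z)) \<partial>\<nu>) \<le> norm (\<psi> y * (B * R1))" by simp
        qed
      qed (use nu.borel_measurable_lebesgue_integral[of "\<lambda>y z. norm (?f y z)" lborel] in measurable)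
      show "AE y in lborel. integrable \<nu> (\<lambda>z. case_prod ?f (y, z))" using Ti by (intro AE_I2) simp
    qed
    have "(LINT z:?T|\<nu>. ?w (x + \<eta> i z) - ?w x - \<eta> i z \<bullet> g) = (\<integral>z. (\<integral>y. ?f y z \<partial>lborel) \<partial>\<nu>)"
    proof -
      have "(\<integral>y. \<psi> y * (c * H y z) \<partial>lborel) = c * (\<integral>y. \<psi> y * H y z \<partial>lborel)" for c z
        by (simp only: mult.left_commute[of _ c] integral_mult_right_zero)
      then show ?thesis unfolding set_lebesgue_integral_def wH by simp
    qed
    also have "\<dots> = (\<integral>y. (\<integral>z. ?f y z \<partial>\<nu>) \<partial>lborel)" by (rule P.Fubini_integral[OF fi])
    also have "\<dots> = (\<integral>y. \<psi> y * Jk \<kappa> y \<partial>lborel)" by (simp add: Jk_def set_lebesgue_integral_def)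
    finally have FJ: "(LINT z:?T|\<nu>. ?w (x + \<eta> i z) - ?w x - \<eta> i z \<bullet> g) = (\<integral>y. \<psi> y * Jk \<kappa> y \<partial>lborel)" .
    have Jm[measurable]: "Jk \<kappa> \<in> borel_measurable borel"
    proof -
      have "case_prod (\<lambda>y z. indicator ?T z *\<^sub>R H y z) \<in> borel_measurable (lborel \<Otimes>\<^sub>M \<nu>)" unfolding case_prod_beta' by measurable
      from nu.borel_measurable_lebesgue_integral[OF this] show ?thesis by (simp add: Jk_def[abs_def] set_lebesgue_integral_def)
    qed
    have Jb: "\<bar>Jk \<kappa> y\<bar> \<le> B * R1" for y
      unfolding Jk_def set_lebesgue_integral_def using order_trans[OF integral_abs_bound Tb] by simp
    have Ji: "integrable lborel (\<lambda>y. \<psi> y * Jk \<kappa> y)"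
    proof (rule Bochner_Integration.integrable_bound[of _ "\<lambda>y. \<psi> y * (B * R1)"])
      show "integrable lborel (\<lambda>y. \<psi> y * (B * R1))" by (intro integrable_mult_left \<psi>i)
      show "AE y in lborel. norm (\<psi> y * Jk \<kappa> y) \<le> norm (\<psi> y * (B * R1))"
        unfolding real_norm_def
      proof (intro AE_I2 order_trans[OF _ abs_ge_self])
        show "\<bar>\<psi> y * Jk \<kappa> y\<bar> \<le> \<psi> y * (B * R1)" for y
          using mult_left_mono[OF Jb \<psi>0] by (simp add: abs_mult \<psi>0)
      qed
    qed measurable
    have aeI: "AE y in lborel. \<bar>Il y\<bar> \<le> K0" using ae unfolding Il_def H_def G_def by eventually_elim simp
    have Ii: "integrable lborel (\<lambda>y. \<psi> y * Il y)"
    proof (rule Bochner_Integration.integrable_bound[of _ "\<lambda>y. \<psi> y * K0"])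
      show "integrable lborel (\<lambda>y. \<psi> y * K0)" by (intro integrable_mult_left \<psi>i)
      show "AE y in lborel. norm (\<psi> y * Il y) \<le> norm (\<psi> y * K0)"
        using aeI by eventually_elim (use \<psi>0 K0 in \<open>simp add: abs_mult mult_left_mono\<close>)
    qed measurable
    have "(\<integral>y. \<psi> y * Ik \<kappa> y \<partial>lborel) = (\<integral>y. \<psi> y * Il y - \<psi> y * Jk \<kappa> y \<partial>lborel)"
    proof (rule integral_cong_AE)
      have ind: "(\<lambda>z. indicator {z. norm z < \<kappa>} z *\<^sub>R H y z) = (\<lambda>z. if norm z < \<kappa> then H y z else 0)" for y by auto
      have "case_prod (\<lambda>y z. if norm z < \<kappa> then H y z else 0) \<in> borel_measurable (lborel \<Otimes>\<^sub>M \<nu>)" unfolding case_prod_beta' by measurable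
      from nu.borel_measurable_lebesgue_integral[OF this]
      have "Ik \<kappa> \<in> borel_measurable borel" by (simp add: Ik_def[abs_def] set_lebesgue_integral_def ind[simplified])
      then show "(\<lambda>y. \<psi> y * Ik \<kappa> y) \<in> borel_measurable lborel" by measurable
      show "(\<lambda>y. \<psi> y * Il y - \<psi> y * Jk \<kappa> y) \<in> borel_measurable lborel" by measurable
      show "AE y in lborel. \<psi> y * Ik \<kappa> y = \<psi> y * Il y - \<psi> y * Jk \<kappa> y"
        using ae
      proof eventually_elim
        case (elim y)
        then have hi: "integrable \<nu> (H y)" by (simp add: H_def[abs_def] G_def)
        have "Ik \<kappa> y = (\<integral>z. H y z - indicator ?T z * H y z \<partial>\<nu>)"
          unfolding Ik_def set_lebesgue_integral_def
          by (intro Bochner_Integration.integral_cong refl) (auto simp: indicator_def)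
        also have "\<dots> = Il y - Jk \<kappa> y"
          using hi Ti by (simp add: Il_def Jk_def set_lebesgue_integral_def)
        finally show ?case by (simp add: right_diff_distrib)
      qed
    qed
    also have "\<dots> = (\<integral>y. \<psi> y * Il y \<partial>lborel) - (\<integral>y. \<psi> y * Jk \<kappa> y \<partial>lborel)" using Ii Ji by simp
    finally have eq: "(\<integral>y. \<psi> y * Jk \<kappa> y \<partial>lborel) = (\<integral>y. \<psi> y * Il y \<partial>lborel) - (\<integral>y. \<psi> y * Ik \<kappa> y \<partial>lborel)" by simp
    have "\<bar>\<integral>y. \<psi> y * Il y \<partial>lborel\<bar> \<le> (\<integral>y. \<bar>\<psi> y * Il y\<bar> \<partial>lborel)" by (rule integral_abs_bound)
    also have "\<dots> \<le> (\<integral>y. \<psi> y * K0 \<partial>lborel)"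
    proof (rule integral_mono_AE)
      show "AE y in lborel. \<bar>\<psi> y * Il y\<bar> \<le> \<psi> y * K0"
        using aeI by eventually_elim (use \<psi>0 in \<open>simp add: abs_mult mult_left_mono\<close>)
    qed (use Ii \<psi>i in auto)
    also have "\<dots> = K0" by (simp add: \<psi>1)
    finally show ?thesis unfolding FJ eq by linarith
  qed
  \<comment> \<open>The band between \<kappa> and \<delta> is charged to the curvature of the
    mollified function, uniformly in \<kappa>.\<close>
  have jr: "\<bar>LINT z:jumps|\<nu>. ?w (x + \<eta> i z) - ?w x - \<eta> i z \<bullet> g\<bar> - R * m2 \<le> \<bar>LINT z:{z. \<kappa> \<le> norm z}|\<nu>. ?w (x + \<eta> i z) - ?w x - \<eta> i z \<bullet> g\<bar>"
    if \<kappa>: "0 < \<kappa>" "\<kappa> < \<delta>" for \<kappa>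
  proof -
    let ?h = "\<lambda>z. ?w (x + \<eta> i z) - ?w x - \<eta> i z \<bullet> g"
    have "continuous_on UNIV ?w"
    proof -
      obtain D D2 where "C2_with UNIV ?w D D2" using C2_on_mollify[OF \<epsilon> uc] by (auto simp: C2_on_def)
      then have "(?w has_derivative blinfun_apply (D p)) (at p)" for p by (simp add: C2_with_def)
      then show ?thesis by (intro continuous_at_imp_continuous_on ballI has_derivative_continuous)
    qed
    then have [measurable]: "?w \<in> borel_measurable borel" by (rule borel_measurable_continuous_onI)
    have hm[measurable]: "?h \<in> borel_measurable \<nu>" by measurable
    note [measurable] = tail_sets(1)[OF \<kappa>(1)]
    have hB: "\<bar>?h z\<bar> \<le> B * r z" if "z \<noteq> 0" for z
    proof -
      have "\<bar>\<integral>y. \<psi> y * H y z \<partial>lborel\<bar> \<le> (\<integral>y. \<bar>\<psi> y * H y z\<bar> \<partial>lborel)" by (rule integral_abs_bound)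
      also have "\<dots> \<le> (\<integral>y. \<psi> y * (B * r z) \<partial>lborel)"
      proof (rule integral_mono')
        show "integrable lborel (\<lambda>y. \<psi> y * (B * r z))" by (intro integrable_mult_left \<psi>i)
        show "\<bar>\<psi> y * H y z\<bar> \<le> \<psi> y * (B * r z)" for y using Hb[OF that] \<psi>0 by (simp add: abs_mult mult_left_mono)
        show "0 \<le> \<psi> y * (B * r z)" for y using \<psi>0 B0 r_pos_part[OF that] by simp
      qed
      also have "\<dots> = B * r z" by (simp add: \<psi>1)
      finally show ?thesis unfolding wH .
    qed
    have tint: "set_integrable \<nu> {z. \<kappa> \<le> norm z} ?h"
      by (rule set_integral_dominated(1)[OF set_integrable_mult_right[OF r_tail_integrable[OF \<kappa>(1)], of B]])
        (use hB in \<open>auto simp: set_borel_measurable_def space_\<nu>\<close>)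
    have jint: "set_integrable \<nu> jumps ?h"
      by (rule jumps_integral_bound(1)[OF hm, of 0 B]) (use hB jumps_nonzero in simp)
    define A where "A = {z. \<kappa> \<le> norm z} - jumps"
    have [measurable]: "A \<in> sets \<nu>" unfolding A_def by (intro sets.Diff tail_sets \<kappa> jumps_sets)
    have aint: "set_integrable \<nu> A ?h" by (rule set_integrable_subset[OF tint]) (auto simp: A_def)
    have "{z. \<kappa> \<le> norm z} = jumps \<union> A" using \<kappa> by (auto simp: A_def jumps_def)
    then have "(LINT z:{z. \<kappa> \<le> norm z}|\<nu>. ?h z) = (LINT z:jumps|\<nu>. ?h z) + (LINT z:A|\<nu>. ?h z)"
      using set_integral_Un[OF _ jint aint] by (auto simp: A_def)
    moreover have "\<bar>LINT z:A|\<nu>. ?h z\<bar> \<le> R * m2"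
    proof -
      have le: "\<bar>indicator A z * ?h z\<bar> \<le> R * (indicator {z. norm z \<le> \<delta>} z * (r z)\<^sup>2)" if "z \<in> space \<nu>" for z
      proof (cases "z \<in> A")
        case True
        have z: "z \<noteq> 0" "norm z \<le> \<delta>" using True that by (auto simp: A_def jumps_def space_\<nu>)
        have "(norm (\<eta> i z))\<^sup>2 \<le> (r z)\<^sup>2" using \<eta>_le[OF i z(1)] by (intro power_mono) auto
        then have "R * (norm (\<eta> i z))\<^sup>2 \<le> R * (r z)\<^sup>2" by (rule mult_left_mono[OF _ R])
        then show ?thesis using tay[of "\<eta> i z"] True z by simp
      qed (use R in simp)
      have "\<bar>LINT z:A|\<nu>. ?h z\<bar> \<le> (\<integral>z. \<bar>indicator A z * ?h z\<bar> \<partial>\<nu>)"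
        unfolding set_lebesgue_integral_def real_scaleR_def by (rule integral_abs_bound)
      also have "\<dots> \<le> (\<integral>z. R * (indicator {z. norm z \<le> \<delta>} z * (r z)\<^sup>2) \<partial>\<nu>)"
        using le aint small_square_integrable[of \<delta>] by (intro integral_mono integrable_abs integrable_mult_right) (auto simp: set_integrable_def)
      also have "\<dots> = R * m2" by (simp add: m2_def set_lebesgue_integral_def)
      finally show ?thesis .
    qed
    ultimately show ?thesis by linarith
  qed
  have "((\<lambda>\<kappa>. K0 + \<bar>\<integral>y. \<psi> y * Ik \<kappa> y \<partial>lborel\<bar>) \<longlongrightarrow> K0 + \<bar>0\<bar>) (at_right 0)"
    using distr unfolding \<psi>_def Ik_def H_def G_def by (intro tendsto_add tendsto_const tendsto_rabs)
  then have "\<bar>LINT z:jumps|\<nu>. ?w (x + \<eta> i z) - ?w x - \<eta> i z \<bullet> g\<bar> - R * m2 \<le> K0 + \<bar>0\<bar>"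
  proof (rule tendsto_lowerbound)
    have "\<forall>\<^sub>F \<kappa> in at_right 0. \<kappa> \<in> {0<..<\<delta>}" by (rule eventually_at_right_real[OF \<delta>(1)])
    then show "\<forall>\<^sub>F \<kappa> in at_right 0. \<bar>LINT z:jumps|\<nu>. ?w (x + \<eta> i z) - ?w x - \<eta> i z \<bullet> g\<bar> - R * m2 \<le> K0 + \<bar>\<integral>y. \<psi> y * Ik \<kappa> y \<partial>lborel\<bar>"
      by eventually_elim (use jr F in \<open>auto intro: order_trans\<close>)
  qed simp
  then show ?thesis by simp
qed

end

section \<open>The one-sided estimate\<close>

lemma le_of_vanishing_weight:
  fixes x y z :: real
  assumes "\<And>\<mu>. 0 < \<mu> \<Longrightarrow> x \<le> y + \<mu> * z"
  shows "x \<le> y"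
proof (rule field_le_epsilon)
  fix e :: real assume "0 < e"
  then have "0 < e / (\<bar>z\<bar> + 1)" by (simp add: add_nonneg_pos)
  then have "x \<le> y + e / (\<bar>z\<bar> + 1) * z" by (rule assms)
  also have "e / (\<bar>z\<bar> + 1) * z \<le> e / (\<bar>z\<bar> + 1) * (\<bar>z\<bar> + 1)"
    using \<open>0 < e / (\<bar>z\<bar> + 1)\<close> by (intro mult_left_mono) auto
  also have "\<dots> = e" by (simp add: add_nonneg_eq_0_iff)
  finally show "x \<le> y + e" by simp
qed

context isaacs_data begin

text \<open>A function with slope and curvature at most 1 whose growth makes maxima exist on the
  unbounded space.\<close>

lemma weight_profile:
  obtains gq Lq where "smooth_profile (smoothed_norm 1) gq 1 1 Lq" "0 \<le> Lq"
proof -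
  have p: "smooth_profile (smoothed_norm 1) (\<lambda>y. y /\<^sub>R smoothed_norm 1 y) 1 1 (jump_modulus 1 1)"
    using smooth_profile_smoothed_norm[of 1 0] by simp
  moreover obtain i where "i \<in> I" using I_nonempty by blast
  then have "0 \<le> jump_modulus 1 1" using smooth_profileD(7)[OF p] abs_ge_zero order_trans by blast
  ultimately show ?thesis by (rule that)
qed

lemma smooth_profile_const: "smooth_profile (\<lambda>_. k) (\<lambda>_. 0) 0 0 0"
  unfolding smooth_profile_def by (simp add: C2_on_const GDERIV_const)

text \<open>Subtracting a small multiple of the smoothed norm makes any profile coercive from above.
  Each constant of the barrier changes by a multiple of \<mu>, and \<mu> tends to 0.\<close>

lemma visc_lower_boundary:
  assumes G: "game_operator I G" and f: "source f" and u: "visc_super G f u" "bounded_cont M u"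
    and w: "smooth_profile w g P R L0" and w0: "\<And>y. w y \<le> u 0 y" and uK: "\<And>y. u 0 y \<le> K"
    and s: "s \<in> {0..T}"
  shows "w y - (K + K * K + K * P + L0 + R * m2) * s \<le> u s y"
proof -
  obtain gq Lq where q: "smooth_profile (smoothed_norm 1) gq 1 1 Lq" "0 \<le> Lq" by (rule weight_profile)
  have "w y - (K + K * K + K * P + L0 + R * m2) * s \<le> u s y + \<mu> * (smoothed_norm 1 y + (K + Lq + m2) * s)" if \<mu>: "0 < \<mu>" for \<mu>
  proof -
  let ?q = "smoothed_norm 1 :: real^'n \<Rightarrow> real"
  have q1: "norm y \<le> ?q y" "0 \<le> ?q y" for y
    using smoothed_norm_bounds(1)[of 1 y] norm_ge_zero[of y] by linarith+
  have q2: "0 \<le> \<mu> * ?q y" for y using \<mu> q1(2)[of y] by simp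
  let ?w = "\<lambda>y. w y + (0 + (- \<mu>) * ?q y)"
  have sp: "smooth_profile ?w (\<lambda>y. g y + (- \<mu>) *\<^sub>R gq y) (P + \<bar>- \<mu>\<bar> * 1) (R + \<bar>- \<mu>\<bar> * 1) (L0 + \<bar>- \<mu>\<bar> * Lq)"
    by (rule smooth_profile_add[OF w smooth_profile_affine[OF q(1)]])
  have "?w y - (K + K * K + K * (P + \<bar>- \<mu>\<bar> * 1) + (L0 + \<bar>- \<mu>\<bar> * Lq) + (R + \<bar>- \<mu>\<bar> * 1) * m2) * s \<le> u s y"
  proof (rule visc_lower_barrier[OF G f u sp _ _ _ order_refl s])
    show le: "?w y \<le> u 0 y" for y using w0[of y] q2[of y] by simp
    then show "?w y \<le> K" for y using uK[of y] order_trans by blast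
    fix B
    have "{y. B \<le> ?w y} \<subseteq> cball 0 ((K - B) / \<mu>)"
    proof
      fix y assume y: "y \<in> {y. B \<le> ?w y}"
      have "w y \<le> K" using w0[of y] uK[of y] by linarith
      then have "\<mu> * ?q y \<le> K - B" using y by simp
      moreover have "\<mu> * norm y \<le> \<mu> * ?q y" using \<mu> q1[of y] by (intro mult_left_mono) auto
      ultimately have "\<mu> * norm y \<le> K - B" by linarith
      then have "norm y \<le> (K - B) / \<mu>" using \<mu> by (simp add: pos_le_divide_eq mult.commute)
      then show "y \<in> cball 0 ((K - B) / \<mu>)" by simp
    qed
    then show "bounded {y. B \<le> ?w y}" by (rule bounded_subset[OF bounded_cball])
  qed
  then show ?thesis using \<mu> by (simp add: algebra_simps)
  qed
  then show ?thesis by (rule le_of_vanishing_weight)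
qed

text \<open>The profile may depend on \<open>y0\<close> while its constants may not. A cone with
  vertex \<open>y0\<close> is therefore as good as a global smooth approximation.\<close>

definition approximable :: "(real^'n \<Rightarrow> real) \<Rightarrow> real \<Rightarrow> real \<Rightarrow> real \<Rightarrow> real \<Rightarrow> bool" where
  "approximable u0 P R L0 E \<longleftrightarrow> (\<forall>y0.
     (\<exists>w g. smooth_profile w g P R L0 \<and> (\<forall>y. u0 y \<le> w y) \<and> w y0 \<le> u0 y0 + E) \<and>
     (\<exists>w g. smooth_profile w g P R L0 \<and> (\<forall>y. w y \<le> u0 y) \<and> u0 y0 - E \<le> w y0))"

lemma approximable_uminus:
  assumes "approximable u0 P R L0 E" shows "approximable (\<lambda>y. - u0 y) P R L0 E"
  unfolding approximable_def
proof (intro allI conjI)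
  fix y0
  obtain w g where w: "smooth_profile w g P R L0" "\<And>y. w y \<le> u0 y" "u0 y0 - E \<le> w y0"
    using assms unfolding approximable_def by blast
  have "smooth_profile (\<lambda>y. 0 + (- 1) * w y) (\<lambda>y. (- 1) *\<^sub>R g y) P R L0"
    using smooth_profile_affine[OF w(1), of 0 "- 1"] by simp
  then show "\<exists>w g. smooth_profile w g P R L0 \<and> (\<forall>y. - u0 y \<le> w y) \<and> w y0 \<le> - u0 y0 + E"
    using w(2,3) by (intro exI[of _ "\<lambda>y. 0 + (- 1) * w y"] exI[of _ "\<lambda>y. (- 1) *\<^sub>R g y"]) simp
next
  fix y0
  obtain w g where w: "smooth_profile w g P R L0" "\<And>y. u0 y \<le> w y" "w y0 \<le> u0 y0 + E"
    using assms unfolding approximable_def by blast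
  have "smooth_profile (\<lambda>y. 0 + (- 1) * w y) (\<lambda>y. (- 1) *\<^sub>R g y) P R L0"
    using smooth_profile_affine[OF w(1), of 0 "- 1"] by simp
  then show "\<exists>w g. smooth_profile w g P R L0 \<and> (\<forall>y. w y \<le> - u0 y) \<and> - u0 y0 - E \<le> w y0"
    using w(2,3) by (intro exI[of _ "\<lambda>y. 0 + (- 1) * w y"] exI[of _ "\<lambda>y. (- 1) *\<^sub>R g y"]) simp
qed

end

text \<open>The coefficients collected in \<open>estimate_arith\<close>: 1 and
  \<open>K\<^sup>2\<close> from the terms at time zero, the others from the rate of
  \<open>doubling_comparison\<close>, with \<open>T\<close> replaced by its bound
  \<open>Tm\<close>.\<close>

definition estimate_const :: "real \<Rightarrow> real \<Rightarrow> real \<Rightarrow> real" where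
  "estimate_const K Tm CS = (let M = K + (K + K * K) * Tm; Em = exp (K * (6 + M) * Tm)
     in 1 + K\<^sup>2 + 2 * (Tm * (K * (1 + M))) + K * (Tm * Tm) + Tm * (Em * (K * Tm + 1 / 2)) + Tm * (Em * CS))"

text \<open>\<open>\<tau>\<close> equalizes \<open>Lb\<^sup>2 * \<tau>\<close> and
  \<open>m * dt / \<tau>\<close>; in \<open>\<epsilon>\<close> the first summand equalizes
  \<epsilon> and \<open>m * S / \<epsilon>\<close>, and the second secures
  \<open>\<tau> \<le> \<epsilon>\<close>. The inequality \<open>T \<le> Tm * m\<close> converts the
  length of the time interval into \<open>m\<close>.\<close>

lemma estimate_arith:
  fixes K T Tm CS S dt Lb M :: real
  assumes K: "0 < K" and T: "0 < T" "T \<le> Tm" "1 \<le> Tm" and CS: "0 \<le> CS" and S: "0 < S" and dt: "0 < dt" "dt \<le> T" and Lb: "1 \<le> Lb"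
    and M: "M = K + (K + K * K) * Tm"
  defines "m \<equiv> min T 1"
  defines "\<tau> \<equiv> sqrt (dt * m) / Lb"
  defines "\<epsilon> \<equiv> sqrt (S * m) + \<tau>"
  shows "Lb\<^sup>2 * \<tau> / 2 + K\<^sup>2 * \<epsilon> / 2 + T * (K * (1 + M) * ((\<epsilon> + \<tau>) / 2) + K * dt + exp (K * (6 + M) * T) * ((K * T + 1 / 2) * (dt / \<tau>))
       + exp (K * (6 + M) * T) * (CS * S / (2 * \<epsilon>)))
    \<le> estimate_const K Tm CS * (sqrt (S * m) + Lb * sqrt (dt * m))"
proof -
  have m: "0 < m" "m \<le> 1" "m \<le> T" "T \<le> Tm * m"
    using T unfolding m_def by (auto simp: min_def intro: order_trans[of _ "1 * T"] mult_right_mono)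
  define a where "a = sqrt (S * m)"
  define d where "d = sqrt (dt * m)"
  have a: "0 < a" and d: "0 < d" using S m dt by (simp_all add: a_def d_def)
  have a2: "a * a = S * m" and d2: "d * d = dt * m" using S m dt by (simp_all add: a_def d_def)
  have \<tau>: "\<tau> = d / Lb" "0 < \<tau>" using d Lb by (simp_all add: \<tau>_def d_def)
  have \<tau>L: "\<tau> \<le> Lb * d"
  proof -
    have "\<tau> \<le> d / 1" unfolding \<tau>(1) using Lb d by (intro divide_left_mono) auto
    also have "\<dots> \<le> Lb * d" using mult_right_mono[OF Lb, of d] d by simp
    finally show ?thesis .
  qed
  have \<epsilon>: "\<epsilon> = a + \<tau>" by (simp add: \<epsilon>_def a_def)
  define Em where "Em = exp (K * (6 + M) * Tm)"
  have M0: "0 \<le> M" unfolding M using K T by simp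
  have Em: "exp (K * (6 + M) * T) \<le> Em" "0 < Em" unfolding Em_def using K M0 T by (auto intro!: mult_left_mono)
  define D where "D = Lb * d"
  have D: "0 < D" "d \<le> D" using Lb d mult_right_mono[OF Lb, of d] by (auto simp: D_def)
  have 1: "Lb\<^sup>2 * \<tau> / 2 = D / 2" using Lb by (simp add: \<tau>(1) D_def power2_eq_square)
  have 2: "K\<^sup>2 * \<epsilon> / 2 \<le> K\<^sup>2 * (a + D)"
  proof -
    have "\<epsilon> \<le> a + D" using \<tau>L by (simp add: \<epsilon> D_def)
    then have "K\<^sup>2 * \<epsilon> \<le> K\<^sup>2 * (a + D)" by (rule mult_left_mono) simp
    moreover have "0 \<le> K\<^sup>2 * \<epsilon>" using a \<tau> by (simp add: \<epsilon>)
    ultimately show ?thesis by linarith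
  qed
  have 3: "T * (K * (1 + M) * ((\<epsilon> + \<tau>) / 2)) \<le> Tm * (K * (1 + M)) * (2 * (a + D))"
  proof -
    have "(\<epsilon> + \<tau>) / 2 \<le> 2 * (a + D)" using \<tau>L a D \<tau> by (simp add: \<epsilon> D_def)
    then have "K * (1 + M) * ((\<epsilon> + \<tau>) / 2) \<le> K * (1 + M) * (2 * (a + D))" using K M0 by (intro mult_left_mono) auto
    then have "T * (K * (1 + M) * ((\<epsilon> + \<tau>) / 2)) \<le> Tm * (K * (1 + M) * (2 * (a + D)))"
      using K M0 T a \<tau> \<epsilon> by (intro mult_mono) auto
    then show ?thesis by simp
  qed
  have 4: "T * (K * dt) \<le> K * (Tm * Tm) * D"
  proof -
    have "dt \<le> Tm * m" using dt m by linarith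
    then have "dt * dt \<le> dt * (Tm * m)" using dt by (intro mult_left_mono) auto
    also have "\<dots> = Tm * (d * d)" unfolding d2 by simp
    also have "\<dots> \<le> (Tm * Tm) * (d * d)" using T by (intro mult_right_mono) auto
    finally have "dt\<^sup>2 \<le> (Tm * d)\<^sup>2" by (simp add: power2_eq_square mult_ac)
    then have "dt \<le> Tm * d" by (rule power2_le_imp_le) (use T d in simp)
    also have "\<dots> \<le> Tm * D" using D T by (intro mult_left_mono) auto
    finally have dtD: "dt \<le> Tm * D" .
    have "K * dt \<le> K * (Tm * D)" by (rule mult_left_mono[OF dtD]) (use K in simp)
    then have "T * (K * dt) \<le> Tm * (K * (Tm * D))" by (rule mult_mono[OF T(2)]) (use T K dt in simp_all)
    then show ?thesis by (simp add: mult_ac)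
  qed
  have 5: "T * (exp (K * (6 + M) * T) * ((K * T + 1 / 2) * (dt / \<tau>))) \<le> Tm * (Em * (K * Tm + 1 / 2)) * D"
  proof -
    have A: "T * (dt / \<tau>) \<le> Tm * D"
    proof -
      have "dt / \<tau> = D / m" using d2 m d Lb by (simp add: \<tau>(1) D_def field_simps)
      then have "T * (dt / \<tau>) = T / m * D" by simp
      also have "\<dots> \<le> Tm * D" using m D by (intro mult_right_mono) (auto simp: pos_divide_le_eq)
      finally show ?thesis .
    qed
    have B: "exp (K * (6 + M) * T) * (K * T + 1 / 2) \<le> Em * (K * Tm + 1 / 2)"
      using Em K T by (intro mult_mono add_mono mult_left_mono) auto
    have "0 \<le> Em * (K * Tm + 1 / 2)" "0 \<le> T * (dt / \<tau>)" using K T dt \<tau>(2) Em by simp_all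
    then have "(exp (K * (6 + M) * T) * (K * T + 1 / 2)) * (T * (dt / \<tau>)) \<le> (Em * (K * Tm + 1 / 2)) * (Tm * D)"
      by (rule mult_mono[OF B A])
    then show ?thesis by (simp only: mult_ac)
  qed
  have 6: "T * (exp (K * (6 + M) * T) * (CS * S / (2 * \<epsilon>))) \<le> Tm * (Em * CS) * a"
  proof -
    have "S / (2 * \<epsilon>) \<le> S / a" using S a \<tau> by (intro divide_left_mono) (auto simp: \<epsilon>)
    then have "T * (S / (2 * \<epsilon>)) \<le> T * (S / a)" using T by (intro mult_left_mono) auto
    also have "S / a = a / m" using a2 a m by (simp add: field_simps)
    also have "T * (a / m) = T / m * a" by simp
    also have "\<dots> \<le> Tm * a" using m a by (intro mult_right_mono) (auto simp: pos_divide_le_eq)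
    finally have A: "T * (S / (2 * \<epsilon>)) \<le> Tm * a" .
    have B: "exp (K * (6 + M) * T) * CS \<le> Em * CS" using Em CS by (intro mult_right_mono) auto
    have "0 \<le> \<epsilon>" using a \<tau>(2) by (simp add: \<epsilon>)
    then have "0 \<le> Em * CS" "0 \<le> T * (S / (2 * \<epsilon>))" using Em CS T S by simp_all
    then have "(exp (K * (6 + M) * T) * CS) * (T * (S / (2 * \<epsilon>))) \<le> (Em * CS) * (Tm * a)"
      by (rule mult_mono[OF B A])
    then show ?thesis by (simp add: mult_ac)
  qed
  define c1 c2 c3 c4 where "c1 = Tm * (K * (1 + M))" and "c2 = K * (Tm * Tm)" and "c3 = Tm * (Em * (K * Tm + 1 / 2))" and "c4 = Tm * (Em * CS)"
  have c: "0 \<le> c1" "0 \<le> c2" "0 \<le> c3" "0 \<le> c4" using K M0 T Em CS by (simp_all add: c1_def c2_def c3_def c4_def)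
  have C: "estimate_const K Tm CS = 1 + K\<^sup>2 + 2 * c1 + c2 + c3 + c4"
    by (simp add: estimate_const_def Let_def M Em_def c1_def c2_def c3_def c4_def)
  have "D / 2 + K\<^sup>2 * (a + D) + (c1 * (2 * (a + D)) + c2 * D + c3 * D + c4 * a) \<le> (1 + K\<^sup>2 + 2 * c1 + c2 + c3 + c4) * (a + D)"
  proof -
    have "0 \<le> a" "0 \<le> D / 2" "0 \<le> c2 * a" "0 \<le> c3 * a" "0 \<le> c4 * D" using c a D by simp_all
    moreover have "(1 + K\<^sup>2 + 2 * c1 + c2 + c3 + c4) * (a + D) - (D / 2 + K\<^sup>2 * (a + D) + (c1 * (2 * (a + D)) + c2 * D + c3 * D + c4 * a))
       = a + D / 2 + c2 * a + c3 * a + c4 * D" by (simp add: algebra_simps)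
    ultimately show ?thesis by linarith
  qed
  then show ?thesis
    unfolding C using 1 2 3 4 5 6 unfolding distrib_left[of T] c1_def[symmetric] c2_def[symmetric] c3_def[symmetric] c4_def[symmetric]
      a_def[symmetric] d_def[symmetric] D_def[symmetric] by linarith
qed

section \<open>Barriers for the scheme and the choice of the doubling parameters\<close>

context isaacs_scheme begin

lemma dt_le_T: "dt \<le> T"
proof -
  have "T = dt * real MT" using MT by simp
  then show ?thesis using mult_left_mono[of 1 "real MT" dt] MT dt_pos by simp
qed

lemma mesh_error_nonneg: "0 \<le> mesh_error"
  unfolding mesh_error_def using dx_pos K_pos m_nonneg' by simp

lemma scheme_upper_boundary:
  assumes G: "game_operator I G" and f: "source f" and U: "scheme G f U" "grid_bounded M U"
    and w: "smooth_profile w g P R L0" and w0: "\<And>j. U 0 (grid_pt dx j) \<le> w (grid_pt dx j)" and wK: "\<And>y. - K \<le> w y"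
    and n: "n \<le> MT"
  shows "U (real n * dt) (grid_pt dx j) \<le> w (grid_pt dx j) + (K + K * K + K * P + L0 + R * mesh_error) * (real n * dt)"
proof -
  obtain gq Lq where q: "smooth_profile (smoothed_norm 1) gq 1 1 Lq" "0 \<le> Lq" by (rule weight_profile)
  have "U (real n * dt) (grid_pt dx j) \<le> w (grid_pt dx j) + (K + K * K + K * P + L0 + R * mesh_error) * (real n * dt)
     + \<mu> * (smoothed_norm 1 (grid_pt dx j) + (K + Lq + mesh_error) * (real n * dt))" if \<mu>: "0 < \<mu>" for \<mu>
  proof -
  let ?q = "smoothed_norm 1 :: real^'n \<Rightarrow> real"
  have q1: "norm y \<le> ?q y" "0 \<le> ?q y" for y
    using smoothed_norm_bounds(1)[of 1 y] norm_ge_zero[of y] by linarith+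
  have q2: "0 \<le> \<mu> * ?q y" for y using \<mu> q1(2)[of y] by simp
  let ?w = "\<lambda>y. w y + (0 + \<mu> * ?q y)"
  have sp: "smooth_profile ?w (\<lambda>y. g y + \<mu> *\<^sub>R gq y) (P + \<bar>\<mu>\<bar> * 1) (R + \<bar>\<mu>\<bar> * 1) (L0 + \<bar>\<mu>\<bar> * Lq)"
    by (rule smooth_profile_add[OF w smooth_profile_affine[OF q(1)]])
  have "U (real n * dt) (grid_pt dx j) \<le> ?w (grid_pt dx j)
     + (K + K * K + K * (P + \<bar>\<mu>\<bar> * 1) + (L0 + \<bar>\<mu>\<bar> * Lq) + (R + \<bar>\<mu>\<bar> * 1) * mesh_error) * (real n * dt)"
  proof (rule scheme_upper_barrier[OF G f U sp _ _ _ order_refl n])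
    show "U 0 (grid_pt dx j) \<le> ?w (grid_pt dx j)" for j using w0[of j] q2[of "grid_pt dx j"] by simp
    show "- K \<le> ?w y" for y using wK[of y] q2[of y] by simp
    fix B
    have "{y. ?w y \<le> B} \<subseteq> cball 0 ((B + K) / \<mu>)"
    proof
      fix y assume y: "y \<in> {y. ?w y \<le> B}"
      then have "\<mu> * ?q y \<le> B + K" using wK[of y] by simp
      moreover have "\<mu> * norm y \<le> \<mu> * ?q y" using \<mu> q1[of y] by (intro mult_left_mono) auto
      ultimately have "\<mu> * norm y \<le> B + K" by linarith
      then have "norm y \<le> (B + K) / \<mu>" using \<mu> by (simp add: pos_le_divide_eq mult.commute)
      then show "y \<in> cball 0 ((B + K) / \<mu>)" by simp
    qed
    then show "bounded {y. ?w y \<le> B}" by (rule bounded_subset[OF bounded_cball])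
  qed
  then show ?thesis using \<mu> by (simp add: algebra_simps)
  qed
  then show ?thesis by (rule le_of_vanishing_weight)
qed

text \<open>\<open>budget\<close> leaves open how the barrier error is booked. The part of order one
  belongs into the slope \<open>Lb\<close>; curvature times \<open>m2 + mesh_error\<close> can be
  booked as a constant in \<open>E0\<close>, where it is not multiplied by
  \<open>sqrt dt\<close>.\<close>

lemma one_sided_estimate:
  assumes G: "game_operator I G" and f: "source f" and U: "scheme G f U" "grid_bounded MU U"
    and u: "visc_super G f u" "bounded_cont Mu u"
    and u0: "\<And>x y. \<bar>u0 x - u0 y\<bar> \<le> K * norm (x - y)" "\<And>x. \<bar>u0 x\<bar> \<le> K"
    and init: "\<And>j. U 0 (grid_pt dx j) = u0 (grid_pt dx j)" "\<And>y. u 0 y = u0 y"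
    and appr: "approximable u0 P R L0 E1"
    and Tm: "T \<le> Tm" "1 \<le> Tm" and S: "0 < S" "0 \<le> CS" "m2 + mesh_error \<le> CS * S"
    and Lb: "1 \<le> Lb" and E0: "0 \<le> E0"
    and budget: "\<And>t. t \<in> {0..T} \<Longrightarrow> E1 + (K + K * K + K * P + L0 + R * (m2 + mesh_error)) * t \<le> E0 + Lb * t"
    and n: "n \<le> MT"
  shows "U (real n * dt) (grid_pt dx j) - u (real n * dt) (grid_pt dx j)
    \<le> 2 * E0 + estimate_const K Tm CS * (sqrt (S * min T 1) + Lb * sqrt (dt * min T 1))"
proof -
  define M where "M = K + (K + K * K) * Tm"
  have M0: "0 \<le> M" using K_pos Tm by (simp add: M_def)
  have R0: "0 \<le> R"
    using appr unfolding approximable_def using smooth_profileD(5) by blast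
  have slopes: "(K + K * K + K * P + L0 + R * mesh_error) * t \<le> (K + K * K + K * P + L0 + R * (m2 + mesh_error)) * t"
    "(K + K * K + K * P + L0 + R * m2) * t \<le> (K + K * K + K * P + L0 + R * (m2 + mesh_error)) * t" if "t \<in> {0..T}" for t
    using that R0 m_nonneg(3) mesh_error_nonneg by (auto intro!: mult_right_mono mult_left_mono)
  have bU: "U (real n * dt) (grid_pt dx j) \<le> u0 (grid_pt dx j) + E0 + Lb * (real n * dt)" if n: "n \<le> MT" for n j
  proof -
    obtain w g where w: "smooth_profile w g P R L0" "\<And>y. u0 y \<le> w y" "w (grid_pt dx j) \<le> u0 (grid_pt dx j) + E1"
      using appr unfolding approximable_def by blast
    have "U (real n * dt) (grid_pt dx j) \<le> w (grid_pt dx j) + (K + K * K + K * P + L0 + R * mesh_error) * (real n * dt)"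
    proof (rule scheme_upper_boundary[OF G f U w(1) _ _ n])
      show "- K \<le> w y" for y using u0(2)[of y] w(2)[of y] by linarith
    qed (simp add: init w)
    then show ?thesis using w(3) slopes(1)[OF grid_time[OF n]] budget[OF grid_time[OF n]] by linarith
  qed
  have bu: "u0 y - E0 - Lb * s \<le> u s y" if s: "s \<in> {0..T}" for s y
  proof -
    obtain w g where w: "smooth_profile w g P R L0" "\<And>y. w y \<le> u0 y" "u0 y - E1 \<le> w y"
      using appr unfolding approximable_def by blast
    have "w y - (K + K * K + K * P + L0 + R * m2) * s \<le> u s y"
    proof (rule visc_lower_boundary[OF G f u w(1) _ _ s])
      show "u 0 y \<le> K" for y using u0(2)[of y] by (simp add: init)
    qed (simp add: init w)
    then show ?thesis using w(3) slopes(2)[OF s] budget[OF s] by linarith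
  qed
  have KT: "(K + K * K) * t \<le> (K + K * K) * Tm" if "t \<in> {0..T}" for t
    using that Tm K_pos by (intro mult_left_mono) auto
  \<comment> \<open>Constant barriers have slope and curvature zero, so this bound is independent of
    the grid. It is the origin of \<open>M\<close>.\<close>
  have MUb: "U (real n * dt) (grid_pt dx j) \<le> M" if n: "n \<le> MT" for n j
  proof -
    have "U (real n * dt) (grid_pt dx j) \<le> K + (K + K * K + K * 0 + 0 + 0 * mesh_error) * (real n * dt)"
    proof (rule scheme_upper_boundary[OF G f U smooth_profile_const _ _ n])
      show "U 0 (grid_pt dx j) \<le> K" for j using u0(2)[of "grid_pt dx j"] by (simp add: init)
    qed (use K_pos in simp)
    then show ?thesis using KT[OF grid_time[OF n]] by (simp add: M_def)
  qed
  have Mub: "- M \<le> u s y" if s: "s \<in> {0..T}" for s y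
  proof -
    have "- K - (K + K * K + K * 0 + 0 + 0 * m2) * s \<le> u s y"
    proof (rule visc_lower_boundary[OF G f u smooth_profile_const _ _ s])
      show "- K \<le> u 0 y" for y using u0(2)[of y] by (simp add: init)
      show "u 0 y \<le> K" for y using u0(2)[of y] by (simp add: init)
    qed
    then show ?thesis using KT[OF s] by (simp add: M_def)
  qed
  obtain gq Lq where q: "smooth_profile (smoothed_norm 1) gq 1 1 Lq" "0 \<le> Lq" by (rule weight_profile)
  define m where "m = min T 1"
  define \<tau> where "\<tau> = sqrt (dt * m) / Lb"
  define \<epsilon> where "\<epsilon> = sqrt (S * m) + \<tau>"
  have m: "0 < m" using T_pos by (simp add: m_def)
  have \<tau>: "0 < \<tau>" using dt_pos m Lb by (simp add: \<tau>_def)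
  have \<tau>\<epsilon>: "\<tau> \<le> \<epsilon>" using S m by (simp add: \<epsilon>_def)
  let ?Em = "exp (K * (6 + M) * T)"
  have "U (real n * dt) (grid_pt dx j) - u (real n * dt) (grid_pt dx j)
    \<le> 2 * E0 + Lb\<^sup>2 * \<tau> / 2 + K\<^sup>2 * \<epsilon> / 2
      + T * (K * (1 + M) * ((\<epsilon> + \<tau>) / 2) + K * dt + ?Em * ((K * T + 1 / 2) * (dt / \<tau>)) + ?Em * ((m2 + mesh_error) / (2 * \<epsilon>)))"
    by (rule doubling_comparison[OF G f U u u0(1) bU bu M0 MUb Mub E0 \<tau> \<tau>\<epsilon> q(1) smoothed_norm_bounds(1)[OF zero_less_one] n])
  also have "\<dots> \<le> 2 * E0 + Lb\<^sup>2 * \<tau> / 2 + K\<^sup>2 * \<epsilon> / 2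
      + T * (K * (1 + M) * ((\<epsilon> + \<tau>) / 2) + K * dt + ?Em * ((K * T + 1 / 2) * (dt / \<tau>)) + ?Em * (CS * S / (2 * \<epsilon>)))"
    using S(3) T_pos \<tau> \<tau>\<epsilon> by (intro add_left_mono mult_left_mono divide_right_mono) auto
  also have "\<dots> \<le> 2 * E0 + estimate_const K Tm CS * (sqrt (S * m) + Lb * sqrt (dt * m))"
    using estimate_arith[OF K_pos T_pos Tm S(2,1) dt_pos dt_le_T Lb M_def]
    unfolding m_def[symmetric] \<tau>_def[symmetric] \<epsilon>_def[symmetric] by linarith
  finally show ?thesis by (simp add: m_def)
qed

end

section \<open>Duality\<close>

lemma norm1_boundD:
  assumes w: "norm1 S w \<le> ennreal K" and K: "0 \<le> K"
  shows "(t, x) \<in> S \<Longrightarrow> norm (w t x) \<le> K"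
    "(t, x) \<in> S \<Longrightarrow> (s, y) \<in> S \<Longrightarrow> norm (w t x - w s y) \<le> K * (\<bar>t - s\<bar> + norm (x - y))"
proof -
  show "norm (w t x) \<le> K" if "(t, x) \<in> S"
  proof -
    have "ennreal (norm (w t x)) \<le> norm0 S (\<lambda>(t, x). w t x)"
      unfolding norm0_def by (rule SUP_upper2[OF that]) simp
    also have "\<dots> \<le> norm1 S w" unfolding norm1_def by simp
    also have "\<dots> \<le> ennreal K" by (rule w)
    finally show ?thesis using K by simp
  qed
  show "norm (w t x - w s y) \<le> K * (\<bar>t - s\<bar> + norm (x - y))" if p: "(t, x) \<in> S" "(s, y) \<in> S"
  proof (cases "(t, x) = (s, y)")
    case False
    then have pos: "0 < \<bar>t - s\<bar> + norm (x - y)" by (auto simp: add_pos_nonneg add_nonneg_pos)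
    have "ennreal (norm (w t x - w s y) / (\<bar>t - s\<bar> + norm (x - y)))
      \<le> (SUP ((t, x), (s, y)) \<in> {(p, q). p \<in> S \<and> q \<in> S \<and> p \<noteq> q}.
          ennreal (norm (w t x - w s y) / (\<bar>t - s\<bar> + norm (x - y))))"
      by (rule SUP_upper2[of "((t, x), (s, y))"]) (use p False in auto)
    also have "\<dots> \<le> norm1 S w" unfolding norm1_def by simp
    also have "\<dots> \<le> ennreal K" by (rule w)
    finally have "norm (w t x - w s y) / (\<bar>t - s\<bar> + norm (x - y)) \<le> K" using K by simp
    then show ?thesis using pos by (simp add: pos_divide_le_eq)
  qed (use K in simp)
qed

definition infsup :: "'a metric \<Rightarrow> 'b metric \<Rightarrow> ('a \<times> 'b \<Rightarrow> real) \<Rightarrow> real" where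
  "infsup A B X = (INF \<alpha>\<in>mspace A. SUP \<beta>\<in>mspace B. X (\<alpha>, \<beta>))"

lemma game_operator_infsup:
  assumes A: "mspace A \<noteq> {}" and B: "mspace B \<noteq> {}"
  shows "game_operator (mspace A \<times> mspace B) (infsup A B)"
  unfolding game_operator_def
proof (intro conjI allI impI)
  show "infsup A B (\<lambda>_. 0) = 0" using A B by (simp add: infsup_def)
  fix X Y :: "'a \<times> 'b \<Rightarrow> real" and e
  assume *: "bounded_family (mspace A \<times> mspace B) X \<and> bounded_family (mspace A \<times> mspace B) Y \<and>
    (\<forall>i\<in>mspace A \<times> mspace B. X i \<le> Y i + e)"
  then obtain M M' where M: "\<And>\<alpha> \<beta>. \<alpha> \<in> mspace A \<Longrightarrow> \<beta> \<in> mspace B \<Longrightarrow> \<bar>X (\<alpha>, \<beta>)\<bar> \<le> M"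
    and M': "\<And>\<alpha> \<beta>. \<alpha> \<in> mspace A \<Longrightarrow> \<beta> \<in> mspace B \<Longrightarrow> \<bar>Y (\<alpha>, \<beta>)\<bar> \<le> M'"
    unfolding bounded_family_def by force
  have XY: "X (\<alpha>, \<beta>) \<le> Y (\<alpha>, \<beta>) + e" if "\<alpha> \<in> mspace A" "\<beta> \<in> mspace B" for \<alpha> \<beta> using * that by auto
  have bY: "bdd_above ((\<lambda>\<beta>. Y (\<alpha>, \<beta>)) ` mspace B)" if "\<alpha> \<in> mspace A" for \<alpha>
    using M'[OF that] by (intro bdd_aboveI2[of _ _ M']) (simp add: abs_le_iff)
  have bX: "bdd_above ((\<lambda>\<beta>. X (\<alpha>, \<beta>)) ` mspace B)" if "\<alpha> \<in> mspace A" for \<alpha>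
    using M[OF that] by (intro bdd_aboveI2[of _ _ M]) (simp add: abs_le_iff)
  have bS: "bdd_below ((\<lambda>\<alpha>. SUP \<beta>\<in>mspace B. X (\<alpha>, \<beta>)) ` mspace A)"
  proof (rule bdd_belowI2[of _ "- M"])
    fix \<alpha> assume a: "\<alpha> \<in> mspace A"
    obtain \<beta> where b: "\<beta> \<in> mspace B" using B by blast
    have "- M \<le> X (\<alpha>, \<beta>)" using M[OF a b] by linarith
    also have "\<dots> \<le> (SUP \<beta>\<in>mspace B. X (\<alpha>, \<beta>))" by (rule cSUP_upper[OF b bX[OF a]])
    finally show "- M \<le> (SUP \<beta>\<in>mspace B. X (\<alpha>, \<beta>))" .
  qed
  have "infsup A B X - e \<le> infsup A B Y"
    unfolding infsup_def
  proof (rule cINF_greatest[OF A])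
    fix \<alpha> assume a: "\<alpha> \<in> mspace A"
    have "(INF \<alpha>\<in>mspace A. SUP \<beta>\<in>mspace B. X (\<alpha>, \<beta>)) \<le> (SUP \<beta>\<in>mspace B. X (\<alpha>, \<beta>))" by (rule cINF_lower[OF bS a])
    also have "\<dots> \<le> (SUP \<beta>\<in>mspace B. Y (\<alpha>, \<beta>)) + e"
    proof (rule cSUP_least[OF B])
      fix \<beta> assume b: "\<beta> \<in> mspace B"
      show "X (\<alpha>, \<beta>) \<le> (SUP \<beta>\<in>mspace B. Y (\<alpha>, \<beta>)) + e" using XY[OF a b] cSUP_upper[OF b bY[OF a]] by linarith
    qed
    finally show "(INF \<alpha>\<in>mspace A. SUP \<beta>\<in>mspace B. X (\<alpha>, \<beta>)) - e \<le> (SUP \<beta>\<in>mspace B. Y (\<alpha>, \<beta>))" by simp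
  qed
  then show "infsup A B X \<le> infsup A B Y + e" by simp
qed

definition dual_game :: "(('i \<Rightarrow> real) \<Rightarrow> real) \<Rightarrow> ('i \<Rightarrow> real) \<Rightarrow> real" where
  "dual_game G X = - G (\<lambda>i. - X i)"

lemma game_operator_dual:
  assumes "game_operator I G" shows "game_operator I (dual_game G)"
  unfolding game_operator_def
proof (intro conjI allI impI)
  show "dual_game G (\<lambda>_. 0) = 0" using assms by (simp add: dual_game_def game_operator_def)
  fix X Y :: "'a \<Rightarrow> real" and e
  assume *: "bounded_family I X \<and> bounded_family I Y \<and> (\<forall>i\<in>I. X i \<le> Y i + e)"
  then have "bounded_family I (\<lambda>i. - X i)" "bounded_family I (\<lambda>i. - Y i)" by (simp_all add: bounded_family_def)
  moreover have "\<forall>i\<in>I. - Y i \<le> - X i + e" using * by force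
  ultimately have "G (\<lambda>i. - Y i) \<le> G (\<lambda>i. - X i) + e" using assms unfolding game_operator_def by blast
  then show "dual_game G X \<le> dual_game G Y + e" by (simp add: dual_game_def)
qed

text \<open>\<open>grad\<close> and \<open>vector_derivative\<close> are descriptions and respect
  negation only where derivatives exist. Existence is provided here, with the time derivative taken
  within the half-open interval.\<close>

lemma C2_on_slices:
  fixes \<phi> :: "real \<Rightarrow> real^'n \<Rightarrow> real"
  assumes "C2_on (Q_dom T) (\<lambda>(s, y). \<phi> s y)" and t: "0 < t" "t \<le> T"
  shows "\<phi> t differentiable (at x)" "\<exists>d. ((\<lambda>s. \<phi> s x) has_vector_derivative d) (at t within {0<..T})"
proof -
  obtain D D2 where "C2_with (Q_dom T) (\<lambda>(s, y). \<phi> s y) D D2" using assms by (auto simp: C2_on_def)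
  then have D: "((\<lambda>(s, y). \<phi> s y) has_derivative blinfun_apply (D (t, x))) (at (t, x) within Q_dom T)"
    using t by (simp add: C2_with_def Q_dom_def)
  have "((\<lambda>y. (t, y)) has_derivative (\<lambda>h. (0, h))) (at x)" by (auto intro!: derivative_eq_intros)
  moreover have "((\<lambda>(s, y). \<phi> s y) has_derivative blinfun_apply (D (t, x))) (at (t, x) within range (\<lambda>y. (t, y)))"
    by (rule has_derivative_subset[OF D]) (use t in \<open>auto simp: Q_dom_def\<close>)
  ultimately have "((\<lambda>y. (\<lambda>(s, y). \<phi> s y) (t, y)) has_derivative (\<lambda>h. D (t, x) (0, h))) (at x)"
    by (rule has_derivative_in_compose)
  then show "\<phi> t differentiable (at x)" by (auto simp: differentiable_def)
  have "((\<lambda>s. (s, x)) has_derivative (\<lambda>h. (h, 0))) (at t within {0<..T})" by (auto intro!: derivative_eq_intros)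
  moreover have "((\<lambda>(s, y). \<phi> s y) has_derivative blinfun_apply (D (t, x))) (at (t, x) within (\<lambda>s. (s, x)) ` {0<..T})"
    by (rule has_derivative_subset[OF D]) (auto simp: Q_dom_def)
  ultimately have "((\<lambda>s. (\<lambda>(s, y). \<phi> s y) (s, x)) has_derivative (\<lambda>h. D (t, x) (h, 0))) (at t within {0<..T})"
    by (rule has_derivative_in_compose)
  then have "((\<lambda>s. \<phi> s x) has_derivative (\<lambda>h. D (t, x) (h, 0))) (at t within {0<..T})" by (simp only: split_conv)
  moreover have "(\<lambda>h. D (t, x) (h, 0)) = (\<lambda>h. h *\<^sub>R D (t, x) (1, 0))"
  proof
    fix h
    have "D (t, x) (h, 0) = D (t, x) (h *\<^sub>R (1, 0))" by simp
    then show "D (t, x) (h, 0) = h *\<^sub>R D (t, x) (1, 0)" by (simp only: blinfun.scaleR_right)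
  qed
  ultimately have "((\<lambda>s. \<phi> s x) has_vector_derivative D (t, x) (1, 0)) (at t within {0<..T})"
    unfolding has_vector_derivative_def by (simp only:)
  then show "\<exists>d. ((\<lambda>s. \<phi> s x) has_vector_derivative d) (at t within {0<..T})" by (rule exI)
qed

lemma grad_uminus:
  fixes w :: "real^'n \<Rightarrow> real"
  assumes "w differentiable (at x)" shows "grad (\<lambda>y. - w y) x = - grad w x"
proof -
  note g = differentiable_GDERIV[OF assms]
  show ?thesis using grad_eqI[OF GDERIV_minus[OF g]] grad_eqI[OF g] by simp
qed

lemma at_within_half_open_nonbot:
  assumes "0 < t" "t \<le> T" shows "at t within {0<..T::real} \<noteq> bot"
proof -
  have "t islimpt {0<..<t}" using assms(1) by (simp add: islimpt_greaterThanLessThan2)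
  then have "t islimpt {0<..T}" by (rule islimpt_subset) (use assms in auto)
  then show ?thesis by (simp add: trivial_limit_within)
qed

lemma nonlocal_on_uminus: "nonlocal_on S \<nu> \<eta> (\<lambda>t x. - w t x) (- p) t x = - nonlocal_on S \<nu> \<eta> w p t x"
proof -
  have "nonlocal_on S \<nu> \<eta> (\<lambda>t x. - w t x) (- p) t x
    = (\<integral>z. - (indicator S z *\<^sub>R (w t (x + \<eta> t x z) - w t x - \<eta> t x z \<bullet> p)) \<partial>\<nu>)"
    unfolding nonlocal_on_def set_lebesgue_integral_def
    by (intro Bochner_Integration.integral_cong refl) (simp add: algebra_simps)
  then show ?thesis by (simp add: nonlocal_on_def set_lebesgue_integral_def)
qed

context isaacs_data begin

definition visc_sub :: "(('i \<Rightarrow> real) \<Rightarrow> real) \<Rightarrow> ('i \<Rightarrow> real \<Rightarrow> real^'n \<Rightarrow> real) \<Rightarrow> (real \<Rightarrow> real^'n \<Rightarrow> real) \<Rightarrow> bool" where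
  "visc_sub G f u \<longleftrightarrow> (\<forall>\<kappa> \<phi> t x. 0 < \<kappa> \<and> \<kappa> < 1 \<and> C2_on (Q_dom T) (\<lambda>(s, y). \<phi> s y) \<and> (t, x) \<in> Q_dom T \<and>
        (\<forall>(s, y) \<in> Q_dom T. u s y - \<phi> s y \<le> u t x - \<phi> t x)
     \<longrightarrow> vector_derivative (\<lambda>s. \<phi> s x) (at t within {0<..T}) +
       G (\<lambda>i. - f i t x + c i t x * u t x - b i t x \<bullet> grad (\<phi> t) x
        - nonlocal_inner \<nu> (\<lambda>_ _. \<eta> i) \<kappa> \<phi> t x
        - nonlocal_outer \<nu> (\<lambda>_ _. \<eta> i) \<kappa> u (grad (\<phi> t) x) t x) \<le> 0)"

text \<open>To test \<open>- u\<close> from below with \<phi> is to test \<open>u\<close> from above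
  with \<open>- \<phi>\<close>. All terms except \<open>f\<close> are linear in the solution and the
  test function, so the sign passes through them.\<close>

lemma visc_super_dual:
  assumes u: "visc_sub G f u"
  shows "visc_super (dual_game G) (\<lambda>i t x. - f i t x) (\<lambda>t x. - u t x)"
  unfolding visc_super_def
proof (intro allI impI, elim conjE)
  fix \<kappa> :: real and \<phi> :: "real \<Rightarrow> real^'n \<Rightarrow> real" and t :: real and x :: "real^'n"
  assume \<kappa>: "0 < \<kappa>" "\<kappa> < 1" and C2: "C2_on (Q_dom T) (\<lambda>(s, y). \<phi> s y)" and tx: "(t, x) \<in> Q_dom T"
    and min: "\<forall>(s, y)\<in>Q_dom T. - u t x - \<phi> t x \<le> - u s y - \<phi> s y"
  have t: "0 < t" "t \<le> T" using tx by (auto simp: Q_dom_def)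
  define \<psi> where "\<psi> s y = - \<phi> s y" for s and y :: "real^'n"
  have "C2_on (Q_dom T) (\<lambda>p. (- 1) * (\<lambda>(s, y). \<phi> s y) p)" by (rule C2_on_cmul[OF C2])
  then have C2': "C2_on (Q_dom T) (\<lambda>(s, y). \<psi> s y)" by (simp add: \<psi>_def case_prod_beta')
  have max: "\<forall>(s, y)\<in>Q_dom T. u s y - \<psi> s y \<le> u t x - \<psi> t x"
    using min by (force simp: \<psi>_def)
  have gr: "grad (\<psi> t) x = - grad (\<phi> t) x"
    unfolding \<psi>_def[abs_def] by (rule grad_uminus[OF C2_on_slices(1)[OF C2 t]])
  obtain d where d: "((\<lambda>s. \<phi> s x) has_vector_derivative d) (at t within {0<..T})" using C2_on_slices(2)[OF C2 t] by blast
  have d': "((\<lambda>s. \<psi> s x) has_vector_derivative - d) (at t within {0<..T})"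
    unfolding \<psi>_def by (rule has_vector_derivative_minus[OF d])
  have vd: "vector_derivative (\<lambda>s. \<psi> s x) (at t within {0<..T}) = - vector_derivative (\<lambda>s. \<phi> s x) (at t within {0<..T})"
    using vector_derivative_within[OF at_within_half_open_nonbot[OF t] d] vector_derivative_within[OF at_within_half_open_nonbot[OF t] d'] by simp
  have inner: "nonlocal_inner \<nu> (\<lambda>_ _. \<eta> i) \<kappa> \<psi> t x = - nonlocal_inner \<nu> (\<lambda>_ _. \<eta> i) \<kappa> \<phi> t x" for i
    unfolding nonlocal_inner_def gr unfolding \<psi>_def[abs_def] by (rule nonlocal_on_uminus)
  have outer: "nonlocal_outer \<nu> (\<lambda>_ _. \<eta> i) \<kappa> (\<lambda>t x. - u t x) (grad (\<phi> t) x) t x = - nonlocal_outer \<nu> (\<lambda>_ _. \<eta> i) \<kappa> u (grad (\<psi> t) x) t x" for i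
    unfolding nonlocal_outer_def gr using nonlocal_on_uminus[of _ \<nu> _ u "- grad (\<phi> t) x" t x] by simp
  have "vector_derivative (\<lambda>s. \<psi> s x) (at t within {0<..T}) +
       G (\<lambda>i. - f i t x + c i t x * u t x - b i t x \<bullet> grad (\<psi> t) x
        - nonlocal_inner \<nu> (\<lambda>_ _. \<eta> i) \<kappa> \<psi> t x - nonlocal_outer \<nu> (\<lambda>_ _. \<eta> i) \<kappa> u (grad (\<psi> t) x) t x) \<le> 0"
    by (rule u[unfolded visc_sub_def, THEN spec, THEN spec, THEN spec, THEN spec, THEN mp]) (intro conjI \<kappa> C2' tx max)
  moreover have "(\<lambda>i. - (- (- f i t x) + c i t x * - u t x - b i t x \<bullet> grad (\<phi> t) x
        - nonlocal_inner \<nu> (\<lambda>_ _. \<eta> i) \<kappa> \<phi> t x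
        - nonlocal_outer \<nu> (\<lambda>_ _. \<eta> i) \<kappa> (\<lambda>t x. - u t x) (grad (\<phi> t) x) t x))
     = (\<lambda>i. - f i t x + c i t x * u t x - b i t x \<bullet> grad (\<psi> t) x
        - nonlocal_inner \<nu> (\<lambda>_ _. \<eta> i) \<kappa> \<psi> t x - nonlocal_outer \<nu> (\<lambda>_ _. \<eta> i) \<kappa> u (grad (\<psi> t) x) t x)"
    unfolding inner outer by (simp add: gr algebra_simps)
  ultimately show "0 \<le> vector_derivative (\<lambda>s. \<phi> s x) (at t within {0<..T}) +
       dual_game G (\<lambda>i. - (- f i t x) + c i t x * - u t x - b i t x \<bullet> grad (\<phi> t) x
        - nonlocal_inner \<nu> (\<lambda>_ _. \<eta> i) \<kappa> \<phi> t x
        - nonlocal_outer \<nu> (\<lambda>_ _. \<eta> i) \<kappa> (\<lambda>t x. - u t x) (grad (\<phi> t) x) t x)"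
    unfolding dual_game_def vd by simp
qed

lemma bounded_cont_uminus: "bounded_cont M u \<Longrightarrow> bounded_cont M (\<lambda>t x. - u t x)"
  unfolding bounded_cont_def by (auto simp: case_prod_beta' intro: continuous_on_minus)

lemma source_uminus: "source f \<Longrightarrow> source (\<lambda>i t x. - f i t x)"
  unfolding source_def by (simp add: abs_minus_commute)

end

section \<open>Duality for the scheme and the two-sided bound\<close>

context isaacs_scheme begin

lemma scheme_dual:
  assumes "scheme G f U"
  shows "scheme (dual_game G) (\<lambda>i t x. - f i t x) (\<lambda>t x. - U t x)"
  unfolding scheme_def Let_def
proof (intro ballI allI)
  fix n and j :: "int^'n"
  assume n: "n \<in> {1..MT}"
  let ?t = "real n * dt" and ?s = "real (n - 1) * dt" and ?x = "grid_pt dx j"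
  have U: "U ?t ?x = U ?s ?x - dt * G (\<lambda>i. - f i ?s ?x + c i ?t ?x * U ?s ?x
           - \<theta> * D_op (b i) (\<lambda>_ _. \<eta> i) \<nu> \<delta> dx U ?t ?x - (1 - \<theta>) * D_op (b i) (\<lambda>_ _. \<eta> i) \<nu> \<delta> dx U ?s ?x
           - \<theta>' * J_op \<omega> (\<lambda>_ _. \<eta> i) \<nu> \<delta> dx U ?t ?x - (1 - \<theta>') * J_op \<omega> (\<lambda>_ _. \<eta> i) \<nu> \<delta> dx U ?s ?x)"
    using assms n unfolding scheme_def Let_def by blast
  have eq: "(\<lambda>i. - (- (- f i ?s ?x) + c i ?t ?x * - U ?s ?x
           - \<theta> * D_op (b i) (\<lambda>_ _. \<eta> i) \<nu> \<delta> dx (\<lambda>t x. - U t x) ?t ?x - (1 - \<theta>) * D_op (b i) (\<lambda>_ _. \<eta> i) \<nu> \<delta> dx (\<lambda>t x. - U t x) ?s ?x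
           - \<theta>' * J_op \<omega> (\<lambda>_ _. \<eta> i) \<nu> \<delta> dx (\<lambda>t x. - U t x) ?t ?x - (1 - \<theta>') * J_op \<omega> (\<lambda>_ _. \<eta> i) \<nu> \<delta> dx (\<lambda>t x. - U t x) ?s ?x))
     = (\<lambda>i. - f i ?s ?x + c i ?t ?x * U ?s ?x
           - \<theta> * D_op (b i) (\<lambda>_ _. \<eta> i) \<nu> \<delta> dx U ?t ?x - (1 - \<theta>) * D_op (b i) (\<lambda>_ _. \<eta> i) \<nu> \<delta> dx U ?s ?x
           - \<theta>' * J_op \<omega> (\<lambda>_ _. \<eta> i) \<nu> \<delta> dx U ?t ?x - (1 - \<theta>') * J_op \<omega> (\<lambda>_ _. \<eta> i) \<nu> \<delta> dx U ?s ?x)"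
    unfolding op_uminus by (rule ext) simp
  show "- U ?t ?x = - U ?s ?x - dt * dual_game G (\<lambda>i. - (- f i ?s ?x) + c i ?t ?x * - U ?s ?x
           - \<theta> * D_op (b i) (\<lambda>_ _. \<eta> i) \<nu> \<delta> dx (\<lambda>t x. - U t x) ?t ?x - (1 - \<theta>) * D_op (b i) (\<lambda>_ _. \<eta> i) \<nu> \<delta> dx (\<lambda>t x. - U t x) ?s ?x
           - \<theta>' * J_op \<omega> (\<lambda>_ _. \<eta> i) \<nu> \<delta> dx (\<lambda>t x. - U t x) ?t ?x - (1 - \<theta>') * J_op \<omega> (\<lambda>_ _. \<eta> i) \<nu> \<delta> dx (\<lambda>t x. - U t x) ?s ?x)"
    unfolding dual_game_def eq U by simp
qed

lemma two_sided_estimate: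
  assumes G: "game_operator I G" and f: "source f" and U: "scheme G f U" "grid_bounded MU U"
    and u: "visc_super G f u" "visc_sub G f u" "bounded_cont Mu u"
    and u0: "\<And>x y. \<bar>u0 x - u0 y\<bar> \<le> K * norm (x - y)" "\<And>x. \<bar>u0 x\<bar> \<le> K"
    and init: "\<And>j. U 0 (grid_pt dx j) = u0 (grid_pt dx j)" "\<And>y. u 0 y = u0 y"
    and appr: "approximable u0 P R L0 E1"
    and Tm: "T \<le> Tm" "1 \<le> Tm" and S: "0 < S" "0 \<le> CS" "m2 + mesh_error \<le> CS * S"
    and Lb: "1 \<le> Lb" and E0: "0 \<le> E0"
    and budget: "\<And>t. t \<in> {0..T} \<Longrightarrow> E1 + (K + K * K + K * P + L0 + R * (m2 + mesh_error)) * t \<le> E0 + Lb * t"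
    and n: "n \<le> MT"
  shows "\<bar>U (real n * dt) (grid_pt dx j) - u (real n * dt) (grid_pt dx j)\<bar>
    \<le> 2 * E0 + estimate_const K Tm CS * (sqrt (S * min T 1) + Lb * sqrt (dt * min T 1))"
proof -
  have "U (real n * dt) (grid_pt dx j) - u (real n * dt) (grid_pt dx j)
    \<le> 2 * E0 + estimate_const K Tm CS * (sqrt (S * min T 1) + Lb * sqrt (dt * min T 1))"
    by (rule one_sided_estimate[OF G f U u(1,3) u0 init appr Tm S Lb E0 budget n])
  moreover have "- U (real n * dt) (grid_pt dx j) - - u (real n * dt) (grid_pt dx j)
    \<le> 2 * E0 + estimate_const K Tm CS * (sqrt (S * min T 1) + Lb * sqrt (dt * min T 1))"
  proof (rule one_sided_estimate[OF game_operator_dual[OF G] source_uminus[OF f] scheme_dual[OF U(1)] _ visc_super_dual[OF u(2)] bounded_cont_uminus[OF u(3)]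
        _ _ _ _ approximable_uminus[OF appr] Tm S Lb E0 budget n])
    show "grid_bounded MU (\<lambda>t x. - U t x)" using U(2) by (simp add: grid_bounded_def)
    show "\<bar>- u0 x - - u0 y\<bar> \<le> K * norm (x - y)" for x y using u0(1)[of x y] by (simp add: abs_minus_commute)
    show "\<bar>- u0 x\<bar> \<le> K" for x using u0(2)[of x] by simp
  qed (simp_all add: init)
  ultimately show ?thesis by (simp add: abs_le_iff)
qed

end

text \<open>Jumps are prescribed for \<open>z \<noteq> 0\<close> only. The origin lies outside the
  space of \<nu>, so the value there is immaterial even if \<open>S\<close> contains it.\<close>

lemma integral_cong_jump:
  assumes "space \<nu> = - {0}" "\<And>z. z \<noteq> 0 \<Longrightarrow> h z = h' z"
  shows "(LINT z:S|\<nu>. h z) = (LINT z:S|\<nu>. h' z)"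
  unfolding set_lebesgue_integral_def by (rule Bochner_Integration.integral_cong) (use assms in auto)

lemma operator_cong_jump:
  assumes sp: "space \<nu> = - {0}" and eq: "\<And>z. z \<noteq> 0 \<Longrightarrow> \<eta> t x z = \<eta>' z"
  shows "D_op b \<eta> \<nu> \<delta> dx w t x = D_op b (\<lambda>_ _. \<eta>') \<nu> \<delta> dx w t x"
    "d_coeff b \<eta> \<nu> \<delta> dx k t x = d_coeff b (\<lambda>_ _. \<eta>') \<nu> \<delta> dx k t x"
    "kappa_coeff \<omega> \<eta> \<nu> \<delta> k t x = kappa_coeff \<omega> (\<lambda>_ _. \<eta>') \<nu> \<delta> k t x"
    "J_op \<omega> \<eta> \<nu> \<delta> dx w t x = J_op \<omega> (\<lambda>_ _. \<eta>') \<nu> \<delta> dx w t x"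
    "nonlocal_inner \<nu> \<eta> \<kappa> \<phi> t x = nonlocal_inner \<nu> (\<lambda>_ _. \<eta>') \<kappa> \<phi> t x"
    "nonlocal_outer \<nu> \<eta> \<kappa> \<phi> p t x = nonlocal_outer \<nu> (\<lambda>_ _. \<eta>') \<kappa> \<phi> p t x"
    "nonlocal \<nu> \<eta> \<phi> t x = nonlocal \<nu> (\<lambda>_ _. \<eta>') \<phi> t x"
proof -
  have b: "b_tilde b \<eta> \<nu> \<delta> t x = b_tilde b (\<lambda>_ _. \<eta>') \<nu> \<delta> t x"
    unfolding b_tilde_def by (rule arg_cong[where f="\<lambda>v. b t x - v"]) (rule integral_cong_jump[OF sp eq])
  show "D_op b \<eta> \<nu> \<delta> dx w t x = D_op b (\<lambda>_ _. \<eta>') \<nu> \<delta> dx w t x"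
    "d_coeff b \<eta> \<nu> \<delta> dx k t x = d_coeff b (\<lambda>_ _. \<eta>') \<nu> \<delta> dx k t x"
    unfolding D_op_def d_coeff_def b by (rule refl)+
  show *: "kappa_coeff \<omega> \<eta> \<nu> \<delta> k t x = kappa_coeff \<omega> (\<lambda>_ _. \<eta>') \<nu> \<delta> k t x" for k
    unfolding kappa_coeff_def by (rule integral_cong_jump[OF sp]) (simp add: eq)
  show "J_op \<omega> \<eta> \<nu> \<delta> dx w t x = J_op \<omega> (\<lambda>_ _. \<eta>') \<nu> \<delta> dx w t x"
    unfolding J_op_def * by (rule refl)
  have **: "nonlocal_on S \<nu> \<eta> \<phi> p t x = nonlocal_on S \<nu> (\<lambda>_ _. \<eta>') \<phi> p t x" for S p
    unfolding nonlocal_on_def by (rule integral_cong_jump[OF sp]) (simp add: eq)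
  show "nonlocal_inner \<nu> \<eta> \<kappa> \<phi> t x = nonlocal_inner \<nu> (\<lambda>_ _. \<eta>') \<kappa> \<phi> t x"
    "nonlocal_outer \<nu> \<eta> \<kappa> \<phi> p t x = nonlocal_outer \<nu> (\<lambda>_ _. \<eta>') \<kappa> \<phi> p t x"
    "nonlocal \<nu> \<eta> \<phi> t x = nonlocal \<nu> (\<lambda>_ _. \<eta>') \<phi> t x"
    unfolding nonlocal_inner_def nonlocal_outer_def nonlocal_def ** by (rule refl)+
qed

text \<open>\<rho> need not be measurable near the origin, so it is replaced there by its linear
  bound. For \<open>norm z \<ge> 1\<close> measurability is inherited from the integrable square of
  \<rho>.\<close>

definition jump_bound :: "real \<Rightarrow> (real^'m \<Rightarrow> real) \<Rightarrow> real^'m \<Rightarrow> real" where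
  "jump_bound K \<rho> z = (if norm z < 1 then K * norm z else \<rho> z)"

lemma continuous_map_jump:
  fixes \<eta> :: "'a \<Rightarrow> 'b \<Rightarrow> real \<Rightarrow> real^'n \<Rightarrow> real^'m \<Rightarrow> real^'n"
  assumes A1: "assm_A1 A B T f c b \<eta>" and T: "0 < T" and i: "\<alpha> \<in> mspace A" "\<beta> \<in> mspace B"
  shows "continuous_on (- {0}) (\<eta> \<alpha> \<beta> 0 0)"
proof -
  let ?X = "prod_topology (mtopology_of A) (prod_topology (mtopology_of B) (top_of_set ({0..T} \<times> UNIV \<times> - {0})))"
  have "continuous_map ?X euclidean (\<lambda>(\<alpha>, \<beta>, t, x, z). \<eta> \<alpha> \<beta> t x z)"
    using A1 unfolding assm_A1_def Let_def by blast
  moreover have "continuous_map (top_of_set (- {0})) ?X (\<lambda>z. (\<alpha>, \<beta>, 0 :: real, 0 :: real^'n, z))"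
  proof (intro continuous_map_pairedI)
    have "continuous_on (- {0}) (\<lambda>z. (0 :: real, 0 :: real^'n, z))" by (intro continuous_intros)
    then show "continuous_map (top_of_set (- {0})) (top_of_set ({0..T} \<times> UNIV \<times> - {0})) (\<lambda>z. (0 :: real, 0 :: real^'n, z))"
      unfolding continuous_map_in_subtopology continuous_map_iff_continuous using T by (intro conjI) auto
    show "continuous_map (top_of_set (- {0})) (mtopology_of A) (\<lambda>z. \<alpha>)"
      "continuous_map (top_of_set (- {0})) (mtopology_of B) (\<lambda>z. \<beta>)" using i by (simp_all add: continuous_map_const)
  qed
  ultimately have "continuous_map (top_of_set (- {0})) euclidean ((\<lambda>(\<alpha>, \<beta>, t, x, z). \<eta> \<alpha> \<beta> t x z) \<circ> (\<lambda>z. (\<alpha>, \<beta>, 0 :: real, 0 :: real^'n, z)))"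
    by (rule continuous_map_compose[rotated])
  then show ?thesis by (simp add: o_def)
qed

section \<open>Integrals of the jump sizes\<close>

text \<open>For \<open>\<kappa> \<le> norm z\<close> the bound is at least
  \<open>min (K * \<kappa>) 1\<close>, so on the tail mass and first moment are dominated by the
  second moment.\<close>

lemma jump_bound_integrable:
  fixes \<nu> :: "(real^'m) measure" and \<rho> :: "real^'m \<Rightarrow> real"
  assumes K: "0 < K" and A4: "assm_A4 L \<nu> \<rho>"
    and \<rho>0: "\<And>z. z \<noteq> 0 \<Longrightarrow> 0 \<le> \<rho> z" and \<rho>1: "\<And>z. 1 \<le> norm z \<Longrightarrow> 1 \<le> \<rho> z \<and> \<rho> z \<le> (\<rho> z)\<^sup>2"
  shows "jump_bound K \<rho> \<in> borel_measurable \<nu>" "integrable \<nu> (\<lambda>z. (jump_bound K \<rho> z)\<^sup>2)"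
    "0 < \<kappa> \<Longrightarrow> set_integrable \<nu> {z. \<kappa> \<le> norm z} (jump_bound K \<rho>)"
    "0 < \<kappa> \<Longrightarrow> emeasure \<nu> {z. \<kappa> \<le> norm z} < \<infinity>"
    "(\<integral>\<^sup>+z. ennreal (indicator {z. 1 \<le> norm z} z * (\<rho> z)\<^sup>2) \<partial>\<nu>) \<le> ennreal L" "0 \<le> L"
proof -
  let ?r = "jump_bound K \<rho>"
  have sets: "sets \<nu> = sets (restrict_space borel (- {0}))"
    and i1: "integrable \<nu> (\<lambda>z. indicator {z. norm z < 1} z * (norm z)\<^sup>2)"
    and i2: "integrable \<nu> (\<lambda>z. indicator {z. 1 \<le> norm z} z * (\<rho> z)\<^sup>2)"
    and L: "(\<integral>z. indicator {z. norm z < 1} z * (norm z)\<^sup>2 \<partial>\<nu>) + (\<integral>z. indicator {z. 1 \<le> norm z} z * (\<rho> z)\<^sup>2 \<partial>\<nu>) \<le> L"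
    using A4 by (simp_all add: assm_A4_def set_integrable_def set_lebesgue_integral_def)
  have sp: "space \<nu> = - {0}" using sets_eq_imp_space_eq[OF sets] by (simp add: space_restrict_space)
  have [measurable]: "(\<lambda>z. norm z) \<in> borel_measurable \<nu>"
    by (subst measurable_cong_sets[OF sets refl]) (auto intro: measurable_restrict_space1)
  have ts: "{z. \<kappa> \<le> norm z} \<in> sets \<nu>" if "0 < \<kappa>" for \<kappa> :: real
    unfolding sets using that by (auto simp: sets_restrict_space_iff)
  have nn: "0 \<le> (\<integral>z. indicator {z. norm z < 1} z * (norm z)\<^sup>2 \<partial>\<nu>)" "0 \<le> (\<integral>z. indicator {z. 1 \<le> norm z} z * (\<rho> z)\<^sup>2 \<partial>\<nu>)"
    by (intro integral_nonneg_AE AE_I2; simp)+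
  show L0: "0 \<le> L" using L nn by linarith
  have "(\<integral>\<^sup>+z. ennreal (indicator {z. 1 \<le> norm z} z * (\<rho> z)\<^sup>2) \<partial>\<nu>) = ennreal (\<integral>z. indicator {z. 1 \<le> norm z} z * (\<rho> z)\<^sup>2 \<partial>\<nu>)"
    by (rule nn_integral_eq_integral[OF i2]) simp
  also have "\<dots> \<le> ennreal L" using L nn by (intro ennreal_leI) linarith
  finally show "(\<integral>\<^sup>+z. ennreal (indicator {z. 1 \<le> norm z} z * (\<rho> z)\<^sup>2) \<partial>\<nu>) \<le> ennreal L" .
  have m: "(\<lambda>z. indicator {z. 1 \<le> norm z} z * (\<rho> z)\<^sup>2) \<in> borel_measurable \<nu>" using i2 by simp
  \<comment> \<open>Recovers \<rho> on large jumps as the root of the function that is known to be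
    measurable.\<close>
  have req: "?r z = (if norm z < 1 then K * norm z else sqrt (indicator {z. 1 \<le> norm z} z * (\<rho> z)\<^sup>2))" if "z \<in> space \<nu>" for z
    using that \<rho>0[of z] by (simp add: jump_bound_def sp)
  have "(\<lambda>z. sqrt (indicator {z. 1 \<le> norm z} z * (\<rho> z)\<^sup>2)) \<in> borel_measurable \<nu>"
    by (rule measurable_compose[OF m borel_measurable_sqrt])
  then have "(\<lambda>z. if norm z < 1 then K * norm z else sqrt (indicator {z. 1 \<le> norm z} z * (\<rho> z)\<^sup>2)) \<in> borel_measurable \<nu>"
    by (rule measurable_If[rotated]) measurable
  then show rm: "?r \<in> borel_measurable \<nu>" using measurable_cong[of \<nu> ?r, OF req, of borel] by metis
  have "(\<lambda>z. (?r z)\<^sup>2) = (\<lambda>z. K\<^sup>2 * (indicator {z. norm z < 1} z * (norm z)\<^sup>2) + indicator {z. 1 \<le> norm z} z * (\<rho> z)\<^sup>2)"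
    by (rule ext) (simp add: jump_bound_def power_mult_distrib)
  then show ri: "integrable \<nu> (\<lambda>z. (?r z)\<^sup>2)" using i1 i2 by simp
  have lower: "min (K * \<kappa>) 1 \<le> ?r z" if "\<kappa> \<le> norm z" "0 < \<kappa>" for \<kappa> z
    using that \<rho>1[of z] K by (auto simp: jump_bound_def min.coboundedI1 min.coboundedI2 mult_left_mono)
  show "set_integrable \<nu> {z. \<kappa> \<le> norm z} ?r" if \<kappa>: "0 < \<kappa>"
    unfolding set_integrable_def
  proof (rule Bochner_Integration.integrable_bound)
    let ?q = "min (K * \<kappa>) 1"
    have q: "0 < ?q" using K \<kappa> by simp
    show "integrable \<nu> (\<lambda>z. (1 / ?q) * (?r z)\<^sup>2)" by (rule integrable_mult_right[OF ri])
    show "(\<lambda>z. indicator {z. \<kappa> \<le> norm z} z *\<^sub>R ?r z) \<in> borel_measurable \<nu>" using ts[OF \<kappa>] rm by measurable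
    show "AE z in \<nu>. norm (indicator {z. \<kappa> \<le> norm z} z *\<^sub>R ?r z) \<le> norm ((1 / ?q) * (?r z)\<^sup>2)"
    proof (rule AE_I2)
      fix z
      show "norm (indicator {z. \<kappa> \<le> norm z} z *\<^sub>R ?r z) \<le> norm ((1 / ?q) * (?r z)\<^sup>2)"
      proof (cases "\<kappa> \<le> norm z")
        case True
        then have l: "?q \<le> ?r z" using lower \<kappa> by blast
        then have r: "0 \<le> ?r z" using q by linarith
        have "?q * ?r z \<le> ?r z * ?r z" by (rule mult_right_mono[OF l r])
        then have "?r z \<le> (?r z)\<^sup>2 / ?q" by (subst pos_le_divide_eq[OF q]) (simp add: power2_eq_square mult.commute)
        then show ?thesis using True r q by simp
      qed simp
    qed
  qed
  show "emeasure \<nu> {z. \<kappa> \<le> norm z} < \<infinity>" if \<kappa>: "0 < \<kappa>"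
  proof -
    let ?q = "min (K * \<kappa>) 1"
    have q: "0 < ?q" using K \<kappa> by simp
    have "integrable \<nu> (indicator {z. \<kappa> \<le> norm z} :: _ \<Rightarrow> real)"
    proof (rule Bochner_Integration.integrable_bound)
      show "integrable \<nu> (\<lambda>z. (1 / ?q\<^sup>2) * (?r z)\<^sup>2)" by (rule integrable_mult_right[OF ri])
      show "(indicator {z. \<kappa> \<le> norm z} :: _ \<Rightarrow> real) \<in> borel_measurable \<nu>" using ts[OF \<kappa>] by measurable
      show "AE z in \<nu>. norm (indicator {z. \<kappa> \<le> norm z} z :: real) \<le> norm ((1 / ?q\<^sup>2) * (?r z)\<^sup>2)"
      proof (rule AE_I2)
        fix z
        show "norm (indicator {z. \<kappa> \<le> norm z} z :: real) \<le> norm ((1 / ?q\<^sup>2) * (?r z)\<^sup>2)"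
        proof (cases "\<kappa> \<le> norm z")
          case True
          then have "?q\<^sup>2 \<le> (?r z)\<^sup>2" using lower \<kappa> q by (intro power_mono) auto
          moreover have "0 < ?q\<^sup>2" using q by simp
          ultimately have "1 \<le> (?r z)\<^sup>2 / ?q\<^sup>2" by (subst pos_le_divide_eq) auto
          then show ?thesis using True by simp
        qed simp
      qed
    qed
    then have "emeasure \<nu> ({z. \<kappa> \<le> norm z} \<inter> space \<nu>) < \<infinity>" by (simp add: integrable_indicator_iff)
    moreover have "{z. \<kappa> \<le> norm z} \<inter> space \<nu> = {z. \<kappa> \<le> norm z}" using \<kappa> by (auto simp: sp)
    ultimately show ?thesis by simp
  qed
qed

lemma Gam_nonneg: "0 < a \<Longrightarrow> a \<le> 1 \<Longrightarrow> 0 \<le> Gam \<sigma> a"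
  by (simp add: Gam_def)

lemma powr_le_Gam: "0 < a \<Longrightarrow> a \<le> 1 \<Longrightarrow> a powr (1 - \<sigma>) \<le> 1 + Gam \<sigma> a"
  using powr_le1[of "1 - \<sigma>" a] by (auto simp: Gam_def)

text \<open>One predicate for the moment bounds at all radii, so that \<open>D\<close> can be fixed
  outside the locale that fixes the measure.\<close>

definition levy_moments :: "real \<Rightarrow> real \<Rightarrow> real \<Rightarrow> (real^'m) measure \<Rightarrow> (real^'m \<Rightarrow> real) \<Rightarrow> bool" where
  "levy_moments \<sigma> D L \<nu> \<rho> \<longleftrightarrow> (\<forall>a. 0 < a \<and> a \<le> 1 \<longrightarrow>
      (\<integral>\<^sup>+z. ennreal ((norm z)\<^sup>2) * indicator {z. norm z < a} z \<partial>\<nu>) \<le> ennreal (D * a powr (2 - \<sigma>))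
    \<and> (\<integral>\<^sup>+z. ennreal (norm z) * indicator {z. a \<le> norm z \<and> norm z < 1} z \<partial>\<nu>) \<le> ennreal (D * (1 + Gam \<sigma> a))
    \<and> (\<integral>\<^sup>+z. indicator {z. a \<le> norm z \<and> norm z < 1} z \<partial>\<nu>) \<le> ennreal (D * a powr (- \<sigma>)))
    \<and> (\<integral>\<^sup>+z. ennreal (indicator {z. 1 \<le> norm z} z * (\<rho> z)\<^sup>2) \<partial>\<nu>) \<le> ennreal L"

text \<open>One estimate for all moments below: square near the origin, affine at intermediate
  jumps, \<rho> squared beyond. Only the positive part of \<open>h\<close> is estimated, so
  integrability of \<open>h\<close> does not have to be discussed.\<close>

lemma levy_integral_le:
  fixes \<nu> :: "(real^'m) measure"
  assumes M: "levy_moments \<sigma> D L \<nu> \<rho>" and DL: "0 \<le> D" "0 \<le> L"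
    and sets: "sets \<nu> = sets (restrict_space borel (- {0}))"
    and \<rho>: "(\<lambda>z. indicator {z. 1 \<le> norm z} z * (\<rho> z)\<^sup>2) \<in> borel_measurable \<nu>"
    and a: "0 < a" "a \<le> 1" and co: "0 \<le> \<alpha>" "0 \<le> \<beta>" "0 \<le> \<gamma>" "0 \<le> \<kappa>"
    and h1: "\<And>z. z \<noteq> 0 \<Longrightarrow> norm z < a \<Longrightarrow> h z \<le> \<alpha> * (norm z)\<^sup>2"
    and h2: "\<And>z. a \<le> norm z \<Longrightarrow> norm z < 1 \<Longrightarrow> h z \<le> \<beta> * norm z + \<gamma>"
    and h3: "\<And>z. 1 \<le> norm z \<Longrightarrow> h z \<le> \<kappa> * (\<rho> z)\<^sup>2"
  shows "(\<integral>z. h z \<partial>\<nu>) \<le> \<alpha> * (D * a powr (2 - \<sigma>)) + (\<beta> * (D * (1 + Gam \<sigma> a)) + (\<gamma> * (D * a powr (- \<sigma>)) + \<kappa> * L))"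
proof (rule integral_real_bounded)
  have sp: "space \<nu> = - {0}" using sets_eq_imp_space_eq[OF sets] by (simp add: space_restrict_space)
  have nm[measurable]: "(\<lambda>z. norm z) \<in> borel_measurable \<nu>"
    by (subst measurable_cong_sets[OF sets refl]) (auto intro: measurable_restrict_space1)
  have g: "0 \<le> Gam \<sigma> a" by (rule Gam_nonneg[OF a])
  let ?f1 = "\<lambda>z. ennreal ((norm z)\<^sup>2) * indicator {z. norm z < a} z"
    and ?f2 = "\<lambda>z. ennreal (norm z) * indicator {z. a \<le> norm z \<and> norm z < 1} z"
    and ?f3 = "\<lambda>z. indicator {z. a \<le> norm z \<and> norm z < 1} z :: ennreal"
    and ?f4 = "\<lambda>z. ennreal (indicator {z. 1 \<le> norm z} z * (\<rho> z)\<^sup>2)"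
  have "?f1 = (\<lambda>z. if norm z < a then ennreal ((norm z)\<^sup>2) else 0)"
    "?f2 = (\<lambda>z. if a \<le> norm z \<and> norm z < 1 then ennreal (norm z) else 0)"
    "?f3 = (\<lambda>z. if a \<le> norm z \<and> norm z < 1 then 1 else 0)" by auto
  then have fm[measurable]: "?f1 \<in> borel_measurable \<nu>" "?f2 \<in> borel_measurable \<nu>" "?f3 \<in> borel_measurable \<nu>" "?f4 \<in> borel_measurable \<nu>"
    using \<rho> by simp_all
  have "(\<integral>\<^sup>+z. ennreal (h z) \<partial>\<nu>) \<le> (\<integral>\<^sup>+z. ennreal \<alpha> * ?f1 z + (ennreal \<beta> * ?f2 z + (ennreal \<gamma> * ?f3 z + ennreal \<kappa> * ?f4 z)) \<partial>\<nu>)"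
  proof (rule nn_integral_mono)
    fix z assume "z \<in> space \<nu>"
    then have z: "z \<noteq> 0" by (simp add: sp)
    consider "norm z < a" | "a \<le> norm z" "norm z < 1" | "1 \<le> norm z" by linarith
    then show "ennreal (h z) \<le> ennreal \<alpha> * ?f1 z + (ennreal \<beta> * ?f2 z + (ennreal \<gamma> * ?f3 z + ennreal \<kappa> * ?f4 z))"
    proof cases
      case 1
      then show ?thesis using ennreal_leI[OF h1[OF z 1]] a co by (simp add: ennreal_mult)
    next
      case 2
      then show ?thesis using ennreal_leI[OF h2[OF 2]] co by (simp add: ennreal_mult)
    next
      case 3
      then show ?thesis using ennreal_leI[OF h3[OF 3]] a co by (simp add: ennreal_mult)
    qed
  qed
  also have "\<dots> = ennreal \<alpha> * (\<integral>\<^sup>+z. ?f1 z \<partial>\<nu>) + (ennreal \<beta> * (\<integral>\<^sup>+z. ?f2 z \<partial>\<nu>) + (ennreal \<gamma> * (\<integral>\<^sup>+z. ?f3 z \<partial>\<nu>) + ennreal \<kappa> * (\<integral>\<^sup>+z. ?f4 z \<partial>\<nu>)))"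
    by (simp only: nn_integral_add nn_integral_cmult fm borel_measurable_add borel_measurable_times_ennreal borel_measurable_const)
  also have "\<dots> \<le> ennreal \<alpha> * ennreal (D * a powr (2 - \<sigma>)) + (ennreal \<beta> * ennreal (D * (1 + Gam \<sigma> a)) + (ennreal \<gamma> * ennreal (D * a powr (- \<sigma>)) + ennreal \<kappa> * ennreal L))"
    using M a unfolding levy_moments_def by (intro add_mono mult_left_mono) auto
  also have "\<dots> = ennreal (\<alpha> * (D * a powr (2 - \<sigma>)) + (\<beta> * (D * (1 + Gam \<sigma> a)) + (\<gamma> * (D * a powr (- \<sigma>)) + \<kappa> * L)))"
    using co DL g by (simp add: ennreal_mult)
  finally show "(\<integral>\<^sup>+z. ennreal (h z) \<partial>\<nu>) \<le> \<dots>" .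
  show "0 \<le> \<alpha> * (D * a powr (2 - \<sigma>)) + (\<beta> * (D * (1 + Gam \<sigma> a)) + (\<gamma> * (D * a powr (- \<sigma>)) + \<kappa> * L))"
    using co DL g by simp
qed

section \<open>The abstract data of the game\<close>

locale error_estimate =
  fixes \<sigma> K L C\<^sub>\<nu> cN Cw Kw :: real and A :: "'a metric" and B :: "'b metric" and T :: real
    and u0 :: "real^'n \<Rightarrow> real" and f c b
    and \<eta> :: "'a \<Rightarrow> 'b \<Rightarrow> real \<Rightarrow> real^'n \<Rightarrow> real^'m \<Rightarrow> real^'n" and \<rho> \<nu> u \<omega> \<theta> \<theta>' \<delta> dt MT dx U
  assumes \<sigma>: "0 < \<sigma>" "\<sigma> < 2" and K: "0 < K"
    and setting: "error_estimate_setting \<sigma> K L C\<^sub>\<nu> cN Cw Kw A B T u0 f c b \<eta> \<rho> \<nu> u \<omega> \<theta> \<theta>' \<delta> dt MT dx U"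
begin

lemma setting_facts:
  "0 < T" "assm_A1 A B T f c b \<eta>" "assm_A2 K A B T u0 f c b" "assm_A3 K A B T \<eta> \<rho>"
  "assm_A4 L \<nu> \<rho>" "assm_A5 \<sigma> C\<^sub>\<nu> \<nu>"
  "\<And>\<alpha> \<beta> t x z. \<alpha> \<in> mspace A \<Longrightarrow> \<beta> \<in> mspace B \<Longrightarrow> t \<in> {0..T} \<Longrightarrow> z \<noteq> 0 \<Longrightarrow> \<eta> \<alpha> \<beta> t x z = \<eta> \<alpha> \<beta> 0 0 z"
  "0 \<le> \<theta>" "\<theta> \<le> 1" "0 \<le> \<theta>'" "\<theta>' \<le> 1" "1 \<le> MT" "dt = T / real MT" "0 < dx" "dx \<le> \<delta>" "\<delta> \<le> 1"
  "tent_basis cN Cw Kw dx \<omega>" "CFL A B c b \<eta> \<nu> \<omega> \<theta> \<theta>' \<delta> dt MT dx"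
  "ivp_visc_solution A B T u0 f c b \<eta> \<nu> u" "scheme_solution A B u0 f c b \<eta> \<nu> \<omega> \<theta> \<theta>' \<delta> dt MT dx U"
proof -
  note S = setting[unfolded error_estimate_setting_def]
  have *: "\<forall>\<alpha>\<in>mspace A. \<forall>\<beta>\<in>mspace B. \<forall>t\<in>{0..T}. \<forall>s\<in>{0..T}. \<forall>x y z. z \<noteq> 0 \<longrightarrow> \<eta> \<alpha> \<beta> t x z = \<eta> \<alpha> \<beta> s y z"
    using S by (elim conjE)
  show "0 < T" using S by (elim conjE)
  then show "\<eta> \<alpha> \<beta> t x z = \<eta> \<alpha> \<beta> 0 0 z" if "\<alpha> \<in> mspace A" "\<beta> \<in> mspace B" "t \<in> {0..T}" "z \<noteq> 0" for \<alpha> \<beta> t x z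
    by (intro *[rule_format] that) auto
  show "assm_A1 A B T f c b \<eta>" "assm_A2 K A B T u0 f c b" "assm_A3 K A B T \<eta> \<rho>"
    "assm_A4 L \<nu> \<rho>" "assm_A5 \<sigma> C\<^sub>\<nu> \<nu>" "0 \<le> \<theta>" "\<theta> \<le> 1" "0 \<le> \<theta>'" "\<theta>' \<le> 1" "1 \<le> MT" "dt = T / real MT" "0 < dx" "dx \<le> \<delta>" "\<delta> \<le> 1"
    "tent_basis cN Cw Kw dx \<omega>" "CFL A B c b \<eta> \<nu> \<omega> \<theta> \<theta>' \<delta> dt MT dx"
    "ivp_visc_solution A B T u0 f c b \<eta> \<nu> u" "scheme_solution A B u0 f c b \<eta> \<nu> \<omega> \<theta> \<theta>' \<delta> dt MT dx U"
    using S by blast+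
qed

definition "I = mspace A \<times> mspace B"
text \<open>The jumps frozen at time 0 and position 0; away from \<open>z = 0\<close> nothing is
  lost, since they do not depend on time and position.\<close>

definition "\<eta>0 = (\<lambda>(\<alpha>, \<beta>). \<eta> \<alpha> \<beta> 0 0)"
definition "b0 = (\<lambda>(\<alpha>, \<beta>). b \<alpha> \<beta>)"
definition "c0 = (\<lambda>(\<alpha>, \<beta>). c \<alpha> \<beta>)"
definition "f0 = (\<lambda>(\<alpha>, \<beta>). f \<alpha> \<beta>)"

lemma nonempty: "mspace A \<noteq> {}" "mspace B \<noteq> {}"
  using setting_facts(2) by (auto simp: assm_A1_def)

lemma sets_levy: "sets \<nu> = sets (restrict_space borel (- {0}))"
  using setting_facts(5) by (simp add: assm_A4_def)

lemma space_levy': "space \<nu> = - {0}"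
  using sets_eq_imp_space_eq[OF sets_levy] by (simp add: space_restrict_space)

lemma jump_size:
  "z \<noteq> 0 \<Longrightarrow> 0 \<le> \<rho> z" "1 \<le> norm z \<Longrightarrow> 1 \<le> \<rho> z \<and> \<rho> z \<le> (\<rho> z)\<^sup>2"
  "\<alpha> \<in> mspace A \<Longrightarrow> \<beta> \<in> mspace B \<Longrightarrow> z \<noteq> 0 \<Longrightarrow> norm (\<eta> \<alpha> \<beta> 0 0 z) \<le> jump_bound K \<rho> z"
proof -
  note A3 = setting_facts(4)[unfolded assm_A3_def]
  show "z \<noteq> 0 \<Longrightarrow> 0 \<le> \<rho> z" "1 \<le> norm z \<Longrightarrow> 1 \<le> \<rho> z \<and> \<rho> z \<le> (\<rho> z)\<^sup>2" using A3 by blast+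
  assume a: "\<alpha> \<in> mspace A" "\<beta> \<in> mspace B" "z \<noteq> 0"
  have "norm (\<eta> \<alpha> \<beta> 0 0 z) \<le> \<rho> z" using A3 a setting_facts(1) by force
  moreover have "norm z < 1 \<Longrightarrow> \<rho> z \<le> K * norm z" using A3 a by blast
  ultimately show "norm (\<eta> \<alpha> \<beta> 0 0 z) \<le> jump_bound K \<rho> z" by (auto simp: jump_bound_def)
qed

lemma jump_bound_facts:
  "jump_bound K \<rho> \<in> borel_measurable \<nu>" "integrable \<nu> (\<lambda>z. (jump_bound K \<rho> z)\<^sup>2)"
  "0 < \<kappa> \<Longrightarrow> set_integrable \<nu> {z. \<kappa> \<le> norm z} (jump_bound K \<rho>)"
  "0 < \<kappa> \<Longrightarrow> emeasure \<nu> {z. \<kappa> \<le> norm z} < \<infinity>"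
  "(\<integral>\<^sup>+z. ennreal (indicator {z. 1 \<le> norm z} z * (\<rho> z)\<^sup>2) \<partial>\<nu>) \<le> ennreal L" "0 \<le> L"
  by (rule jump_bound_integrable[OF K setting_facts(5) jump_size(1,2)], assumption+)+

lemma data_norms:
  assumes "\<alpha> \<in> mspace A" "\<beta> \<in> mspace B"
  shows "norm1 (Qbar_dom T) (\<lambda>t. u0) \<le> ennreal K" "norm1 (Qbar_dom T) (f \<alpha> \<beta>) \<le> ennreal K"
    "norm1 (Qbar_dom T) (c \<alpha> \<beta>) \<le> ennreal K" "norm1 (Qbar_dom T) (b \<alpha> \<beta>) \<le> ennreal K"
proof -
  have *: "norm1 (Qbar_dom T) (\<lambda>t. u0) + norm1 (Qbar_dom T) (f \<alpha> \<beta>)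
          + norm1 (Qbar_dom T) (c \<alpha> \<beta>) + norm1 (Qbar_dom T) (b \<alpha> \<beta>) \<le> ennreal K"
    using setting_facts(3) assms unfolding assm_A2_def by blast
  have "p \<le> K' \<and> q \<le> K' \<and> r \<le> K' \<and> s \<le> K'" if "p + q + r + s \<le> K'" for p q r s K' :: ennreal
  proof (intro conjI)
    show "p \<le> K'" "q \<le> K'" "r \<le> K'" "s \<le> K'"
      by (rule order_trans[OF _ that]; simp add: add_increasing add_increasing2)+
  qed
  from this[OF *] show "norm1 (Qbar_dom T) (\<lambda>t. u0) \<le> ennreal K" "norm1 (Qbar_dom T) (f \<alpha> \<beta>) \<le> ennreal K"
    "norm1 (Qbar_dom T) (c \<alpha> \<beta>) \<le> ennreal K" "norm1 (Qbar_dom T) (b \<alpha> \<beta>) \<le> ennreal K" by simp_all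
qed

lemma initial_bounds: "\<bar>u0 x - u0 y\<bar> \<le> K * norm (x - y)" "\<bar>u0 x\<bar> \<le> K"
proof -
  obtain \<alpha> \<beta> where "\<alpha> \<in> mspace A" "\<beta> \<in> mspace B" using nonempty by blast
  note D = norm1_boundD[OF data_norms(1)[OF this] less_imp_le[OF K], of 0]
  have m: "(0, z) \<in> Qbar_dom T" for z :: "real^'n" using setting_facts(1) by (simp add: Qbar_dom_def)
  show "\<bar>u0 x - u0 y\<bar> \<le> K * norm (x - y)" using D(2)[OF m m] by simp
  show "\<bar>u0 x\<bar> \<le> K" using D(1)[OF m] by simp
qed

lemma operator_eq:
  assumes i: "i \<in> I" and t: "t \<in> {0..T}"
  shows "D_op (b (fst i) (snd i)) (\<eta> (fst i) (snd i)) \<nu> \<delta> dx w t x = D_op (b0 i) (\<lambda>_ _. \<eta>0 i) \<nu> \<delta> dx w t x"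
    "d_coeff (b (fst i) (snd i)) (\<eta> (fst i) (snd i)) \<nu> \<delta> dx k t x = d_coeff (b0 i) (\<lambda>_ _. \<eta>0 i) \<nu> \<delta> dx k t x"
    "kappa_coeff \<omega> (\<eta> (fst i) (snd i)) \<nu> \<delta> k t x = kappa_coeff \<omega> (\<lambda>_ _. \<eta>0 i) \<nu> \<delta> k t x"
    "J_op \<omega> (\<eta> (fst i) (snd i)) \<nu> \<delta> dx w t x = J_op \<omega> (\<lambda>_ _. \<eta>0 i) \<nu> \<delta> dx w t x"
    "nonlocal_inner \<nu> (\<eta> (fst i) (snd i)) \<kappa> \<phi> t x = nonlocal_inner \<nu> (\<lambda>_ _. \<eta>0 i) \<kappa> \<phi> t x"
    "nonlocal_outer \<nu> (\<eta> (fst i) (snd i)) \<kappa> \<phi> p t x = nonlocal_outer \<nu> (\<lambda>_ _. \<eta>0 i) \<kappa> \<phi> p t x"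
    "nonlocal \<nu> (\<eta> (fst i) (snd i)) \<phi> t x = nonlocal \<nu> (\<lambda>_ _. \<eta>0 i) \<phi> t x"
proof -
  have e: "\<eta> (fst i) (snd i) t x z = \<eta>0 i z" if "z \<noteq> 0" for z
    using setting_facts(7)[of "fst i" "snd i" t z x] i t that by (auto simp: I_def \<eta>0_def case_prod_beta')
  have b: "b (fst i) (snd i) = b0 i" by (simp add: b0_def case_prod_beta')
  show "D_op (b (fst i) (snd i)) (\<eta> (fst i) (snd i)) \<nu> \<delta> dx w t x = D_op (b0 i) (\<lambda>_ _. \<eta>0 i) \<nu> \<delta> dx w t x"
    "d_coeff (b (fst i) (snd i)) (\<eta> (fst i) (snd i)) \<nu> \<delta> dx k t x = d_coeff (b0 i) (\<lambda>_ _. \<eta>0 i) \<nu> \<delta> dx k t x"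
    "kappa_coeff \<omega> (\<eta> (fst i) (snd i)) \<nu> \<delta> k t x = kappa_coeff \<omega> (\<lambda>_ _. \<eta>0 i) \<nu> \<delta> k t x"
    "J_op \<omega> (\<eta> (fst i) (snd i)) \<nu> \<delta> dx w t x = J_op \<omega> (\<lambda>_ _. \<eta>0 i) \<nu> \<delta> dx w t x"
    "nonlocal_inner \<nu> (\<eta> (fst i) (snd i)) \<kappa> \<phi> t x = nonlocal_inner \<nu> (\<lambda>_ _. \<eta>0 i) \<kappa> \<phi> t x"
    "nonlocal_outer \<nu> (\<eta> (fst i) (snd i)) \<kappa> \<phi> p t x = nonlocal_outer \<nu> (\<lambda>_ _. \<eta>0 i) \<kappa> \<phi> p t x"
    "nonlocal \<nu> (\<eta> (fst i) (snd i)) \<phi> t x = nonlocal \<nu> (\<lambda>_ _. \<eta>0 i) \<phi> t x"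
    unfolding b by (rule operator_cong_jump; (rule space_levy' | (rule e, assumption)))+
qed

lemma eta0_measurable: assumes i: "i \<in> I" shows "\<eta>0 i \<in> borel_measurable \<nu>"
proof -
  have "continuous_on (- {0}) (\<eta> (fst i) (snd i) 0 0)"
    by (rule continuous_map_jump[OF setting_facts(2,1)]) (use i in \<open>auto simp: I_def\<close>)
  then have "\<eta> (fst i) (snd i) 0 0 \<in> borel_measurable (restrict_space borel (- {0}))"
    by (rule borel_measurable_continuous_on_restrict)
  then show ?thesis unfolding \<eta>0_def case_prod_beta' by (simp add: measurable_cong_sets[OF sets_levy refl])
qed

text \<open>The abstract results become available with pairs of controls as indices and
  \<open>jump_bound K \<rho>\<close> as the common measurable majorant of all jumps.\<close>

sublocale isaacs_scheme I \<nu> \<eta>0 "jump_bound K \<rho>" \<delta> b0 c0 K T cN Cw Kw dx \<omega> \<theta> \<theta>' dt MT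
proof unfold_locales
  have Q: "(t, x) \<in> Qbar_dom T" if "t \<in> {0..T}" for t and x :: "real^'n" using that by (simp add: Qbar_dom_def)
  show "0 < \<delta>" "\<delta> \<le> 1" "0 < dx" "tent_basis cN Cw Kw dx \<omega>" "0 \<le> \<theta>" "\<theta> \<le> 1" "0 \<le> \<theta>'" "\<theta>' \<le> 1" "1 \<le> MT" "dt = T / real MT" "0 < T" "0 < K"
    using setting_facts K by simp_all
  show "sets \<nu> = sets (restrict_space borel (- {0}))" by (rule sets_levy)
  show "\<eta>0 i \<in> borel_measurable \<nu>" if "i \<in> I" for i by (rule eta0_measurable[OF that])
  show "norm (\<eta>0 i z) \<le> jump_bound K \<rho> z" if "i \<in> I" "z \<noteq> 0" for i z
    using jump_size(3)[of "fst i" "snd i" z] that by (auto simp: I_def \<eta>0_def case_prod_beta')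
  show "jump_bound K \<rho> \<in> borel_measurable \<nu>" "integrable \<nu> (\<lambda>z. (jump_bound K \<rho> z)\<^sup>2)"
    by (rule jump_bound_facts)+
  show "set_integrable \<nu> {z. \<kappa> \<le> norm z} (jump_bound K \<rho>)" "emeasure \<nu> {z. \<kappa> \<le> norm z} < \<infinity>" if "0 < \<kappa>" for \<kappa>
    using jump_bound_facts(3,4)[OF that] by simp_all
  show "I \<noteq> {}" using nonempty by (simp add: I_def)
  fix i assume i: "i \<in> I"
  then have i': "fst i \<in> mspace A" "snd i \<in> mspace B" by (auto simp: I_def)
  note N = norm1_boundD[OF data_norms(3)[OF i'] less_imp_le[OF K]] norm1_boundD[OF data_norms(4)[OF i'] less_imp_le[OF K]]
  show "norm (b0 i t x) \<le> K" if "t \<in> {0..T}" for t x using N(3)[OF Q[OF that]] by (simp add: b0_def case_prod_beta')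
  show "norm (b0 i t x - b0 i s y) \<le> K * (\<bar>t - s\<bar> + norm (x - y))" if "t \<in> {0..T}" "s \<in> {0..T}" for t s x y
    using N(4)[OF Q[OF that(1)] Q[OF that(2)]] by (simp add: b0_def case_prod_beta')
  show "0 \<le> c0 i t x \<and> c0 i t x \<le> K" if "t \<in> {0..T}" for t x
  proof -
    have "0 \<le> c (fst i) (snd i) t x" using setting_facts(2) i' that unfolding assm_A1_def by blast
    moreover have "norm (c (fst i) (snd i) t x) \<le> K" by (rule N(1)[OF Q[OF that]])
    ultimately show ?thesis by (simp add: c0_def case_prod_beta')
  qed
  show "\<bar>c0 i t x - c0 i s y\<bar> \<le> K * (\<bar>t - s\<bar> + norm (x - y))" if "t \<in> {0..T}" "s \<in> {0..T}" for t s x y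
    using N(2)[OF Q[OF that(1)] Q[OF that(2)]] by (simp add: c0_def case_prod_beta')
  fix n and j :: "int^'n" assume n: "n \<in> {1..MT}"
  have s: "real (n - 1) * dt \<in> {0..T}"
  proof -
    have dt: "0 \<le> dt" "real MT * dt = T" using setting_facts(1,12,13) by simp_all
    have "real (n - 1) * dt \<le> real MT * dt" using n dt by (intro mult_right_mono) auto
    then show ?thesis using dt by simp
  qed
  have "dt * ((1 - \<theta>) * (\<Sum>\<^sub>\<infinity>k\<in>-{0}. d_coeff (b (fst i) (snd i)) (\<eta> (fst i) (snd i)) \<nu> \<delta> dx k (real (n - 1) * dt) (grid_pt dx j))
            + (1 - \<theta>') * (\<Sum>\<^sub>\<infinity>k\<in>-{0}. kappa_coeff \<omega> (\<eta> (fst i) (snd i)) \<nu> \<delta> k (real (n - 1) * dt) (grid_pt dx j))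
            + c (fst i) (snd i) (real n * dt) (grid_pt dx j)) \<le> 1"
    using setting_facts(18) i' n unfolding CFL_def Let_def by blast
  then show "dt * ((1 - \<theta>) * (\<Sum>\<^sub>\<infinity>k\<in>-{0}. d_coeff (b0 i) (\<lambda>_ _. \<eta>0 i) \<nu> \<delta> dx k (real (n - 1) * dt) (grid_pt dx j))
            + (1 - \<theta>') * (\<Sum>\<^sub>\<infinity>k\<in>-{0}. kappa_coeff \<omega> (\<lambda>_ _. \<eta>0 i) \<nu> \<delta> k (real (n - 1) * dt) (grid_pt dx j))
            + c0 i (real n * dt) (grid_pt dx j)) \<le> 1"
    unfolding operator_eq[OF i s] by (simp add: c0_def case_prod_beta')
qed

abbreviation "G \<equiv> infsup A B"

lemma game: "game_operator I G"
  unfolding I_def by (rule game_operator_infsup[OF nonempty])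

lemma infsup_cong: "(\<And>i. i \<in> I \<Longrightarrow> X i = Y i) \<Longrightarrow> G X = G Y"
  unfolding infsup_def I_def by (intro INF_cong SUP_cong refl) simp

lemma source_f0: "source f0"
  unfolding source_def
proof (intro ballI allI conjI)
  have Q: "(t, x) \<in> Qbar_dom T" if "t \<in> {0..T}" for t and x :: "real^'n" using that by (simp add: Qbar_dom_def)
  fix i t x assume i: "i \<in> I" and t: "t \<in> {0..T}"
  then have i': "fst i \<in> mspace A" "snd i \<in> mspace B" by (auto simp: I_def)
  note N = norm1_boundD[OF data_norms(2)[OF i'] less_imp_le[OF K]]
  show "\<bar>f0 i t x\<bar> \<le> K" using N(1)[OF Q[OF t]] by (simp add: f0_def case_prod_beta')
  show "\<bar>f0 i t x - f0 i s y\<bar> \<le> K * (\<bar>t - s\<bar> + norm (x - y))" if "s \<in> {0..T}" for s y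
    using N(2)[OF Q[OF t] Q[OF that]] by (simp add: f0_def case_prod_beta')
qed

lemma scheme_U: "scheme G f0 U"
  unfolding scheme_def Let_def
proof (intro ballI allI)
  fix n and j :: "int^'n" assume n: "n \<in> {1..MT}"
  let ?t = "real n * dt" and ?s = "real (n - 1) * dt" and ?x = "grid_pt dx j"
  have t: "?t \<in> {0..T}" and s: "?s \<in> {0..T}" using grid_time[of n] grid_time[of "n - 1"] n by auto
  have "U ?t ?x = U ?s ?x - dt * (INF \<alpha>\<in>mspace A. SUP \<beta>\<in>mspace B.
           - f \<alpha> \<beta> ?s ?x + c \<alpha> \<beta> ?t ?x * U ?s ?x
           - \<theta> * D_op (b \<alpha> \<beta>) (\<eta> \<alpha> \<beta>) \<nu> \<delta> dx U ?t ?x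
           - (1 - \<theta>) * D_op (b \<alpha> \<beta>) (\<eta> \<alpha> \<beta>) \<nu> \<delta> dx U ?s ?x
           - \<theta>' * J_op \<omega> (\<eta> \<alpha> \<beta>) \<nu> \<delta> dx U ?t ?x
           - (1 - \<theta>') * J_op \<omega> (\<eta> \<alpha> \<beta>) \<nu> \<delta> dx U ?s ?x)"
    using setting_facts(20) n unfolding scheme_solution_def Let_def by blast
  also have "(INF \<alpha>\<in>mspace A. SUP \<beta>\<in>mspace B.
           - f \<alpha> \<beta> ?s ?x + c \<alpha> \<beta> ?t ?x * U ?s ?x
           - \<theta> * D_op (b \<alpha> \<beta>) (\<eta> \<alpha> \<beta>) \<nu> \<delta> dx U ?t ?x
           - (1 - \<theta>) * D_op (b \<alpha> \<beta>) (\<eta> \<alpha> \<beta>) \<nu> \<delta> dx U ?s ?x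
           - \<theta>' * J_op \<omega> (\<eta> \<alpha> \<beta>) \<nu> \<delta> dx U ?t ?x
           - (1 - \<theta>') * J_op \<omega> (\<eta> \<alpha> \<beta>) \<nu> \<delta> dx U ?s ?x)
    = G (\<lambda>i. - f (fst i) (snd i) ?s ?x + c (fst i) (snd i) ?t ?x * U ?s ?x
           - \<theta> * D_op (b (fst i) (snd i)) (\<eta> (fst i) (snd i)) \<nu> \<delta> dx U ?t ?x
           - (1 - \<theta>) * D_op (b (fst i) (snd i)) (\<eta> (fst i) (snd i)) \<nu> \<delta> dx U ?s ?x
           - \<theta>' * J_op \<omega> (\<eta> (fst i) (snd i)) \<nu> \<delta> dx U ?t ?x
           - (1 - \<theta>') * J_op \<omega> (\<eta> (fst i) (snd i)) \<nu> \<delta> dx U ?s ?x)"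
    unfolding infsup_def by simp
  also have "\<dots> = G (\<lambda>i. - f0 i ?s ?x + c0 i ?t ?x * U ?s ?x
           - \<theta> * D_op (b0 i) (\<lambda>_ _. \<eta>0 i) \<nu> \<delta> dx U ?t ?x
           - (1 - \<theta>) * D_op (b0 i) (\<lambda>_ _. \<eta>0 i) \<nu> \<delta> dx U ?s ?x
           - \<theta>' * J_op \<omega> (\<lambda>_ _. \<eta>0 i) \<nu> \<delta> dx U ?t ?x
           - (1 - \<theta>') * J_op \<omega> (\<lambda>_ _. \<eta>0 i) \<nu> \<delta> dx U ?s ?x)"
  proof (rule infsup_cong)
    fix i assume i: "i \<in> I"
    have "f (fst i) (snd i) = f0 i" "c (fst i) (snd i) = c0 i" by (simp_all add: f0_def c0_def case_prod_beta')
    then show "- f (fst i) (snd i) ?s ?x + c (fst i) (snd i) ?t ?x * U ?s ?x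
           - \<theta> * D_op (b (fst i) (snd i)) (\<eta> (fst i) (snd i)) \<nu> \<delta> dx U ?t ?x
           - (1 - \<theta>) * D_op (b (fst i) (snd i)) (\<eta> (fst i) (snd i)) \<nu> \<delta> dx U ?s ?x
           - \<theta>' * J_op \<omega> (\<eta> (fst i) (snd i)) \<nu> \<delta> dx U ?t ?x
           - (1 - \<theta>') * J_op \<omega> (\<eta> (fst i) (snd i)) \<nu> \<delta> dx U ?s ?x
      = - f0 i ?s ?x + c0 i ?t ?x * U ?s ?x
           - \<theta> * D_op (b0 i) (\<lambda>_ _. \<eta>0 i) \<nu> \<delta> dx U ?t ?x
           - (1 - \<theta>) * D_op (b0 i) (\<lambda>_ _. \<eta>0 i) \<nu> \<delta> dx U ?s ?x
           - \<theta>' * J_op \<omega> (\<lambda>_ _. \<eta>0 i) \<nu> \<delta> dx U ?t ?x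
           - (1 - \<theta>') * J_op \<omega> (\<lambda>_ _. \<eta>0 i) \<nu> \<delta> dx U ?s ?x"
      by (simp only: operator_eq[OF i t] operator_eq[OF i s])
  qed
  finally show "U ?t ?x = U ?s ?x - dt * G (\<lambda>i. - f0 i ?s ?x + c0 i ?t ?x * U ?s ?x
           - \<theta> * D_op (b0 i) (\<lambda>_ _. \<eta>0 i) \<nu> \<delta> dx U ?t ?x
           - (1 - \<theta>) * D_op (b0 i) (\<lambda>_ _. \<eta>0 i) \<nu> \<delta> dx U ?s ?x
           - \<theta>' * J_op \<omega> (\<lambda>_ _. \<eta>0 i) \<nu> \<delta> dx U ?t ?x
           - (1 - \<theta>') * J_op \<omega> (\<lambda>_ _. \<eta>0 i) \<nu> \<delta> dx U ?s ?x)" .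
qed

lemma grid_bounded_U: obtains MU where "grid_bounded MU U"
proof -
  have "bounded ((\<lambda>(t, x). U t x) ` grid dt MT dx)" using setting_facts(20) by (simp add: scheme_solution_def)
  then obtain MU where MU: "\<And>v. v \<in> (\<lambda>(t, x). U t x) ` grid dt MT dx \<Longrightarrow> \<bar>v\<bar> \<le> MU" by (auto simp: bounded_iff)
  have "grid_bounded MU U"
    unfolding grid_bounded_def
  proof (intro allI impI MU)
    fix n and j :: "int^'n" assume "n \<le> MT"
    then have "(real n * dt, grid_pt dx j) \<in> grid dt MT dx" by (auto simp: grid_def)
    then show "U (real n * dt) (grid_pt dx j) \<in> (\<lambda>(t, x). U t x) ` grid dt MT dx" by (rule rev_image_eqI) simp
  qed
  then show ?thesis by (rule that)
qed

lemma visc_lhs_eq: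
  assumes t: "t \<in> {0..T}"
  shows "visc_lhs A B T f c b \<eta> \<nu> \<kappa> u \<phi> t x = vector_derivative (\<lambda>s. \<phi> s x) (at t within {0<..T}) +
       G (\<lambda>i. - f0 i t x + c0 i t x * u t x - b0 i t x \<bullet> grad (\<phi> t) x
        - nonlocal_inner \<nu> (\<lambda>_ _. \<eta>0 i) \<kappa> \<phi> t x
        - nonlocal_outer \<nu> (\<lambda>_ _. \<eta>0 i) \<kappa> u (grad (\<phi> t) x) t x)"
proof -
  have "(INF \<alpha>\<in>mspace A. SUP \<beta>\<in>mspace B.
        - f \<alpha> \<beta> t x + c \<alpha> \<beta> t x * u t x - b \<alpha> \<beta> t x \<bullet> grad (\<phi> t) x
        - nonlocal_inner \<nu> (\<eta> \<alpha> \<beta>) \<kappa> \<phi> t x - nonlocal_outer \<nu> (\<eta> \<alpha> \<beta>) \<kappa> u (grad (\<phi> t) x) t x)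
     = G (\<lambda>i. - f (fst i) (snd i) t x + c (fst i) (snd i) t x * u t x - b (fst i) (snd i) t x \<bullet> grad (\<phi> t) x
        - nonlocal_inner \<nu> (\<eta> (fst i) (snd i)) \<kappa> \<phi> t x - nonlocal_outer \<nu> (\<eta> (fst i) (snd i)) \<kappa> u (grad (\<phi> t) x) t x)"
    unfolding infsup_def by simp
  also have "\<dots> = G (\<lambda>i. - f0 i t x + c0 i t x * u t x - b0 i t x \<bullet> grad (\<phi> t) x
        - nonlocal_inner \<nu> (\<lambda>_ _. \<eta>0 i) \<kappa> \<phi> t x - nonlocal_outer \<nu> (\<lambda>_ _. \<eta>0 i) \<kappa> u (grad (\<phi> t) x) t x)"
  proof (rule infsup_cong)
    fix i assume i: "i \<in> I"
    have "f (fst i) (snd i) = f0 i" "c (fst i) (snd i) = c0 i" "b (fst i) (snd i) = b0 i"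
      by (simp_all add: f0_def c0_def b0_def case_prod_beta')
    then show "- f (fst i) (snd i) t x + c (fst i) (snd i) t x * u t x - b (fst i) (snd i) t x \<bullet> grad (\<phi> t) x
        - nonlocal_inner \<nu> (\<eta> (fst i) (snd i)) \<kappa> \<phi> t x - nonlocal_outer \<nu> (\<eta> (fst i) (snd i)) \<kappa> u (grad (\<phi> t) x) t x
      = - f0 i t x + c0 i t x * u t x - b0 i t x \<bullet> grad (\<phi> t) x
        - nonlocal_inner \<nu> (\<lambda>_ _. \<eta>0 i) \<kappa> \<phi> t x - nonlocal_outer \<nu> (\<lambda>_ _. \<eta>0 i) \<kappa> u (grad (\<phi> t) x) t x"
      by (simp only: operator_eq[OF i t])
  qed
  finally show ?thesis by (simp only: visc_lhs_def)
qed

lemma visc_u: "visc_super G f0 u" "visc_sub G f0 u"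
proof -
  have S: "visc_subsolution A B T f c b \<eta> \<nu> u" "visc_supersolution A B T f c b \<eta> \<nu> u"
    using setting_facts(19) by (simp_all add: ivp_visc_solution_def)
  have t: "t \<in> {0..T}" if "(t, x) \<in> Q_dom T" for t and x :: "real^'n" using that by (auto simp: Q_dom_def)
  show "visc_super G f0 u"
    unfolding visc_super_def
  proof (intro allI impI)
    fix \<kappa> :: real and \<phi> :: "real \<Rightarrow> real^'n \<Rightarrow> real" and t :: real and x :: "real^'n"
    assume *: "0 < \<kappa> \<and> \<kappa> < 1 \<and> C2_on (Q_dom T) (\<lambda>(s, y). \<phi> s y) \<and> (t, x) \<in> Q_dom T \<and>
        (\<forall>(s, y) \<in> Q_dom T. u t x - \<phi> t x \<le> u s y - \<phi> s y)"
    then have "0 \<le> visc_lhs A B T f c b \<eta> \<nu> \<kappa> u \<phi> t x" using S(2) unfolding visc_supersolution_def by blast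
    moreover have "t \<in> {0..T}" using * t by blast
    ultimately show "0 \<le> vector_derivative (\<lambda>s. \<phi> s x) (at t within {0<..T}) +
       G (\<lambda>i. - f0 i t x + c0 i t x * u t x - b0 i t x \<bullet> grad (\<phi> t) x
        - nonlocal_inner \<nu> (\<lambda>_ _. \<eta>0 i) \<kappa> \<phi> t x
        - nonlocal_outer \<nu> (\<lambda>_ _. \<eta>0 i) \<kappa> u (grad (\<phi> t) x) t x)" by (simp only: visc_lhs_eq)
  qed
  show "visc_sub G f0 u"
    unfolding visc_sub_def
  proof (intro allI impI)
    fix \<kappa> :: real and \<phi> :: "real \<Rightarrow> real^'n \<Rightarrow> real" and t :: real and x :: "real^'n"
    assume *: "0 < \<kappa> \<and> \<kappa> < 1 \<and> C2_on (Q_dom T) (\<lambda>(s, y). \<phi> s y) \<and> (t, x) \<in> Q_dom T \<and>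
        (\<forall>(s, y) \<in> Q_dom T. u s y - \<phi> s y \<le> u t x - \<phi> t x)"
    then have "visc_lhs A B T f c b \<eta> \<nu> \<kappa> u \<phi> t x \<le> 0" using S(1) unfolding visc_subsolution_def by blast
    moreover have "t \<in> {0..T}" using * t by blast
    ultimately show "vector_derivative (\<lambda>s. \<phi> s x) (at t within {0<..T}) +
       G (\<lambda>i. - f0 i t x + c0 i t x * u t x - b0 i t x \<bullet> grad (\<phi> t) x
        - nonlocal_inner \<nu> (\<lambda>_ _. \<eta>0 i) \<kappa> \<phi> t x
        - nonlocal_outer \<nu> (\<lambda>_ _. \<eta>0 i) \<kappa> u (grad (\<phi> t) x) t x) \<le> 0" by (simp only: visc_lhs_eq)
  qed
qed

lemma bounded_cont_u: obtains Mu where "bounded_cont Mu u"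
proof -
  have "bounded ((\<lambda>(t, x). u t x) ` Qbar_dom T)" and uc: "continuous_on (Qbar_dom T) (\<lambda>(t, x). u t x)"
    using setting_facts(19) by (simp_all add: ivp_visc_solution_def)
  then obtain Mu where Mu: "\<And>v. v \<in> (\<lambda>(t, x). u t x) ` Qbar_dom T \<Longrightarrow> \<bar>v\<bar> \<le> Mu" by (auto simp: bounded_iff)
  have "\<bar>u t x\<bar> \<le> Mu" if "t \<in> {0..T}" for t x
    by (rule Mu, rule rev_image_eqI[of "(t, x)"]) (use that in \<open>auto simp: Qbar_dom_def\<close>)
  then have "bounded_cont Mu u" using uc by (auto simp: bounded_cont_def Qbar_dom_def)
  then show ?thesis by (rule that)
qed

lemma setting_estimate:
  assumes appr: "approximable u0 P R L0 E1"
    and Tm: "T \<le> Tm" "1 \<le> Tm" and S: "0 < S" "0 \<le> CS" "m2 + mesh_error \<le> CS * S"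
    and Lb: "1 \<le> Lb" and E0: "0 \<le> E0"
    and budget: "\<And>t. t \<in> {0..T} \<Longrightarrow> E1 + (K + K * K + K * P + L0 + R * (m2 + mesh_error)) * t \<le> E0 + Lb * t"
    and tx: "(t, x) \<in> grid dt MT dx"
  shows "\<bar>U t x - u t x\<bar> \<le> 2 * E0 + estimate_const K Tm CS * (sqrt (S * min T 1) + Lb * sqrt (dt * min T 1))"
proof -
  obtain n j where n: "n \<le> MT" and t: "t = real n * dt" and x: "x = grid_pt dx j" using tx by (auto simp: grid_def)
  obtain MU where MU: "grid_bounded MU U" by (rule grid_bounded_U)
  obtain Mu where Mu: "bounded_cont Mu u" by (rule bounded_cont_u)
  have i: "U 0 (grid_pt dx j) = u0 (grid_pt dx j)" "u 0 y = u0 y" for j y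
    using setting_facts(19,20) by (simp_all add: scheme_solution_def ivp_visc_solution_def)
  show ?thesis unfolding t x
    by (rule two_sided_estimate[OF game source_f0 scheme_U MU visc_u Mu initial_bounds i appr Tm S Lb E0 budget n])
qed

end

section \<open>Smooth approximation of the initial data\<close>

text \<open>\<open>dx\<close> alone is of the order of the spatial error. For \<sigma> = 1, where
  \<open>Gam\<close> may vanish, the second summand takes over: \<open>dx \<le> \<delta>\<close>,
  which is \<open>\<delta> powr (2 - \<sigma>)\<close>.\<close>

lemma spatial_step_le:
  assumes \<sigma>: "0 < \<sigma>" "\<sigma> < 2" and d: "0 < dx" "dx \<le> \<delta>" "\<delta> \<le> 1"
  shows "dx \<le> Gam \<sigma> \<delta> * dx + \<delta> powr (2 - \<sigma>)"
proof -
  have \<delta>: "0 < \<delta>" using d by simp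
  consider "\<sigma> < 1" | "\<sigma> = 1" | "1 < \<sigma>" by linarith
  then show ?thesis
  proof cases
    case 1
    then show ?thesis by (simp add: Gam_def)
  next
    case 2
    have "0 \<le> - ln \<delta> * dx" using d \<delta> by (intro mult_nonneg_nonneg) auto
    then show ?thesis using 2 d \<delta> by (simp add: Gam_def)
  next
    case 3
    have "1 \<le> \<delta> powr (1 - \<sigma>)" using 3 d \<delta> powr_mono'[of "1 - \<sigma>" 0 \<delta>] by simp
    then have "1 * dx \<le> \<delta> powr (1 - \<sigma>) * dx" using d by (intro mult_right_mono) auto
    moreover have "0 \<le> \<delta> powr (2 - \<sigma>)" by simp
    ultimately show ?thesis using 3 unfolding Gam_def by (simp only: if_True)
  qed
qed

section \<open>Moments of the kept and dropped jumps; smoothed cones\<close>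

context error_estimate begin

context
  fixes D :: real
  assumes M: "levy_moments \<sigma> D L \<nu> \<rho>" and D: "0 \<le> D"
begin

lemma jump_integral_le:
  assumes a: "0 < a" "a \<le> 1" and co: "0 \<le> \<alpha>" "0 \<le> \<beta>" "0 \<le> \<gamma>" "0 \<le> \<kappa>"
    and h1: "\<And>z. z \<noteq> 0 \<Longrightarrow> norm z < a \<Longrightarrow> h z \<le> \<alpha> * (norm z)\<^sup>2"
    and h2: "\<And>z. a \<le> norm z \<Longrightarrow> norm z < 1 \<Longrightarrow> h z \<le> \<beta> * norm z + \<gamma>"
    and h3: "\<And>z. 1 \<le> norm z \<Longrightarrow> h z \<le> \<kappa> * (\<rho> z)\<^sup>2"
  shows "(\<integral>z. h z \<partial>\<nu>) \<le> \<alpha> * (D * a powr (2 - \<sigma>)) + (\<beta> * (D * (1 + Gam \<sigma> a)) + (\<gamma> * (D * a powr (- \<sigma>)) + \<kappa> * L))"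
proof (rule levy_integral_le[OF M D jump_bound_facts(6) sets_levy _ a co h1 h2 h3])
  show "(\<lambda>z. indicator {z. 1 \<le> norm z} z * (\<rho> z)\<^sup>2) \<in> borel_measurable \<nu>"
    using setting_facts(5) by (auto simp: assm_A4_def set_integrable_def)
qed

lemma jump_bound_small: "norm z < 1 \<Longrightarrow> jump_bound K \<rho> z = K * norm z"
  and jump_bound_large: "1 \<le> norm z \<Longrightarrow> jump_bound K \<rho> z = \<rho> z"
  by (simp_all add: jump_bound_def)

lemma m0_le: "m0 \<le> D * \<delta> powr (- \<sigma>) + L"
proof -
  have "(\<integral>z. indicator jumps z \<partial>\<nu>) \<le> 0 * (D * \<delta> powr (2 - \<sigma>)) + (0 * (D * (1 + Gam \<sigma> \<delta>)) + (1 * (D * \<delta> powr (- \<sigma>)) + 1 * L))"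
  proof (rule jump_integral_le)
    show "indicator jumps z \<le> 1 * (\<rho> z)\<^sup>2" if "1 \<le> norm z" for z
    proof -
      have "1 \<le> (\<rho> z)\<^sup>2" using jump_size(2)[OF that] by linarith
      then show ?thesis by (simp add: indicator_def)
    qed
  qed (use \<delta> in \<open>auto simp: jumps_def indicator_def\<close>)
  moreover have "(\<integral>z. indicator jumps z \<partial>\<nu>) = m0"
    using sets.sets_into_space[OF jumps_sets] by (simp add: m0_def Int_absorb2)
  ultimately show ?thesis by simp
qed

lemma m1_le: "m1 \<le> K * (D * (1 + Gam \<sigma> \<delta>)) + L"
proof -
  have "(\<integral>z. indicator jumps z * jump_bound K \<rho> z \<partial>\<nu>)
    \<le> 0 * (D * \<delta> powr (2 - \<sigma>)) + (K * (D * (1 + Gam \<sigma> \<delta>)) + (0 * (D * \<delta> powr (- \<sigma>)) + 1 * L))"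
  proof (rule jump_integral_le)
    show "indicator jumps z * jump_bound K \<rho> z \<le> 1 * (\<rho> z)\<^sup>2" if "1 \<le> norm z" for z
      using jump_size(2)[OF that] that by (simp add: indicator_def jump_bound_large)
  qed (use \<delta> K in \<open>auto simp: jumps_def indicator_def jump_bound_small\<close>)
  then show ?thesis by (simp add: m1_def set_lebesgue_integral_def)
qed

lemma m2_le: "m2 \<le> 4 * (K\<^sup>2 * D + L) * \<delta> powr (2 - \<sigma>)"
proof -
  \<comment> \<open>The integral runs over a closed ball, the moment bound over an open one. The
    radius \<open>2 * \<delta>\<close>, capped at 1, contains the closed ball, except for \<delta> =
    1, where the unit sphere falls under the large jumps.\<close>
  let ?a = "min 1 (2 * \<delta>)" and ?p = "\<delta> powr (2 - \<sigma>)"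
  have a: "0 < ?a" "?a \<le> 1" using \<delta> by auto
  have "(\<integral>z. indicator {z. norm z \<le> \<delta>} z * (jump_bound K \<rho> z)\<^sup>2 \<partial>\<nu>)
    \<le> K\<^sup>2 * (D * ?a powr (2 - \<sigma>)) + (0 * (D * (1 + Gam \<sigma> ?a)) + (0 * (D * ?a powr (- \<sigma>)) + ?p * L))"
  proof (rule jump_integral_le)
    show "indicator {z. norm z \<le> \<delta>} z * (jump_bound K \<rho> z)\<^sup>2 \<le> K\<^sup>2 * (norm z)\<^sup>2" if "norm z < ?a" for z
      using that by (simp add: indicator_def jump_bound_small power_mult_distrib)
    show "indicator {z. norm z \<le> \<delta>} z * (jump_bound K \<rho> z)\<^sup>2 \<le> 0 * norm z + 0" if "?a \<le> norm z" "norm z < 1" for z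
    proof -
      have "\<not> norm z \<le> \<delta>" using that \<delta> by auto
      then show ?thesis by simp
    qed
    show "indicator {z. norm z \<le> \<delta>} z * (jump_bound K \<rho> z)\<^sup>2 \<le> ?p * (\<rho> z)\<^sup>2" if "1 \<le> norm z" for z
    proof (cases "norm z \<le> \<delta>")
      case True
      then have "\<delta> = 1" using that \<delta> by simp
      then show ?thesis using that by (simp add: indicator_def jump_bound_large)
    qed simp
  qed (use a in auto)
  then have "m2 \<le> K\<^sup>2 * (D * ?a powr (2 - \<sigma>)) + ?p * L" by (simp add: m2_def set_lebesgue_integral_def)
  also have "\<dots> \<le> K\<^sup>2 * (D * (4 * ?p)) + 4 * (?p * L)"
  proof (intro add_mono mult_left_mono D)
    have "?a powr (2 - \<sigma>) \<le> (2 * \<delta>) powr (2 - \<sigma>)" using a \<sigma> by (intro powr_mono2) auto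
    also have "\<dots> = 2 powr (2 - \<sigma>) * ?p" using \<delta> by (simp add: powr_mult)
    also have "\<dots> \<le> 2 powr 2 * ?p" using \<sigma> by (intro mult_right_mono powr_mono) auto
    finally show "?a powr (2 - \<sigma>) \<le> 4 * ?p" by simp
    have "0 \<le> ?p * L" using jump_bound_facts(6) by simp
    then show "?p * L \<le> 4 * (?p * L)" by linarith
  qed simp
  also have "\<dots> = 4 * (K\<^sup>2 * D + L) * ?p" by (simp add: algebra_simps)
  finally show ?thesis .
qed

text \<open>The crossover is put at \<open>a = min e 1\<close>: below it the curvature
  \<open>1 / e\<close> meets the second moment and gives \<open>a powr (1 - \<sigma>)\<close>, above
  it the slope meets the first moment and gives \<open>1 + Gam \<sigma> a\<close>.\<close>

lemma jump_modulus_le: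
  assumes e: "0 < e"
  shows "jump_modulus 1 (1 / e) \<le> (K\<^sup>2 * D + 2 * K * D + 2 * L) * (1 + Gam \<sigma> (min e 1))"
proof -
  define a where "a = min e 1"
  have a: "0 < a" "a \<le> 1" "a \<le> e" using e by (auto simp: a_def)
  have g: "0 \<le> Gam \<sigma> a" by (rule Gam_nonneg[OF a(1,2)])
  have "(\<integral>z. indicator jumps z * min (2 * 1 * jump_bound K \<rho> z) (1 / e * (jump_bound K \<rho> z)\<^sup>2) \<partial>\<nu>)
    \<le> (K\<^sup>2 / a) * (D * a powr (2 - \<sigma>)) + (2 * K * (D * (1 + Gam \<sigma> a)) + (0 * (D * a powr (- \<sigma>)) + 2 * L))"
  proof (rule jump_integral_le)
    show "indicator jumps z * min (2 * 1 * jump_bound K \<rho> z) (1 / e * (jump_bound K \<rho> z)\<^sup>2) \<le> K\<^sup>2 / a * (norm z)\<^sup>2" if "norm z < a" for z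
    proof -
      have "1 / e * (K * norm z)\<^sup>2 \<le> 1 / a * (K * norm z)\<^sup>2" using a e by (intro mult_right_mono frac_le) auto
      then have *: "1 / e * (K * norm z)\<^sup>2 \<le> K\<^sup>2 / a * (norm z)\<^sup>2" by (simp add: power_mult_distrib)
      have n: "norm z < 1" and z0: "0 \<le> K\<^sup>2 / a * (norm z)\<^sup>2" using that a by auto
      have "min (2 * 1 * jump_bound K \<rho> z) (1 / e * (jump_bound K \<rho> z)\<^sup>2) \<le> K\<^sup>2 / a * (norm z)\<^sup>2"
        unfolding jump_bound_small[OF n] by (rule min.coboundedI2[OF *])
      then show ?thesis using z0 by (auto simp: indicator_def)
    qed
    show "indicator jumps z * min (2 * 1 * jump_bound K \<rho> z) (1 / e * (jump_bound K \<rho> z)\<^sup>2) \<le> 2 * K * norm z + 0" if "norm z < 1" for z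
    proof -
      have z0: "0 \<le> K * norm z" using K by simp
      have "min (2 * 1 * jump_bound K \<rho> z) (1 / e * (jump_bound K \<rho> z)\<^sup>2) \<le> 2 * K * norm z"
        unfolding jump_bound_small[OF that] by (rule min.coboundedI1) simp
      then show ?thesis using z0 by (auto simp: indicator_def)
    qed
    show "indicator jumps z * min (2 * 1 * jump_bound K \<rho> z) (1 / e * (jump_bound K \<rho> z)\<^sup>2) \<le> 2 * (\<rho> z)\<^sup>2" if "1 \<le> norm z" for z
    proof -
      have "min (2 * 1 * jump_bound K \<rho> z) (1 / e * (jump_bound K \<rho> z)\<^sup>2) \<le> 2 * (\<rho> z)\<^sup>2"
        unfolding jump_bound_large[OF that] using jump_size(2)[OF that] by (intro min.coboundedI1) simp
      then show ?thesis by (auto simp: indicator_def)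
    qed
  qed (use a K in auto)
  then have "jump_modulus 1 (1 / e) \<le> K\<^sup>2 / a * (D * a powr (2 - \<sigma>)) + 2 * K * (D * (1 + Gam \<sigma> a)) + 2 * L"
    by (simp add: jump_modulus_def set_lebesgue_integral_def)
  also have "K\<^sup>2 / a * (D * a powr (2 - \<sigma>)) = K\<^sup>2 * D * a powr (1 - \<sigma>)"
  proof -
    have "a powr (2 - \<sigma>) = a powr (1 - \<sigma>) * a powr 1" by (simp only: powr_add[symmetric]) simp
    then show ?thesis using a by simp
  qed
  also have "\<dots> \<le> K\<^sup>2 * D * (1 + Gam \<sigma> a)" using D by (intro mult_left_mono powr_le_Gam a) simp
  also have "2 * L \<le> 2 * L * (1 + Gam \<sigma> a)" using g jump_bound_facts(6) by (simp add: mult_left_mono distrib_left)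
  finally show ?thesis unfolding a_def[symmetric] by (simp add: algebra_simps)
qed

text \<open>In \<open>dx\<^sup>2 * m0\<close> one factor \<open>dx\<close> is exchanged for
  \<delta>, turning \<open>\<delta> powr (- \<sigma>)\<close> into
  \<open>\<delta> powr (1 - \<sigma>)\<close>, at most \<open>1 + Gam \<sigma> \<delta>\<close>. The
  interpolation error is then of the same order as the upwind error.\<close>

lemma total_error_le:
  "m2 + mesh_error \<le> (real CARD('n) * (K + 2 * K * D + L) + cN\<^sup>2 * (2 * D + L) + 4 * (K\<^sup>2 * D + L)) * (Gam \<sigma> \<delta> * dx + \<delta> powr (2 - \<sigma>))"
proof -
  define S where "S = Gam \<sigma> \<delta> * dx + \<delta> powr (2 - \<sigma>)"
  define N where "N = real CARD('n)"
  note L0 = jump_bound_facts(6)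
  have dx: "0 < dx" "dx \<le> \<delta>" "dx \<le> 1" using setting_facts(14-16) by auto
  have g: "0 \<le> Gam \<sigma> \<delta>" by (rule Gam_nonneg[OF \<delta>])
  have S1: "dx \<le> S" unfolding S_def by (rule spatial_step_le[OF \<sigma> dx(1,2) \<delta>(2)])
  have S2: "Gam \<sigma> \<delta> * dx \<le> S" "\<delta> powr (2 - \<sigma>) \<le> S" using g dx by (simp_all add: S_def)
  have "dx * (N * (K + m1)) \<le> dx * (N * (K + (K * (D * (1 + Gam \<sigma> \<delta>)) + L)))"
    using dx m1_le by (intro mult_left_mono add_left_mono) (auto simp: N_def)
  also have "\<dots> = N * ((K + K * D + L) * dx + K * D * (Gam \<sigma> \<delta> * dx))" by (simp add: algebra_simps)
  also have "\<dots> \<le> N * ((K + K * D + L) * S + K * D * S)"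
    using S1 S2 K D L0 by (intro mult_left_mono add_mono) (auto simp: N_def)
  also have "\<dots> = N * (K + 2 * K * D + L) * S" by (simp add: algebra_simps)
  finally have A: "dx * (N * (K + m1)) \<le> N * (K + 2 * K * D + L) * S" .
  have "dx\<^sup>2 * m0 \<le> dx\<^sup>2 * (D * \<delta> powr (- \<sigma>) + L)" using m0_le by (rule mult_left_mono) simp
  also have "\<dots> = D * (dx * (dx * \<delta> powr (- \<sigma>))) + L * (dx * dx)" by (simp add: power2_eq_square algebra_simps)
  also have "\<dots> \<le> D * (2 * S) + L * S"
  proof (intro add_mono mult_left_mono D L0)
    have "dx * \<delta> powr (- \<sigma>) \<le> \<delta> * \<delta> powr (- \<sigma>)" using dx by (intro mult_right_mono) auto
    also have "\<delta> * \<delta> powr (- \<sigma>) = \<delta> powr 1 * \<delta> powr (- \<sigma>)" using \<delta> by simp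
    also have "\<dots> = \<delta> powr (1 - \<sigma>)" by (simp only: powr_add[symmetric]) simp
    also have "\<dots> \<le> 1 + Gam \<sigma> \<delta>" by (rule powr_le_Gam[OF \<delta>])
    finally have "dx * (dx * \<delta> powr (- \<sigma>)) \<le> dx * (1 + Gam \<sigma> \<delta>)" using dx by (intro mult_left_mono) auto
    also have "\<dots> = dx + Gam \<sigma> \<delta> * dx" by (simp add: algebra_simps)
    also have "\<dots> \<le> 2 * S" using S1 S2 by linarith
    finally show "dx * (dx * \<delta> powr (- \<sigma>)) \<le> 2 * S" .
    have "dx * dx \<le> dx * 1" using dx by (intro mult_left_mono) auto
    then show "dx * dx \<le> S" using S1 by linarith
  qed
  finally have "dx\<^sup>2 * m0 \<le> (2 * D + L) * S" by (simp add: algebra_simps)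
  then have B: "cN\<^sup>2 * (dx\<^sup>2 * m0) \<le> cN\<^sup>2 * ((2 * D + L) * S)" by (rule mult_left_mono) simp
  have "4 * (K\<^sup>2 * D + L) * \<delta> powr (2 - \<sigma>) \<le> 4 * (K\<^sup>2 * D + L) * S" using S2 D L0 by (intro mult_left_mono) auto
  then have C: "m2 \<le> 4 * (K\<^sup>2 * D + L) * S" using m2_le by linarith
  have "m2 + mesh_error = m2 + dx * (N * (K + m1)) + cN\<^sup>2 * (dx\<^sup>2 * m0)" by (simp add: mesh_error_def N_def)
  also have "\<dots> \<le> 4 * (K\<^sup>2 * D + L) * S + N * (K + 2 * K * D + L) * S + cN\<^sup>2 * ((2 * D + L) * S)"
    by (intro add_mono A B C)
  finally show ?thesis unfolding S_def[symmetric] N_def[symmetric] by (simp add: algebra_simps)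
qed

end

text \<open>Cones of slope \<open>K\<close> with vertex at \<open>y0\<close> enclose a
  \<open>K\<close>-Lipschitz function and touch it at \<open>y0\<close>; rounding the vertex at
  scale \<open>e\<close> costs \<open>K * e\<close> there.\<close>

lemma approximable_lipschitz:
  assumes e: "0 < e"
  shows "approximable u0 K (K / e) (K * jump_modulus 1 (1 / e)) (K * e)"
  unfolding approximable_def
proof (intro allI conjI)
  fix y0 :: "real^'n"
  note q = smooth_profile_smoothed_norm[OF e, of y0]
  have le: "K * norm (y - y0) \<le> K * smoothed_norm e (y - y0)" for y
    using smoothed_norm_bounds(1)[OF e, of "y - y0"] K by (intro mult_left_mono) auto
  have at: "K * smoothed_norm e (y0 - y0) = K * e" by (simp add: smoothed_norm_bounds(4)[OF e])
  show "\<exists>w g. smooth_profile w g K (K / e) (K * jump_modulus 1 (1 / e)) \<and> (\<forall>y. u0 y \<le> w y) \<and> w y0 \<le> u0 y0 + K * e"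
  proof (intro exI conjI allI)
    show "smooth_profile (\<lambda>y. u0 y0 + K * smoothed_norm e (y - y0)) (\<lambda>y. K *\<^sub>R ((y - y0) /\<^sub>R smoothed_norm e (y - y0))) K (K / e) (K * jump_modulus 1 (1 / e))"
      using smooth_profile_affine[OF q, of "u0 y0" K] K by simp
    show "u0 y \<le> u0 y0 + K * smoothed_norm e (y - y0)" for y using initial_bounds(1)[of y y0] le[of y] by linarith
    show "u0 y0 + K * smoothed_norm e (y0 - y0) \<le> u0 y0 + K * e" using at by linarith
  qed
  show "\<exists>w g. smooth_profile w g K (K / e) (K * jump_modulus 1 (1 / e)) \<and> (\<forall>y. w y \<le> u0 y) \<and> u0 y0 - K * e \<le> w y0"
  proof (intro exI conjI allI)
    show "smooth_profile (\<lambda>y. u0 y0 + (- K) * smoothed_norm e (y - y0)) (\<lambda>y. (- K) *\<^sub>R ((y - y0) /\<^sub>R smoothed_norm e (y - y0))) K (K / e) (K * jump_modulus 1 (1 / e))"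
      using smooth_profile_affine[OF q, of "u0 y0" "- K"] K by simp
    show "u0 y0 + (- K) * smoothed_norm e (y - y0) \<le> u0 y" for y using initial_bounds(1)[of y y0] le[of y] by linarith
    show "u0 y0 - K * e \<le> u0 y0 + (- K) * smoothed_norm e (y0 - y0)" using at by linarith
  qed
qed

end

text \<open>Integrability of \<open>F2\<close> is not presupposed: if the product is not integrable
  then neither is \<open>F2\<close>, and both sides are 0 by the convention for Bochner
  integrals.\<close>

lemma lborel_integral_mult:
  fixes F1 :: "'v::euclidean_space \<Rightarrow> real" and F2 :: "'w::euclidean_space \<Rightarrow> real"
  assumes F1: "integrable lborel F1"
  shows "(\<integral>p. F1 (fst p) * F2 (snd p) \<partial>lborel) = (\<integral>t. F1 t \<partial>lborel) * (\<integral>y. F2 y \<partial>lborel)"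
proof (cases "integrable lborel (\<lambda>p. F1 (fst p) * F2 (snd p))")
  case True
  then have i: "integrable (lborel \<Otimes>\<^sub>M lborel) (\<lambda>p. F1 (fst p) * F2 (snd p))" by (simp add: lborel_prod)
  have "(\<integral>p. F1 (fst p) * F2 (snd p) \<partial>lborel) = (\<integral>p. F1 (fst p) * F2 (snd p) \<partial>(lborel \<Otimes>\<^sub>M lborel))" by (simp add: lborel_prod)
  also have "\<dots> = (\<integral>t. (\<integral>y. F1 t * F2 y \<partial>lborel) \<partial>lborel)"
    using lborel_pair.integral_fst'[OF i] by simp
  finally show ?thesis by simp
next
  case False
  have "\<not> integrable lborel F2"
  proof
    assume F2: "integrable lborel F2"
    have "integrable (lborel \<Otimes>\<^sub>M lborel) (\<lambda>p. F1 (fst p) * F2 (snd p))"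
    proof (rule lborel_pair.Fubini_integrable)
      show "(\<lambda>p. F1 (fst p) * F2 (snd p)) \<in> borel_measurable (lborel \<Otimes>\<^sub>M lborel)"
        using F1 F2 by (auto intro!: borel_measurable_times intro: measurable_compose[OF measurable_fst] measurable_compose[OF measurable_snd])
      show "integrable lborel (\<lambda>x. \<integral>y. norm (F1 (fst (x, y)) * F2 (snd (x, y))) \<partial>lborel)"
        using F1 by (simp add: abs_mult)
      show "AE x in lborel. integrable lborel (\<lambda>y. F1 (fst (x, y)) * F2 (snd (x, y)))" using F2 by simp
    qed
    then show False using False by (simp add: lborel_prod)
  qed
  then show ?thesis using False by (simp add: not_integrable_integral_eq)
qed

lemma not_AE_outside_interval:
  assumes "0 < T" shows "\<not> (AE t in lborel. t \<notin> {0..T::real})"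
  using assms AE_iff_null_sets[of "{0..T}" lborel] by (simp add: null_sets_def emeasure_lborel_Icc del: atLeastAtMost_iff)

lemma bump_time_not_zero:
  assumes T: "0 < T"
  shows "\<not> (AE t in lborel. indicator {0..T} t * bump (t :: real) = (0 :: real))"
proof
  assume *: "AE t in lborel. indicator {0..T} t * bump (t :: real) = (0 :: real)"
  let ?s = "min T (1 / 2)"
  have pos: "indicator {0..T} t * bump t \<noteq> (0 :: real)" if "t \<in> {0..?s}" for t :: real
  proof -
    have "\<bar>t\<bar>\<^sup>2 \<le> (1 / 2)\<^sup>2" using that by (intro power_mono) auto
    then have "0 < 1 - t\<^sup>2" by (simp add: power_divide)
    then show ?thesis using that by (simp add: bump_def)
  qed
  have "AE t in lborel. t \<notin> {0..?s}" using * by eventually_elim (use pos in blast)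
  then show False using not_AE_outside_interval[of ?s] T by simp
qed

section \<open>Initial data with bounded nonlocal operator\<close>

context error_estimate begin

context
  fixes K0
  assumes nib: "nonlocal_initial_bound A B T \<eta> \<nu> u0 K0"
begin

text \<open>The jumps do not depend on time, so one time slice on which the space-time statement
  holds suffices. Such a slice exists because \<open>{0..T}\<close> is not a null set.\<close>

lemma initial_AE:
  assumes i: "i \<in> I"
  shows "AE y in lborel. u0 differentiable (at y) \<and>
       integrable \<nu> (\<lambda>z. u0 (y + \<eta>0 i z) - u0 y - \<eta>0 i z \<bullet> grad u0 y) \<and>
       \<bar>\<integral>z. u0 (y + \<eta>0 i z) - u0 y - \<eta>0 i z \<bullet> grad u0 y \<partial>\<nu>\<bar> \<le> K0"
proof -
  let ?e = "\<eta> (fst i) (snd i)"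
  let ?Q = "\<lambda>t x. u0 differentiable (at x) \<and>
           integrable \<nu> (\<lambda>z. u0 (x + ?e t x z) - u0 x - ?e t x z \<bullet> grad u0 x) \<and>
           \<bar>nonlocal \<nu> ?e (\<lambda>t. u0) t x\<bar> \<le> K0"
  have i': "fst i \<in> mspace A" "snd i \<in> mspace B" using i by (auto simp: I_def)
  have "AE (t, x) in lborel. (t, x) \<in> Qbar_dom T \<longrightarrow> ?Q t x"
    using nib i' unfolding nonlocal_initial_bound_def by blast
  then have "AE p in (lborel \<Otimes>\<^sub>M lborel). case p of (t, x) \<Rightarrow> (t, x) \<in> Qbar_dom T \<longrightarrow> ?Q t x"
    by (simp only: lborel_prod)
  from lborel_pair.AE_pair[OF this]
  have ae: "AE t in lborel. AE x in lborel. (t, x) \<in> Qbar_dom T \<longrightarrow> ?Q t x" by simp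
  have "\<exists>t\<in>{0..T}. AE x in lborel. ?Q t x"
  proof (rule ccontr)
    assume no: "\<not> ?thesis"
    have "AE t in lborel. t \<notin> {0..T}"
      using ae
    proof eventually_elim
      case (elim t)
      show ?case
      proof
        assume t: "t \<in> {0..T}"
        have "AE x in lborel. ?Q t x" using elim t by (simp add: Qbar_dom_def)
        then show False using no t by blast
      qed
    qed
    then show False using not_AE_outside_interval[OF T_pos] by blast
  qed
  then obtain t where t: "t \<in> {0..T}" and Q: "AE x in lborel. ?Q t x" by blast
  from Q show ?thesis
  proof eventually_elim
    case (elim y)
    have e: "?e t y z = \<eta>0 i z" if "z \<in> space \<nu>" for z
      using setting_facts(7)[OF i' t, of z y] that by (simp add: space_\<nu> \<eta>0_def case_prod_beta')
    have "integrable \<nu> (\<lambda>z. u0 (y + ?e t y z) - u0 y - ?e t y z \<bullet> grad u0 y)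
      = integrable \<nu> (\<lambda>z. u0 (y + \<eta>0 i z) - u0 y - \<eta>0 i z \<bullet> grad u0 y)"
      by (rule Bochner_Integration.integrable_cong[OF refl]) (simp add: e)
    moreover have "nonlocal \<nu> ?e (\<lambda>t. u0) t y = (\<integral>z. u0 (y + \<eta>0 i z) - u0 y - \<eta>0 i z \<bullet> grad u0 y \<partial>\<nu>)"
      unfolding operator_eq[OF i t] by (simp add: nonlocal_def nonlocal_on_def set_lebesgue_integral_def)
    ultimately show ?case using elim by simp
  qed
qed

text \<open>The distributional hypothesis is tested with a bump in time multiplied by a mollifier in
  space. The time factor contributes a nonzero constant, by which the limit is divided.\<close>

lemma initial_distribution:
  assumes i: "i \<in> I" and \<epsilon>: "0 < \<epsilon>"
  shows "((\<lambda>\<kappa>. \<integral>y. mollifier \<epsilon> (x - y) * (LINT z:{z. norm z < \<kappa>}|\<nu>. u0 (y + \<eta>0 i z) - u0 y - \<eta>0 i z \<bullet> grad u0 y) \<partial>lborel)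
       \<longlongrightarrow> 0) (at_right 0)"
proof -
  define J where "J \<kappa> y = (LINT z:{z. norm z < \<kappa>}|\<nu>. u0 (y + \<eta>0 i z) - u0 y - \<eta>0 i z \<bullet> grad u0 y)" for \<kappa> y
  define \<psi> :: "real \<times> (real^'n) \<Rightarrow> real" where "\<psi> p = bump (fst p) * mollifier \<epsilon> (x - snd p)" for p
  have i': "fst i \<in> mspace A" "snd i \<in> mspace B" using i by (auto simp: I_def)
  have C2: "C2_on UNIV \<psi>"
  proof -
    have "C2_on UNIV (\<lambda>p :: real \<times> (real^'n). bump (fst p - 0))" by (rule C2_on_bump) (rule bounded_linear_fst)
    moreover have "C2_on UNIV (\<lambda>p :: real \<times> (real^'n). bump ((- (1 / \<epsilon>)) *\<^sub>R snd p - (- (1 / \<epsilon>)) *\<^sub>R x))"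
      by (rule C2_on_bump) (intro bounded_linear_intros)
    ultimately have "C2_on UNIV (\<lambda>p :: real \<times> (real^'n). bump (fst p - 0) *
        ((1 / (\<epsilon> ^ DIM(real^'n) * bump_mass TYPE(real^'n))) * bump ((- (1 / \<epsilon>)) *\<^sub>R snd p - (- (1 / \<epsilon>)) *\<^sub>R x)))"
      by (intro C2_on_mult C2_on_cmul)
    moreover have "(x - y) /\<^sub>R \<epsilon> = (- (1 / \<epsilon>)) *\<^sub>R y - (- (1 / \<epsilon>)) *\<^sub>R x" for y
      by (simp add: algebra_simps divide_inverse)
    ultimately show ?thesis unfolding \<psi>_def[abs_def] mollifier_def by (simp only: diff_0_right)
  qed
  have "{p. \<psi> p \<noteq> 0} \<subseteq> cball 0 1 \<times> cball x \<epsilon>"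
  proof
    fix p assume p: "p \<in> {p. \<psi> p \<noteq> 0}"
    then have "\<not> 1 < norm (fst p)" "\<not> \<epsilon> < norm (x - snd p)"
      using bump_support[of "fst p"] mollifier_support[OF \<epsilon>, of "x - snd p"] by (auto simp: \<psi>_def)
    then show "p \<in> cball 0 1 \<times> cball x \<epsilon>" by (auto simp: mem_Times_iff dist_norm)
  qed
  then have "bounded {p. \<psi> p \<noteq> 0}" by (rule bounded_subset[rotated]) (intro bounded_Times bounded_cball)
  then have cpt: "compact (closure {p. \<psi> p \<noteq> 0})" by (simp add: compact_closure)
  have lim: "((\<lambda>\<kappa>. LINT p:Qbar_dom T|lborel. \<psi> p * nonlocal_inner \<nu> (\<eta> (fst i) (snd i)) \<kappa> (\<lambda>t. u0) (fst p) (snd p)) \<longlongrightarrow> 0) (at_right 0)"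
    using nib i' C2 cpt unfolding nonlocal_initial_bound_def by blast
  define F1 where "F1 t = indicator {0..T} t * bump (t :: real)" for t
  have F1i: "integrable lborel F1"
    unfolding F1_def[abs_def] using integrable_real_mult_indicator[OF _ integrable_bump, of "{0..T}"] by (simp add: mult.commute)
  have nz: "\<not> (AE t in lborel. F1 t = 0)" unfolding F1_def by (rule bump_time_not_zero[OF T_pos])
  have eq: "(LINT p:Qbar_dom T|lborel. \<psi> p * nonlocal_inner \<nu> (\<eta> (fst i) (snd i)) \<kappa> (\<lambda>t. u0) (fst p) (snd p))
    = (\<integral>t. F1 t \<partial>lborel) * (\<integral>y. mollifier \<epsilon> (x - y) * J \<kappa> y \<partial>lborel)" for \<kappa>
  proof -
    have "indicator (Qbar_dom T) p *\<^sub>R (\<psi> p * nonlocal_inner \<nu> (\<eta> (fst i) (snd i)) \<kappa> (\<lambda>t. u0) (fst p) (snd p))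
      = F1 (fst p) * (mollifier \<epsilon> (x - snd p) * J \<kappa> (snd p))" for p
    proof (cases "fst p \<in> {0..T}")
      case True
      have "nonlocal_inner \<nu> (\<eta> (fst i) (snd i)) \<kappa> (\<lambda>t. u0) (fst p) (snd p) = J \<kappa> (snd p)"
        unfolding operator_eq(5)[OF i True] by (simp add: nonlocal_inner_def nonlocal_on_def J_def)
      then show ?thesis using True by (simp add: \<psi>_def F1_def Qbar_dom_def indicator_def mem_Times_iff)
    next
      case False
      then have "p \<notin> Qbar_dom T" by (simp add: Qbar_dom_def mem_Times_iff)
      then show ?thesis using False by (simp add: F1_def)
    qed
    then show ?thesis
      unfolding set_lebesgue_integral_def using lborel_integral_mult[OF F1i, of "\<lambda>y. mollifier \<epsilon> (x - y) * J \<kappa> y"] by simp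
  qed
  have c: "(\<integral>t. F1 t \<partial>lborel) \<noteq> 0"
  proof -
    have "AE t in lborel. 0 \<le> F1 t" by (simp add: F1_def bump_nonneg)
    then show ?thesis using nz integral_nonneg_eq_0_iff_AE[OF F1i] by blast
  qed
  have "((\<lambda>\<kappa>. (1 / (\<integral>t. F1 t \<partial>lborel)) * ((\<integral>t. F1 t \<partial>lborel) * (\<integral>y. mollifier \<epsilon> (x - y) * J \<kappa> y \<partial>lborel))) \<longlongrightarrow> (1 / (\<integral>t. F1 t \<partial>lborel)) * 0) (at_right 0)"
    using lim unfolding eq by (rule tendsto_mult_left)
  then show ?thesis using c by (simp add: J_def)
qed

text \<open>Replaces the generic bound \<open>jump_modulus K R\<close>, which may deteriorate as
  \<epsilon> tends to 0, by one in which \<epsilon> enters only through the dropped jumps.\<close>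

lemma smooth_profile_mollify:
  assumes \<epsilon>: "0 < \<epsilon>"
  defines "R \<equiv> mollifier_const TYPE(real^'n) * K / \<epsilon>"
  obtains g where "smooth_profile (mollify \<epsilon> u0) g K R (\<bar>K0\<bar> + R * m2)" "\<And>y. \<bar>mollify \<epsilon> u0 y - u0 y\<bar> \<le> K * \<epsilon>"
proof -
  have lip: "\<bar>u0 x - u0 y\<bar> \<le> K * norm (x - y)" for x y by (rule initial_bounds)
  have "K-lipschitz_on UNIV u0" using lip K by (auto simp: lipschitz_on_def dist_norm)
  then have uc: "continuous_on UNIV u0" by (rule lipschitz_on_continuous_on)
  have R: "0 \<le> R" using mollifier_const_nonneg[where 'v = "real^'n"] K \<epsilon> by (simp add: R_def)
  obtain g where g: "\<And>y. GDERIV (mollify \<epsilon> u0) y :> g y" "\<And>y. norm (g y) \<le> K"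
    and tay: "\<And>y h. \<bar>mollify \<epsilon> u0 (y + h) - mollify \<epsilon> u0 y - h \<bullet> g y\<bar> \<le> R * (norm h)\<^sup>2"
    and ap: "\<And>y. \<bar>mollify \<epsilon> u0 y - u0 y\<bar> \<le> K * \<epsilon>"
    by (rule mollify_profile[OF \<epsilon> lip less_imp_le[OF K], folded R_def]) (rule that)
  have sp: "smooth_profile (mollify \<epsilon> u0) g K R (jump_modulus K R)"
    by (rule smooth_profileI[OF C2_on_mollify[OF \<epsilon> uc] g R tay])
  have "\<bar>(LINT z:jumps|\<nu>. mollify \<epsilon> u0 (y + \<eta>0 i z) - mollify \<epsilon> u0 y) - drift i \<bullet> g y\<bar> \<le> \<bar>K0\<bar> + R * m2" if i: "i \<in> I" for i y
  proof -
    have i2: "set_integrable \<nu> jumps (\<lambda>z. \<eta>0 i z \<bullet> g y)"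
      using integrable_inner_left[OF \<eta>_jumps_integrable[OF i, unfolded set_integrable_def], of "g y"]
      by (simp add: set_integrable_def)
    have "(LINT z:jumps|\<nu>. mollify \<epsilon> u0 (y + \<eta>0 i z) - mollify \<epsilon> u0 y) - drift i \<bullet> g y
      = (LINT z:jumps|\<nu>. mollify \<epsilon> u0 (y + \<eta>0 i z) - mollify \<epsilon> u0 y - \<eta>0 i z \<bullet> g y)"
      unfolding drift_inner[OF i] using set_integral_diff(2)[OF profile_jump_integrable(2)[OF sp i] i2] by simp
    moreover have "\<bar>LINT z:jumps|\<nu>. mollify \<epsilon> u0 (y + \<eta>0 i z) - mollify \<epsilon> u0 y - \<eta>0 i z \<bullet> g y\<bar> \<le> K0 + R * m2"
      by (rule mollify_nonlocal_bound[OF i \<epsilon> lip initial_AE[OF i] initial_distribution[OF i \<epsilon>] g(1) tay R])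
    ultimately show ?thesis by linarith
  qed
  then have "smooth_profile (mollify \<epsilon> u0) g K R (\<bar>K0\<bar> + R * m2)" using sp unfolding smooth_profile_def by blast
  then show ?thesis using ap by (rule that)
qed

text \<open>Raising or lowering the mollification by its distance \<open>K * \<epsilon>\<close> from
  \<open>u0\<close> puts it on one side, which doubles the error. Here the same profile serves for
  all \<open>y0\<close>, up to its constant.\<close>

lemma approximable_regular:
  assumes \<epsilon>: "0 < \<epsilon>"
  defines "R \<equiv> mollifier_const TYPE(real^'n) * K / \<epsilon>"
  shows "approximable u0 K R (\<bar>K0\<bar> + R * m2) (2 * (K * \<epsilon>))"
  unfolding approximable_def
proof (intro allI conjI)
  fix y0 :: "real^'n"
  obtain g where sp: "smooth_profile (mollify \<epsilon> u0) g K R (\<bar>K0\<bar> + R * m2)" and ap: "\<And>y. \<bar>mollify \<epsilon> u0 y - u0 y\<bar> \<le> K * \<epsilon>"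
    by (rule smooth_profile_mollify[OF \<epsilon>, folded R_def]) (rule that)
  have s: "smooth_profile (\<lambda>y. k + 1 * mollify \<epsilon> u0 y) (\<lambda>y. 1 *\<^sub>R g y) K R (\<bar>K0\<bar> + R * m2)" for k
    using smooth_profile_affine[OF sp, of k 1] by simp
  show "\<exists>w g. smooth_profile w g K R (\<bar>K0\<bar> + R * m2) \<and> (\<forall>y. u0 y \<le> w y) \<and> w y0 \<le> u0 y0 + 2 * (K * \<epsilon>)"
  proof (intro exI conjI allI)
    show "u0 y \<le> K * \<epsilon> + 1 * mollify \<epsilon> u0 y" for y using ap[of y] by linarith
    show "K * \<epsilon> + 1 * mollify \<epsilon> u0 y0 \<le> u0 y0 + 2 * (K * \<epsilon>)" using ap[of y0] by linarith
  qed (rule s)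
  show "\<exists>w g. smooth_profile w g K R (\<bar>K0\<bar> + R * m2) \<and> (\<forall>y. w y \<le> u0 y) \<and> u0 y0 - 2 * (K * \<epsilon>) \<le> w y0"
  proof (intro exI conjI allI)
    show "- (K * \<epsilon>) + 1 * mollify \<epsilon> u0 y \<le> u0 y" for y using ap[of y] by linarith
    show "u0 y0 - 2 * (K * \<epsilon>) \<le> - (K * \<epsilon>) + 1 * mollify \<epsilon> u0 y0" using ap[of y0] by linarith
  qed (rule s)
qed

end

end

section \<open>Rates\<close>

lemma sqrt_spatial_error:
  fixes \<sigma> m dx \<delta> :: real
  assumes m: "0 \<le> m" and d: "0 < dx" "dx \<le> \<delta>" "\<delta> \<le> 1"
  shows "sqrt ((Gam \<sigma> \<delta> * dx + \<delta> powr (2 - \<sigma>)) * m)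
    \<le> m powr (1/2) * (Gam \<sigma> \<delta> powr (1/2) * dx powr (1/2) + \<delta> powr (1 - \<sigma>/2))"
proof -
  have \<delta>: "0 < \<delta>" using d by simp
  have g: "0 \<le> Gam \<sigma> \<delta>" by (rule Gam_nonneg[OF \<delta> d(3)])
  have "sqrt ((Gam \<sigma> \<delta> * dx + \<delta> powr (2 - \<sigma>)) * m) = sqrt (Gam \<sigma> \<delta> * dx + \<delta> powr (2 - \<sigma>)) * sqrt m" by (rule real_sqrt_mult)
  also have "\<dots> \<le> (sqrt (Gam \<sigma> \<delta> * dx) + sqrt (\<delta> powr (2 - \<sigma>))) * sqrt m"
    using g d m by (intro mult_right_mono sqrt_add_le_add_sqrt) auto
  also have "sqrt (\<delta> powr (2 - \<sigma>)) = \<delta> powr (1 - \<sigma>/2)"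
    by (simp add: powr_half_sqrt[symmetric] powr_powr diff_divide_distrib)
  also have "sqrt (Gam \<sigma> \<delta> * dx) = Gam \<sigma> \<delta> powr (1/2) * dx powr (1/2)"
    using g d by (simp add: real_sqrt_mult powr_half_sqrt)
  finally show ?thesis using m by (simp add: powr_half_sqrt mult.commute)
qed

lemma rate_regular_bound:
  fixes \<sigma> T dt dx \<delta> :: real
  assumes T: "0 < T" and dt: "0 < dt" and d: "0 < dx" "dx \<le> \<delta>" "\<delta> \<le> 1"
  shows "sqrt ((Gam \<sigma> \<delta> * dx + \<delta> powr (2 - \<sigma>)) * min T 1) + sqrt (dt * min T 1) \<le> rate_regular \<sigma> T dt dx \<delta>"
proof -
  have m: "0 \<le> min T 1" using T by simp
  have "sqrt (dt * min T 1) = min T 1 powr (1/2) * dt powr (1/2)"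
    using m dt by (simp add: real_sqrt_mult powr_half_sqrt)
  then show ?thesis using sqrt_spatial_error[OF m d, of \<sigma>] unfolding rate_regular_def by (simp add: distrib_left)
qed

text \<open>For \<sigma> > 1 the radius \<open>r\<close> solves
  \<open>r powr (1 - \<sigma>) * sqrt (dt * m) = r\<close>; otherwise it is
  \<open>sqrt (dt * m)\<close>. The three summands of the constant serve 3 for \<sigma> < 1,
  \<open>1 + 2 / l0\<close> for \<sigma> = 1, where \<open>l0\<close> absorbs the terms without
  logarithm, and \<open>2 + 2 * Tm\<close> for \<sigma> > 1.\<close>

lemma rate_lipschitz_bound:
  fixes \<sigma> T Tm dt dx \<delta> l0 :: real
  assumes \<sigma>: "0 < \<sigma>" "\<sigma> < 2" and T: "0 < T" "T \<le> Tm" "1 \<le> Tm" and dt: "0 < dt" "dt \<le> T"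
    and d: "0 < dx" "dx \<le> \<delta>" "\<delta> \<le> 1" and l0: "0 < l0" "\<sigma> = 1 \<longrightarrow> l0 \<le> \<bar>ln dt\<bar>"
  defines "m \<equiv> min T 1"
  defines "r \<equiv> (dt * m) powr (1 / (2 * max \<sigma> 1))" and "s \<equiv> sqrt ((Gam \<sigma> \<delta> * dx + \<delta> powr (2 - \<sigma>)) * m)"
  shows "r + s + (1 + Gam \<sigma> (min (r + s) 1)) * sqrt (dt * m) \<le> (3 + 2 / l0 + 2 * Tm) * rate_lipschitz \<sigma> T dt dx \<delta>"
proof -
  have m: "0 < m" "m \<le> 1" using T by (auto simp: m_def)
  have dm: "0 < dt * m" using dt m by simp
  have r: "0 < r" unfolding r_def using dm by (subst powr_gt_zero) linarith
  have \<delta>: "0 < \<delta>" using d by simp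
  have s0: "0 \<le> s" using Gam_nonneg[OF \<delta> d(3), of \<sigma>] d m by (simp add: s_def)
  define P where "P = Gam \<sigma> \<delta> powr (1/2) * dx powr (1/2) + \<delta> powr (1 - \<sigma>/2)"
  have P0: "0 \<le> P" by (simp add: P_def)
  have s: "s \<le> m powr (1/2) * P" unfolding s_def P_def by (rule sqrt_spatial_error[OF less_imp_le[OF m(1)] d])
  define q where "q = sqrt (dt * m)"
  have q0: "0 < q" using dm by (simp add: q_def)
  have q: "q = m powr (1/2) * dt powr (1/2)" using m dt by (simp add: q_def real_sqrt_mult powr_half_sqrt)
  define c where "c = 3 + 2 / l0 + 2 * Tm"
  have c: "3 \<le> c" "2 + 2 * Tm \<le> c" "1 + 2 / l0 \<le> c" "1 \<le> c" using l0 T by (auto simp: c_def add_nonneg_nonneg)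
  have sc: "s \<le> c * (m powr (1/2) * P)"
  proof -
    have "1 * (m powr (1/2) * P) \<le> c * (m powr (1/2) * P)" using c P0 by (intro mult_right_mono) auto
    then show ?thesis using s by simp
  qed
  consider "\<sigma> < 1" | "\<sigma> = 1" | "1 < \<sigma>" by linarith
  then have "r + s + (1 + Gam \<sigma> (min (r + s) 1)) * q \<le> c * rate_lipschitz \<sigma> T dt dx \<delta>"
  proof cases
    case 1
    then have "r = q" using dm by (simp add: r_def q_def powr_half_sqrt)
    moreover have "Gam \<sigma> x = 1" for x using 1 by (simp add: Gam_def)
    moreover have "3 * q \<le> c * q" using c q0 by (intro mult_right_mono) auto
    ultimately have "r + s + (1 + Gam \<sigma> (min (r + s) 1)) * q \<le> c * q + c * (m powr (1/2) * P)" using sc by simp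
    also have "\<dots> = c * rate_lipschitz \<sigma> T dt dx \<delta>"
      using 1 by (simp add: rate_lipschitz_def q m_def[symmetric] P_def Gam_def algebra_simps)
    finally show ?thesis .
  next
    case 2
    then have rq: "r = q" using dm by (simp add: r_def q_def powr_half_sqrt)
    have lnr: "2 * ln r = ln dt + ln m" using dt m by (simp add: rq q_def ln_sqrt ln_mult)
    have G: "Gam \<sigma> (min (r + s) 1) \<le> \<bar>ln dt\<bar>"
    proof (cases "r + s < 1")
      case True
      have "ln r \<le> ln (r + s)" using r s0 by simp
      \<comment> \<open>For \<open>T \<le> 1\<close> one has \<open>dt \<le> m\<close>, so
        \<open>2 * ln r\<close> is at least \<open>2 * ln dt\<close>; for larger \<open>T\<close>
        the factor \<open>m\<close> is 1.\<close>
      moreover have "- ln r \<le> \<bar>ln dt\<bar>"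
      proof (cases "T \<le> 1")
        case T1: True
        then have "ln dt \<le> ln m" "ln m \<le> 0" using dt T by (auto simp: m_def)
        then show ?thesis using lnr abs_ge_minus_self[of "ln dt"] abs_ge_zero[of "ln dt"] by linarith
      next
        case False
        then have "ln m = 0" by (simp add: m_def)
        then show ?thesis using lnr abs_ge_minus_self[of "ln dt"] abs_ge_zero[of "ln dt"] by linarith
      qed
      ultimately show ?thesis using 2 True by (simp add: Gam_def)
    next
      case False
      then show ?thesis using 2 by (simp add: Gam_def min_def)
    qed
    have "2 * q + \<bar>ln dt\<bar> * q \<le> c * (q * \<bar>ln dt\<bar>)"
    proof -
      have "2 = 2 / l0 * l0" using l0 by simp
      also have "\<dots> \<le> 2 / l0 * \<bar>ln dt\<bar>" using 2 l0 by (intro mult_left_mono) auto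
      finally have "2 + \<bar>ln dt\<bar> \<le> (1 + 2 / l0) * \<bar>ln dt\<bar>" by (simp add: distrib_right)
      also have "\<dots> \<le> c * \<bar>ln dt\<bar>" using c by (intro mult_right_mono) auto
      finally have "(2 + \<bar>ln dt\<bar>) * q \<le> (c * \<bar>ln dt\<bar>) * q" using q0 by (intro mult_right_mono) auto
      then show ?thesis by (simp add: algebra_simps)
    qed
    moreover have "(1 + Gam \<sigma> (min (r + s) 1)) * q \<le> (1 + \<bar>ln dt\<bar>) * q" using G q0 by (intro mult_right_mono) auto
    moreover have "(1 + \<bar>ln dt\<bar>) * q = q + \<bar>ln dt\<bar> * q" by (simp add: distrib_right)
    ultimately have "r + s + (1 + Gam \<sigma> (min (r + s) 1)) * q \<le> c * (q * \<bar>ln dt\<bar>) + c * (m powr (1/2) * P)"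
      using sc rq by linarith
    also have "\<dots> = c * rate_lipschitz \<sigma> T dt dx \<delta>"
    proof -
      have "Gam \<sigma> \<delta> = \<bar>ln \<delta>\<bar>" using 2 \<delta> d(3) by (simp add: Gam_def)
      then have "P = dx powr (1/2) * \<bar>ln \<delta>\<bar> powr (1/2) + \<delta> powr (1/2)" using 2 by (simp add: P_def mult.commute)
      moreover have "rate_lipschitz \<sigma> T dt dx \<delta> = m powr (1/2) * (dt powr (1/2) * \<bar>ln dt\<bar> + (dx powr (1/2) * \<bar>ln \<delta>\<bar> powr (1/2) + \<delta> powr (1/2)))"
        using 2 by (simp add: rate_lipschitz_def m_def add.assoc)
      ultimately show ?thesis unfolding q by (simp only: distrib_left mult.assoc)
    qed
    finally show ?thesis .
  next
    case 3
    have re: "r = (dt * m) powr (1 / (2 * \<sigma>))" using 3 by (simp add: r_def)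
    have rs: "r powr \<sigma> = q" using 3 dm by (simp add: re q_def powr_powr powr_half_sqrt)
    have rq: "q \<le> Tm * r"
    proof -
      have "dt * m \<le> T * 1" using dt m T by (intro mult_mono) auto
      then have le: "dt * m \<le> Tm" using T by simp
      have "r powr (\<sigma> - 1) = (dt * m) powr ((\<sigma> - 1) / (2 * \<sigma>))" by (simp add: re powr_powr)
      also have "\<dots> \<le> Tm powr ((\<sigma> - 1) / (2 * \<sigma>))" using 3 dm le by (intro powr_mono2) auto
      also have "\<dots> \<le> Tm powr 1" using 3 T by (intro powr_mono) (auto simp: field_simps)
      finally have "r powr (\<sigma> - 1) \<le> Tm" using T by simp
      then have "r powr (\<sigma> - 1) * r \<le> Tm * r" using r by (intro mult_right_mono) auto
      moreover have "r powr (\<sigma> - 1) * r = r powr \<sigma>" using r powr_add[of r "\<sigma> - 1" 1] by simp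
      ultimately show ?thesis using rs by simp
    qed
    have G: "Gam \<sigma> (min (r + s) 1) \<le> 1 + r powr (1 - \<sigma>)"
    proof (cases "r + s < 1")
      case True
      have "(r + s) powr (1 - \<sigma>) \<le> r powr (1 - \<sigma>)" using 3 r s0 by (intro powr_mono2') auto
      then show ?thesis using 3 True by (simp add: Gam_def)
    qed (use 3 in \<open>simp add: Gam_def min_def\<close>)
    have "(1 + Gam \<sigma> (min (r + s) 1)) * q \<le> (2 + r powr (1 - \<sigma>)) * q" using G q0 by (intro mult_right_mono) auto
    also have "\<dots> = 2 * q + r powr (1 - \<sigma>) * r powr \<sigma>" by (simp add: rs algebra_simps)
    also have "r powr (1 - \<sigma>) * r powr \<sigma> = r" using r by (simp add: powr_add[symmetric])
    finally have "r + s + (1 + Gam \<sigma> (min (r + s) 1)) * q \<le> (2 + 2 * Tm) * r + s" using rq by (simp add: algebra_simps)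
    also have "\<dots> \<le> c * r + c * (m powr (1/2) * P)" using c r sc by (intro add_mono mult_right_mono) auto
    also have "\<dots> = c * rate_lipschitz \<sigma> T dt dx \<delta>"
    proof -
      have "r = m powr (1 / (2 * \<sigma>)) * dt powr (1 / (2 * \<sigma>))" using m dt by (simp add: re powr_mult mult.commute)
      then have "rate_lipschitz \<sigma> T dt dx \<delta> = r + m powr (1/2) * P" using 3 by (simp add: rate_lipschitz_def m_def P_def)
      then show ?thesis by (simp add: distrib_left)
    qed
    finally show ?thesis .
  qed
  then show ?thesis by (simp only: q_def c_def)
qed

lemma rate_nonneg: "0 < \<delta> \<Longrightarrow> \<delta> \<le> 1 \<Longrightarrow> 0 \<le> rate_lipschitz \<sigma> T dt dx \<delta>" "0 \<le> rate_regular \<sigma> T dt dx \<delta>"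
proof -
  assume "0 < \<delta>" "\<delta> \<le> 1"
  then show "0 \<le> rate_lipschitz \<sigma> T dt dx \<delta>" by (simp add: rate_lipschitz_def)
qed (simp add: rate_regular_def)

lemma estimate_const_nonneg: "0 \<le> K \<Longrightarrow> 0 \<le> Tm \<Longrightarrow> 0 \<le> CS \<Longrightarrow> 0 \<le> estimate_const K Tm CS"
  by (simp add: estimate_const_def Let_def)

section \<open>The error estimates\<close>

definition spatial_const :: "'n::finite itself \<Rightarrow> real \<Rightarrow> real \<Rightarrow> real \<Rightarrow> real \<Rightarrow> real" where
  "spatial_const _ K L cN D = real CARD('n) * (K + 2 * K * D + L) + cN\<^sup>2 * (2 * D + L) + 4 * (K\<^sup>2 * D + L)"

text \<open>Twice the offset of the barriers plus the doubling constant times one plus the slope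
  constant, all measured in units of \<open>r + s + \<Gamma> * q\<close> as in
  \<open>lipschitz_estimate\<close>.\<close>

definition lipschitz_const :: "'n::finite itself \<Rightarrow> real \<Rightarrow> real \<Rightarrow> real \<Rightarrow> real \<Rightarrow> real \<Rightarrow> real" where
  "lipschitz_const n K L cN D Tm = (let CS = spatial_const n K L cN D in
     2 * (K + K * CS * Tm)
     + estimate_const K Tm CS * (1 + (1 + K + 2 * K\<^sup>2 + K * (K\<^sup>2 * D + 2 * K * D + 2 * L))))"

definition regular_const :: "'n::finite itself \<Rightarrow> real \<Rightarrow> real \<Rightarrow> real \<Rightarrow> real \<Rightarrow> real \<Rightarrow> real \<Rightarrow> real" where
  "regular_const n K L cN D Tm K0 = (let CS = spatial_const n K L cN D in
     2 * (2 * K + 2 * (mollifier_const TYPE(real^'n) * K) * CS * Tm)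
     + estimate_const K Tm CS * (1 + (1 + K + 2 * K\<^sup>2 + \<bar>K0\<bar>)))"

section \<open>Insertion of the smoothing radii\<close>

context error_estimate begin

context
  fixes D Tm CS S m :: real
  assumes M: "levy_moments \<sigma> D L \<nu> \<rho>" and D: "0 \<le> D" and Tm: "T \<le> Tm" "1 \<le> Tm"
    and CS_eq: "CS = spatial_const TYPE('n) K L cN D"
    and S_eq: "S = Gam \<sigma> \<delta> * dx + \<delta> powr (2 - \<sigma>)" and m_eq: "m = min T 1"
begin

lemma grid_step: "0 < dx" "dx \<le> \<delta>" "\<delta> \<le> 1"
  using setting_facts(14-16) by simp_all

lemma S_pos: "0 < S"
  using spatial_step_le[OF \<sigma> grid_step] grid_step by (simp add: S_eq)

lemma CS_nonneg: "0 \<le> CS"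
  using K D jump_bound_facts(6) by (simp add: CS_eq spatial_const_def)

lemma error_le: "m2 + mesh_error \<le> CS * S"
  using total_error_le[OF M D] by (simp add: CS_eq spatial_const_def S_eq)

lemma m_pos: "0 < m" using T_pos by (simp add: m_eq)

lemma T_le: "T \<le> Tm * m"
proof (cases "T \<le> 1")
  case True
  have "1 * T \<le> Tm * T" using Tm T_pos by (intro mult_right_mono) auto
  then show ?thesis using True by (simp add: m_eq)
qed (use Tm in \<open>simp add: m_eq\<close>)

lemma T_S_le:
  assumes e: "sqrt (S * m) \<le> e"
  shows "T * (S / e) \<le> Tm * sqrt (S * m)"
proof -
  have s: "0 < sqrt (S * m)" using S_pos m_pos by simp
  have "T * S \<le> Tm * m * S" using T_le S_pos by (intro mult_right_mono) auto
  also have "\<dots> = Tm * (sqrt (S * m) * sqrt (S * m))" using S_pos m_pos by simp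
  also have "\<dots> \<le> Tm * (sqrt (S * m) * e)" using e s Tm by (intro mult_left_mono) auto
  finally have "T * S \<le> (Tm * sqrt (S * m)) * e" by (simp only: mult.assoc)
  moreover have "0 < e" using e s by linarith
  ultimately show ?thesis by (simp add: pos_divide_le_eq)
qed

lemma lipschitz_estimate:
  assumes l0: "0 < l0" "\<sigma> = 1 \<longrightarrow> l0 \<le> \<bar>ln dt\<bar>" and tx: "(t, x) \<in> grid dt MT dx"
  shows "\<bar>U t x - u t x\<bar> \<le> lipschitz_const TYPE('n) K L cN D Tm * (3 + 2 / l0 + 2 * Tm) * rate_lipschitz \<sigma> T dt dx \<delta>"
proof -
  define r where "r = (dt * m) powr (1 / (2 * max \<sigma> 1))"
  define s where "s = sqrt (S * m)"
  define q where "q = sqrt (dt * m)"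
  \<comment> \<open>The smoothing radius. It is at least \<open>sqrt (S * m)\<close>, so that the
    curvature \<open>K / e\<close> times the spatial error over the time interval stays of that
    order, and at least \<open>r\<close>, which balances the slope against
    \<open>sqrt dt\<close>.\<close>
  define e where "e = r + s"
  define \<Gamma> where "\<Gamma> = 1 + Gam \<sigma> (min e 1)"
  define CJ where "CJ = K\<^sup>2 * D + 2 * K * D + 2 * L"
  define CL where "CL = 1 + K + 2 * K\<^sup>2 + K * CJ"
  define E0 where "E0 = K * e + T * ((K / e) * (CS * S))"
  define EC where "EC = estimate_const K Tm CS"
  have L0: "0 \<le> L" by (rule jump_bound_facts(6))
  have s: "0 < s" using S_pos m_pos by (simp add: s_def)
  have r: "0 \<le> r" by (simp add: r_def)
  have e: "0 < e" "s \<le> e" using r s by (auto simp: e_def)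
  have q: "0 \<le> q" using dt_pos m_pos by (simp add: q_def)
  have \<Gamma>: "1 \<le> \<Gamma>" using Gam_nonneg[of "min e 1" \<sigma>] e by (simp add: \<Gamma>_def)
  have CJ: "0 \<le> CJ" using K D L0 by (simp add: CJ_def)
  have CL: "1 \<le> CL" using K CJ by (simp add: CL_def)
  have CLG: "1 \<le> CL * \<Gamma>" using mult_mono[of 1 CL 1 \<Gamma>] CL \<Gamma> by simp
  have EC: "0 \<le> EC" using estimate_const_nonneg[of K Tm CS] K Tm CS_nonneg by (simp add: EC_def)
  have KS: "0 \<le> (K / e) * (CS * S)" using K e CS_nonneg S_pos by simp
  have E0: "0 \<le> E0" unfolding E0_def using K e T_pos CS_nonneg S_pos by (intro add_nonneg_nonneg mult_nonneg_nonneg) auto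
  have "\<bar>U t x - u t x\<bar> \<le> 2 * E0 + estimate_const K Tm CS * (sqrt (S * min T 1) + CL * \<Gamma> * sqrt (dt * min T 1))"
  proof (rule setting_estimate[OF approximable_lipschitz[OF e(1)] Tm S_pos CS_nonneg error_le CLG E0 _ tx])
    fix \<tau> assume \<tau>: "\<tau> \<in> {0..T}"
    have "K * jump_modulus 1 (1 / e) \<le> K * (CJ * \<Gamma>)"
      using jump_modulus_le[OF M D e(1)] K unfolding CJ_def \<Gamma>_def by (intro mult_left_mono) auto
    moreover have "(K + 2 * K\<^sup>2) * 1 \<le> (K + 2 * K\<^sup>2) * \<Gamma>" using \<Gamma> K by (intro mult_left_mono) auto
    ultimately have "K + K * K + K * K + K * jump_modulus 1 (1 / e) \<le> CL * \<Gamma>"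
      using \<Gamma> by (simp add: CL_def power2_eq_square algebra_simps)
    then have "(K + K * K + K * K + K * jump_modulus 1 (1 / e)) * \<tau> \<le> CL * \<Gamma> * \<tau>" using \<tau> by (intro mult_right_mono) auto
    moreover have "K / e * (m2 + mesh_error) * \<tau> \<le> T * ((K / e) * (CS * S))"
    proof -
      have "K / e * (m2 + mesh_error) \<le> (K / e) * (CS * S)" using error_le K e by (intro mult_left_mono) auto
      then have "K / e * (m2 + mesh_error) * \<tau> \<le> (K / e) * (CS * S) * \<tau>" using \<tau> by (intro mult_right_mono) auto
      also have "\<dots> \<le> (K / e) * (CS * S) * T" using \<tau> KS by (intro mult_left_mono) auto
      finally show ?thesis by (simp only: mult.commute)
    qed
    ultimately show "K * e + (K + K * K + K * K + K * jump_modulus 1 (1 / e) + K / e * (m2 + mesh_error)) * \<tau> \<le> E0 + CL * \<Gamma> * \<tau>"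
      unfolding E0_def distrib_right[of _ "K / e * (m2 + mesh_error)"] by linarith
  qed
  also have "\<dots> = 2 * E0 + EC * (s + CL * \<Gamma> * q)" by (simp add: EC_def s_def q_def m_eq)
  also have "\<dots> \<le> (2 * (K + K * CS * Tm) + EC * (1 + CL)) * (r + s + \<Gamma> * q)"
  proof -
    have "T * (S / e) \<le> Tm * s" unfolding s_def by (rule T_S_le) (use e s_def in simp)
    then have "K * CS * (T * (S / e)) \<le> K * CS * (Tm * s)" using K CS_nonneg by (intro mult_left_mono) auto
    moreover have "E0 = K * e + K * CS * (T * (S / e))" by (simp add: E0_def)
    ultimately have "E0 \<le> K * e + K * CS * (Tm * s)" by linarith
    also have "\<dots> \<le> K * (r + s + \<Gamma> * q) + K * CS * (Tm * (r + s + \<Gamma> * q))"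
      using K CS_nonneg Tm r q \<Gamma> by (intro add_mono mult_left_mono) (auto simp: e_def)
    finally have A: "E0 \<le> (K + K * CS * Tm) * (r + s + \<Gamma> * q)" by (simp only: distrib_right mult.assoc)
    have "s + CL * (\<Gamma> * q) \<le> 1 * (r + s + \<Gamma> * q) + CL * (r + s + \<Gamma> * q)"
      using r s q \<Gamma> CL by (intro add_mono mult_left_mono) auto
    then have "s + CL * \<Gamma> * q \<le> (1 + CL) * (r + s + \<Gamma> * q)" by (simp add: distrib_right mult.assoc)
    then have "EC * (s + CL * \<Gamma> * q) \<le> EC * ((1 + CL) * (r + s + \<Gamma> * q))" using EC by (rule mult_left_mono)
    moreover have "(2 * (K + K * CS * Tm) + EC * (1 + CL)) * (r + s + \<Gamma> * q)
      = 2 * ((K + K * CS * Tm) * (r + s + \<Gamma> * q)) + EC * ((1 + CL) * (r + s + \<Gamma> * q))" by (simp only: distrib_right mult.assoc)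
    ultimately show ?thesis using A by linarith
  qed
  also have "2 * (K + K * CS * Tm) + EC * (1 + CL) = lipschitz_const TYPE('n) K L cN D Tm"
    by (simp add: lipschitz_const_def Let_def EC_def CL_def CJ_def CS_eq)
  also have "\<dots> * (r + s + \<Gamma> * q) \<le> lipschitz_const TYPE('n) K L cN D Tm * ((3 + 2 / l0 + 2 * Tm) * rate_lipschitz \<sigma> T dt dx \<delta>)"
  proof (rule mult_left_mono)
    show "r + s + \<Gamma> * q \<le> (3 + 2 / l0 + 2 * Tm) * rate_lipschitz \<sigma> T dt dx \<delta>"
      unfolding \<Gamma>_def e_def unfolding r_def s_def q_def S_eq m_eq
      by (rule rate_lipschitz_bound[OF \<sigma> T_pos Tm dt_pos dt_le_T grid_step l0])
    have "0 \<le> 2 * (K + K * CS * Tm) + EC * (1 + CL)" using K CS_nonneg Tm EC CL by simp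
    then show "0 \<le> lipschitz_const TYPE('n) K L cN D Tm"
      by (simp add: lipschitz_const_def Let_def EC_def CL_def CJ_def CS_eq)
  qed
  finally show ?thesis by (simp only: mult.assoc)
qed

lemma regular_estimate:
  assumes nib: "nonlocal_initial_bound A B T \<eta> \<nu> u0 K0" and tx: "(t, x) \<in> grid dt MT dx"
  shows "\<bar>U t x - u t x\<bar> \<le> regular_const TYPE('n) K L cN D Tm K0 * rate_regular \<sigma> T dt dx \<delta>"
proof -
  \<comment> \<open>This also serves as mollification radius. The slope \<open>CL\<close> does not
    depend on it, so the time step imposes no further lower bound.\<close>
  define s where "s = sqrt (S * m)"
  define q where "q = sqrt (dt * m)"
  define Cn where "Cn = mollifier_const TYPE(real^'n) * K"
  define R where "R = Cn / s"
  define CL where "CL = 1 + K + 2 * K\<^sup>2 + \<bar>K0\<bar>"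
  \<comment> \<open>The curvature enters twice, through the nonlocal bound of the mollification and
    through the consistency error of the barriers, hence the factor 2 before
    \<open>R\<close>.\<close>
  define E0 where "E0 = 2 * (K * s) + T * (2 * R * (CS * S))"
  define EC where "EC = estimate_const K Tm CS"
  have s: "0 < s" using S_pos m_pos by (simp add: s_def)
  have q: "0 \<le> q" using dt_pos m_pos by (simp add: q_def)
  have Cn: "0 \<le> Cn" using K mollifier_const_nonneg[where 'v = "real^'n"] by (simp add: Cn_def)
  have CL: "1 \<le> CL" using K by (simp add: CL_def)
  have EC: "0 \<le> EC" using estimate_const_nonneg[of K Tm CS] K Tm CS_nonneg by (simp add: EC_def)
  have R: "0 \<le> R" using Cn s by (simp add: R_def)
  have KS: "0 \<le> 2 * R * (CS * S)" using R CS_nonneg S_pos by simp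
  have E0: "0 \<le> E0" unfolding E0_def using K s T_pos R CS_nonneg S_pos by (intro add_nonneg_nonneg mult_nonneg_nonneg) auto
  have "\<bar>U t x - u t x\<bar> \<le> 2 * E0 + estimate_const K Tm CS * (sqrt (S * min T 1) + CL * sqrt (dt * min T 1))"
  proof (rule setting_estimate[OF approximable_regular[OF nib s, folded Cn_def, folded R_def] Tm S_pos CS_nonneg error_le CL E0 _ tx])
    fix \<tau> assume \<tau>: "\<tau> \<in> {0..T}"
    have "R * m2 + R * (m2 + mesh_error) \<le> R * (CS * S) + R * (CS * S)"
      using R error_le mesh_error_nonneg by (intro add_mono mult_left_mono) auto
    then have "R * m2 + R * (m2 + mesh_error) \<le> 2 * R * (CS * S)" by linarith
    then have "(R * m2 + R * (m2 + mesh_error)) * \<tau> \<le> (2 * R * (CS * S)) * \<tau>"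
      using \<tau> by (intro mult_right_mono) auto
    also have "\<dots> \<le> (2 * R * (CS * S)) * T" using \<tau> KS by (intro mult_left_mono) auto
    also have "\<dots> = T * (2 * R * (CS * S))" by (rule mult.commute)
    finally have 1: "(R * m2 + R * (m2 + mesh_error)) * \<tau> \<le> T * (2 * R * (CS * S))" .
    have 2: "(K + K * K + K * K + \<bar>K0\<bar>) * \<tau> \<le> CL * \<tau>"
      using \<tau> by (intro mult_right_mono) (auto simp: CL_def power2_eq_square)
    have "(K + K * K + K * K + (\<bar>K0\<bar> + R * m2) + R * (m2 + mesh_error)) * \<tau>
      = (K + K * K + K * K + \<bar>K0\<bar>) * \<tau> + (R * m2 + R * (m2 + mesh_error)) * \<tau>"
      by (simp only: distrib_right[symmetric] add.assoc)
    then show "2 * (K * s) + (K + K * K + K * K + (\<bar>K0\<bar> + R * m2) + R * (m2 + mesh_error)) * \<tau> \<le> E0 + CL * \<tau>"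
      using 1 2 unfolding E0_def by linarith
  qed
  also have "\<dots> = 2 * E0 + EC * (s + CL * q)" by (simp add: EC_def s_def q_def m_eq)
  also have "\<dots> \<le> (2 * (2 * K + 2 * Cn * CS * Tm) + EC * (1 + CL)) * (s + q)"
  proof -
    have "T * (S / s) \<le> Tm * s" unfolding s_def by (rule T_S_le) simp
    then have "2 * Cn * CS * (T * (S / s)) \<le> 2 * Cn * CS * (Tm * s)" using Cn CS_nonneg by (intro mult_left_mono) auto
    moreover have "E0 = 2 * K * s + 2 * Cn * CS * (T * (S / s))" by (simp add: E0_def R_def)
    ultimately have "E0 \<le> 2 * K * s + 2 * Cn * CS * (Tm * s)" by linarith
    also have "\<dots> \<le> 2 * K * (s + q) + 2 * Cn * CS * (Tm * (s + q))"
      using K Cn CS_nonneg Tm q by (intro add_mono mult_left_mono) auto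
    finally have A: "E0 \<le> (2 * K + 2 * Cn * CS * Tm) * (s + q)" by (simp only: distrib_right mult.assoc)
    have "s + CL * q \<le> 1 * (s + q) + CL * (s + q)"
      using s q CL by (intro add_mono mult_left_mono) auto
    then have "s + CL * q \<le> (1 + CL) * (s + q)" by (simp only: distrib_right)
    then have "EC * (s + CL * q) \<le> EC * ((1 + CL) * (s + q))" using EC by (rule mult_left_mono)
    moreover have "(2 * (2 * K + 2 * Cn * CS * Tm) + EC * (1 + CL)) * (s + q)
      = 2 * ((2 * K + 2 * Cn * CS * Tm) * (s + q)) + EC * ((1 + CL) * (s + q))" by (simp only: distrib_right mult.assoc)
    ultimately show ?thesis using A by linarith
  qed
  also have "2 * (2 * K + 2 * Cn * CS * Tm) + EC * (1 + CL) = regular_const TYPE('n) K L cN D Tm K0"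
    by (simp add: regular_const_def Let_def EC_def CL_def Cn_def CS_eq)
  also have "\<dots> * (s + q) \<le> regular_const TYPE('n) K L cN D Tm K0 * rate_regular \<sigma> T dt dx \<delta>"
  proof (rule mult_left_mono)
    show "s + q \<le> rate_regular \<sigma> T dt dx \<delta>"
      unfolding s_def q_def S_eq m_eq by (rule rate_regular_bound[OF T_pos dt_pos grid_step])
    have "0 \<le> 2 * (2 * K + 2 * Cn * CS * Tm) + EC * (1 + CL)" using K CS_nonneg Tm EC CL Cn by simp
    then show "0 \<le> regular_const TYPE('n) K L cN D Tm K0"
      by (simp add: regular_const_def Let_def EC_def CL_def Cn_def CS_eq)
  qed
  finally show ?thesis .
qed

end

lemma scale_by_horizon: "0 \<le> y \<Longrightarrow> \<bar>C\<bar> * y \<le> \<bar>C\<bar> * (1 + T) * y"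
  using T_pos by (intro mult_right_mono) (simp_all add: mult_le_cancel_left1)

end

theorem theorem3p4:
  fixes \<sigma> K L C\<^sub>\<nu> cN Cw Kw Tmax :: real
  assumes "0 < \<sigma>" and "\<sigma> < 2" and "0 < K" and "0 < C\<^sub>\<nu>"
  shows "(\<forall>l0>0. \<exists>C. \<forall>(A :: 'a metric) (B :: 'b metric) T (u0 :: real^'n \<Rightarrow> real) f c b
             (\<eta> :: 'a \<Rightarrow> 'b \<Rightarrow> real \<Rightarrow> real^'n \<Rightarrow> real^'m \<Rightarrow> real^'n) \<rho> \<nu> u \<omega> \<theta> \<theta>' \<delta> dt MT dx U.
           error_estimate_setting \<sigma> K L C\<^sub>\<nu> cN Cw Kw A B T u0 f c b \<eta> \<rho> \<nu> u \<omega> \<theta> \<theta>' \<delta> dt MT dx U \<and>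
           T \<le> Tmax \<and> (\<sigma> = 1 \<longrightarrow> l0 \<le> \<bar>ln dt\<bar>) \<longrightarrow>
           (\<forall>(t, x) \<in> grid dt MT dx.
              \<bar>U t x - u t x\<bar> \<le> C * (1 + T) * rate_lipschitz \<sigma> T dt dx \<delta>))
       \<and> (\<forall>K0. \<exists>C. \<forall>(A :: 'a metric) (B :: 'b metric) T (u0 :: real^'n \<Rightarrow> real) f c b
             (\<eta> :: 'a \<Rightarrow> 'b \<Rightarrow> real \<Rightarrow> real^'n \<Rightarrow> real^'m \<Rightarrow> real^'n) \<rho> \<nu> u \<omega> \<theta> \<theta>' \<delta> dt MT dx U.
           error_estimate_setting \<sigma> K L C\<^sub>\<nu> cN Cw Kw A B T u0 f c b \<eta> \<rho> \<nu> u \<omega> \<theta> \<theta>' \<delta> dt MT dx U \<and>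
           T \<le> Tmax \<and> nonlocal_initial_bound A B T \<eta> \<nu> u0 K0 \<longrightarrow>
           (\<forall>(t, x) \<in> grid dt MT dx.
              \<bar>U t x - u t x\<bar> \<le> C * (1 + T) * rate_regular \<sigma> T dt dx \<delta>))"
proof -
  obtain D where D: "0 < D" and mom:
    "\<And>(\<nu> :: (real^'m) measure) a. sets \<nu> = sets (restrict_space borel (- {0})) \<Longrightarrow> assm_A5 \<sigma> C\<^sub>\<nu> \<nu> \<Longrightarrow> 0 < a \<Longrightarrow> a \<le> 1 \<Longrightarrow>
      (\<integral>\<^sup>+z. ennreal ((norm z)\<^sup>2) * indicator {z. norm z < a} z \<partial>\<nu>) \<le> ennreal (D * a powr (2 - \<sigma>))
    \<and> (\<integral>\<^sup>+z. ennreal (norm z) * indicator {z. a \<le> norm z \<and> norm z < 1} z \<partial>\<nu>) \<le> ennreal (D * (1 + Gam \<sigma> a))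
    \<and> (\<integral>\<^sup>+z. indicator {z. a \<le> norm z \<and> norm z < 1} z \<partial>\<nu>) \<le> ennreal (D * a powr (- \<sigma>))"
    using levy_moment_bounds[OF assms(4,1,2)] by blast
  \<comment> \<open>At least 1, so that \<open>T \<le> Tm * min T 1\<close> also holds for small
    \<open>T\<close>.\<close>
  define Tm where "Tm = max Tmax 1"
  have setting: "error_estimate \<sigma> K L C\<^sub>\<nu> cN Cw Kw A B T u0 f c b \<eta> \<rho> \<nu> u \<omega> \<theta> \<theta>' \<delta> dt MT dx U
      \<and> levy_moments \<sigma> D L \<nu> \<rho> \<and> T \<le> Tm"
    if "error_estimate_setting \<sigma> K L C\<^sub>\<nu> cN Cw Kw A B T u0 f c b \<eta> \<rho> \<nu> u \<omega> \<theta> \<theta>' \<delta> dt MT dx U" "T \<le> Tmax"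
    for A :: "'a metric" and B :: "'b metric" and T and u0 :: "real^'n \<Rightarrow> real" and f c b
      and \<eta> :: "'a \<Rightarrow> 'b \<Rightarrow> real \<Rightarrow> real^'n \<Rightarrow> real^'m \<Rightarrow> real^'n" and \<rho> \<nu> u \<omega> \<theta> \<theta>' \<delta> dt MT dx U
  proof (intro conjI)
    show e: "error_estimate \<sigma> K L C\<^sub>\<nu> cN Cw Kw A B T u0 f c b \<eta> \<rho> \<nu> u \<omega> \<theta> \<theta>' \<delta> dt MT dx U"
      by (rule error_estimate.intro[OF assms(1-3) that(1)])
    show "T \<le> Tm" using that(2) by (simp add: Tm_def)
    show "levy_moments \<sigma> D L \<nu> \<rho>"
      unfolding levy_moments_def
      using mom[OF error_estimate.sets_levy[OF e] error_estimate.setting_facts(6)[OF e]] error_estimate.jump_bound_facts(5)[OF e] by blast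
  qed
  have Tm: "1 \<le> Tm" by (simp add: Tm_def)
  show ?thesis
  proof (intro conjI allI impI)
    fix l0 :: real assume l0: "0 < l0"
    let ?C = "lipschitz_const TYPE('n) K L cN D Tm * (3 + 2 / l0 + 2 * Tm)"
    show "\<exists>C. \<forall>(A :: 'a metric) (B :: 'b metric) T (u0 :: real^'n \<Rightarrow> real) f c b
             (\<eta> :: 'a \<Rightarrow> 'b \<Rightarrow> real \<Rightarrow> real^'n \<Rightarrow> real^'m \<Rightarrow> real^'n) \<rho> \<nu> u \<omega> \<theta> \<theta>' \<delta> dt MT dx U.
           error_estimate_setting \<sigma> K L C\<^sub>\<nu> cN Cw Kw A B T u0 f c b \<eta> \<rho> \<nu> u \<omega> \<theta> \<theta>' \<delta> dt MT dx U \<and>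
           T \<le> Tmax \<and> (\<sigma> = 1 \<longrightarrow> l0 \<le> \<bar>ln dt\<bar>) \<longrightarrow>
           (\<forall>(t, x) \<in> grid dt MT dx. \<bar>U t x - u t x\<bar> \<le> C * (1 + T) * rate_lipschitz \<sigma> T dt dx \<delta>)"
    proof (rule exI[of _ "\<bar>?C\<bar>"], intro allI impI ballI, elim conjE, clarify)
      fix A :: "'a metric" and B :: "'b metric" and T and u0 :: "real^'n \<Rightarrow> real" and f c b
        and \<eta> :: "'a \<Rightarrow> 'b \<Rightarrow> real \<Rightarrow> real^'n \<Rightarrow> real^'m \<Rightarrow> real^'n" and \<rho> \<nu> u \<omega> \<theta> \<theta>' \<delta> dt MT dx U t and x :: "real^'n"
      assume s: "error_estimate_setting \<sigma> K L C\<^sub>\<nu> cN Cw Kw A B T u0 f c b \<eta> \<rho> \<nu> u \<omega> \<theta> \<theta>' \<delta> dt MT dx U" "T \<le> Tmax"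
        and l: "\<sigma> = 1 \<longrightarrow> l0 \<le> \<bar>ln dt\<bar>" and tx: "(t, x) \<in> grid dt MT dx"
      note S = setting[OF s, THEN conjunct1] setting[OF s, THEN conjunct2, THEN conjunct1] setting[OF s, THEN conjunct2, THEN conjunct2]
      have \<delta>: "0 < \<delta>" "\<delta> \<le> 1" using error_estimate.setting_facts(14-16)[OF S(1)] by auto
      note rate = rate_nonneg(1)[OF \<delta>, of \<sigma> T dt dx]
      have "\<bar>U t x - u t x\<bar> \<le> ?C * rate_lipschitz \<sigma> T dt dx \<delta>"
        by (rule error_estimate.lipschitz_estimate[OF S(1,2) less_imp_le[OF D] S(3) Tm refl refl refl l0 l tx])
      also have "\<dots> \<le> \<bar>?C\<bar> * rate_lipschitz \<sigma> T dt dx \<delta>" by (rule mult_right_mono[OF abs_ge_self rate])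
      also have "\<dots> \<le> \<bar>?C\<bar> * (1 + T) * rate_lipschitz \<sigma> T dt dx \<delta>"
        by (rule error_estimate.scale_by_horizon[OF S(1) rate])
      finally show "\<bar>U t x - u t x\<bar> \<le> \<bar>?C\<bar> * (1 + T) * rate_lipschitz \<sigma> T dt dx \<delta>" .
    qed
  next
    fix K0 :: real
    let ?C = "regular_const TYPE('n) K L cN D Tm K0"
    show "\<exists>C. \<forall>(A :: 'a metric) (B :: 'b metric) T (u0 :: real^'n \<Rightarrow> real) f c b
             (\<eta> :: 'a \<Rightarrow> 'b \<Rightarrow> real \<Rightarrow> real^'n \<Rightarrow> real^'m \<Rightarrow> real^'n) \<rho> \<nu> u \<omega> \<theta> \<theta>' \<delta> dt MT dx U.
           error_estimate_setting \<sigma> K L C\<^sub>\<nu> cN Cw Kw A B T u0 f c b \<eta> \<rho> \<nu> u \<omega> \<theta> \<theta>' \<delta> dt MT dx U \<and>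
           T \<le> Tmax \<and> nonlocal_initial_bound A B T \<eta> \<nu> u0 K0 \<longrightarrow>
           (\<forall>(t, x) \<in> grid dt MT dx. \<bar>U t x - u t x\<bar> \<le> C * (1 + T) * rate_regular \<sigma> T dt dx \<delta>)"
    proof (rule exI[of _ "\<bar>?C\<bar>"], intro allI impI ballI, elim conjE, clarify)
      fix A :: "'a metric" and B :: "'b metric" and T and u0 :: "real^'n \<Rightarrow> real" and f c b
        and \<eta> :: "'a \<Rightarrow> 'b \<Rightarrow> real \<Rightarrow> real^'n \<Rightarrow> real^'m \<Rightarrow> real^'n" and \<rho> \<nu> u \<omega> \<theta> \<theta>' \<delta> dt MT dx U t and x :: "real^'n"
      assume s: "error_estimate_setting \<sigma> K L C\<^sub>\<nu> cN Cw Kw A B T u0 f c b \<eta> \<rho> \<nu> u \<omega> \<theta> \<theta>' \<delta> dt MT dx U" "T \<le> Tmax"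
        and nib: "nonlocal_initial_bound A B T \<eta> \<nu> u0 K0" and tx: "(t, x) \<in> grid dt MT dx"
      note S = setting[OF s, THEN conjunct1] setting[OF s, THEN conjunct2, THEN conjunct1] setting[OF s, THEN conjunct2, THEN conjunct2]
      note rate = rate_nonneg(2)[of \<sigma> T dt dx \<delta>]
      have "\<bar>U t x - u t x\<bar> \<le> ?C * rate_regular \<sigma> T dt dx \<delta>"
        by (rule error_estimate.regular_estimate[OF S(1,2) less_imp_le[OF D] S(3) Tm refl refl refl nib tx])
      also have "\<dots> \<le> \<bar>?C\<bar> * rate_regular \<sigma> T dt dx \<delta>" by (rule mult_right_mono[OF abs_ge_self rate])
      also have "\<dots> \<le> \<bar>?C\<bar> * (1 + T) * rate_regular \<sigma> T dt dx \<delta>"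
        by (rule error_estimate.scale_by_horizon[OF S(1) rate])
      finally show "\<bar>U t x - u t x\<bar> \<le> \<bar>?C\<bar> * (1 + T) * rate_regular \<sigma> T dt dx \<delta>" .
    qed
  qed
qed

end
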